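(* Assume $u\in\mathcal Y$ is a solution of $$-\Delta u=f(d(x),z,u)\ \text{ in }\Omega_{0\beta},\qquad \frac{\partial u}{\partial\theta}=0\ \text{ on }\gamma_{0\beta}\cup\Gamma_0\cup\Gamma_\beta$$ with Morse index $m(u)\le1$. Assume further that $f(r,z,u)$ is convex with respect to $u$. 1. If $m(u)=0$, then $u$ is constant with respect to the angular variable $\theta$. 2. If $m(u)=1$, then $u$ is either independent of $\theta$ or strictly monotone with respect to $\theta$ in $\Omega_{0\beta}$, in which case $u$ has a nonvanishing derivative $u_\theta$ in $\Omega_{0\beta}$ and $\inf_{\psi\in C^1_0(\Omega_{0\beta})}Q_{\Omega_{0\beta}}(\psi)=0$.
   Context: Let $N\ge2$. For $x\in\mathbb R^N$ put $d(x)=\sqrt{x_1^2+x_2^2}$, $z=(x_3,\dots,x_N)\in\mathbb R^{N-2}$ (ignored if $N=2$), $\Upsilon=\{x:d(x)=0\}$. A point $x\notin\Upsilon$ has cylindrical coordinates $(r,\theta,z)$, $r=d(x)$, $\theta=\theta(x)\in[0,2\pi)$, $x_1=r\cos\theta$, $x_2=r\sin\theta$. Fix $r_1\in[0,+\infty)$ and $\beta\in(0,2\pi)$. For $0\le\theta_1<\theta_2<2\pi$ let $\Omega_{\theta_1\theta_2}=\{x\in\mathbb R^N:d(x)>r_1,\ \theta(x)\in(\theta_1,\theta_2)\}$ (an unbounded domain), $\Gamma_{\theta_i}=\{x:d(x)>r_1,\ \theta(x)=\theta_i\}$, and $\gamma_{\theta_1\theta_2}=\{x:d(x)=r_1,\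 \theta(x)\in[\theta_1,\theta_2]\}$ if $r_1>0$, $\gamma_{\theta_1\theta_2}=\emptyset$ if $r_1=0$. $f(r,z,u)$ is locally Hölder continuous on $[0,+\infty)\times\mathbb R^{N-1}$ together with $f'=\partial f/\partial u$. Write $u_\theta=\partial u/\partial\theta$. $\mathcal Y$ is the set of all $u\in C^2(\Omega_{0\beta})\cap C^0(\overline\Omega_{0\beta})$ such that $u_\theta\in C^0(\overline\Omega_{0\beta}\setminus\Upsilon)$ and $\nabla u\in L^2(\Omega_{0\beta},\mathbb R^N)$. Solutions $u\in\mathcal Y$ satisfy the problem pointwise (such $u$ belong to $C^2(\Omega_{0\beta}\cup\Gamma_0\cup\Gamma_\beta)$). For $D\subset\overline\Omega_{0\beta}$, $C^1_0(D)$ is the set of $\varphi\in C^1(D)$ with compact support contained in $D$. $Q_{\Omega_{0\beta}}(\varphi)=\int_{\Omega_{0\beta}}(|\nabla\varphi|^2-f'(d(x),z,u)\varphi^2)\,dx$. A solution $u$ has Morse index $m(u)=0$ (is stable) if $Q_{\Omega_{0\beta}}(\varphi)\ge0$ for every $\varphi\in C^1_0(\Omega_{0\beta}\cup\Gamma_0\cup\Gamma_\beta)$; it has Morse index $m(u)=M\ge1$ if $M$ is the maximal dimension of a vector subspace $X\subset C^1_0(\Omega_{0\beta}\cup\Gamma_0\cup\Gamma_\beta)$ such that $Q_{\Omega_{0\beta}}(\varphi)<0$ for every $\varphi\in X\setminus\{0\}$. *)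

theory Defs
  imports "HOL-Analysis.Analysis" "HOL-Library.Function_Algebras"
begin

text \<open>
  The ambient space is \<open>real ^ 'n\<close>, with \<open>N = CARD('n)\<close>. Two distinct indices \<open>i\<close>, \<open>j\<close> play the
  role of the first two coordinates, so \<open>i \<noteq> j\<close> expresses \<open>N \<ge> 2\<close>. The vector of the remaining
  coordinates is kept inside \<open>real ^ 'n\<close>, with its \<open>i\<close>-th and \<open>j\<close>-th components set to zero; the
  subspace \<open>zspace i j\<close> of such vectors is an isometric copy of the Euclidean space of dimension
  \<open>N - 2\<close> (it is trivial if \<open>N = 2\<close>).
\<close>

definition dist_axis :: "'n::finite \<Rightarrow> 'n \<Rightarrow> real ^ 'n \<Rightarrow> real" where
  "dist_axis i j x = sqrt ((x $ i)\<^sup>2 + (x $ j)\<^sup>2)"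

definition zpart :: "'n::finite \<Rightarrow> 'n \<Rightarrow> real ^ 'n \<Rightarrow> real ^ 'n" where
  "zpart i j x = (\<chi> k. if k = i \<or> k = j then 0 else x $ k)"

definition zspace :: "'n::finite \<Rightarrow> 'n \<Rightarrow> (real ^ 'n) set" where
  "zspace i j = {z. z $ i = 0 \<and> z $ j = 0}"

definition axis_set :: "'n::finite \<Rightarrow> 'n \<Rightarrow> (real ^ 'n) set" where
  "axis_set i j = {x. dist_axis i j x = 0}"

text \<open>\<^const>\<open>Arg2pi\<close> takes values in \<open>[0, 2\<pi>)\<close>.\<close>

definition angle :: "'n::finite \<Rightarrow> 'n \<Rightarrow> real ^ 'n \<Rightarrow> real" where
  "angle i j x = Arg2pi (Complex (x $ i) (x $ j))"

definition cyl_point :: "'n::finite \<Rightarrow> 'n \<Rightarrow> real \<Rightarrow> real \<Rightarrow> real ^ 'n \<Rightarrow> real ^ 'n" where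
  "cyl_point i j r t z = (\<chi> k. if k = i then r * cos t else if k = j then r * sin t else z $ k)"

definition Omega :: "'n::finite \<Rightarrow> 'n \<Rightarrow> real \<Rightarrow> real \<Rightarrow> real \<Rightarrow> (real ^ 'n) set" where
  "Omega i j r1 t1 t2 = {x. dist_axis i j x > r1 \<and> angle i j x \<in> {t1<..<t2}}"

definition Gamma_face :: "'n::finite \<Rightarrow> 'n \<Rightarrow> real \<Rightarrow> real \<Rightarrow> (real ^ 'n) set" where
  "Gamma_face i j r1 t = {x. dist_axis i j x > r1 \<and> angle i j x = t}"

definition gamma_arc :: "'n::finite \<Rightarrow> 'n \<Rightarrow> real \<Rightarrow> real \<Rightarrow> real \<Rightarrow> (real ^ 'n) set" where
  "gamma_arc i j r1 t1 t2 =
     (if r1 > 0 then {x. dist_axis i j x = r1 \<and> angle i j x \<in> {t1..t2}} else {})"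

definition Omega_faces :: "'n::finite \<Rightarrow> 'n \<Rightarrow> real \<Rightarrow> real \<Rightarrow> (real ^ 'n) set" where
  "Omega_faces i j r1 \<beta> =
     Omega i j r1 0 \<beta> \<union> Gamma_face i j r1 0 \<union> Gamma_face i j r1 \<beta>"

definition partial :: "'n::finite \<Rightarrow> (real ^ 'n \<Rightarrow> real) \<Rightarrow> real ^ 'n \<Rightarrow> real" where
  "partial k u x = frechet_derivative u (at x) (axis k 1)"

definition grad :: "(real ^ 'n::finite \<Rightarrow> real) \<Rightarrow> real ^ 'n \<Rightarrow> real ^ 'n" where
  "grad u x = (\<chi> k. partial k u x)"

definition laplacian :: "(real ^ 'n::finite \<Rightarrow> real) \<Rightarrow> real ^ 'n \<Rightarrow> real" where
  "laplacian u x = (\<Sum>k\<in>UNIV. partial k (partial k u) x)"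

text \<open>Only meant for open \<open>S\<close>, since the derivatives are two-sided.\<close>

definition C2_on :: "(real ^ 'n::finite) set \<Rightarrow> (real ^ 'n \<Rightarrow> real) \<Rightarrow> bool" where
  "C2_on S u \<longleftrightarrow>
     (\<forall>x\<in>S. u differentiable (at x)) \<and>
     (\<forall>k. \<forall>x\<in>S. partial k u differentiable (at x)) \<and>
     (\<forall>k l. continuous_on S (partial l (partial k u)))"

text \<open>
  The sector \<open>[0, \<beta>]\<close> is the range of the angle on the closed domain, so the derivative within
  \<open>{0..\<beta>}\<close> is two-sided in the interior and one-sided on the two faces \<open>\<theta> = 0\<close> and \<open>\<theta> = \<beta>\<close>;
  it only involves values of \<open>u\<close> on the closure of \<open>Omega i j r1 0 \<beta>\<close>.
\<close>

definition dtheta :: "'n::finite \<Rightarrow> 'n \<Rightarrow> real \<Rightarrow> (real ^ 'n \<Rightarrow> real) \<Rightarrow> real ^ 'n \<Rightarrow> real" where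
  "dtheta i j \<beta> u x =
     vector_derivative (\<lambda>t. u (cyl_point i j (dist_axis i j x) t (zpart i j x)))
       (at (angle i j x) within {0..\<beta>})"

definition dtheta_exists ::
    "'n::finite \<Rightarrow> 'n \<Rightarrow> real \<Rightarrow> (real ^ 'n \<Rightarrow> real) \<Rightarrow> real ^ 'n \<Rightarrow> bool" where
  "dtheta_exists i j \<beta> u x \<longleftrightarrow>
     (\<lambda>t. u (cyl_point i j (dist_axis i j x) t (zpart i j x)))
       differentiable (at (angle i j x) within {0..\<beta>})"

definition Yspace :: "'n::finite \<Rightarrow> 'n \<Rightarrow> real \<Rightarrow> real \<Rightarrow> (real ^ 'n \<Rightarrow> real) set" where
  "Yspace i j r1 \<beta> =
     {u. C2_on (Omega i j r1 0 \<beta>) u \<and>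
         continuous_on (closure (Omega i j r1 0 \<beta>)) u \<and>
         (\<forall>x \<in> closure (Omega i j r1 0 \<beta>) - axis_set i j. dtheta_exists i j \<beta> u x) \<and>
         continuous_on (closure (Omega i j r1 0 \<beta>) - axis_set i j) (dtheta i j \<beta> u) \<and>
         set_integrable lborel (Omega i j r1 0 \<beta>) (\<lambda>x. (norm (grad u x))\<^sup>2)}"

definition is_solution ::
    "'n::finite \<Rightarrow> 'n \<Rightarrow> real \<Rightarrow> real \<Rightarrow> (real \<Rightarrow> real ^ 'n \<Rightarrow> real \<Rightarrow> real) \<Rightarrow>
     (real ^ 'n \<Rightarrow> real) \<Rightarrow> bool" where
  "is_solution i j r1 \<beta> f u \<longleftrightarrow>
     (\<forall>x \<in> Omega i j r1 0 \<beta>. - laplacian u x = f (dist_axis i j x) (zpart i j x) (u x)) \<and>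
     (\<forall>x \<in> gamma_arc i j r1 0 \<beta> \<union> Gamma_face i j r1 0 \<union> Gamma_face i j r1 \<beta>.
        dtheta i j \<beta> u x = 0)"

text \<open>The Hoelder exponent and constant may depend on the neighbourhood.\<close>

definition locally_holder_on :: "'a::metric_space set \<Rightarrow> ('a \<Rightarrow> real) \<Rightarrow> bool" where
  "locally_holder_on S g \<longleftrightarrow>
     (\<forall>x\<in>S. \<exists>e>0. \<exists>\<alpha>. 0 < \<alpha> \<and> \<alpha> \<le> 1 \<and>
        (\<exists>C. \<forall>p \<in> S \<inter> ball x e. \<forall>q \<in> S \<inter> ball x e. \<bar>g p - g q\<bar> \<le> C * dist p q powr \<alpha>))"

definition nonlinearity_ok ::
    "'n::finite \<Rightarrow> 'n \<Rightarrow> (real \<Rightarrow> real ^ 'n \<Rightarrow> real \<Rightarrow> real) \<Rightarrow> bool" where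
  "nonlinearity_ok i j f \<longleftrightarrow>
     (\<forall>r\<ge>0. \<forall>z\<in>zspace i j. \<forall>s. f r z field_differentiable (at s)) \<and>
     locally_holder_on ({0..} \<times> zspace i j \<times> UNIV) (\<lambda>(r, z, s). f r z s) \<and>
     locally_holder_on ({0..} \<times> zspace i j \<times> UNIV) (\<lambda>(r, z, s). deriv (f r z) s)"

definition C1_on :: "(real ^ 'n::finite) set \<Rightarrow> (real ^ 'n \<Rightarrow> real) \<Rightarrow> bool" where
  "C1_on D \<phi> \<longleftrightarrow>
     (\<exists>g. continuous_on D g \<and> (\<forall>x\<in>D. (\<phi> has_derivative (\<lambda>h. g x \<bullet> h)) (at x within D)))"

text \<open>
  Functions on \<open>D\<close> are represented by their extension by zero, which is unique; no smoothness
  across the part of the boundary of \<open>D\<close> contained in \<open>D\<close> is implied.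
\<close>

definition C1_0 :: "(real ^ 'n::finite) set \<Rightarrow> (real ^ 'n \<Rightarrow> real) set" where
  "C1_0 D = {\<phi>. C1_on D \<phi> \<and> compact (closure {x. \<phi> x \<noteq> 0}) \<and> closure {x. \<phi> x \<noteq> 0} \<subseteq> D}"

definition Qform ::
    "'n::finite \<Rightarrow> 'n \<Rightarrow> real \<Rightarrow> real \<Rightarrow> (real \<Rightarrow> real ^ 'n \<Rightarrow> real \<Rightarrow> real) \<Rightarrow>
     (real ^ 'n \<Rightarrow> real) \<Rightarrow> (real ^ 'n \<Rightarrow> real) \<Rightarrow> real" where
  "Qform i j r1 \<beta> f u \<phi> =
     (LINT x:Omega i j r1 0 \<beta>|lborel.
        (norm (grad \<phi> x))\<^sup>2 - deriv (f (dist_axis i j x) (zpart i j x)) (u x) * (\<phi> x)\<^sup>2)"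

interpretation fun_space: vector_space "\<lambda>(c::real) (\<phi>::'a \<Rightarrow> real) x. c * \<phi> x"
  by unfold_locales (auto simp: fun_eq_iff algebra_simps)

definition fin_dim :: "('a \<Rightarrow> real) set \<Rightarrow> bool" where
  "fin_dim X \<longleftrightarrow> (\<exists>B. finite B \<and> fun_space.span B = X)"

definition negative_subspace ::
    "'n::finite \<Rightarrow> 'n \<Rightarrow> real \<Rightarrow> real \<Rightarrow> (real \<Rightarrow> real ^ 'n \<Rightarrow> real \<Rightarrow> real) \<Rightarrow>
     (real ^ 'n \<Rightarrow> real) \<Rightarrow> (real ^ 'n \<Rightarrow> real) set \<Rightarrow> bool" where
  "negative_subspace i j r1 \<beta> f u X \<longleftrightarrow>
     fun_space.subspace X \<and> X \<subseteq> C1_0 (Omega_faces i j r1 \<beta>) \<and>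
     (\<forall>\<phi> \<in> X - {0}. Qform i j r1 \<beta> f u \<phi> < 0)"

text \<open>
  A relation rather than a function, because the index need not be finite. Finite dimensionality
  is required explicitly because the library dimension of an infinite-dimensional space is 0.
\<close>

definition has_morse_index ::
    "'n::finite \<Rightarrow> 'n \<Rightarrow> real \<Rightarrow> real \<Rightarrow> (real \<Rightarrow> real ^ 'n \<Rightarrow> real \<Rightarrow> real) \<Rightarrow>
     (real ^ 'n \<Rightarrow> real) \<Rightarrow> nat \<Rightarrow> bool" where
  "has_morse_index i j r1 \<beta> f u M \<longleftrightarrow>
     (if M = 0 then \<forall>\<phi> \<in> C1_0 (Omega_faces i j r1 \<beta>). Qform i j r1 \<beta> f u \<phi> \<ge> 0
      else (\<exists>X. negative_subspace i j r1 \<beta> f u X \<and> fin_dim X \<and> fun_space.dim X = M) \<and>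
           (\<forall>X. negative_subspace i j r1 \<beta> f u X \<longrightarrow> fin_dim X \<and> fun_space.dim X \<le> M))"

definition theta_independent_on ::
    "'n::finite \<Rightarrow> 'n \<Rightarrow> (real ^ 'n) set \<Rightarrow> (real ^ 'n \<Rightarrow> real) \<Rightarrow> bool" where
  "theta_independent_on i j S u \<longleftrightarrow>
     (\<forall>x\<in>S. \<forall>y\<in>S. dist_axis i j x = dist_axis i j y \<longrightarrow> zpart i j x = zpart i j y \<longrightarrow> u x = u y)"

definition theta_strict_increasing_on ::
    "'n::finite \<Rightarrow> 'n \<Rightarrow> (real ^ 'n) set \<Rightarrow> (real ^ 'n \<Rightarrow> real) \<Rightarrow> bool" where
  "theta_strict_increasing_on i j S u \<longleftrightarrow>
     (\<forall>x\<in>S. \<forall>y\<in>S. dist_axis i j x = dist_axis i j y \<longrightarrow> zpart i j x = zpart i j y \<longrightarrow>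
        angle i j x < angle i j y \<longrightarrow> u x < u y)"

definition theta_strict_monotone_on ::
    "'n::finite \<Rightarrow> 'n \<Rightarrow> (real ^ 'n) set \<Rightarrow> (real ^ 'n \<Rightarrow> real) \<Rightarrow> bool" where
  "theta_strict_monotone_on i j S u \<longleftrightarrow>
     theta_strict_increasing_on i j S u \<or> theta_strict_increasing_on i j S (\<lambda>x. - u x)"

end

theory Submission
  imports Defs
begin

text \<open>
  Write \<open>v = u\<^sub>\<theta>\<close> and \<open>V = f'(d(x), z, u)\<close>. Since the equation is invariant under rotations about the
  axis, \<open>v\<close> is a weak solution of the linearised equation \<open>-\<Delta>v = Vv\<close>, and the boundary
  condition says that \<open>v\<close> vanishes on the faces and on the inner arc. So, formally,
  \<open>Q(v\<^sup>+) = Q(v\<^sup>-) = 0\<close> although \<open>v\<close> vanishes on the faces, whereas the test functions of \<open>Q\<close> need not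
  vanish there. This is the source of all the rigidity.

  \<^bold>\<open>The stable case.\<close> Cut-offs of truncations of \<open>v\<^sup>+\<close> form a sequence of test functions whose \<open>Q\<close> tends to
  a value at most \<open>0\<close>; the inequality \<open>|v| \<le> d(x) |\<nabla>u|\<close> with \<open>\<nabla>u \<in> L\<^sup>2\<close> controls the cut-off error near the
  axis and at infinity. If \<open>Q \<ge> 0\<close>, then by Cauchy--Schwarz the limit \<open>v\<^sup>+\<close> is orthogonal to every test
  function, also to those that do not vanish on the face \<open>\<theta> = 0\<close>. Hence \<open>v\<^sup>+\<close> extended by zero across that
  face is still a weak solution, it vanishes beyond the face, and a nonnegative function of this kind
  vanishes everywhere as soon as it vanishes on an open set. So \<open>v \<le> 0\<close>, likewise \<open>v \<ge> 0\<close>, and \<open>u\<close> does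
  not depend on \<open>\<theta>\<close>. The argument is local in the angle: it works on a sector \<open>0 < \<theta> < b\<close> if \<open>v\<close> has the
  right sign on \<open>\<theta> = b\<close> and \<open>Q \<ge> 0\<close> for test functions supported in \<open>0 \<le> \<theta> < b\<close>
  (\<open>stable_sector_imp_nonpos\<close>).

  \<^bold>\<open>Index one.\<close> Test functions supported in different halves of the sector are orthogonal for \<open>Q\<close>, so
  \<open>Q\<close> is nonnegative on one of the two halves (\<open>stable_on_one_half\<close>); after a reflection this is the half
  \<open>0 \<le> \<theta> < \<beta>/2\<close>. Let \<open>w = u - u \<circ> S\<close>, where \<open>S\<close> is the reflection that exchanges the halves. By convexity
  of \<open>f\<close> in \<open>u\<close> the difference \<open>w\<close> is a subsolution of the linearised equation, it satisfies the Neumann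
  condition on \<open>\<theta> = 0\<close> and vanishes on \<open>\<theta> = \<beta>/2\<close>, so the truncations of \<open>w\<^sup>+\<close> have nonpositive energy in the
  limit. As above, \<open>w\<^sup>+\<close> vanishes on the whole half as soon as \<open>w\<close> is negative somewhere
  (\<open>stable_half_imp_reflection_sign\<close>). Hence \<open>w\<close> has one sign on the half, and therefore so does
  \<open>v\<close> on \<open>\<theta> = \<beta>/2\<close>, where \<open>2v\<close> is the angular derivative of \<open>w\<close>. The stable case applied to the half sector
  gives \<open>v\<close> one sign on the half.

  It remains to pass to the other half. If, say, \<open>v \<ge> 0\<close> does not vanish identically on the half, the
  truncations of \<open>v\<^sup>+\<close>, corrected by a function that does not vanish on the face, give a direction \<open>\<phi>\<^sub>1\<close>
  with \<open>Q(\<phi>\<^sub>1) < 0\<close> to which the truncations of \<open>v\<^sup>-\<close> are orthogonal. Index one makes \<open>Q\<close>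
  nonnegative on the orthogonal complement of \<open>\<phi>\<^sub>1\<close>, so \<open>v\<^sup>-\<close> is again a null direction, and it vanishes
  because it vanishes on the half (\<open>nonneg_extends\<close>). If \<open>v = 0\<close> on the half, then \<open>u\<close> is constant along arcs
  there and a comparison of \<open>u\<close> with its rotations gives \<open>v = 0\<close> everywhere (\<open>zero_on_half_imp_zero\<close>).

  Finally a solution \<open>v\<close> of one sign is identically zero or has no zero, by the strong maximum
  principle; in the second case Picone's identity gives \<open>Q \<ge> 0\<close> on functions with compact support in the open sector.
\<close>

section \<open>Test functions and integration by parts\<close>

text \<open>Since \<open>h'(0) = 0\<close>, cutting off at \<open>e\<close> keeps the function differentiable; this is
  how all truncations below get to be of class \<open>C\<^sup>1\<close>.\<close>
lemma DERIV_pos_part_comp: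
  fixes h h' :: "real \<Rightarrow> real"
  assumes h: "\<And>m. m \<ge> 0 \<Longrightarrow> DERIV h m :> h' m" and 0: "h' 0 = 0"
  shows "DERIV (\<lambda>s. h (max 0 (s - e))) s :> h' (max 0 (s - e))"
proof -
  have *: "((\<lambda>s. h (s - e)) has_field_derivative h' (s - e)) (at s within A)" if "s \<ge> e" for s A
  proof -
    have "DERIV (\<lambda>s. h (s - e)) s :> h' (s - e) * 1"
      by (rule DERIV_chain2[of h]) (use h[of "s - e"] that in \<open>auto intro!: derivative_eq_intros\<close>)
    then show ?thesis by (auto intro: has_field_derivative_at_within)
  qed
  consider "s < e" | "s > e" | "s = e" by linarith
  then show ?thesis
  proof cases
    case 1
    have "((\<lambda>s. h (max 0 (s - e))) has_field_derivative 0) (at s)"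
      by (rule has_field_derivative_transform_within_open[of "\<lambda>_. h 0" _ _ "{..<e}"]) (use 1 in auto)
    with 1 0 show ?thesis by simp
  next
    case 2
    have "((\<lambda>s. h (max 0 (s - e))) has_field_derivative h' (s - e)) (at s)"
      by (rule has_field_derivative_transform_within_open[of "\<lambda>t. h (t - e)" _ _ "{e<..}"])
        (use 2 *[of s UNIV] in auto)
    with 2 show ?thesis by simp
  next
    case 3
    have "((\<lambda>s. h (max 0 (s - e))) has_field_derivative 0) (at s within {..s})"
      by (rule has_field_derivative_transform_within[where f = "\<lambda>_. h 0" and d = 1]) (auto simp: 3)
    moreover have "((\<lambda>s. h (max 0 (s - e))) has_field_derivative 0) (at s within {s..})"
      by (rule has_field_derivative_transform_within[where f = "\<lambda>s. h (s - e)" and d = 1])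
        (use *[of s "{s..}"] 3 0 in auto)
    ultimately have "((\<lambda>s. h (max 0 (s - e))) has_field_derivative 0) (at s within {..s} \<union> {s..})"
      unfolding has_field_derivative_iff by (auto intro: Lim_Un)
    moreover have "{..s} \<union> {s..} = (UNIV :: real set)" by auto
    ultimately show ?thesis using 0 3 by simp
  qed
qed

lemma DERIV_pos_part_power:
  "DERIV (\<lambda>t. (max 0 t) ^ Suc (Suc n)) (t::real) :> real (Suc (Suc n)) * (max 0 t) ^ Suc n"
proof -
  have "DERIV (\<lambda>s. (max 0 (s - 0)) ^ Suc (Suc n)) t :> real (Suc (Suc n)) * (max 0 (t - 0)) ^ Suc n"
    by (rule DERIV_pos_part_comp) (auto intro!: derivative_eq_intros simp del: power_Suc)
  then show ?thesis by simp
qed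

lemma GDERIV_cong_open:
  assumes "GDERIV f x :> d" "open S" "x \<in> S" "\<And>y. y \<in> S \<Longrightarrow> f y = g y"
  shows "GDERIV g x :> d"
  using assms unfolding gderiv_def by (blast intro: has_derivative_transform_within_open)

lemma GDERIV_unique:
  assumes "GDERIV f x :> d" "GDERIV f x :> e"
  shows "d = e"
proof -
  have "(\<lambda>h. inner h d) = (\<lambda>h. inner h e)"
    using assms unfolding gderiv_def by (rule has_derivative_unique)
  then show ?thesis by (metis inner_commute vector_eq_rdot)
qed

lemma GDERIV_isCont: "GDERIV f x :> d \<Longrightarrow> isCont f x"
  unfolding gderiv_def by (rule has_derivative_continuous)

text \<open>The gradient is carried as a second argument, so that weak equations can be stated and linear combinations
  formed without differentiability side conditions.\<close>
definition C1c :: "'a::euclidean_space set \<Rightarrow> ('a \<Rightarrow> real) \<Rightarrow> ('a \<Rightarrow> 'a) \<Rightarrow> bool" where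
  "C1c D \<psi> G \<longleftrightarrow> (\<forall>x. GDERIV \<psi> x :> G x) \<and> continuous_on UNIV G \<and>
     (\<exists>K. compact K \<and> K \<subseteq> D \<and> (\<forall>x. x \<notin> K \<longrightarrow> \<psi> x = 0))"

lemma C1c_gderiv: "C1c D \<psi> G \<Longrightarrow> GDERIV \<psi> x :> G x"
  by (simp add: C1c_def)

lemma C1c_cont: "C1c D \<psi> G \<Longrightarrow> continuous_on A \<psi>" "C1c D \<psi> G \<Longrightarrow> continuous_on A G"
  by (auto simp: C1c_def intro: continuous_at_imp_continuous_on GDERIV_isCont continuous_on_subset)

lemma GDERIV_zero_on_open:
  assumes "GDERIV f x :> d" "open S" "x \<in> S" "\<And>y. y \<in> S \<Longrightarrow> f y = 0"
  shows "d = 0"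
  using GDERIV_unique[OF GDERIV_cong_open[OF assms(1-3), of "\<lambda>_. 0"] GDERIV_const] assms by simp

lemma C1cE:
  assumes "C1c D \<psi> G"
  obtains K where "compact K" "K \<subseteq> D" "\<And>x. x \<notin> K \<Longrightarrow> \<psi> x = 0" "\<And>x. x \<notin> K \<Longrightarrow> G x = 0"
proof -
  obtain K where K: "compact K" "K \<subseteq> D" "\<And>x. x \<notin> K \<Longrightarrow> \<psi> x = 0"
    using assms by (auto simp: C1c_def)
  have "G x = 0" if "x \<notin> K" for x
    by (rule GDERIV_zero_on_open[OF C1c_gderiv[OF assms], of "- K"]) (use that K compact_imp_closed in auto)
  with K that show ?thesis by blast
qed

lemma C1c_mono: "C1c D \<psi> G \<Longrightarrow> D \<subseteq> E \<Longrightarrow> C1c E \<psi> G"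
  unfolding C1c_def by blast

lemma C1c_extend:
  assumes D: "open D" and f: "\<And>x. x \<in> D \<Longrightarrow> GDERIV f x :> Df x" and cont: "continuous_on D Df"
    and K: "compact K" "K \<subseteq> D" "\<And>x. x \<in> D - K \<Longrightarrow> f x = 0"
  shows "C1c D (\<lambda>x. if x \<in> D then f x else 0) (\<lambda>x. if x \<in> D then Df x else 0)"
proof -
  let ?f = "\<lambda>x. if x \<in> D then f x else 0" and ?g = "\<lambda>x. if x \<in> D then Df x else 0"
  have cl: "open (- K)" using K compact_imp_closed by auto
  have Df0: "Df x = 0" if "x \<in> D - K" for x
    by (rule GDERIV_zero_on_open[OF f, of x "D \<inter> - K"]) (use that D cl K in auto)
  have 1: "GDERIV ?f x :> ?g x" for x
  proof (cases "x \<in> D")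
    case True
    then show ?thesis using GDERIV_cong_open[OF f[OF True] D True, of ?f] by simp
  next
    case False
    have "GDERIV ?f x :> 0"
      by (rule GDERIV_cong_open[OF GDERIV_const[of 0] cl]) (use False K in auto)
    with False show ?thesis by simp
  qed
  have "continuous_on D ?g" using cont by (rule continuous_on_eq) auto
  moreover have "continuous_on (- K) ?g"
    by (rule continuous_on_eq[of _ "\<lambda>_. 0"]) (use Df0 in auto)
  ultimately have "continuous_on (D \<union> - K) ?g"
    using D cl by (intro continuous_on_open_Un)
  moreover have "D \<union> - K = UNIV" using K by auto
  ultimately show ?thesis unfolding C1c_def using 1 K by auto
qed

lemma integrable_compact_support:
  fixes h :: "'a::euclidean_space \<Rightarrow> 'b::euclidean_space"
  assumes "compact K" "continuous_on K h" "\<And>x. x \<notin> K \<Longrightarrow> h x = 0"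
  shows "integrable lborel h"
proof -
  have "integrable lborel (\<lambda>x. indicator K x *\<^sub>R h x)"
    by (rule borel_integrable_compact[OF assms(1,2)])
  moreover have "(\<lambda>x. indicator K x *\<^sub>R h x) = h"
    using assms(3) by (auto simp: indicator_def fun_eq_iff)
  ultimately show ?thesis by simp
qed

lemma C1c_integrable:
  fixes f :: "'a::euclidean_space \<Rightarrow> real"
  assumes "C1c D \<psi> G"
  shows "continuous_on D f \<Longrightarrow> integrable lborel (\<lambda>x. f x * \<psi> x)"
    and "continuous_on D F \<Longrightarrow> integrable lborel (\<lambda>x. F x \<bullet> G x)"
proof -
  obtain K where K: "compact K" "K \<subseteq> D" "\<And>x. x \<notin> K \<Longrightarrow> \<psi> x = 0" "\<And>x. x \<notin> K \<Longrightarrow> G x = 0"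
    using C1cE[OF assms] by metis
  show "integrable lborel (\<lambda>x. f x * \<psi> x)" if "continuous_on D f"
    by (rule integrable_compact_support[OF K(1)])
      (use K that C1c_cont[OF assms] in \<open>auto intro!: continuous_intros continuous_on_subset[OF that]\<close>)
  show "integrable lborel (\<lambda>x. F x \<bullet> G x)" if "continuous_on D F"
    by (rule integrable_compact_support[OF K(1)])
      (use K that C1c_cont[OF assms] in \<open>auto intro!: continuous_intros continuous_on_subset[OF that]\<close>)
qed

lemma lborel_integral_translation:
  fixes f :: "'a::euclidean_space \<Rightarrow> real"
  assumes "f \<in> borel_measurable borel"
  shows "(LINT x|lborel. f (c + x)) = (LINT x|lborel. f x)"
proof -
  have "lborel = distr lborel borel (\<lambda>x. c + x)"
    using lborel_affine[of 1 c] by (simp add: density_1)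
  then have "(LINT x|lborel. f x) = (LINT x|distr lborel borel (\<lambda>x. c + x). f x)" by simp
  also have "\<dots> = (LINT x|lborel. f (c + x))"
    using assms by (subst integral_distr) auto
  finally show ?thesis by simp
qed

lemma GDERIV_increment_bound:
  fixes F :: "'a::euclidean_space \<Rightarrow> real"
  assumes "\<And>x. GDERIV F x :> G x" and "\<And>x. norm (G x) \<le> C"
  shows "\<bar>F x - F y\<bar> \<le> C * norm (x - y)"
proof -
  have "norm (F x - F y) \<le> C * norm (x - y)"
  proof (rule differentiable_bound[of UNIV F "\<lambda>x h. h \<bullet> G x"])
    show "onorm (\<lambda>h. h \<bullet> G z) \<le> C" for z
    proof (rule onorm_bound)
      show "0 \<le> C" using assms(2)[of z] norm_ge_zero[of "G z"] by linarith
      show "norm (h \<bullet> G z) \<le> C * norm h" for h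
        by (metis Cauchy_Schwarz_ineq2 assms(2) inner_commute mult.commute mult_left_mono norm_ge_zero order_trans real_norm_def)
    qed
  qed (use assms in \<open>auto simp: gderiv_def\<close>)
  then show ?thesis by simp
qed

text \<open>The difference quotients of \<open>F\<close> have integral zero by translation invariance of the measure,
  and they are dominated because \<open>F\<close> is Lipschitz with compact support.\<close>
lemma integral_derivative_compact_support:
  fixes F :: "'a::euclidean_space \<Rightarrow> real"
  assumes F: "C1c UNIV F G"
  shows "(LINT x|lborel. G x \<bullet> b) = 0"
proof -
  obtain K where K: "compact K" "\<And>x. x \<notin> K \<Longrightarrow> F x = 0" "\<And>x. x \<notin> K \<Longrightarrow> G x = 0"
    using C1cE[OF F] by metis
  obtain C0 where C0: "\<And>x. x \<in> K \<Longrightarrow> norm (G x) \<le> C0"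
    using compact_imp_bounded[OF compact_continuous_image[OF C1c_cont(2)[OF F] K(1)]]
    unfolding bounded_iff by auto
  define C where "C = max 0 C0"
  have C: "norm (G x) \<le> C" for x
    using C0[of x] K(3)[of x] by (cases "x \<in> K") (auto simp: C_def)
  obtain R where R: "\<And>x. x \<in> K \<Longrightarrow> norm x \<le> R"
    using compact_imp_bounded[OF K(1)] unfolding bounded_iff by auto
  have meas: "F \<in> borel_measurable borel"
    using C1c_cont(1)[OF F, of UNIV] by (rule borel_measurable_continuous_onI)
  have intF: "integrable lborel F"
    by (rule integrable_compact_support[OF K(1)]) (use K C1c_cont[OF F] in auto)
  have intFt: "integrable lborel (\<lambda>x. F (c + x))" for c
  proof (rule integrable_compact_support[of "(\<lambda>x. x - c) ` K"])
    show "compact ((\<lambda>x. x - c) ` K)"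
      by (intro compact_continuous_image K continuous_intros)
    show "continuous_on ((\<lambda>x. x - c) ` K) (\<lambda>x. F (c + x))"
      by (rule continuous_on_compose2[OF C1c_cont(1)[OF F, of UNIV]]) (auto intro!: continuous_intros)
    show "F (c + x) = 0" if "x \<notin> (\<lambda>x. x - c) ` K" for x
    proof (rule K(2))
      show "c + x \<notin> K" using that by (auto simp: image_iff)
    qed
  qed
  define q where "q n x = real (Suc n) * (F (inverse (real (Suc n)) *\<^sub>R b + x) - F x)" for n x
  define w where "w x = C * norm b * indicator (cball 0 (R + norm b)) x" for x :: 'a
  have int0: "(LINT x|lborel. q n x) = 0" for n
    unfolding q_def using intF intFt lborel_integral_translation[OF meas] by simp
  have lim: "(\<lambda>n. LINT x|lborel. q n x) \<longlonglongrightarrow> (LINT x|lborel. G x \<bullet> b)"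
  proof (rule integral_dominated_convergence[where w = w])
    show "(\<lambda>x. G x \<bullet> b) \<in> borel_measurable lborel"
      using C1c_cont(2)[OF F, of UNIV]
      by (auto intro!: borel_measurable_continuous_onI continuous_intros)
    show "q n \<in> borel_measurable lborel" for n
      unfolding q_def using intF intFt by (intro borel_measurable_times borel_measurable_diff) auto
    show "integrable lborel w"
      unfolding w_def by (intro integrable_mult_right integrable_real_indicator) (use emeasure_lborel_cball_finite in auto)
    show "AE x in lborel. (\<lambda>n. q n x) \<longlonglongrightarrow> G x \<bullet> b"
    proof (rule AE_I2)
      fix x
      have "((\<lambda>t. F (t *\<^sub>R b + x)) has_field_derivative (G (0 *\<^sub>R b + x) \<bullet> b)) (at 0)"
      proof -
        have "((\<lambda>t. F (t *\<^sub>R b + x)) has_derivative (\<lambda>t. (t *\<^sub>R b) \<bullet> G (0 *\<^sub>R b + x))) (at 0)"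
          by (rule has_derivative_compose[of "\<lambda>t. t *\<^sub>R b + x" "\<lambda>t. t *\<^sub>R b" 0 UNIV F "\<lambda>h. h \<bullet> G (0 *\<^sub>R b + x)"])
            (use C1c_gderiv[OF F, of "0 *\<^sub>R b + x"] in \<open>auto simp: gderiv_def intro!: derivative_eq_intros\<close>)
        then show ?thesis
          unfolding has_field_derivative_def
          by (rule has_derivative_eq_rhs) (auto simp: inner_commute fun_eq_iff)
      qed
      then have "((\<lambda>t. (F (t *\<^sub>R b + x) - F x) / t) \<longlongrightarrow> G x \<bullet> b) (at 0)"
        by (simp add: has_field_derivative_iff)
      moreover have "filterlim (\<lambda>n. inverse (real (Suc n))) (at 0) sequentially"
        using LIMSEQ_inverse_real_of_nat by (auto simp: filterlim_at)
      ultimately have "(\<lambda>n. (F (inverse (real (Suc n)) *\<^sub>R b + x) - F x) / inverse (real (Suc n))) \<longlonglongrightarrow> G x \<bullet> b"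
        by (rule filterlim_compose)
      then show "(\<lambda>n. q n x) \<longlonglongrightarrow> G x \<bullet> b"
        by (simp add: q_def field_simps)
    qed
    show "AE x in lborel. norm (q n x) \<le> w x" for n
    proof (rule AE_I2)
      fix x
      let ?t = "inverse (real (Suc n))"
      have t: "0 < ?t" "?t \<le> 1" by (auto simp: field_simps)
      show "norm (q n x) \<le> w x"
      proof (cases "norm x \<le> R + norm b")
        case True
        have "\<bar>F (?t *\<^sub>R b + x) - F x\<bar> \<le> C * norm (?t *\<^sub>R b + x - x)"
          by (rule GDERIV_increment_bound[OF C1c_gderiv[OF F] C])
        then have "\<bar>q n x\<bar> \<le> real (Suc n) * (C * (?t * norm b))"
          unfolding q_def abs_mult by (intro mult_mono) auto
        also have "\<dots> = C * norm b" by simp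
        finally show ?thesis using True by (simp add: w_def dist_norm)
      next
        case False
        have "x \<notin> K" using False R[of x] norm_ge_zero[of b] by linarith
        moreover have "norm x \<le> norm (?t *\<^sub>R b + x) + norm b"
        proof -
          have "norm x \<le> norm (?t *\<^sub>R b + x) + norm (?t *\<^sub>R b)"
            using norm_triangle_ineq4[of "?t *\<^sub>R b + x" "?t *\<^sub>R b"] by simp
          moreover have "norm (?t *\<^sub>R b) \<le> norm b" using t by (simp add: mult_left_le_one_le)
          ultimately show ?thesis by linarith
        qed
        then have "?t *\<^sub>R b + x \<notin> K" using False R[of "?t *\<^sub>R b + x"] by linarith
        ultimately show ?thesis using K(2) by (simp add: q_def w_def C_def)
      qed
    qed
  qed
  then show ?thesis by (simp add: int0 LIMSEQ_const_iff)
qed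

text \<open>Only the product \<open>f X\<close> needs compact support. Extended by zero its
  components are of class \<open>C\<^sup>1\<close> on the whole space, and each contributes an integral of a
  derivative.\<close>
lemma divergence_theorem_compact_support:
  fixes X :: "'a::euclidean_space \<Rightarrow> 'a"
  assumes D: "open D" and f: "\<And>x. x \<in> D \<Longrightarrow> GDERIV f x :> Df x" "continuous_on D Df"
    and X: "\<And>x b. x \<in> D \<Longrightarrow> b \<in> Basis \<Longrightarrow> GDERIV (\<lambda>x. X x \<bullet> b) x :> H b x"
      "\<And>b. b \<in> Basis \<Longrightarrow> continuous_on D (H b)"
    and K: "compact K" "K \<subseteq> D" "\<And>x. x \<in> D - K \<Longrightarrow> f x = 0 \<or> X x = 0"
  shows "(LINT x|lborel. indicator D x * (Df x \<bullet> X x + f x * (\<Sum>b\<in>Basis. H b x \<bullet> b))) = 0"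
    and "integrable lborel (\<lambda>x. indicator D x * (Df x \<bullet> X x + f x * (\<Sum>b\<in>Basis. H b x \<bullet> b)))"
proof -
  let ?F = "\<lambda>b x. if x \<in> D then f x * (X x \<bullet> b) else 0"
  let ?G = "\<lambda>b x. if x \<in> D then f x *\<^sub>R H b x + (X x \<bullet> b) *\<^sub>R Df x else 0"
  have cf: "continuous_on D f"
    using f(1) by (auto intro: continuous_at_imp_continuous_on GDERIV_isCont)
  have c: "C1c D (?F b) (?G b)" if b: "b \<in> Basis" for b
  proof (rule C1c_extend[OF D])
    show "GDERIV (\<lambda>x. f x * (X x \<bullet> b)) x :> f x *\<^sub>R H b x + (X x \<bullet> b) *\<^sub>R Df x" if "x \<in> D" for x
      by (rule GDERIV_mult) (use f X b that in auto)
    have "continuous_on D (\<lambda>x. X x \<bullet> b)"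
      using X(1)[OF _ b] by (auto intro: continuous_at_imp_continuous_on GDERIV_isCont)
    then show "continuous_on D (\<lambda>x. f x *\<^sub>R H b x + (X x \<bullet> b) *\<^sub>R Df x)"
      by (intro continuous_on_add continuous_on_scaleR cf f(2) X(2)[OF b])
    show "f x * (X x \<bullet> b) = 0" if "x \<in> D - K" for x
      using K(3)[OF that] by auto
  qed (use K in auto)
  have eq: "(\<lambda>x. indicator D x * (Df x \<bullet> X x + f x * (\<Sum>b\<in>Basis. H b x \<bullet> b))) = (\<lambda>x. \<Sum>b\<in>Basis. ?G b x \<bullet> b)"
  proof
    fix x
    have "Df x \<bullet> X x = (\<Sum>b\<in>Basis. (X x \<bullet> b) * (Df x \<bullet> b))"
      by (simp add: euclidean_inner[of "Df x" "X x"] mult.commute)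
    then show "indicator D x * (Df x \<bullet> X x + f x * (\<Sum>b\<in>Basis. H b x \<bullet> b)) = (\<Sum>b\<in>Basis. ?G b x \<bullet> b)"
      by (simp add: indicator_def inner_add_left sum.distrib sum_distrib_left)
  qed
  have int: "integrable lborel (\<lambda>x. ?G b x \<bullet> b)" if b: "b \<in> Basis" for b
    using C1c_integrable(2)[OF c[OF b], of "\<lambda>_. b"] by (simp add: inner_commute)
  show "integrable lborel (\<lambda>x. indicator D x * (Df x \<bullet> X x + f x * (\<Sum>b\<in>Basis. H b x \<bullet> b)))"
    unfolding eq using int by (intro Bochner_Integration.integrable_sum)
  show "(LINT x|lborel. indicator D x * (Df x \<bullet> X x + f x * (\<Sum>b\<in>Basis. H b x \<bullet> b))) = 0"
    unfolding eq using int integral_derivative_compact_support[OF C1c_mono[OF c]]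
    by (subst Bochner_Integration.integral_sum) auto
qed


section \<open>Invariance of Lebesgue measure under isometries\<close>

lemma nn_integral_lborel_translation:
  fixes f :: "'a::euclidean_space \<Rightarrow> ennreal"
  assumes "f \<in> borel_measurable borel"
  shows "(\<integral>\<^sup>+x. f (c + x) \<partial>lborel) = (\<integral>\<^sup>+x. f x \<partial>lborel)"
proof -
  have "lborel = distr lborel borel (\<lambda>x. c + x)"
    using lborel_affine[of 1 c] by (simp add: density_1)
  then have "(\<integral>\<^sup>+x. f x \<partial>lborel) = (\<integral>\<^sup>+x. f x \<partial>distr lborel borel (\<lambda>x. c + x))" by simp
  also have "\<dots> = (\<integral>\<^sup>+x. f (c + x) \<partial>lborel)"
    using assms by (subst nn_integral_distr) auto
  finally show ?thesis by simp
qed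

text \<open>The uniqueness argument for Haar measure: both \<open>\<lambda>(T\<inverse>A) \<lambda>(B)\<close> and \<open>\<lambda>(A) \<lambda>(B)\<close>, for a ball
  \<open>B\<close> about the origin, are the double integral of \<open>1\<^sub>A(T x) 1\<^sub>B(y - T x)\<close>.\<close>
lemma lborel_distr_isometry:
  fixes T Ti :: "'a::euclidean_space \<Rightarrow> 'a"
  assumes lin: "linear T" "linear Ti" and inv: "\<And>x. T (Ti x) = x" and nrm: "\<And>x. norm (T x) = norm x"
  shows "distr lborel borel T = lborel"
proof (rule measure_eqI)
  show "sets (distr lborel borel T) = sets lborel" by simp
next
  fix A assume "A \<in> sets (distr lborel borel T)"
  then have A[measurable]: "A \<in> sets borel" by simp
  define B :: "'a set" where "B = ball 0 1"
  have B[measurable]: "B \<in> sets borel" by (simp add: B_def)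
  have T[measurable]: "T \<in> borel_measurable borel"
    using lin(1) by (intro borel_measurable_continuous_onI linear_continuous_on linear_conv_bounded_linear[THEN iffD1])
  have ind: "(indicator A x :: ennreal) \<in> {0,1}" for x by (auto simp: indicator_def)
  have e1: "(\<integral>\<^sup>+y. indicator B (y - T x) \<partial>lborel) = emeasure lborel B" for x
    using nn_integral_lborel_translation[of "\<lambda>y. indicator B y" "- T x"] by simp
  have e2: "(\<integral>\<^sup>+y. indicator A (T x + y) \<partial>lborel) = emeasure lborel A" for x
    using nn_integral_lborel_translation[of "\<lambda>y. indicator A y" "T x"] by simp
  have e3: "(\<integral>\<^sup>+x. indicator A (T x) * indicator B (y - T x) \<partial>lborel)
      = (\<integral>\<^sup>+x. indicator A (T x + y) * indicator B (- T x) \<partial>lborel)" for y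
    using nn_integral_lborel_translation[of "\<lambda>x. indicator A (T x) * indicator B (y - T x)" "Ti y"]
    by (simp add: linear_add[OF lin(1)] inv add.commute)
  have "emeasure (distr lborel borel T) A * emeasure lborel B
      = (\<integral>\<^sup>+x. indicator A (T x) \<partial>lborel) * emeasure lborel B"
    using nn_integral_distr[of T lborel borel "indicator A"] by simp
  also have "\<dots> = (\<integral>\<^sup>+x. indicator A (T x) * (\<integral>\<^sup>+y. indicator B (y - T x) \<partial>lborel) \<partial>lborel)"
    by (simp add: e1 nn_integral_multc)
  also have "\<dots> = (\<integral>\<^sup>+x. \<integral>\<^sup>+y. indicator A (T x) * indicator B (y - T x) \<partial>lborel \<partial>lborel)"
    by (simp add: nn_integral_cmult)
  also have "\<dots> = (\<integral>\<^sup>+y. \<integral>\<^sup>+x. indicator A (T x) * indicator B (y - T x) \<partial>lborel \<partial>lborel)"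
    by (rule lborel_pair.Fubini') measurable
  also have "\<dots> = (\<integral>\<^sup>+y. \<integral>\<^sup>+x. indicator A (T x + y) * indicator B (- T x) \<partial>lborel \<partial>lborel)"
    by (simp add: e3)
  also have "\<dots> = (\<integral>\<^sup>+x. \<integral>\<^sup>+y. indicator A (T x + y) * indicator B (- T x) \<partial>lborel \<partial>lborel)"
    by (rule lborel_pair.Fubini') measurable
  also have "\<dots> = (\<integral>\<^sup>+x. emeasure lborel A * indicator B (- T x) \<partial>lborel)"
    by (simp add: nn_integral_multc e2)
  also have "\<dots> = emeasure lborel A * (\<integral>\<^sup>+x. indicator B x \<partial>lborel)"
    by (simp add: nn_integral_cmult B_def indicator_def nrm)
  finally have "emeasure (distr lborel borel T) A * emeasure lborel B = emeasure lborel A * emeasure lborel B"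
    by simp
  moreover have "emeasure lborel B \<noteq> top" unfolding B_def using emeasure_lborel_ball_finite[of "0::'a" 1] by auto
  moreover have "emeasure lborel B \<noteq> 0"
  proof
    assume "emeasure lborel B = 0"
    then have "measure lborel B = 0" by (simp add: measure_def)
    then show False unfolding B_def using content_ball_pos[of 1 "0::'a"] by simp
  qed
  ultimately have "emeasure (distr lborel borel T) A * emeasure lborel B / emeasure lborel B
      = emeasure lborel A * emeasure lborel B / emeasure lborel B" by (simp only:)
  then show "emeasure (distr lborel borel T) A = emeasure lborel A"
    using mult_divide_eq_ennreal[OF \<open>emeasure lborel B \<noteq> 0\<close> \<open>emeasure lborel B \<noteq> top\<close>] by simp
qed

lemma integral_isometry:
  fixes T Ti :: "'a::euclidean_space \<Rightarrow> 'a" and f :: "'a \<Rightarrow> real"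
  assumes "linear T" "linear Ti" "\<And>x. T (Ti x) = x" "\<And>x. norm (T x) = norm x"
  shows "f \<in> borel_measurable borel \<Longrightarrow> (LINT x|lborel. f (T x)) = (LINT x|lborel. f x)"
    and "f \<in> borel_measurable borel \<Longrightarrow> integrable lborel (\<lambda>x. f (T x)) \<longleftrightarrow> integrable lborel f"
    and "h \<in> borel_measurable borel \<Longrightarrow> (\<integral>\<^sup>+x. h (T x) \<partial>lborel) = (\<integral>\<^sup>+x. h x \<partial>lborel)"
proof -
  have T[measurable]: "T \<in> borel_measurable borel"
    using assms(1) by (intro borel_measurable_continuous_onI linear_continuous_on linear_conv_bounded_linear[THEN iffD1])
  note d = lborel_distr_isometry[OF assms, symmetric]
  show "(LINT x|lborel. f (T x)) = (LINT x|lborel. f x)" if "f \<in> borel_measurable borel"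
    using that by (subst (2) d, subst integral_distr) auto
  show "integrable lborel (\<lambda>x. f (T x)) \<longleftrightarrow> integrable lborel f" if "f \<in> borel_measurable borel"
    using that by (subst (2) d, subst integrable_distr_eq) auto
  show "(\<integral>\<^sup>+x. h (T x) \<partial>lborel) = (\<integral>\<^sup>+x. h x \<partial>lborel)" if "h \<in> borel_measurable borel"
    using that by (subst (2) d, subst nn_integral_distr) auto
qed

section \<open>Second derivatives and radial test functions\<close>

lemma second_difference_mvt:
  fixes F :: "real \<Rightarrow> real \<Rightarrow> real"
  assumes h: "h > 0"
    and F1: "\<And>s t. \<lbrakk>0 \<le> s; s \<le> h; 0 \<le> t; t \<le> h\<rbrakk> \<Longrightarrow> DERIV (\<lambda>s. F s t) s :> F1 s t"
    and F12: "\<And>s t. \<lbrakk>0 \<le> s; s \<le> h; 0 \<le> t; t \<le> h\<rbrakk> \<Longrightarrow> DERIV (\<lambda>t. F1 s t) t :> F12 s t"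
  shows "\<exists>s t. 0 < s \<and> s < h \<and> 0 < t \<and> t < h \<and> F h h - F h 0 - F 0 h + F 0 0 = h\<^sup>2 * F12 s t"
proof -
  have "\<exists>s. 0 < s \<and> s < h \<and> (F h h - F h 0) - (F 0 h - F 0 0) = (h - 0) * (F1 s h - F1 s 0)"
    by (rule MVT2[OF h]) (use F1 h in \<open>auto intro!: DERIV_diff\<close>)
  then obtain s where s: "0 < s" "s < h" "(F h h - F h 0) - (F 0 h - F 0 0) = h * (F1 s h - F1 s 0)" by auto
  have "\<exists>t. 0 < t \<and> t < h \<and> F1 s h - F1 s 0 = (h - 0) * F12 s t"
    by (rule MVT2[OF h]) (use F12 s in auto)
  then obtain t where "0 < t" "t < h" "F1 s h - F1 s 0 = h * F12 s t" by auto
  with s show ?thesis by (intro exI[of _ s] exI[of _ t]) (auto simp: power2_eq_square algebra_simps)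
qed

lemma GDERIV_line:
  fixes f :: "'a::real_inner \<Rightarrow> real"
  assumes "GDERIV f (c + t *\<^sub>R b) :> d"
  shows "DERIV (\<lambda>t. f (c + t *\<^sub>R b)) t :> b \<bullet> d"
proof -
  have "((\<lambda>t. f (c + t *\<^sub>R b)) has_derivative (\<lambda>s. (s *\<^sub>R b) \<bullet> d)) (at t)"
    by (rule has_derivative_compose[of "\<lambda>t. c + t *\<^sub>R b" "\<lambda>s. s *\<^sub>R b" t UNIV f "\<lambda>h. h \<bullet> d"])
      (use assms in \<open>auto simp: gderiv_def intro!: derivative_eq_intros\<close>)
  then show ?thesis
    unfolding has_field_derivative_def by (rule has_derivative_eq_rhs) (auto simp: fun_eq_iff)
qed

text \<open>Applied to \<open>u\<close> on a small parallelogram in both orders, the mean value theorem gives two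
  expressions for the same second difference; the continuity of the second derivatives then forces equality in
  the limit.\<close>
lemma second_derivative_symmetric:
  fixes u :: "'a::euclidean_space \<Rightarrow> real"
  assumes S: "open S" "x \<in> S"
    and u: "\<And>y. y \<in> S \<Longrightarrow> GDERIV u y :> Du y"
    and A: "\<And>y. y \<in> S \<Longrightarrow> GDERIV (\<lambda>y. a \<bullet> Du y) y :> DA y" "continuous_on S DA"
    and B: "\<And>y. y \<in> S \<Longrightarrow> GDERIV (\<lambda>y. b \<bullet> Du y) y :> DB y" "continuous_on S DB"
  shows "b \<bullet> DA x = a \<bullet> DB x"
proof (rule ccontr)
  assume ne: "b \<bullet> DA x \<noteq> a \<bullet> DB x"
  define e where "e = \<bar>b \<bullet> DA x - a \<bullet> DB x\<bar> / 2"
  have e: "e > 0" using ne by (simp add: e_def)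
  have "isCont (\<lambda>y. b \<bullet> DA y) x" "isCont (\<lambda>y. a \<bullet> DB y) x"
    using S A(2) B(2) by (auto simp: continuous_on_eq_continuous_at intro!: continuous_intros)
  then obtain d1 d2 where d1: "d1 > 0" "\<And>y. dist y x < d1 \<Longrightarrow> \<bar>b \<bullet> DA y - b \<bullet> DA x\<bar> < e"
      and d2: "d2 > 0" "\<And>y. dist y x < d2 \<Longrightarrow> \<bar>a \<bullet> DB y - a \<bullet> DB x\<bar> < e"
    using e unfolding continuous_at_eps_delta by (metis dist_real_def)
  obtain d3 where d3: "d3 > 0" "ball x d3 \<subseteq> S" using S openE by blast
  define d where "d = Min {d1, d2, d3}"
  have d: "d > 0" "d \<le> d1" "d \<le> d2" "d \<le> d3" using d1 d2 d3 by (auto simp: d_def)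
  define M where "M = norm a + norm b + 1"
  have M: "M > 0" unfolding M_def by (auto intro: add_nonneg_pos)
  define h where "h = d / (2 * M)"
  have h: "h > 0" using d M by (simp add: h_def)
  have near: "dist (x + s *\<^sub>R a + t *\<^sub>R b) x < d" if "0 \<le> s" "s \<le> h" "0 \<le> t" "t \<le> h" for s t
  proof -
    have "dist (x + s *\<^sub>R a + t *\<^sub>R b) x = norm (s *\<^sub>R a + t *\<^sub>R b)" by (simp add: dist_norm algebra_simps)
    also have "\<dots> \<le> s * norm a + t * norm b"
      using norm_triangle_ineq[of "s *\<^sub>R a" "t *\<^sub>R b"] that by simp
    also have "\<dots> \<le> h * norm a + h * norm b" using that by (intro add_mono mult_right_mono) auto
    also have "\<dots> \<le> h * M" using h by (simp add: M_def algebra_simps)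
    also have "\<dots> < d" using M d by (simp add: h_def)
    finally show ?thesis .
  qed
  have nS: "x + s *\<^sub>R a + t *\<^sub>R b \<in> S" if "0 \<le> s" "s \<le> h" "0 \<le> t" "t \<le> h" for s t
    using near[OF that] d(4) d3(2) by (auto simp: dist_commute subset_iff)
  define F where "F s t = u (x + s *\<^sub>R a + t *\<^sub>R b)" for s t
  have c: "x + s *\<^sub>R a + t *\<^sub>R b = (x + t *\<^sub>R b) + s *\<^sub>R a" for s t by simp
  have 1: "\<exists>s t. 0 < s \<and> s < h \<and> 0 < t \<and> t < h \<and> F h h - F h 0 - F 0 h + F 0 0
      = h\<^sup>2 * (b \<bullet> DA (x + s *\<^sub>R a + t *\<^sub>R b))"
  proof (rule second_difference_mvt[OF h, where ?F1.0 = "\<lambda>s t. a \<bullet> Du (x + s *\<^sub>R a + t *\<^sub>R b)"])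
    fix s t :: real assume st: "0 \<le> s" "s \<le> h" "0 \<le> t" "t \<le> h"
    show "DERIV (\<lambda>s. F s t) s :> a \<bullet> Du (x + s *\<^sub>R a + t *\<^sub>R b)"
      unfolding F_def c by (rule GDERIV_line) (use u nS[OF st] in \<open>simp add: algebra_simps\<close>)
    show "DERIV (\<lambda>t. a \<bullet> Du (x + s *\<^sub>R a + t *\<^sub>R b)) t :> b \<bullet> DA (x + s *\<^sub>R a + t *\<^sub>R b)"
      by (rule GDERIV_line[where f = "\<lambda>y. a \<bullet> Du y"]) (use A nS[OF st] in simp)
  qed
  have 2: "\<exists>t s. 0 < t \<and> t < h \<and> 0 < s \<and> s < h \<and> F h h - F 0 h - F h 0 + F 0 0
      = h\<^sup>2 * (a \<bullet> DB (x + s *\<^sub>R a + t *\<^sub>R b))"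
  proof (rule second_difference_mvt[OF h, of "\<lambda>t s. F s t" "\<lambda>t s. b \<bullet> Du (x + s *\<^sub>R a + t *\<^sub>R b)"])
    fix t s :: real assume st: "0 \<le> t" "t \<le> h" "0 \<le> s" "s \<le> h"
    show "DERIV (\<lambda>t. F s t) t :> b \<bullet> Du (x + s *\<^sub>R a + t *\<^sub>R b)"
      unfolding F_def by (rule GDERIV_line) (use u nS[of s t] st in simp)
    show "DERIV (\<lambda>s. b \<bullet> Du (x + s *\<^sub>R a + t *\<^sub>R b)) s :> a \<bullet> DB (x + s *\<^sub>R a + t *\<^sub>R b)"
      unfolding c by (rule GDERIV_line[where f = "\<lambda>y. b \<bullet> Du y"]) (use B nS[of s t] st in \<open>simp add: algebra_simps\<close>)
  qed
  from 1 obtain s t where st: "0 < s" "s < h" "0 < t" "t < h"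
    "F h h - F h 0 - F 0 h + F 0 0 = h\<^sup>2 * (b \<bullet> DA (x + s *\<^sub>R a + t *\<^sub>R b))" by blast
  from 2 obtain s' t' where st': "0 < s'" "s' < h" "0 < t'" "t' < h"
    "F h h - F 0 h - F h 0 + F 0 0 = h\<^sup>2 * (a \<bullet> DB (x + s' *\<^sub>R a + t' *\<^sub>R b))" by blast
  have "h\<^sup>2 * (b \<bullet> DA (x + s *\<^sub>R a + t *\<^sub>R b)) = h\<^sup>2 * (a \<bullet> DB (x + s' *\<^sub>R a + t' *\<^sub>R b))"
    using st(5) st'(5) by linarith
  then have eq: "b \<bullet> DA (x + s *\<^sub>R a + t *\<^sub>R b) = a \<bullet> DB (x + s' *\<^sub>R a + t' *\<^sub>R b)" using h by simp
  have "\<bar>b \<bullet> DA (x + s *\<^sub>R a + t *\<^sub>R b) - b \<bullet> DA x\<bar> < e"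
    using d1(2) near[of s t] st d(2) by (simp add: less_le_trans)
  moreover have "\<bar>a \<bullet> DB (x + s' *\<^sub>R a + t' *\<^sub>R b) - a \<bullet> DB x\<bar> < e"
    using d2(2) near[of s' t'] st' d(3) by (simp add: less_le_trans)
  ultimately show False using eq by (simp add: e_def) (smt (verit) field_sum_of_halves)
qed

text \<open>Radial test functions \<open>(R\<^sup>2 - |x - y|\<^sup>2)\<^sub>+\<^sup>m\<close>.\<close>

definition bump :: "'a::euclidean_space \<Rightarrow> real \<Rightarrow> nat \<Rightarrow> 'a \<Rightarrow> real" where
  "bump y R m x = (max 0 (R\<^sup>2 - (norm (x - y))\<^sup>2)) ^ m"

definition bump_grad :: "'a::euclidean_space \<Rightarrow> real \<Rightarrow> nat \<Rightarrow> 'a \<Rightarrow> 'a" where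
  "bump_grad y R m x = (- 2 * real m * (max 0 (R\<^sup>2 - (norm (x - y))\<^sup>2)) ^ (m - 1)) *\<^sub>R (x - y)"

definition bump_lap :: "'a::euclidean_space \<Rightarrow> real \<Rightarrow> nat \<Rightarrow> 'a \<Rightarrow> real" where
  "bump_lap y R m x = 4 * real m * real (m - 1) * (max 0 (R\<^sup>2 - (norm (x - y))\<^sup>2)) ^ (m - 2) * (norm (x - y))\<^sup>2
     - 2 * real DIM('a) * real m * (max 0 (R\<^sup>2 - (norm (x - y))\<^sup>2)) ^ (m - 1)"

lemma GDERIV_norm_diff_square: "GDERIV (\<lambda>x. (norm (x - y))\<^sup>2) x :> 2 *\<^sub>R (x - y)"
  unfolding gderiv_def power2_norm_eq_inner
  by (auto intro!: derivative_eq_intros simp: inner_commute inner_diff)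

lemma GDERIV_bump_power:
  "GDERIV (\<lambda>x. (max 0 (R\<^sup>2 - (norm (x - y))\<^sup>2)) ^ Suc (Suc n)) x :>
     (- 2 * real (Suc (Suc n)) * (max 0 (R\<^sup>2 - (norm (x - y))\<^sup>2)) ^ Suc n) *\<^sub>R (x - y)"
  by (rule GDERIV_subst[OF GDERIV_DERIV_compose[OF GDERIV_diff[OF GDERIV_const GDERIV_norm_diff_square] DERIV_pos_part_power]])
    (simp only: diff_0 scaleR_minus_right scaleR_scaleR scaleR_minus_left[symmetric], rule arg_cong2[where f = scaleR], simp_all add: algebra_simps)

lemma GDERIV_bump: "m \<ge> 2 \<Longrightarrow> GDERIV (bump y R m) x :> bump_grad y R m x"
  using GDERIV_bump_power[of R y "m - 2" x]
  by (simp add: bump_def[abs_def] bump_grad_def del: power_Suc add: Suc_diff_Suc numeral_2_eq_2)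

lemma continuous_on_bump: "continuous_on A (bump y R m)" "continuous_on A (bump_grad y R m)" "continuous_on A (bump_lap y R m)"
  unfolding bump_def[abs_def] bump_grad_def[abs_def] bump_lap_def[abs_def] by (intro continuous_intros)+

definition bump_hess :: "'a::euclidean_space \<Rightarrow> real \<Rightarrow> nat \<Rightarrow> 'a \<Rightarrow> 'a \<Rightarrow> 'a" where
  "bump_hess y R m b x = (- 2 * real m * (max 0 (R\<^sup>2 - (norm (x - y))\<^sup>2)) ^ (m - 1)) *\<^sub>R b
     + (4 * real m * real (m - 1) * (max 0 (R\<^sup>2 - (norm (x - y))\<^sup>2)) ^ (m - 2) * ((x - y) \<bullet> b)) *\<^sub>R (x - y)"

lemma GDERIV_bump_grad:
  assumes "m \<ge> 3"
  shows "GDERIV (\<lambda>x. bump_grad y R m x \<bullet> b) x :> bump_hess y R m b x"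
proof -
  have "m = Suc (Suc (Suc (m - 3)))" using assms by simp
  then obtain n where n: "m = Suc (Suc (Suc n))" by blast
  have i: "GDERIV (\<lambda>x. (x - y) \<bullet> b) x :> b"
    unfolding gderiv_def by (auto intro!: derivative_eq_intros)
  show ?thesis
    unfolding bump_grad_def bump_hess_def n inner_scaleR_left
    by (rule GDERIV_subst[OF GDERIV_mult[OF GDERIV_mult[OF GDERIV_const] i]], simp only: diff_Suc_1, rule GDERIV_bump_power,
        rule arg_cong2[where f = "(+)"], simp,
        simp only: scaleR_zero_right add_0_right scaleR_scaleR, rule arg_cong2[where f = scaleR], simp_all add: algebra_simps)
qed

lemma continuous_on_bump_hess: "continuous_on A (bump_hess y R m b)"
  unfolding bump_hess_def[abs_def] by (intro continuous_intros)

lemma bump_hess_trace: "(\<Sum>b\<in>Basis. bump_hess y R m b x \<bullet> b) = bump_lap y R m x"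
proof -
  define v where "v = x - y"
  define p where "p = max 0 (R\<^sup>2 - (norm v)\<^sup>2)"
  define c where "c = - 2 * real m * p ^ (m - 1)"
  define d where "d = 4 * real m * real (m - 1) * p ^ (m - 2)"
  have "(\<Sum>b\<in>Basis. bump_hess y R m b x \<bullet> b) = (\<Sum>b\<in>Basis. c + d * ((v \<bullet> b) * (v \<bullet> b)))"
    by (intro sum.cong refl) (simp add: bump_hess_def c_def d_def p_def v_def[symmetric] inner_add_left inner_diff_left)
  also have "\<dots> = real DIM('a) * c + d * (v \<bullet> v)"
    by (simp add: sum.distrib sum_distrib_left[symmetric] euclidean_inner[of v v])
  also have "\<dots> = bump_lap y R m x"
    by (simp add: bump_lap_def c_def d_def p_def v_def[symmetric] power2_norm_eq_inner)
  finally show ?thesis .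
qed

lemma bump_outside: 
  assumes "x \<notin> cball y R" "R > 0"
  shows "m \<ge> 1 \<Longrightarrow> bump y R m x = 0" "m \<ge> 2 \<Longrightarrow> bump_grad y R m x = 0" "m \<ge> 3 \<Longrightarrow> bump_lap y R m x = 0"
proof -
  have "R\<^sup>2 - (norm (x - y))\<^sup>2 \<le> 0"
    using assms by (simp add: dist_norm norm_minus_commute power_mono)
  then have "max 0 (R\<^sup>2 - (norm (x - y))\<^sup>2) = 0" by simp
  then show "m \<ge> 1 \<Longrightarrow> bump y R m x = 0" "m \<ge> 2 \<Longrightarrow> bump_grad y R m x = 0" "m \<ge> 3 \<Longrightarrow> bump_lap y R m x = 0"
    by (auto simp: bump_def bump_grad_def bump_lap_def zero_power)
qed

lemma bump_nonneg: "bump y R m x \<ge> 0" by (simp add: bump_def)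

lemma C1c_bump:
  assumes "m \<ge> 2" "R > 0" "cball y R \<subseteq> D"
  shows "C1c D (bump y R m) (bump_grad y R m)"
  unfolding C1c_def using assms bump_outside(1)[of _ y R m] GDERIV_bump[of m y R]
  by (intro conjI exI[of _ "cball y R"]) (auto simp: continuous_on_bump)

text \<open>For large \<open>m\<close> the bump is a strict subsolution of \<open>-\<Delta> + K\<close> away from its centre.\<close>
lemma bump_strict_subsolution:
  assumes "0 < R0" "R0 < R" "K \<ge> 0"
  obtains m where "m \<ge> 3"
    "\<And>x::'a::euclidean_space. norm (x - y) \<ge> R0 \<Longrightarrow> norm (x - y) < R \<Longrightarrow> - bump_lap y R m x + K * bump y R m x < 0"
    "\<And>x::'a. norm (x - y) \<ge> R0 \<Longrightarrow> - bump_lap y R m x + K * bump y R m x \<le> 0"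
proof -
  define c where "c = 2 * real DIM('a) * R\<^sup>2 + K * R ^ 4"
  obtain m0 :: nat where m0: "real m0 > c / (4 * R0\<^sup>2)" using reals_Archimedean2 by blast
  define m where "m = m0 + 3"
  have m: "m \<ge> 3" by (simp add: m_def)
  have mc: "4 * R0\<^sup>2 * real (m - 1) > c"
  proof -
    have "c < 4 * R0\<^sup>2 * real m0" using m0 assms by (simp add: field_simps)
    also have "\<dots> \<le> 4 * R0\<^sup>2 * real (m - 1)" by (intro mult_left_mono) (auto simp: m_def)
    finally show ?thesis .
  qed
  have strict: "- bump_lap y R m x + K * bump y R m x < 0" if x: "norm (x - y) \<ge> R0" "norm (x - y) < R" for x :: 'a
  proof -
    define s where "s = (norm (x - y))\<^sup>2"
    define P where "P = R\<^sup>2 - s"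
    have s: "s \<ge> R0\<^sup>2" using x assms by (simp add: s_def power_mono)
    have P: "P > 0" "P \<le> R\<^sup>2" using x assms by (auto simp: P_def s_def power_strict_mono)
    have mx: "max 0 (R\<^sup>2 - s) = P" using P by (simp add: P_def)
    have "m = Suc (Suc (m - 2))" using m by simp
    then obtain n where n: "m = Suc (Suc n)" by blast
    have "2 * real DIM('a) * real m * P + K * P\<^sup>2 < 4 * real m * real (m - 1) * s"
    proof -
      have "K * P\<^sup>2 \<le> K * (R\<^sup>2)\<^sup>2" using P assms(3) by (intro mult_left_mono power_mono) auto
      also have "\<dots> = 1 * (K * R ^ 4)" by simp
      also have "\<dots> \<le> real m * (K * R ^ 4)" using m assms by (intro mult_right_mono) auto
      finally have 1: "K * P\<^sup>2 \<le> real m * (K * R ^ 4)" .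
      have 2: "2 * real DIM('a) * real m * P \<le> 2 * real DIM('a) * real m * R\<^sup>2" using P by (intro mult_left_mono) auto
      have "2 * real DIM('a) * real m * P + K * P\<^sup>2 \<le> real m * c"
        using 1 2 unfolding c_def by (simp add: algebra_simps)
      also have "\<dots> < real m * (4 * R0\<^sup>2 * real (m - 1))" using mc m by (intro mult_strict_left_mono) auto
      also have "\<dots> \<le> real m * (4 * s * real (m - 1))" using s by (intro mult_left_mono mult_right_mono) auto
      finally show ?thesis by (simp add: mult_ac)
    qed
    then have "(2 * real DIM('a) * real m * P + K * P\<^sup>2 - 4 * real m * real (m - 1) * s) * P ^ n < 0"
      using P by (intro mult_neg_pos) auto
    moreover have "- bump_lap y R m x + K * bump y R m x = (2 * real DIM('a) * real m * P + K * P\<^sup>2 - 4 * real m * real (m - 1) * s) * P ^ n"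
      unfolding bump_lap_def bump_def s_def[symmetric] mx by (simp add: n algebra_simps power2_eq_square)
    ultimately show ?thesis by simp
  qed
  moreover have "- bump_lap y R m x + K * bump y R m x \<le> 0" if "norm (x - y) \<ge> R0" for x :: 'a
  proof (cases "norm (x - y) < R")
    case True then show ?thesis using strict[OF that] by simp
  next
    case False
    then have "max 0 (R\<^sup>2 - (norm (x - y))\<^sup>2) = 0" using assms by (simp add: power_mono)
    then show ?thesis using m by (simp add: bump_lap_def bump_def zero_power)
  qed
  ultimately show ?thesis using that m by blast
qed

lemma integral_grad_bump:
  fixes D :: "'a::euclidean_space set"
  assumes D: "open D" and f: "\<And>x. x \<in> D \<Longrightarrow> GDERIV f x :> Df x" "continuous_on D Df"
    and K: "compact K" "K \<subseteq> D" "\<And>x. x \<in> D - K \<Longrightarrow> f x = 0 \<or> bump_grad y R m x = 0" and m: "m \<ge> 3"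
  shows "(LINT x|lborel. indicator D x * (Df x \<bullet> bump_grad y R m x + f x * bump_lap y R m x)) = 0"
    and "integrable lborel (\<lambda>x. indicator D x * (Df x \<bullet> bump_grad y R m x + f x * bump_lap y R m x))"
  using divergence_theorem_compact_support[OF D f, of "bump_grad y R m" "bump_hess y R m" K]
    GDERIV_bump_grad[OF m] continuous_on_bump_hess[of D] K by (auto simp: bump_hess_trace)

text \<open>A nonpositive function with nonnegative integral vanishes almost everywhere, hence at points of continuity.\<close>
lemma nonpos_integrand_zero:
  fixes h :: "'a::euclidean_space \<Rightarrow> real"
  assumes h: "integrable lborel h" "\<And>x. h x \<le> 0" "(LINT x|lborel. h x) \<ge> 0"
    and U: "open U" "continuous_on U h" "x \<in> U"
  shows "h x = 0"
proof (rule ccontr)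
  assume "h x \<noteq> 0"
  have "(LINT x|lborel. - h x) = 0"
    using h(3) Bochner_Integration.integral_nonneg[of lborel "\<lambda>x. - h x"] h(1,2) by auto
  then have ae: "AE x in lborel. - h x = 0"
    using integral_nonneg_eq_0_iff_AE[of lborel "\<lambda>x. - h x"] h(1,2) by auto
  define W where "W = {z \<in> U. h z \<noteq> 0}"
  have "open W"
  proof -
    have "W = U \<inter> h -` (- {0})" by (auto simp: W_def)
    then show ?thesis using U(1,2) by (simp add: continuous_open_preimage open_Compl)
  qed
  moreover have "W \<noteq> {}" using U \<open>h x \<noteq> 0\<close> by (auto simp: W_def)
  moreover have "negligible W"
  proof -
    have "AE x in lborel. x \<notin> W" using ae by eventually_elim (auto simp: W_def)
    then have "AE x in lebesgue. x \<notin> W" by (rule AE_completion)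
    then have "{x. \<not> x \<notin> W} \<in> null_sets lebesgue"
      using \<open>open W\<close> by (subst (asm) AE_iff_null) auto
    then show ?thesis by (simp add: negligible_iff_null_sets)
  qed
  ultimately show False using open_not_negligible by blast
qed

lemma GDERIV_continuous_on: "(\<And>x. x \<in> D \<Longrightarrow> GDERIV f x :> Df x) \<Longrightarrow> continuous_on D f"
  by (blast intro: continuous_at_imp_continuous_on GDERIV_isCont)

section \<open>Truncations and cutoffs\<close>

text \<open>A \<open>C\<^sup>1\<close> approximation of the positive part that vanishes up to \<open>e\<close>: near the
  threshold it is quadratic in \<open>s - e\<close>, far away it is asymptotic to \<open>s\<close> up to a
  constant. The product \<open>Gtr\<close> of the truncation and its derivative is the nonlinearity to be used
  in the test function when the energy of the truncation is computed.\<close>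
definition gtr :: "real \<Rightarrow> real \<Rightarrow> real" where
  "gtr e s = (max 0 (s - e))\<^sup>2 / (max 0 (s - e) + e)"

definition gtr' :: "real \<Rightarrow> real \<Rightarrow> real" where
  "gtr' e s = max 0 (s - e) * (max 0 (s - e) + 2 * e) / (max 0 (s - e) + e)\<^sup>2"

definition Gtr :: "real \<Rightarrow> real \<Rightarrow> real" where
  "Gtr e s = gtr e s * gtr' e s"

definition Gtr' :: "real \<Rightarrow> real \<Rightarrow> real" where
  "Gtr' e s = (gtr' e s)\<^sup>2 + 2 * e\<^sup>2 * (max 0 (s - e))\<^sup>2 / (max 0 (s - e) + e) ^ 4"

lemma DERIV_gtr:
  assumes e: "e > 0"
  shows "DERIV (gtr e) s :> gtr' e s"
  unfolding gtr_def[abs_def] gtr'_def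
proof (rule DERIV_pos_part_comp[where h = "\<lambda>m. m\<^sup>2 / (m + e)" and h' = "\<lambda>m. m * (m + 2 * e) / (m + e)\<^sup>2"])
  fix m :: real assume "m \<ge> 0"
  with e have "m + e \<noteq> 0" by simp
  then show "DERIV (\<lambda>m. m\<^sup>2 / (m + e)) m :> m * (m + 2 * e) / (m + e)\<^sup>2"
    by (auto intro!: derivative_eq_intros simp: power2_eq_square field_simps)
qed simp

lemma DERIV_Gtr:
  assumes e: "e > 0"
  shows "DERIV (Gtr e) s :> Gtr' e s"
proof -
  let ?h = "\<lambda>m. m\<^sup>2 / (m + e) * (m * (m + 2 * e) / (m + e)\<^sup>2)"
  let ?h' = "\<lambda>m. (m * (m + 2 * e) / (m + e)\<^sup>2)\<^sup>2 + 2 * e\<^sup>2 * m\<^sup>2 / (m + e) ^ 4"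
  have "DERIV (\<lambda>s. ?h (max 0 (s - e))) s :> ?h' (max 0 (s - e))"
  proof (rule DERIV_pos_part_comp)
    fix m :: real assume "m \<ge> 0"
    with e have m: "m + e \<noteq> 0" by simp
    have 1: "DERIV (\<lambda>m. m\<^sup>2 / (m + e)) m :> m * (m + 2 * e) / (m + e)\<^sup>2"
      using m by (auto intro!: derivative_eq_intros simp: power2_eq_square field_simps)
    have 2: "DERIV (\<lambda>m. m * (m + 2 * e) / (m + e)\<^sup>2) m :> 2 * e\<^sup>2 / (m + e) ^ 3"
    proof -
      have w: "DERIV (\<lambda>m. (m + e)\<^sup>2) m :> 2 * (m + e)" by (auto intro!: derivative_eq_intros)
      have q: "0 - (0 * w\<^sup>2 - 2 * w * e\<^sup>2) / (w\<^sup>2 * w\<^sup>2) = 2 * e\<^sup>2 / w ^ 3" if "w \<noteq> 0" for w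
        using that by (simp add: power2_eq_square power3_eq_cube)
      have d: "DERIV (\<lambda>m. 1 - e\<^sup>2 / (m + e)\<^sup>2) m :> 2 * e\<^sup>2 / (m + e) ^ 3"
        by (rule DERIV_cong[OF DERIV_diff[OF DERIV_const DERIV_divide[OF DERIV_const w]]])
          (use m q[OF m] in \<open>auto simp: mult.commute\<close>)
      have "1 - e\<^sup>2 / (x + e)\<^sup>2 = x * (x + 2 * e) / (x + e)\<^sup>2" if "x \<in> {- e<..}" for x
      proof -
        have "x * (x + 2 * e) = (x + e)\<^sup>2 - e\<^sup>2" by (simp add: power2_eq_square algebra_simps)
        then show ?thesis using that by (simp add: diff_divide_distrib)
      qed
      then show ?thesis
        by (intro has_field_derivative_transform_within_open[OF d, of "{- e<..}"]) (use \<open>m \<ge> 0\<close> e in auto)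
    qed
    show "DERIV ?h m :> ?h' m"
      by (rule DERIV_cong[OF DERIV_mult[OF 1 2]]) (use m in \<open>simp add: field_simps power2_eq_square power3_eq_cube power4_eq_xxxx\<close>)
  qed simp
  then show ?thesis
    by (simp add: Gtr_def[abs_def] Gtr'_def gtr_def gtr'_def)
qed

lemma continuous_gtr:
  assumes e: "e > 0" and "continuous_on A p"
  shows "continuous_on A (\<lambda>x. gtr e (p x))" "continuous_on A (\<lambda>x. gtr' e (p x))"
    "continuous_on A (\<lambda>x. Gtr e (p x))" "continuous_on A (\<lambda>x. Gtr' e (p x))"
proof -
  have nz: "max 0 (s - e) + e \<noteq> 0" for s using e by (auto simp: max_def)
  show "continuous_on A (\<lambda>x. gtr e (p x))" "continuous_on A (\<lambda>x. gtr' e (p x))"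
    "continuous_on A (\<lambda>x. Gtr e (p x))" "continuous_on A (\<lambda>x. Gtr' e (p x))"
    unfolding gtr_def gtr'_def Gtr_def Gtr'_def
    by (auto intro!: continuous_intros assms nz simp: nz)
qed

lemma gtr_zero: "s \<le> e \<Longrightarrow> gtr e s = 0" "s \<le> e \<Longrightarrow> gtr' e s = 0" "s \<le> e \<Longrightarrow> Gtr e s = 0" "s \<le> e \<Longrightarrow> Gtr' e s = 0"
  by (auto simp: gtr_def gtr'_def Gtr_def Gtr'_def)

lemma gtr_nonneg: 
  assumes "e > 0"
  shows "gtr e s \<ge> 0" "gtr' e s \<ge> 0" "Gtr e s \<ge> 0" "(gtr' e s)\<^sup>2 \<le> Gtr' e s"
  using assms by (auto simp: gtr_def gtr'_def Gtr_def Gtr'_def)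

lemma gtr'_le_1: 
  assumes "e > 0"
  shows "gtr' e s \<le> 1"
proof -
  have "max 0 (s - e) * (max 0 (s - e) + 2 * e) \<le> (max 0 (s - e) + e)\<^sup>2"
    by (simp add: power2_eq_square algebra_simps)
  moreover have "(max 0 (s - e) + e)\<^sup>2 > 0" using assms by (auto simp: max_def)
  ultimately show ?thesis by (simp add: gtr'_def)
qed

lemma gtr_approx:
  assumes "e > 0"
  shows "gtr e s \<le> max 0 s" "max 0 s - 2 * e \<le> gtr e s"
proof -
  show "gtr e s \<le> max 0 s"
  proof (cases "s \<le> e")
    case False
    then have "gtr e s = (s - e)\<^sup>2 / s" by (simp add: gtr_def max_def)
    also have "\<dots> \<le> s"
    proof -
      have "(s - e)\<^sup>2 \<le> s\<^sup>2" using False assms by (intro power_mono) auto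
      then show ?thesis using False assms by (simp add: divide_le_eq power2_eq_square)
    qed
    finally show ?thesis by simp
  qed (auto simp: gtr_zero)
  show "max 0 s - 2 * e \<le> gtr e s"
  proof (cases "s \<le> e")
    case False
    then have "gtr e s = (s - e)\<^sup>2 / s" by (simp add: gtr_def max_def)
    moreover have "s - 2 * e \<le> (s - e)\<^sup>2 / s"
      using False assms by (simp add: le_divide_eq power2_eq_square algebra_simps)
    ultimately show ?thesis using False assms by simp
  qed (use assms in \<open>auto simp: gtr_zero max_def\<close>)
qed

text \<open>The reason for the formula of \<open>gtr\<close>: testing with \<open>g g'\<close> costs an error that is linear in \<open>e\<close>.\<close>
lemma gtr_defect:
  assumes e: "e > 0"
  shows "\<bar>s * Gtr e s - (gtr e s)\<^sup>2\<bar> \<le> 2 * e * gtr e s"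
proof (cases "s \<le> e")
  case False
  define m where "m = s - e"
  have m: "m > 0" "max 0 (s - e) = m" "s = m + e" using False by (auto simp: m_def)
  have g: "gtr e s = m\<^sup>2 / (m + e)" "gtr' e s = m * (m + 2 * e) / (m + e)\<^sup>2"
    by (auto simp: gtr_def gtr'_def m(2))
  have "s * gtr' e s - gtr e s = 2 * e * m / (m + e)"
  proof -
    have "s * gtr' e s - gtr e s = (m + e) * (m * (m + 2 * e) / (m + e)\<^sup>2) - m\<^sup>2 / (m + e)"
      unfolding g by (subst m(3)) (rule refl)
    also have "(m + e) * (m * (m + 2 * e) / (m + e)\<^sup>2) = m * (m + 2 * e) / (m + e)"
      using m(1) e by (simp add: power2_eq_square)
    also have "\<dots> - m\<^sup>2 / (m + e) = 2 * e * m / (m + e)"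
      unfolding diff_divide_distrib[symmetric] by (simp add: power2_eq_square algebra_simps)
    finally show ?thesis .
  qed
  then have eq: "s * Gtr e s - (gtr e s)\<^sup>2 = gtr e s * (2 * e * m / (m + e))"
    by (metis Gtr_def power2_eq_square mult.left_commute right_diff_distrib)
  have "0 \<le> 2 * e * m / (m + e)" "2 * e * m / (m + e) \<le> 2 * e"
    using m(1) e by (auto simp: field_simps)
  moreover note gtr_nonneg(1)[OF e, of s]
  ultimately have "0 \<le> gtr e s * (2 * e * m / (m + e))" "gtr e s * (2 * e * m / (m + e)) \<le> gtr e s * (2 * e)"
    by (auto intro: mult_nonneg_nonneg mult_left_mono simp del: times_divide_eq_right)
  then show ?thesis unfolding eq by (simp only: abs_of_nonneg mult.commute)
qed (auto simp: gtr_zero)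

definition smooth_step :: "real \<Rightarrow> real" where
  "smooth_step s = 1 - (max 0 (1 - (max 0 s)\<^sup>2))\<^sup>2"

definition smooth_step' :: "real \<Rightarrow> real" where
  "smooth_step' s = 4 * max 0 (1 - (max 0 s)\<^sup>2) * max 0 s"

lemma DERIV_smooth_step: "DERIV smooth_step s :> smooth_step' s"
proof -
  have p: "DERIV (\<lambda>t. (max 0 t)\<^sup>2) (t::real) :> 2 * max 0 t" for t
    using DERIV_pos_part_power[of 0 t] by (simp add: numeral_2_eq_2)
  have "DERIV (\<lambda>s. 1 - (max 0 s)\<^sup>2) s :> - (2 * max 0 s)"
    using DERIV_diff[OF DERIV_const p] by simp
  from DERIV_chain2[OF p this]
  have "DERIV (\<lambda>s. (max 0 (1 - (max 0 s)\<^sup>2))\<^sup>2) s :> 2 * max 0 (1 - (max 0 s)\<^sup>2) * (- (2 * max 0 s))" .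
  from DERIV_diff[OF DERIV_const this, of 1]
  show ?thesis by (simp add: smooth_step_def[abs_def] smooth_step'_def mult.assoc)
qed

lemma smooth_step_simps:
  "s \<le> 0 \<Longrightarrow> smooth_step s = 0" "s \<ge> 1 \<Longrightarrow> smooth_step s = 1"
  "s \<le> 0 \<Longrightarrow> smooth_step' s = 0" "s \<ge> 1 \<Longrightarrow> smooth_step' s = 0"
proof -
  have *: "max 0 (1 - (max 0 s)\<^sup>2) = 0" if "s \<ge> 1" for s :: real
    using that one_le_power[OF that, of 2] by (auto simp: max_def intro: antisym)
  show "s \<le> 0 \<Longrightarrow> smooth_step s = 0" "s \<le> 0 \<Longrightarrow> smooth_step' s = 0"
    by (simp_all add: smooth_step_def smooth_step'_def)
  show "s \<ge> 1 \<Longrightarrow> smooth_step s = 1" "s \<ge> 1 \<Longrightarrow> smooth_step' s = 0"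
    using * by (simp_all add: smooth_step_def smooth_step'_def)
qed

lemma smooth_step_bounds: "0 \<le> smooth_step s" "smooth_step s \<le> 1" "0 \<le> smooth_step' s" "smooth_step' s \<le> 4"
proof -
  define a where "a = max 0 (1 - (max 0 s)\<^sup>2)"
  have a: "0 \<le> a" "a \<le> 1" by (auto simp: a_def)
  show "smooth_step s \<le> 1" "0 \<le> smooth_step' s" by (auto simp: smooth_step_def smooth_step'_def)
  show "0 \<le> smooth_step s" using a power_le_one[of a 2] by (simp add: smooth_step_def a_def[symmetric])
  show "smooth_step' s \<le> 4"
  proof (cases "s \<ge> 1")
    case False
    then have "a * max 0 s \<le> 1 * 1" using a by (intro mult_mono) auto
    then show ?thesis by (simp add: smooth_step'_def a_def[symmetric])
  qed (simp add: smooth_step_simps)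
qed

text \<open>The step is positive on positive arguments, so wherever a cut-off built from it
  vanishes, its gradient vanishes as well.\<close>
lemma smooth_step_zero_iff: "smooth_step s = 0 \<Longrightarrow> s \<le> 0"
proof (rule ccontr)
  assume "smooth_step s = 0" "\<not> s \<le> 0"
  then have "(max 0 (1 - s\<^sup>2))\<^sup>2 = 1" "s > 0" by (auto simp: smooth_step_def max_def split: if_splits)
  then have "max 0 (1 - s\<^sup>2) = 1" by (metis max.cobounded1 power2_eq_1_iff zero_le_one neg_0_le_iff_le not_one_le_zero)
  then show False using \<open>s > 0\<close> by (auto simp: max_def split: if_splits)
qed

lemma continuous_smooth_step: "continuous_on A p \<Longrightarrow> continuous_on A (\<lambda>x. smooth_step (p x))"
    "continuous_on A p \<Longrightarrow> continuous_on A (\<lambda>x. smooth_step' (p x))"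
  unfolding smooth_step_def smooth_step'_def by (auto intro!: continuous_intros)

section \<open>Energy of truncated subsolutions\<close>

text \<open>Caccioppoli's computation: the subsolution property is tested with \<open>g(p) g'(p) \<xi>\<^sup>2
  \<alpha>\<close>, and the square is completed using \<open>(g')\<^sup>2 \<le> (g g')'\<close>. The weight
  \<open>\<alpha>\<close> enters linearly and not squared because it is a cut-off near a face whose gradient
  is not small; the error \<open>Dp \<bullet> D\<alpha>\<close> it produces is the flux of \<open>p\<close>
  through that face.\<close>
lemma truncated_energy:
  fixes p V \<xi> \<alpha> :: "'a::euclidean_space \<Rightarrow> real"
  assumes D: "open D"
    and p: "\<And>x. x \<in> D \<Longrightarrow> GDERIV p x :> Dp x" "continuous_on D Dp"
    and V: "continuous_on D V"
    and \<xi>: "\<And>x. x \<in> D \<Longrightarrow> GDERIV \<xi> x :> D\<xi> x" "continuous_on D D\<xi>" "\<And>x. x \<in> D \<Longrightarrow> \<xi> x = 0 \<Longrightarrow> D\<xi> x = 0"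
    and \<alpha>: "\<And>x. x \<in> D \<Longrightarrow> GDERIV \<alpha> x :> D\<alpha> x" "continuous_on D D\<alpha>" "\<And>x. x \<in> D \<Longrightarrow> \<alpha> x = 0 \<Longrightarrow> D\<alpha> x = 0"
      "\<And>x. x \<in> D \<Longrightarrow> \<alpha> x \<ge> 0"
    and e: "e > 0"
    and sub: "\<And>\<psi> G. C1c D \<psi> G \<Longrightarrow> (\<And>x. \<psi> x \<ge> 0) \<Longrightarrow> (LINT x|lborel. Dp x \<bullet> G x) \<le> (LINT x|lborel. V x * p x * \<psi> x)"
    and K: "compact K" "K \<subseteq> D" "\<And>x. x \<in> D - K \<Longrightarrow> p x \<le> e \<or> \<xi> x = 0 \<or> \<alpha> x = 0"
  shows "(LINT x|lborel. indicator D x * (\<alpha> x * ((norm ((gtr' e (p x) * \<xi> x) *\<^sub>R Dp x + gtr e (p x) *\<^sub>R D\<xi> x))\<^sup>2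
            - V x * (gtr e (p x) * \<xi> x)\<^sup>2)))
      \<le> (LINT x|lborel. indicator D x * (\<alpha> x * (2 * e * \<bar>V x\<bar> * gtr e (p x) * (\<xi> x)\<^sup>2 + (gtr e (p x))\<^sup>2 * (norm (D\<xi> x))\<^sup>2)
            + Gtr e (p x) * (\<xi> x)\<^sup>2 * \<bar>Dp x \<bullet> D\<alpha> x\<bar>))" (is "integral\<^sup>L _ ?L \<le> integral\<^sup>L _ ?R")
    and "integrable lborel (\<lambda>x. indicator D x * (\<alpha> x * ((norm ((gtr' e (p x) * \<xi> x) *\<^sub>R Dp x + gtr e (p x) *\<^sub>R D\<xi> x))\<^sup>2
            - V x * (gtr e (p x) * \<xi> x)\<^sup>2)))"
proof -
  have cp: "continuous_on D p" and c\<xi>: "continuous_on D \<xi>" and c\<alpha>: "continuous_on D \<alpha>"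
    by (auto intro!: GDERIV_continuous_on p(1) \<xi>(1) \<alpha>(1))
  note cg = continuous_gtr[OF e cp]
  define f where "f x = Gtr e (p x) * ((\<xi> x)\<^sup>2 * \<alpha> x)" for x
  define Df where "Df x = (Gtr' e (p x) * (\<xi> x)\<^sup>2 * \<alpha> x) *\<^sub>R Dp x + (2 * Gtr e (p x) * \<xi> x * \<alpha> x) *\<^sub>R D\<xi> x
      + (Gtr e (p x) * (\<xi> x)\<^sup>2) *\<^sub>R D\<alpha> x" for x
  have zero: "f x = 0" "Df x = 0" "?L x = 0" "?R x = 0" if "x \<in> D - K" for x
  proof -
    have x: "x \<in> D" using that by simp
    show "f x = 0" "Df x = 0" "?L x = 0" "?R x = 0"
      using K(3)[OF that] \<xi>(3)[OF x] \<alpha>(3)[OF x] by (auto simp: gtr_zero f_def Df_def)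
  qed
  define \<psi> where "\<psi> = (\<lambda>x. if x \<in> D then f x else 0)"
  define G where "G = (\<lambda>x. if x \<in> D then Df x else 0)"
  have C: "C1c D \<psi> G" unfolding \<psi>_def G_def
  proof (rule C1c_extend[OF D _ _ K(1,2)])
    fix x assume x: "x \<in> D"
    have "GDERIV (\<lambda>x. (\<xi> x)\<^sup>2) x :> (2 * \<xi> x) *\<^sub>R D\<xi> x"
      by (rule GDERIV_subst[OF GDERIV_DERIV_compose[OF \<xi>(1)[OF x], of "\<lambda>s. s\<^sup>2" "2 * \<xi> x"]])
        (auto intro!: derivative_eq_intros)
    from GDERIV_mult[OF GDERIV_DERIV_compose[OF p(1)[OF x] DERIV_Gtr[OF e]] GDERIV_mult[OF this \<alpha>(1)[OF x]]]
    show "GDERIV f x :> Df x"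
      unfolding f_def by (rule GDERIV_subst) (simp add: Df_def algebra_simps)
  next
    show "continuous_on D Df" unfolding Df_def by (intro continuous_intros cg c\<xi> c\<alpha> p \<xi> \<alpha>)
  qed (use zero in auto)
  have pos: "\<psi> x \<ge> 0" for x
    using \<alpha>(4) gtr_nonneg(3)[OF e] by (auto simp: \<psi>_def f_def)
  have int1: "integrable lborel (\<lambda>x. Dp x \<bullet> G x)" "integrable lborel (\<lambda>x. V x * p x * \<psi> x)"
    using C1c_integrable(2)[OF C p(2)] C1c_integrable(1)[OF C continuous_on_mult[OF V cp]] by auto
  have onK: "x \<in> K \<Longrightarrow> x \<in> D" for x using K by auto
  show intL: "integrable lborel ?L"
  proof (rule integrable_compact_support[OF K(1)])
    show "continuous_on K ?L"
      by (rule continuous_on_eq[of K "\<lambda>x. \<alpha> x * ((norm ((gtr' e (p x) * \<xi> x) *\<^sub>R Dp x + gtr e (p x) *\<^sub>R D\<xi> x))\<^sup>2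
            - V x * (gtr e (p x) * \<xi> x)\<^sup>2)"])
        (use onK in \<open>auto intro!: continuous_intros continuous_on_subset[OF _ K(2)] cg c\<xi> c\<alpha> p \<xi> V\<close>)
    show "?L x = 0" if "x \<notin> K" for x using zero(3)[of x] that by (cases "x \<in> D") auto
  qed
  have intR: "integrable lborel ?R"
  proof (rule integrable_compact_support[OF K(1)])
    show "continuous_on K ?R"
      by (rule continuous_on_eq[of K "\<lambda>x. \<alpha> x * (2 * e * \<bar>V x\<bar> * gtr e (p x) * (\<xi> x)\<^sup>2 + (gtr e (p x))\<^sup>2 * (norm (D\<xi> x))\<^sup>2)
            + Gtr e (p x) * (\<xi> x)\<^sup>2 * \<bar>Dp x \<bullet> D\<alpha> x\<bar>"])
        (use onK in \<open>auto intro!: continuous_intros continuous_on_subset[OF _ K(2)] cg c\<xi> c\<alpha> p \<xi> V \<alpha>\<close>)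
    show "?R x = 0" if "x \<notin> K" for x using zero(4)[of x] that by (cases "x \<in> D") auto
  qed
  have pt: "?L x \<le> (Dp x \<bullet> G x - V x * p x * \<psi> x) + ?R x" for x
  proof (cases "x \<in> D")
    case False then show ?thesis by (simp add: G_def \<psi>_def)
  next
    case True
    define g g1 k where "g = gtr e (p x)" and "g1 = gtr' e (p x)" and "k = Gtr' e (p x)"
    have Gg: "Gtr e (p x) = g * g1" by (simp add: Gtr_def g_def g1_def)
    have k: "g1\<^sup>2 \<le> k" and g0: "g \<ge> 0" "g1 \<ge> 0" using gtr_nonneg[OF e, of "p x"] by (auto simp: g_def g1_def k_def)
    have a0: "\<alpha> x \<ge> 0" using \<alpha>(4) True by simp
    have n: "(norm ((g1 * \<xi> x) *\<^sub>R Dp x + g *\<^sub>R D\<xi> x))\<^sup>2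
        = g1\<^sup>2 * (\<xi> x)\<^sup>2 * (norm (Dp x))\<^sup>2 + 2 * g * g1 * \<xi> x * (Dp x \<bullet> D\<xi> x) + g\<^sup>2 * (norm (D\<xi> x))\<^sup>2"
      unfolding power2_norm_eq_inner by (simp add: inner_add_left inner_add_right inner_commute power2_eq_square algebra_simps)
    have d: "Dp x \<bullet> G x = k * (\<xi> x)\<^sup>2 * \<alpha> x * (norm (Dp x))\<^sup>2 + 2 * g * g1 * \<xi> x * \<alpha> x * (Dp x \<bullet> D\<xi> x)
        + g * g1 * (\<xi> x)\<^sup>2 * (Dp x \<bullet> D\<alpha> x)"
      using True by (simp add: G_def Df_def Gg k_def[symmetric] inner_add_right power2_norm_eq_inner algebra_simps)
    have 1: "\<alpha> x * (g1\<^sup>2 * (\<xi> x)\<^sup>2 * (norm (Dp x))\<^sup>2) \<le> k * (\<xi> x)\<^sup>2 * \<alpha> x * (norm (Dp x))\<^sup>2"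
      using mult_right_mono[OF k, of "(\<xi> x)\<^sup>2 * \<alpha> x * (norm (Dp x))\<^sup>2"] a0 by (simp add: mult_ac)
    have 2: "- (g * g1 * (\<xi> x)\<^sup>2 * (Dp x \<bullet> D\<alpha> x)) \<le> g * g1 * (\<xi> x)\<^sup>2 * \<bar>Dp x \<bullet> D\<alpha> x\<bar>"
      using mult_left_mono[of "- (Dp x \<bullet> D\<alpha> x)" "\<bar>Dp x \<bullet> D\<alpha> x\<bar>" "g * g1 * (\<xi> x)\<^sup>2"] g0 by simp
    have 3: "\<alpha> x * (V x * (p x * (g * g1) - g\<^sup>2) * (\<xi> x)\<^sup>2) \<le> \<alpha> x * (2 * e * \<bar>V x\<bar> * g * (\<xi> x)\<^sup>2)"
    proof (intro mult_left_mono[OF _ a0])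
      have "V x * (p x * (g * g1) - g\<^sup>2) \<le> \<bar>V x\<bar> * \<bar>p x * (g * g1) - g\<^sup>2\<bar>" by (metis abs_ge_self abs_mult)
      also have "\<dots> \<le> \<bar>V x\<bar> * (2 * e * g)"
        using gtr_defect[OF e, of "p x"] unfolding Gg g_def[symmetric] by (intro mult_left_mono) auto
      finally show "V x * (p x * (g * g1) - g\<^sup>2) * (\<xi> x)\<^sup>2 \<le> 2 * e * \<bar>V x\<bar> * g * (\<xi> x)\<^sup>2"
        by (intro mult_right_mono) (auto simp: mult_ac)
    qed
    have L: "?L x = \<alpha> x * (g1\<^sup>2 * (\<xi> x)\<^sup>2 * (norm (Dp x))\<^sup>2) + 2 * g * g1 * \<xi> x * \<alpha> x * (Dp x \<bullet> D\<xi> x)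
        + \<alpha> x * (g\<^sup>2 * (norm (D\<xi> x))\<^sup>2) - \<alpha> x * (V x * g\<^sup>2 * (\<xi> x)\<^sup>2)"
      unfolding g_def[symmetric] g1_def[symmetric] n using True
      by (simp add: power_mult_distrib algebra_simps)
    have R: "(Dp x \<bullet> G x - V x * p x * \<psi> x) + ?R x = Dp x \<bullet> G x - \<alpha> x * (V x * (p x * (g * g1)) * (\<xi> x)\<^sup>2)
       + \<alpha> x * (2 * e * \<bar>V x\<bar> * g * (\<xi> x)\<^sup>2) + \<alpha> x * (g\<^sup>2 * (norm (D\<xi> x))\<^sup>2) + g * g1 * (\<xi> x)\<^sup>2 * \<bar>Dp x \<bullet> D\<alpha> x\<bar>"
      unfolding \<psi>_def f_def using True by (simp add: Gg g_def[symmetric] algebra_simps)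
    have h3: "\<alpha> x * (V x * (p x * (g * g1)) * (\<xi> x)\<^sup>2) - \<alpha> x * (V x * g\<^sup>2 * (\<xi> x)\<^sup>2) \<le> \<alpha> x * (2 * e * \<bar>V x\<bar> * g * (\<xi> x)\<^sup>2)"
      using 3 by (simp add: algebra_simps)
    show ?thesis unfolding L R unfolding d using 1 2 h3 by linarith
  qed
  have "integral\<^sup>L lborel ?L \<le> (LINT x|lborel. (Dp x \<bullet> G x - V x * p x * \<psi> x) + ?R x)"
    using pt intL intR int1 by (intro integral_mono) auto
  also have "\<dots> = ((LINT x|lborel. Dp x \<bullet> G x) - (LINT x|lborel. V x * p x * \<psi> x)) + integral\<^sup>L lborel ?R"
    using int1 intR by simp
  also have "\<dots> \<le> integral\<^sup>L lborel ?R" using sub[OF C pos] by simp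
  finally show "integral\<^sup>L lborel ?L \<le> integral\<^sup>L lborel ?R" .
qed

section \<open>Propagation of zeros of nonnegative supersolutions\<close>

text \<open>Test with a bump with a large exponent. The weight \<open>-\<Delta> + K\<close> of the bump is nonpositive
  outside the ball of radius \<open>R0\<close>, and inside that ball \<open>q\<close> vanishes. So the
  integrand is nonpositive while its integral is not negative. Continuity of \<open>q\<close>
  is asked for only where its vanishing is claimed, which permits functions extended by zero across a face.\<close>
lemma nonneg_ball_propagation:
  fixes q :: "'a::euclidean_space \<Rightarrow> real"
  assumes R: "0 < R0" "R0 < R" and K: "K \<ge> 0"
    and q: "\<And>x. q x \<ge> 0" "\<And>x. x \<in> ball y R0 \<Longrightarrow> q x = 0"
    and int: "\<And>m. m \<ge> 3 \<Longrightarrow> integrable lborel (\<lambda>x. q x * (- bump_lap y R m x + K * bump y R m x))"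
    and super: "\<And>m. m \<ge> 3 \<Longrightarrow> 0 \<le> (LINT x|lborel. q x * (- bump_lap y R m x + K * bump y R m x))"
    and U: "open U" "U \<subseteq> ball y R" "continuous_on U q" "x \<in> U"
  shows "q x = 0"
proof -
  obtain m where m: "m \<ge> 3"
    "\<And>x. norm (x - y) \<ge> R0 \<Longrightarrow> norm (x - y) < R \<Longrightarrow> - bump_lap y R m x + K * bump y R m x < 0"
    "\<And>x. norm (x - y) \<ge> R0 \<Longrightarrow> - bump_lap y R m x + K * bump y R m x \<le> 0"
    by (rule bump_strict_subsolution[OF R K, of y]) blast
  let ?h = "\<lambda>x. q x * (- bump_lap y R m x + K * bump y R m x)"
  have "?h x = 0"
  proof (rule nonpos_integrand_zero[OF int[OF m(1)] _ super[OF m(1)] U(1) _ U(4)])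
    show "?h x \<le> 0" for x
      using q(2)[of x] m(3)[of x] mult_nonneg_nonpos[OF q(1)[of x]]
      by (cases "norm (x - y) < R0") (auto simp: dist_norm norm_minus_commute)
    show "continuous_on U ?h"
      by (intro continuous_intros U(3) continuous_on_bump)
  qed
  moreover have "norm (x - y) < R" using U by (auto simp: dist_norm norm_minus_commute)
  ultimately show ?thesis
    using q(2)[of x] m(2)[of x] by (cases "norm (x - y) < R0") (auto simp: dist_norm norm_minus_commute)
qed

text \<open>The interior of the zero set is relatively closed: near one of its limit points a small ball of zeros grows,
  by the preceding lemma, to a ball that contains the limit point.\<close>
lemma nonneg_unique_continuation:
  fixes q :: "'a::euclidean_space \<Rightarrow> real"
  assumes D: "open D" "connected D"
    and q: "\<And>x. q x \<ge> 0" "continuous_on D q"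
    and loc: "\<And>x. x \<in> D \<Longrightarrow> \<exists>\<rho>>0. \<exists>K\<ge>0. cball x \<rho> \<subseteq> D \<and>
      (\<forall>y R m. 0 < R \<longrightarrow> cball y R \<subseteq> cball x \<rho> \<longrightarrow> 3 \<le> m \<longrightarrow>
         integrable lborel (\<lambda>x. q x * (- bump_lap y R m x + K * bump y R m x)) \<and>
         0 \<le> (LINT x|lborel. q x * (- bump_lap y R m x + K * bump y R m x)))"
    and U: "open U" "U \<noteq> {}" "U \<subseteq> D" "\<And>x. x \<in> U \<Longrightarrow> q x = 0"
    and x: "x \<in> D"
  shows "q x = 0"
proof -
  define Z where "Z = interior {x \<in> D. q x = 0}"
  have ZD: "Z \<subseteq> {x \<in> D. q x = 0}" by (simp add: Z_def interior_subset)
  have cl: "x \<in> Z" if x: "x \<in> D" "x \<in> closure Z" for x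
  proof -
    obtain \<rho> K where \<rho>: "\<rho> > 0" "K \<ge> 0" "cball x \<rho> \<subseteq> D"
      and I: "\<And>y R m. \<lbrakk>0 < R; cball y R \<subseteq> cball x \<rho>; 3 \<le> m\<rbrakk> \<Longrightarrow>
         integrable lborel (\<lambda>x. q x * (- bump_lap y R m x + K * bump y R m x)) \<and>
         0 \<le> (LINT x|lborel. q x * (- bump_lap y R m x + K * bump y R m x))"
      using loc[OF x(1)] by blast
    obtain z where z: "z \<in> Z" "dist z x < \<rho> / 4"
      using x(2) \<rho>(1) unfolding closure_approachable by (meson divide_pos_pos zero_less_numeral)
    define R where "R = \<rho> / 2"
    have R: "R > 0" "cball z R \<subseteq> cball x \<rho>"
      using \<rho> z by (auto simp: R_def) (smt (verit) dist_commute dist_triangle field_sum_of_halves)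
    obtain r where r: "r > 0" "ball z r \<subseteq> Z"
      using z(1) open_interior openE unfolding Z_def by metis
    define R0 where "R0 = min r (R / 2)"
    have R0: "0 < R0" "R0 < R" "ball z R0 \<subseteq> Z" using r R by (auto simp: R0_def)
    have "q w = 0" if "w \<in> ball z R" for w
    proof (rule nonneg_ball_propagation[OF R0(1,2) \<rho>(2) q(1)])
      show "q x = 0" if "x \<in> ball z R0" for x using that R0 ZD by auto
      show "open (ball z R)" "ball z R \<subseteq> ball z R" "w \<in> ball z R" using that by auto
      show "continuous_on (ball z R) q"
        by (rule continuous_on_subset[OF q(2)]) (use R \<rho>(3) ball_subset_cball in blast)
    qed (use I[OF R] in auto)
    then have "ball z R \<subseteq> {x \<in> D. q x = 0}" using R \<rho>(3) ball_subset_cball[of z R] by blast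
    then have "ball z R \<subseteq> Z" unfolding Z_def by (simp add: interior_maximal)
    moreover have "x \<in> ball z R" using z \<rho> by (simp add: R_def dist_commute)
    ultimately show ?thesis by blast
  qed
  have "U \<subseteq> Z" unfolding Z_def using U by (intro interior_maximal) auto
  have "Z \<inter> D = {} \<or> (D - closure Z) \<inter> D = {}"
  proof (rule connectedD[OF D(2)])
    show "open Z" by (simp add: Z_def)
    show "open (D - closure Z)" using D(1) by (simp add: open_Diff)
    show "Z \<inter> (D - closure Z) \<inter> D = {}" using closure_subset[of Z] by blast
    show "D \<subseteq> Z \<union> (D - closure Z)" using cl by blast
  qed
  then have "x \<in> closure Z" using \<open>U \<subseteq> Z\<close> U x by blast
  then show ?thesis using cl[OF x] ZD by auto
qed

text \<open>Both \<open>r = V p\<close> and differences of nonlinear terms satisfy the hypothesis on the right-hand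
  side, so the lemma covers the linearised equation and the comparison of two solutions.\<close>
lemma weak_solution_unique_continuation:
  fixes p r :: "'a::euclidean_space \<Rightarrow> real"
  assumes D: "open D" "connected D"
    and p: "\<And>x. x \<in> D \<Longrightarrow> GDERIV p x :> Dp x" "continuous_on D Dp" "\<And>x. x \<in> D \<Longrightarrow> p x \<ge> 0"
    and r: "continuous_on D r" "\<And>x. x \<in> D \<Longrightarrow> \<exists>\<rho>>0. \<exists>K\<ge>0. cball x \<rho> \<subseteq> D \<and> (\<forall>y\<in>cball x \<rho>. \<bar>r y\<bar> \<le> K * p y)"
    and eq: "\<And>\<psi> G. C1c D \<psi> G \<Longrightarrow> (LINT x|lborel. Dp x \<bullet> G x) = (LINT x|lborel. r x * \<psi> x)"
    and U: "open U" "U \<noteq> {}" "U \<subseteq> D" "\<And>x. x \<in> U \<Longrightarrow> p x = 0"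
    and x: "x \<in> D"
  shows "p x = 0"
proof -
  define q where "q x = (if x \<in> D then p x else 0)" for x
  have cp: "continuous_on D p" by (rule GDERIV_continuous_on[OF p(1)])
  have cq: "continuous_on D q" by (rule continuous_on_eq[OF cp]) (simp add: q_def)
  have "q x = 0"
  proof (rule nonneg_unique_continuation[OF D _ cq _ U(1,2,3) _ x])
    show "q x \<ge> 0" for x using p(3) by (simp add: q_def)
    show "q x = 0" if "x \<in> U" for x using U that by (auto simp: q_def)
    fix x assume "x \<in> D"
    then obtain \<rho> K where \<rho>: "\<rho> > 0" "K \<ge> 0" "cball x \<rho> \<subseteq> D" and K: "\<And>y. y \<in> cball x \<rho> \<Longrightarrow> \<bar>r y\<bar> \<le> K * p y"
      using r(2) by blast
    show "\<exists>\<rho>>0. \<exists>K\<ge>0. cball x \<rho> \<subseteq> D \<and>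
      (\<forall>y R m. 0 < R \<longrightarrow> cball y R \<subseteq> cball x \<rho> \<longrightarrow> 3 \<le> m \<longrightarrow>
         integrable lborel (\<lambda>x. q x * (- bump_lap y R m x + K * bump y R m x)) \<and>
         0 \<le> (LINT x|lborel. q x * (- bump_lap y R m x + K * bump y R m x)))"
    proof (rule exI[of _ \<rho>], rule conjI[OF \<rho>(1)], rule exI[of _ K], intro conjI allI impI \<rho>(2,3))
      fix y R m assume R: "0 < (R::real)" "cball y R \<subseteq> cball x \<rho>" and m: "3 \<le> (m::nat)"
      have RD: "cball y R \<subseteq> D" using R(2) \<rho>(3) by blast
      have C: "C1c D (bump y R m) (bump_grad y R m)" by (rule C1c_bump) (use m R RD in auto)
      note ig = integral_grad_bump[OF D(1) p(1,2) compact_cball RD _ m]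
      have ig1: "(LINT x|lborel. indicator D x * (Dp x \<bullet> bump_grad y R m x + p x * bump_lap y R m x)) = 0"
        and ig2: "integrable lborel (\<lambda>x. indicator D x * (Dp x \<bullet> bump_grad y R m x + p x * bump_lap y R m x))"
        using ig[of y] bump_outside(2)[of _ y R m] R m by auto
      have off: "bump y R m z = 0" "bump_grad y R m z = 0" "bump_lap y R m z = 0" if "z \<notin> D" for z
      proof -
        have z: "z \<notin> cball y R" using RD that by blast
        show "bump y R m z = 0" by (rule bump_outside(1)[OF z R(1)]) (use m in simp)
        show "bump_grad y R m z = 0" by (rule bump_outside(2)[OF z R(1)]) (use m in simp)
        show "bump_lap y R m z = 0" by (rule bump_outside(3)[OF z R(1) m])
      qed
      have i1: "integrable lborel (\<lambda>x. Dp x \<bullet> bump_grad y R m x)" by (rule C1c_integrable(2)[OF C p(2)])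
      have i2: "integrable lborel (\<lambda>x. r x * bump y R m x)" by (rule C1c_integrable(1)[OF C r(1)])
      have i3: "integrable lborel (\<lambda>x. q x * bump y R m x)" by (rule C1c_integrable(1)[OF C cq])
      have pt: "q z * (- bump_lap y R m z + K * bump y R m z)
          = (Dp z \<bullet> bump_grad y R m z) + K * (q z * bump y R m z)
             - indicator D z * (Dp z \<bullet> bump_grad y R m z + p z * bump_lap y R m z)" for z
        using off[of z] by (cases "z \<in> D") (auto simp: q_def algebra_simps)
      show "integrable lborel (\<lambda>x. q x * (- bump_lap y R m x + K * bump y R m x))"
        unfolding pt using i1 i3 ig2 by (intro Bochner_Integration.integrable_diff Bochner_Integration.integrable_add integrable_mult_right)
      have "(LINT x|lborel. q x * (- bump_lap y R m x + K * bump y R m x))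
          = (LINT x|lborel. Dp x \<bullet> bump_grad y R m x) + (LINT x|lborel. K * (q x * bump y R m x))"
        unfolding pt using i1 i3 ig2 ig1 by simp
      also have "\<dots> = (LINT x|lborel. r x * bump y R m x + K * (q x * bump y R m x))"
        unfolding eq[OF C] using i2 i3 by simp
      also have "\<dots> \<ge> 0"
      proof (rule Bochner_Integration.integral_nonneg)
        fix z
        show "0 \<le> r z * bump y R m z + K * (q z * bump y R m z)"
        proof (cases "z \<in> cball y R")
          case True
          then have "z \<in> cball x \<rho>" "z \<in> D" using R RD by auto
          then have "0 \<le> r z + K * q z" using K[of z] by (simp add: q_def)
          then have "0 \<le> (r z + K * q z) * bump y R m z" by (intro mult_nonneg_nonneg bump_nonneg)
          then show ?thesis by (simp add: algebra_simps)
        qed (use bump_outside(1)[of z y R m] R m in auto)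
      qed
      finally show "0 \<le> (LINT x|lborel. q x * (- bump_lap y R m x + K * bump y R m x))" .
    qed
  qed
  then show ?thesis using x by (simp add: q_def)
qed

section \<open>The strong maximum principle\<close>

text \<open>Hopf's barrier: positive in the ball of radius \<open>R\<close> around \<open>y\<close>, zero on its
  boundary, with \<open>\<Delta>\<close> large in the outer half of the ball if \<open>a\<close> is large.\<close>
definition hopf :: "real \<Rightarrow> real \<Rightarrow> 'a::euclidean_space \<Rightarrow> 'a \<Rightarrow> real" where
  "hopf a R y x = exp (- a * (norm (x - y))\<^sup>2) - exp (- a * R\<^sup>2)"

definition hopf_grad :: "real \<Rightarrow> 'a::euclidean_space \<Rightarrow> 'a \<Rightarrow> 'a" where
  "hopf_grad a y x = (- 2 * a * exp (- a * (norm (x - y))\<^sup>2)) *\<^sub>R (x - y)"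

lemma GDERIV_exp_norm: "GDERIV (\<lambda>x. exp (- a * (norm (x - y))\<^sup>2)) x :> hopf_grad a y x"
proof -
  have "DERIV (\<lambda>s. exp (- a * s)) t :> - a * exp (- a * t)" for t
    by (auto intro!: derivative_eq_intros)
  from GDERIV_DERIV_compose[OF GDERIV_norm_diff_square this]
  show ?thesis by (rule GDERIV_subst) (simp add: hopf_grad_def mult_ac)
qed

lemma GDERIV_hopf: "GDERIV (hopf a R y) x :> hopf_grad a y x"
  unfolding hopf_def[abs_def] using GDERIV_diff[OF GDERIV_exp_norm GDERIV_const] by simp

lemma GDERIV_hopf_grad:
  "GDERIV (\<lambda>x. hopf_grad a y x \<bullet> b) x :>
     (- 2 * a) *\<^sub>R (exp (- a * (norm (x - y))\<^sup>2) *\<^sub>R b + ((x - y) \<bullet> b) *\<^sub>R hopf_grad a y x)"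
proof -
  have i: "GDERIV (\<lambda>x. (x - y) \<bullet> b) x :> b"
    unfolding gderiv_def by (auto intro!: derivative_eq_intros)
  have "hopf_grad a y x \<bullet> b = (- 2 * a) * (exp (- a * (norm (x - y))\<^sup>2) * ((x - y) \<bullet> b))" for x
    by (simp add: hopf_grad_def)
  then show ?thesis
    by (simp only:) (rule GDERIV_subst[OF GDERIV_mult[OF GDERIV_const GDERIV_mult[OF GDERIV_exp_norm i]]], simp)
qed

lemma hopf_trace:
  "(\<Sum>b\<in>Basis. ((- 2 * a) *\<^sub>R (exp (- a * (norm (x - y))\<^sup>2) *\<^sub>R b + ((x - y) \<bullet> b) *\<^sub>R hopf_grad a y x)) \<bullet> b)
    = (4 * a\<^sup>2 * (norm (x - y))\<^sup>2 - 2 * a * real DIM('a)) * exp (- a * (norm (x - y :: 'a::euclidean_space))\<^sup>2)"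
proof -
  define v where "v = x - y"
  define E where "E = exp (- a * (norm v)\<^sup>2)"
  have "(\<Sum>b\<in>Basis. ((- 2 * a) *\<^sub>R (E *\<^sub>R b + (v \<bullet> b) *\<^sub>R ((- 2 * a * E) *\<^sub>R v))) \<bullet> b)
      = (\<Sum>b\<in>Basis. - 2 * a * E + 4 * a\<^sup>2 * E * ((v \<bullet> b) * (v \<bullet> b)))"
    by (intro sum.cong refl) (simp add: inner_add_left inner_diff_left power2_eq_square algebra_simps)
  also have "\<dots> = (4 * a\<^sup>2 * (v \<bullet> v) - 2 * a * real DIM('a)) * E"
    by (simp add: sum.distrib sum_subtractf sum_distrib_left[symmetric] euclidean_inner[of v v]) (simp add: algebra_simps)
  finally show ?thesis by (simp add: E_def v_def[symmetric] hopf_grad_def power2_norm_eq_inner)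
qed

lemma continuous_on_hopf: "continuous_on A (hopf a R y)" "continuous_on A (hopf_grad a y)"
  unfolding hopf_def[abs_def] hopf_grad_def[abs_def] by (intro continuous_intros)+

text \<open>Hopf's argument in weak form. A ball in the positivity set touches the zero set at a point
  \<open>p0\<close>; in the outer half of the ball \<open>p\<close> dominates a multiple of the barrier, so
  its inner normal derivative at \<open>p0\<close> is positive, whereas \<open>p0\<close> is a minimum of
  \<open>p\<close>.\<close>
lemma strong_maximum_principle:
  fixes p V :: "'a::euclidean_space \<Rightarrow> real"
  assumes D: "open D" "connected D"
    and p: "\<And>x. x \<in> D \<Longrightarrow> GDERIV p x :> Dp x" "continuous_on D Dp" "\<And>x. x \<in> D \<Longrightarrow> p x \<ge> 0"
    and V: "continuous_on D V"
    and eq: "\<And>\<psi> G. C1c D \<psi> G \<Longrightarrow> (LINT x|lborel. Dp x \<bullet> G x) = (LINT x|lborel. V x * p x * \<psi> x)"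
    and x0: "x0 \<in> D" "p x0 = 0" and x1: "x1 \<in> D"
  shows "p x1 = 0"
proof (rule ccontr)
  assume "p x1 \<noteq> 0"
  have cp: "continuous_on D p" by (rule GDERIV_continuous_on[OF p(1)])
  define P where "P = {x \<in> D. p x > 0}"
  have "open P"
  proof -
    have "P = D \<inter> p -` {0<..}" by (auto simp: P_def)
    then show ?thesis using cp D(1) by (simp add: continuous_open_preimage)
  qed
  have "x1 \<in> P" using x1 p(3)[OF x1] \<open>p x1 \<noteq> 0\<close> by (simp add: P_def)
  have "\<exists>z\<in>D. p z = 0 \<and> z \<in> closure P"
  proof (rule ccontr)
    assume no: "\<not> ?thesis"
    have "P \<inter> D = {} \<or> (D - closure P) \<inter> D = {}"
    proof (rule connectedD[OF D(2) \<open>open P\<close>])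
      show "open (D - closure P)" using D(1) by (simp add: open_Diff)
      show "P \<inter> (D - closure P) \<inter> D = {}" using closure_subset[of P] by blast
      show "D \<subseteq> P \<union> (D - closure P)" using no p(3) by (force simp: P_def)
    qed
    then show False using \<open>x1 \<in> P\<close> x1 x0 no by blast
  qed
  then obtain z where z: "z \<in> D" "p z = 0" "z \<in> closure P" by blast
  obtain r where r: "r > 0" "cball z r \<subseteq> D" using D(1) z(1) open_contains_cball by blast
  obtain y where y: "y \<in> P" "dist y z < r / 2"
    using z(3) r(1) unfolding closure_approachable by (meson half_gt_zero)
  define d where "d = dist y z"
  define Zr where "Zr = cball y d \<inter> p -` {0}"
  have ballD: "cball y d \<subseteq> D"
  proof
    fix w assume "w \<in> cball y d"
    then have "dist z w \<le> r" using y(2) dist_triangle[of z w y] by (simp add: d_def dist_commute)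
    then show "w \<in> D" using r by auto
  qed
  have "compact Zr"
  proof -
    have "closed Zr" unfolding Zr_def
      by (rule continuous_closed_preimage) (auto intro: continuous_on_subset[OF cp ballD])
    then show ?thesis unfolding Zr_def by (metis compact_Int_closed compact_cball inf_assoc inf.idem inf_commute)
  qed
  moreover have "z \<in> Zr" using z by (simp add: Zr_def d_def)
  ultimately obtain p0 where p0: "p0 \<in> Zr" "\<And>w. w \<in> Zr \<Longrightarrow> dist y p0 \<le> dist y w"
    using distance_attains_inf[of Zr y] compact_imp_closed by blast
  define R where "R = dist y p0"
  have p00: "p p0 = 0" "p0 \<in> D" using p0(1) ballD by (auto simp: Zr_def)
  have R: "R > 0" "R \<le> d" using p0 y(1) by (auto simp: R_def Zr_def P_def)
  have RD: "cball y R \<subseteq> D" using ballD R(2) subset_cball by blast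
  have pos: "p w > 0" if "dist y w < R" for w
  proof (rule ccontr)
    assume "\<not> p w > 0"
    moreover have "w \<in> cball y d" using that R by simp
    ultimately have "w \<in> Zr" using p(3)[of w] ballD by (force simp: Zr_def)
    then show False using p0(2) that by (force simp: R_def)
  qed
  obtain K0 where "\<forall>w\<in>V ` cball y R. norm w \<le> K0"
    using compact_imp_bounded[OF compact_continuous_image[OF continuous_on_subset[OF V RD] compact_cball]]
    unfolding bounded_iff by blast
  then have K0: "\<And>x. x \<in> cball y R \<Longrightarrow> \<bar>V x\<bar> \<le> K0" by auto
  define K where "K = max 1 K0"
  have K: "K > 0" "\<And>x. x \<in> cball y R \<Longrightarrow> \<bar>V x\<bar> \<le> K" using K0 by (auto simp: K_def le_max_iff_disj)
  \<comment> \<open>so large that the barrier is a strict subsolution of \<open>-\<Delta> + K\<close> where \<open>|x - y| \<ge> R/2\<close>\<close>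
  define a where "a = 1 + (2 * real DIM('a) + K) / R\<^sup>2"
  have a: "a \<ge> 1" using K(1) by (simp add: a_def)
  have aR: "a * R\<^sup>2 \<ge> 2 * real DIM('a) + K" using R by (simp add: a_def field_simps)
  define lap where "lap x = (4 * a\<^sup>2 * (norm (x - y))\<^sup>2 - 2 * a * real DIM('a)) * exp (- a * (norm (x - y))\<^sup>2)" for x
  have lap: "lap x \<ge> K * hopf a R y x" if "norm (x - y) \<ge> R / 2" for x
  proof -
    have "(norm (x - y))\<^sup>2 \<ge> (R / 2)\<^sup>2" using that R by (intro power_mono) auto
    then have "4 * a\<^sup>2 * (norm (x - y))\<^sup>2 \<ge> 4 * a\<^sup>2 * (R / 2)\<^sup>2" by (intro mult_left_mono) auto
    then have "4 * a\<^sup>2 * (norm (x - y))\<^sup>2 - 2 * a * real DIM('a) \<ge> a * (a * R\<^sup>2 - 2 * real DIM('a))"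
      by (simp add: power2_eq_square algebra_simps)
    moreover have "a * (a * R\<^sup>2 - 2 * real DIM('a)) \<ge> 1 * K" using a aR K by (intro mult_mono) auto
    ultimately have "4 * a\<^sup>2 * (norm (x - y))\<^sup>2 - 2 * a * real DIM('a) \<ge> K" by linarith
    then have "lap x \<ge> K * exp (- a * (norm (x - y))\<^sup>2)" unfolding lap_def by (intro mult_right_mono) auto
    moreover have "K * hopf a R y x \<le> K * exp (- a * (norm (x - y))\<^sup>2)"
      using K by (intro mult_left_mono) (auto simp: hopf_def)
    ultimately show ?thesis by linarith
  qed
  have R2: "cball y (R / 2) \<noteq> {}" "cball y (R / 2) \<subseteq> D" using R RD by auto
  obtain w0 where w0: "w0 \<in> cball y (R / 2)" "\<And>w. w \<in> cball y (R / 2) \<Longrightarrow> p w0 \<le> p w"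
    using continuous_attains_inf[OF compact_cball R2(1) continuous_on_subset[OF cp R2(2)]] by blast
  define e where "e = p w0"
  have e: "e > 0" unfolding e_def using w0 R by (intro pos) auto
  \<comment> \<open>the multiple \<open>e\<close> is the minimum of \<open>p\<close> on the inner ball, so that \<open>v\<close> is at most zero on both boundary spheres of the annulus\<close>
  define v where "v x = e * hopf a R y x - p x" for x
  have h1: "hopf a R y x \<le> 1" for x
  proof -
    have "exp (- a * (norm (x - y))\<^sup>2) \<le> 1" using a by simp
    then show ?thesis unfolding hopf_def by (smt (verit) exp_ge_zero)
  qed
  have v_inner: "v x \<le> 0" if "dist y x \<le> R / 2" for x
  proof -
    have "e * hopf a R y x \<le> e * 1" using h1 e by (intro mult_left_mono) auto
    moreover have "e \<le> p x" unfolding e_def using that by (intro w0(2)) auto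
    ultimately show ?thesis by (simp add: v_def)
  qed
  have v_outer: "v x \<le> 0" if "dist y x = R" for x
  proof -
    have "hopf a R y x = 0" using that by (simp add: hopf_def dist_norm norm_minus_commute)
    moreover have "p x \<ge> 0" using that RD by (intro p(3)) auto
    ultimately show ?thesis by (simp add: v_def)
  qed
  define A where "A = ball y R - cball y (R / 2)"
  have A: "open A" "A \<subseteq> D" using RD ball_subset_cball[of y R] by (auto simp: A_def open_Diff)
  have cv: "continuous_on (cball y R) v"
    unfolding v_def by (intro continuous_intros continuous_on_hopf continuous_on_subset[OF cp RD])
  have vA: "v x \<le> 0" if x: "x \<in> A" for x
  proof (rule ccontr)
    assume "\<not> v x \<le> 0"
    define \<eta> where "\<eta> = v x / 2"
    have \<eta>: "\<eta> > 0" "v x > \<eta>" using \<open>\<not> v x \<le> 0\<close> by (auto simp: \<eta>_def)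
    define f where "f x = (max 0 (v x - \<eta>))\<^sup>2" for x
    define Df where "Df x = (2 * max 0 (v x - \<eta>)) *\<^sub>R (e *\<^sub>R hopf_grad a y x - Dp x)" for x
    define K' where "K' = cball y R \<inter> v -` {\<eta>..}"
    have "compact K'"
    proof -
      have "closed K'" unfolding K'_def by (rule continuous_closed_preimage[OF cv]) auto
      then show ?thesis unfolding K'_def by (metis compact_Int_closed compact_cball inf_assoc inf.idem)
    qed
    have K'A: "K' \<subseteq> A"
    proof
      fix w assume "w \<in> K'"
      then have w: "dist y w \<le> R" "v w > 0" using \<eta> by (auto simp: K'_def)
      then show "w \<in> A" using v_inner[of w] v_outer[of w] by (force simp: A_def)
    qed
    have GA: "GDERIV f x :> Df x" if "x \<in> A" for x
    proof -
      have "GDERIV v x :> e *\<^sub>R hopf_grad a y x - Dp x" unfolding v_def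
        by (rule GDERIV_subst[OF GDERIV_diff[OF GDERIV_mult[OF GDERIV_const GDERIV_hopf] p(1)]]) (use that A in auto)
      moreover have "DERIV (\<lambda>s. (max 0 (s - \<eta>))\<^sup>2) (v x) :> 2 * max 0 (v x - \<eta>)"
        by (rule DERIV_pos_part_comp[where h = "\<lambda>m. m\<^sup>2" and h' = "\<lambda>m. 2 * m"]) (auto intro!: derivative_eq_intros)
      ultimately show ?thesis unfolding f_def Df_def by (rule GDERIV_DERIV_compose)
    qed
    have cDf: "continuous_on A Df" unfolding Df_def
      using A RD ball_subset_cball[of y R]
      by (intro continuous_intros continuous_on_hopf continuous_on_subset[OF p(2)] continuous_on_subset[OF cv]) (auto simp: A_def)
    have f0: "f x = 0" if "x \<in> A - K'" for x
      using that by (auto simp: f_def K'_def A_def max_def)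
    define \<psi> where "\<psi> = (\<lambda>x. if x \<in> A then f x else 0)"
    define G where "G = (\<lambda>x. if x \<in> A then Df x else 0)"
    have C: "C1c A \<psi> G" unfolding \<psi>_def G_def
      by (rule C1c_extend[OF A(1) GA cDf \<open>compact K'\<close> K'A f0])
    note CD = C1c_mono[OF C A(2)]
    let ?H = "\<lambda>b x. (- 2 * a) *\<^sub>R (exp (- a * (norm (x - y))\<^sup>2) *\<^sub>R b + ((x - y) \<bullet> b) *\<^sub>R hopf_grad a y x)"
    have cH: "continuous_on A (?H b)" for b
      by (intro continuous_intros continuous_on_hopf)
    have ibp: "(LINT x|lborel. indicator A x * (Df x \<bullet> hopf_grad a y x + f x * lap x)) = 0"
      "integrable lborel (\<lambda>x. indicator A x * (Df x \<bullet> hopf_grad a y x + f x * lap x))"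
      using divergence_theorem_compact_support[OF A(1) GA cDf, of "hopf_grad a y" ?H K'] GDERIV_hopf_grad cH
        \<open>compact K'\<close> K'A f0 unfolding lap_def hopf_trace[symmetric] by auto
    have i1: "integrable lborel (\<lambda>x. Dp x \<bullet> G x)" by (rule C1c_integrable(2)[OF CD p(2)])
    have i2: "integrable lborel (\<lambda>x. V x * p x * \<psi> x)"
      by (rule C1c_integrable(1)[OF CD continuous_on_mult[OF V cp]])
    have i3: "integrable lborel (\<lambda>x. v x * \<psi> x)"
      by (rule C1c_integrable(1)[OF C]) (rule continuous_on_subset[OF cv], use ball_subset_cball[of y R] in \<open>auto simp: A_def\<close>)
    let ?h = "\<lambda>x. - (v x * \<psi> x)"
    have "?h x = 0"
    proof (rule nonpos_integrand_zero[OF _ _ _ A(1) _ x])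
      show "integrable lborel ?h" using i3 by simp
      show "?h x \<le> 0" for x using \<eta> by (auto simp: \<psi>_def f_def max_def)
      show "continuous_on A ?h"
        using C1c_cont(1)[OF C] ball_subset_cball[of y R] by (intro continuous_intros continuous_on_subset[OF cv]) (auto simp: A_def)
      have pt: "e * (indicator A x * (Df x \<bullet> hopf_grad a y x + f x * lap x)) - Dp x \<bullet> G x + V x * p x * \<psi> x
          \<ge> K * (v x * \<psi> x)" for x
      proof (cases "x \<in> A")
        case True
        have xR: "x \<in> cball y R" "norm (x - y) \<ge> R / 2" using True by (auto simp: A_def dist_norm norm_minus_commute)
        have "e * (Df x \<bullet> hopf_grad a y x) - Dp x \<bullet> Df x = 2 * max 0 (v x - \<eta>) * (norm (e *\<^sub>R hopf_grad a y x - Dp x))\<^sup>2"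
          unfolding Df_def power2_norm_eq_inner by (simp add: inner_diff_left inner_diff_right inner_commute algebra_simps)
        then have 1: "e * (Df x \<bullet> hopf_grad a y x) - Dp x \<bullet> Df x \<ge> 0" by simp
        have "e * lap x \<ge> e * (K * hopf a R y x)" using lap[OF xR(2)] e by (intro mult_left_mono) auto
        moreover have "V x * p x \<ge> - (K * p x)"
          using K(2)[OF xR(1)] p(3)[of x] True A(2) mult_right_mono[of "- K" "V x" "p x"] by auto
        ultimately have "e * lap x + V x * p x \<ge> K * v x" by (simp add: v_def algebra_simps)
        then have "(e * lap x + V x * p x) * f x \<ge> K * v x * f x" by (intro mult_right_mono) (auto simp: f_def)
        then show ?thesis using 1 True by (simp add: G_def \<psi>_def algebra_simps)
      qed (simp add: G_def \<psi>_def)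
      have "K * (LINT x|lborel. v x * \<psi> x) = (LINT x|lborel. K * (v x * \<psi> x))" by simp
      also have "\<dots> \<le> (LINT x|lborel. e * (indicator A x * (Df x \<bullet> hopf_grad a y x + f x * lap x)) - Dp x \<bullet> G x + V x * p x * \<psi> x)"
        using pt i1 i2 i3 ibp(2) by (intro integral_mono) auto
      also have "\<dots> = 0" using i1 i2 ibp eq[OF CD] by simp
      finally show "0 \<le> (LINT x|lborel. ?h x)" using K(1) by (simp add: mult_le_0_iff)
    qed
    then show False using x \<eta> by (simp add: \<psi>_def f_def)
  qed
  have Dp0: "Dp p0 = 0"
  proof -
    have "(\<lambda>h. h \<bullet> Dp p0) = (\<lambda>h. 0)"
      by (rule differential_zero_maxmin[OF p00(2) D(1)]) (use p(1)[OF p00(2)] p(3) p00 in \<open>auto simp: gderiv_def\<close>)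
    then show ?thesis by (metis inner_eq_zero_iff)
  qed
  define \<phi> where "\<phi> t = p (p0 + t *\<^sub>R (y - p0)) - e * hopf a R y (p0 + t *\<^sub>R (y - p0))" for t
  have "DERIV \<phi> 0 :> (y - p0) \<bullet> Dp (p0 + 0 *\<^sub>R (y - p0)) - e * ((y - p0) \<bullet> hopf_grad a y (p0 + 0 *\<^sub>R (y - p0)))"
    unfolding \<phi>_def by (intro DERIV_diff DERIV_cmult GDERIV_line GDERIV_hopf p(1)) (use p00 in simp)
  moreover have "(y - p0) \<bullet> hopf_grad a y p0 = 2 * a * exp (- a * R\<^sup>2) * R\<^sup>2"
  proof -
    have "(y - p0) \<bullet> (p0 - y) = - (R\<^sup>2)"
      unfolding R_def dist_norm power2_norm_eq_inner by (simp add: inner_diff_left inner_diff_right inner_commute)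
    moreover have "norm (p0 - y) = R" by (simp add: R_def dist_norm norm_minus_commute)
    ultimately show ?thesis by (simp add: hopf_grad_def)
  qed
  ultimately have "DERIV \<phi> 0 :> - (e * (2 * a * exp (- a * R\<^sup>2) * R\<^sup>2))" using Dp0 by simp
  moreover have "- (e * (2 * a * exp (- a * R\<^sup>2) * R\<^sup>2)) < 0" using e a R by simp
  ultimately obtain \<delta> where \<delta>: "\<delta> > 0" "\<And>h. 0 < h \<Longrightarrow> h < \<delta> \<Longrightarrow> \<phi> (0 + h) < \<phi> 0"
    using DERIV_neg_dec_right by blast
  define t where "t = min (\<delta> / 2) (1 / 4)"
  have t: "0 < t" "t < \<delta>" "t \<le> 1 / 4" using \<delta>(1) by (auto simp: t_def)
  have "\<phi> 0 = 0" using p00 by (simp add: \<phi>_def hopf_def R_def dist_norm norm_minus_commute)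
  moreover have "p0 + t *\<^sub>R (y - p0) \<in> A"
  proof -
    have "y - (p0 + t *\<^sub>R (y - p0)) = (1 - t) *\<^sub>R (y - p0)" by (simp add: algebra_simps)
    then have "dist y (p0 + t *\<^sub>R (y - p0)) = (1 - t) * R" using t by (simp add: dist_norm R_def)
    moreover have "(1 - t) * R < 1 * R" using t R by (intro mult_strict_right_mono) auto
    moreover have "(3 / 4) * R \<le> (1 - t) * R" using t R by (intro mult_right_mono) auto
    moreover have "R / 2 < (3 / 4) * R" using R by simp
    ultimately show ?thesis by (simp add: A_def)
  qed
  then have "\<phi> t \<ge> 0" using vA by (force simp: \<phi>_def v_def)
  ultimately show False using \<delta>(2)[of t] t by simp
qed

text \<open>Picone's identity: testing the equation with \<open>\<psi>\<^sup>2 / p\<close> gives \<open>|G - (\<psi>/p)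
  Dp|\<^sup>2\<close> as the integrand of the form.\<close>
lemma positive_solution_imp_stable:
  fixes p V :: "'a::euclidean_space \<Rightarrow> real"
  assumes D: "open D"
    and p: "\<And>x. x \<in> D \<Longrightarrow> GDERIV p x :> Dp x" "continuous_on D Dp" "\<And>x. x \<in> D \<Longrightarrow> p x \<noteq> 0"
    and V: "continuous_on D V"
    and eq: "\<And>\<psi> G. C1c D \<psi> G \<Longrightarrow> (LINT x|lborel. Dp x \<bullet> G x) = (LINT x|lborel. V x * p x * \<psi> x)"
    and C: "C1c D \<psi> G"
  shows "0 \<le> (LINT x|lborel. (norm (G x))\<^sup>2 - V x * (\<psi> x)\<^sup>2)"
proof -
  have cp: "continuous_on D p" by (rule GDERIV_continuous_on[OF p(1)])
  obtain K where K: "compact K" "K \<subseteq> D" "\<And>x. x \<notin> K \<Longrightarrow> \<psi> x = 0" "\<And>x. x \<notin> K \<Longrightarrow> G x = 0"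
    using C1cE[OF C] by metis
  define f where "f x = (\<psi> x)\<^sup>2 * inverse (p x)" for x
  define Df where "Df x = (2 * \<psi> x / p x) *\<^sub>R G x - ((\<psi> x)\<^sup>2 / (p x)\<^sup>2) *\<^sub>R Dp x" for x
  have C2: "C1c D (\<lambda>x. if x \<in> D then f x else 0) (\<lambda>x. if x \<in> D then Df x else 0)"
  proof (rule C1c_extend[OF D _ _ K(1,2)])
    fix x assume x: "x \<in> D"
    have "GDERIV (\<lambda>x. (\<psi> x)\<^sup>2) x :> (2 * \<psi> x) *\<^sub>R G x"
      by (rule GDERIV_subst[OF GDERIV_DERIV_compose[OF C1c_gderiv[OF C], where g = "\<lambda>s. s\<^sup>2" and dg = "2 * \<psi> x"]])
        (auto intro!: derivative_eq_intros)
    from GDERIV_mult[OF this GDERIV_inverse[OF p(1)[OF x] p(3)[OF x]]]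
    show "GDERIV f x :> Df x"
      unfolding f_def by (rule GDERIV_subst) (simp add: Df_def power_inverse divide_inverse mult_ac)
  next
    show "continuous_on D Df" unfolding Df_def
      by (intro continuous_intros C1c_cont[OF C] cp p(2)) (use p(3) in auto)
  qed (use K in \<open>auto simp: f_def\<close>)
  have i1: "integrable lborel (\<lambda>x. G x \<bullet> G x)" by (rule C1c_integrable(2)[OF C C1c_cont(2)[OF C]])
  have i2: "integrable lborel (\<lambda>x. (V x * \<psi> x) * \<psi> x)"
    by (rule C1c_integrable(1)[OF C continuous_on_mult[OF V C1c_cont(1)[OF C]]])
  have i3: "integrable lborel (\<lambda>x. Dp x \<bullet> (if x \<in> D then Df x else 0))" by (rule C1c_integrable(2)[OF C2 p(2)])
  have z: "V x * p x * (if x \<in> D then f x else 0) = (V x * \<psi> x) * \<psi> x" for x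
    using p(3)[of x] K(2,3) by (cases "x \<in> D") (auto simp: f_def power2_eq_square)
  have "(LINT x|lborel. (norm (G x))\<^sup>2 - V x * (\<psi> x)\<^sup>2) = (LINT x|lborel. G x \<bullet> G x) - (LINT x|lborel. (V x * \<psi> x) * \<psi> x)"
    unfolding power2_norm_eq_inner using i1 i2 by (simp add: power2_eq_square mult.assoc)
  also have "\<dots> = (LINT x|lborel. G x \<bullet> G x) - (LINT x|lborel. Dp x \<bullet> (if x \<in> D then Df x else 0))"
    using eq[OF C2] by (simp only: z)
  also have "\<dots> = (LINT x|lborel. G x \<bullet> G x - Dp x \<bullet> (if x \<in> D then Df x else 0))"
    using i1 i3 by simp
  also have "\<dots> \<ge> 0"
  proof (rule Bochner_Integration.integral_nonneg)
    fix x
    show "0 \<le> G x \<bullet> G x - Dp x \<bullet> (if x \<in> D then Df x else 0)"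
    proof (cases "x \<in> D")
      case True
      have "G x \<bullet> G x - Dp x \<bullet> Df x = (G x - (\<psi> x / p x) *\<^sub>R Dp x) \<bullet> (G x - (\<psi> x / p x) *\<^sub>R Dp x)"
        by (simp add: Df_def inner_diff_left inner_diff_right inner_commute power2_eq_square algebra_simps)
      then show ?thesis using True by simp
    qed auto
  qed
  finally show ?thesis .
qed

section \<open>Rotations and reflections about the axis\<close>

definition rot :: "'n::finite \<Rightarrow> 'n \<Rightarrow> real \<Rightarrow> real ^ 'n \<Rightarrow> real ^ 'n" where
  "rot i j t x = (\<chi> k. if k = i then x $ i * cos t - x $ j * sin t
     else if k = j then x $ i * sin t + x $ j * cos t else x $ k)"

text \<open>The reflection that maps the angle \<open>t\<close> to \<open>b - t\<close>; it exchanges the half sectors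
  of the sector of opening \<open>b\<close>.\<close>
definition refl :: "'n::finite \<Rightarrow> 'n \<Rightarrow> real \<Rightarrow> real ^ 'n \<Rightarrow> real ^ 'n" where
  "refl i j b x = (\<chi> k. if k = i then x $ i * cos b + x $ j * sin b
     else if k = j then x $ i * sin b - x $ j * cos b else x $ k)"

text \<open>The vector field that generates the rotations; the angular derivative is
  \<open>\<partial>u/\<partial>\<theta> = T\<theta> x \<bullet> \<nabla>u\<close>.\<close>
definition tang :: "'n::finite \<Rightarrow> 'n \<Rightarrow> real ^ 'n \<Rightarrow> real ^ 'n" where
  "tang i j x = (\<chi> k. if k = i then - x $ j else if k = j then x $ i else 0)"

locale cyl_coords =
  fixes i j :: "'n::finite"
  assumes ij: "i \<noteq> j"
begin

abbreviation "dax \<equiv> dist_axis i j"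
abbreviation "zp \<equiv> zpart i j"
abbreviation "ang \<equiv> angle i j"
abbreviation "R\<theta> \<equiv> rot i j"
abbreviation "S\<theta> \<equiv> refl i j"
abbreviation "T\<theta> \<equiv> tang i j"
abbreviation "cyl \<equiv> cyl_point i j"

lemma inner_split: "x \<bullet> y = x $ i * y $ i + x $ j * y $ j + (\<Sum>k\<in>UNIV - {i, j}. x $ k * y $ k)" for x y :: "real ^ 'n"
proof -
  have "x \<bullet> y = (\<Sum>k\<in>UNIV. x $ k * y $ k)" by (simp add: inner_vec_def)
  also have "\<dots> = x $ i * y $ i + (\<Sum>k\<in>UNIV - {i}. x $ k * y $ k)" by (rule sum.remove) auto
  also have "(\<Sum>k\<in>UNIV - {i}. x $ k * y $ k) = x $ j * y $ j + (\<Sum>k\<in>UNIV - {i} - {j}. x $ k * y $ k)"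
    using ij by (intro sum.remove) auto
  also have "UNIV - {i} - {j} = UNIV - {i, j}" by auto
  finally show ?thesis by simp
qed

lemma linear_maps: "linear (R\<theta> t)" "linear (S\<theta> t)" "linear T\<theta>"
  by (auto intro!: linearI simp: rot_def refl_def tang_def vec_eq_iff algebra_simps)

lemma rot_add: "R\<theta> s (R\<theta> t x) = R\<theta> (s + t) x"
  using ij by (simp add: rot_def vec_eq_iff cos_add sin_add algebra_simps)

lemma rot_0 [simp]: "R\<theta> 0 x = x" by (simp add: rot_def vec_eq_iff)

lemma rot_inverse [simp]: "R\<theta> t (R\<theta> (- t) x) = x" "R\<theta> (- t) (R\<theta> t x) = x"
  by (simp_all add: rot_add)

lemma rot_inner [simp]: "R\<theta> t x \<bullet> R\<theta> t y = x \<bullet> y"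
proof -
  have "(x $ i * cos t - x $ j * sin t) * (y $ i * cos t - y $ j * sin t)
      + (x $ i * sin t + x $ j * cos t) * (y $ i * sin t + y $ j * cos t)
      = (x $ i * y $ i + x $ j * y $ j) * ((sin t)\<^sup>2 + (cos t)\<^sup>2)"
    by algebra
  then show ?thesis using ij unfolding inner_split by (simp add: rot_def cong: sum.cong_simp)
qed

lemma refl_inner [simp]: "S\<theta> t x \<bullet> S\<theta> t y = x \<bullet> y"
proof -
  have "(x $ i * cos t + x $ j * sin t) * (y $ i * cos t + y $ j * sin t)
      + (x $ i * sin t - x $ j * cos t) * (y $ i * sin t - y $ j * cos t)
      = (x $ i * y $ i + x $ j * y $ j) * ((sin t)\<^sup>2 + (cos t)\<^sup>2)"
    by algebra
  then show ?thesis using ij unfolding inner_split by (simp add: refl_def cong: sum.cong_simp)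
qed

lemma rot_norm [simp]: "norm (R\<theta> t x) = norm x" and refl_norm [simp]: "norm (S\<theta> t x) = norm x"
  by (simp_all add: norm_eq_sqrt_inner)

lemma refl_refl [simp]: "S\<theta> b (S\<theta> b x) = x"
proof -
  have "(x $ i * cos b + x $ j * sin b) * cos b + (x $ i * sin b - x $ j * cos b) * sin b = x $ i * ((sin b)\<^sup>2 + (cos b)\<^sup>2)"
    "(x $ i * cos b + x $ j * sin b) * sin b - (x $ i * sin b - x $ j * cos b) * cos b = x $ j * ((sin b)\<^sup>2 + (cos b)\<^sup>2)"
    by algebra+
  then show ?thesis using ij by (simp add: refl_def vec_eq_iff)
qed

lemma tang_rot: "T\<theta> (R\<theta> t x) = R\<theta> t (T\<theta> x)"
  using ij by (simp add: tang_def rot_def vec_eq_iff)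

lemma tang_refl: "S\<theta> b (T\<theta> x) = - T\<theta> (S\<theta> b x)"
  using ij by (simp add: tang_def refl_def vec_eq_iff)

lemma tang_inner: "T\<theta> x \<bullet> y = - (x \<bullet> T\<theta> y)"
  using ij unfolding inner_split by (simp add: tang_def cong: sum.cong_simp)

lemma norm_tang: "norm (T\<theta> x) = dax x"
proof -
  have "T\<theta> x \<bullet> T\<theta> x = (x $ i)\<^sup>2 + (x $ j)\<^sup>2"
    using ij unfolding inner_split by (simp add: tang_def power2_eq_square cong: sum.cong_simp)
  then show ?thesis by (simp add: norm_eq_sqrt_inner dist_axis_def)
qed

lemma dist_axis_nonneg [simp]: "dax x \<ge> 0" by (simp add: dist_axis_def)

lemma dist_axis_le_norm: "dax x \<le> norm x"
proof -
  have "(x $ i)\<^sup>2 + (x $ j)\<^sup>2 \<le> x \<bullet> x"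
    unfolding inner_split power2_eq_square by (simp add: sum_nonneg)
  then show ?thesis by (simp add: norm_eq_sqrt_inner dist_axis_def)
qed

lemma dist_axis_rot [simp]: "dax (R\<theta> t x) = dax x"
  unfolding norm_tang[symmetric] tang_rot by simp

lemma dist_axis_refl [simp]: "dax (S\<theta> t x) = dax x"
  using tang_refl[of t x] refl_norm[of t "T\<theta> x"] by (simp add: norm_tang[symmetric])

lemma zpart_rot [simp]: "zp (R\<theta> t x) = zp x" and zpart_refl [simp]: "zp (S\<theta> t x) = zp x"
  by (simp_all add: zpart_def rot_def refl_def vec_eq_iff)

lemma zpart_zspace [simp]: "zp x \<in> zspace i j" by (simp add: zpart_def zspace_def)

lemma cyl_point_eq [simp]: "cyl (dax x) (ang x) (zp x) = x"
proof -
  have n: "cmod (Complex (x $ i) (x $ j)) = dax x" by (simp add: dist_axis_def cmod_def)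
  have "dax x * cos (ang x) = x $ i" "dax x * sin (ang x) = x $ j"
    using cos_Arg2pi[of "Complex (x $ i) (x $ j)"] sin_Arg2pi[of "Complex (x $ i) (x $ j)"]
    by (simp_all add: angle_def n)
  then show ?thesis by (simp add: cyl_point_def zpart_def vec_eq_iff)
qed

lemma coord_eq: "x $ i = dax x * cos (ang x)" "x $ j = dax x * sin (ang x)"
  using arg_cong[OF cyl_point_eq[of x], of "\<lambda>v. v $ i"] arg_cong[OF cyl_point_eq[of x], of "\<lambda>v. v $ j"] ij
  by (simp_all add: cyl_point_def)

lemma angle_range: "0 \<le> ang x" "ang x < 2 * pi"
  unfolding angle_def using Arg2pi by auto

lemma rot_cyl: "R\<theta> t (cyl r s z) = cyl r (s + t) z"
  using ij by (simp add: rot_def cyl_point_def vec_eq_iff cos_add sin_add algebra_simps)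

lemma refl_cyl: "S\<theta> b (cyl r s z) = cyl r (b - s) z"
  using ij by (simp add: refl_def cyl_point_def vec_eq_iff cos_diff sin_diff algebra_simps)

lemma dist_axis_cyl: "r \<ge> 0 \<Longrightarrow> dax (cyl r s z) = r"
proof -
  assume "r \<ge> 0"
  have "(r * cos s)\<^sup>2 + (r * sin s)\<^sup>2 = r\<^sup>2 * ((sin s)\<^sup>2 + (cos s)\<^sup>2)"
    by algebra
  then show ?thesis using ij \<open>r \<ge> 0\<close> by (simp add: dist_axis_def cyl_point_def)
qed

lemma zpart_cyl: "z \<in> zspace i j \<Longrightarrow> zp (cyl r s z) = z"
  by (auto simp: zpart_def cyl_point_def zspace_def vec_eq_iff)

lemma angle_cyl: "r > 0 \<Longrightarrow> 0 \<le> s \<Longrightarrow> s < 2 * pi \<Longrightarrow> ang (cyl r s z) = s"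
  unfolding angle_def using ij
  by (intro Arg2pi_unique[of r]) (auto simp: cyl_point_def complex_eq_iff Re_exp Im_exp)

lemma cyl_rot: "cyl (dax x) t (zp x) = R\<theta> (t - ang x) x"
  using rot_cyl[of "t - ang x" "dax x" "ang x" "zp x"] by simp

lemma angle_rot: "dax x > 0 \<Longrightarrow> 0 \<le> ang x + t \<Longrightarrow> ang x + t < 2 * pi \<Longrightarrow> ang (R\<theta> t x) = ang x + t"
  using angle_cyl[of "dax x" "ang x + t" "zp x"] rot_cyl[of t "dax x" "ang x" "zp x"] by simp

lemma refl_eq_rot: "S\<theta> b x = R\<theta> (b - 2 * ang x) x"
  using refl_cyl[of b "dax x" "ang x" "zp x"] cyl_rot[of x "b - ang x"] by simp

lemma angle_refl: "dax x > 0 \<Longrightarrow> ang x \<le> b \<Longrightarrow> b < 2 * pi \<Longrightarrow> ang (S\<theta> b x) = b - ang x"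
  unfolding refl_eq_rot using angle_range[of x] by (subst angle_rot) auto

lemma rot_expand: "R\<theta> t x = x + T\<theta> (T\<theta> x) - cos t *\<^sub>R T\<theta> (T\<theta> x) + sin t *\<^sub>R T\<theta> x"
  using ij by (simp add: rot_def tang_def vec_eq_iff algebra_simps)

lemma rot_has_vector_derivative: "((\<lambda>t. R\<theta> t x) has_vector_derivative T\<theta> (R\<theta> t x)) (at t within A)"
proof -
  have "T\<theta> (R\<theta> t x) = sin t *\<^sub>R T\<theta> (T\<theta> x) + cos t *\<^sub>R T\<theta> x"
    using ij by (simp add: rot_def tang_def vec_eq_iff algebra_simps)
  then show ?thesis unfolding rot_expand[of _ x]
    by (auto intro!: derivative_eq_intros simp: has_vector_derivative_def algebra_simps)
qed

lemma continuous_coords: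
  "continuous_on A dax" "continuous_on A zp" "continuous_on A (R\<theta> t)" "continuous_on A (S\<theta> t)" "continuous_on A T\<theta>"
proof -
  show "continuous_on A dax" unfolding dist_axis_def[abs_def] by (intro continuous_intros)
  show "continuous_on A zp" unfolding zpart_def[abs_def]
  proof (rule continuous_on_vec_lambda)
    show "continuous_on A (\<lambda>x. if k = i \<or> k = j then 0 else x $ k)" for k
      by (cases "k = i \<or> k = j") (auto intro!: continuous_intros)
  qed
  show "continuous_on A (R\<theta> t)" "continuous_on A (S\<theta> t)" "continuous_on A T\<theta>"
    using linear_maps by (simp_all add: linear_continuous_on linear_conv_bounded_linear[symmetric])
qed

lemma continuous_on_rot:
  fixes f :: "'a::euclidean_space \<Rightarrow> real" and g :: "'a \<Rightarrow> real ^ 'n"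
  assumes "continuous_on A f" "continuous_on A g"
  shows "continuous_on A (\<lambda>x. R\<theta> (f x) (g x))"
proof -
  have T: "continuous_on A (\<lambda>x. T\<theta> (h x))" if "continuous_on A h" for h :: "'a \<Rightarrow> real ^ 'n"
    by (rule continuous_on_compose2[OF continuous_coords(5)[of UNIV] that]) auto
  show ?thesis unfolding rot_expand
    by (intro continuous_on_add continuous_on_diff continuous_on_scaleR continuous_on_cos continuous_on_sin T assms)
qed

lemma borel_measurable_maps [measurable]:
  "dax \<in> borel_measurable borel" "zp \<in> borel_measurable borel" "R\<theta> t \<in> borel_measurable borel"
  "S\<theta> t \<in> borel_measurable borel" "T\<theta> \<in> borel_measurable borel"
  using continuous_coords[of UNIV] by (auto intro: borel_measurable_continuous_onI)

lemmas integral_rot = integral_isometry[OF linear_maps(1) linear_maps(1) rot_inverse(1) rot_norm]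
lemmas integral_refl = integral_isometry[OF linear_maps(2) linear_maps(2) refl_refl refl_norm]

lemma open_Omega:
  assumes "0 \<le> t1"
  shows "open (Omega i j r1 t1 t2)"
proof -
  define c where "c x = Complex (x $ i) (x $ j)" for x :: "real ^ 'n"
  have cc: "continuous_on UNIV c"
    unfolding c_def complex_eq_iff[abs_def] Complex_eq by (intro continuous_intros)
  have cA: "continuous_on (- \<real>\<^sub>\<ge>\<^sub>0) Arg2pi"
    by (auto intro!: continuous_at_imp_continuous_on continuous_at_Arg2pi)
  have "open (- \<real>\<^sub>\<ge>\<^sub>0 \<inter> Arg2pi -` {t1<..<t2})"
    using closed_nonneg_Reals_complex by (intro continuous_open_preimage[OF cA]) (auto simp: open_Compl)
  moreover have "- \<real>\<^sub>\<ge>\<^sub>0 \<inter> Arg2pi -` {t1<..<t2} = Arg2pi -` {t1<..<t2}"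
  proof -
    have "z \<notin> \<real>\<^sub>\<ge>\<^sub>0" if "Arg2pi z > t1" for z
      using that assms Arg2pi_eq_0[of z] by (auto simp: nonneg_Reals_def complex_nonneg_Reals_iff complex_is_Real_iff)
    then show ?thesis by auto
  qed
  ultimately have "open (Arg2pi -` {t1<..<t2})" by simp
  then have "open (c -` (Arg2pi -` {t1<..<t2}))" by (rule open_vimage[OF _ cc])
  moreover have "open {x. dax x > r1}"
    by (intro open_Collect_less continuous_coords continuous_intros)
  moreover have "Omega i j r1 t1 t2 = {x. dax x > r1} \<inter> c -` (Arg2pi -` {t1<..<t2})"
    by (auto simp: Omega_def angle_def c_def)
  ultimately show ?thesis by auto
qed

lemma continuous_on_cyl: "continuous_on A (\<lambda>(r, t, z). cyl r t z)"
  unfolding cyl_point_def[abs_def] case_prod_unfold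
proof (rule continuous_on_vec_lambda)
  fix k
  show "continuous_on A (\<lambda>x. if k = i then fst x * cos (fst (snd x)) else if k = j then fst x * sin (fst (snd x))
      else snd (snd x) $ k)"
    by (cases "k = i"; cases "k = j") (auto intro!: continuous_intros)
qed

lemma convex_zspace: "convex (zspace i j)"
  by (auto simp: convex_def zspace_def)

lemma Omega_eq_image:
  assumes "r1 \<ge> 0" "0 \<le> t1" "t2 \<le> 2 * pi"
  shows "Omega i j r1 t1 t2 = (\<lambda>(r, t, z). cyl r t z) ` ({r1<..} \<times> {t1<..<t2} \<times> zspace i j)"
proof (intro equalityI subsetI)
  fix x assume x: "x \<in> Omega i j r1 t1 t2"
  show "x \<in> (\<lambda>(r, t, z). cyl r t z) ` ({r1<..} \<times> {t1<..<t2} \<times> zspace i j)"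
    by (rule image_eqI[of _ _ "(dax x, ang x, zp x)"]) (use x in \<open>auto simp: Omega_def\<close>)
next
  fix x assume "x \<in> (\<lambda>(r, t, z). cyl r t z) ` ({r1<..} \<times> {t1<..<t2} \<times> zspace i j)"
  then show "x \<in> Omega i j r1 t1 t2"
    using assms by (auto simp: Omega_def dist_axis_cyl angle_cyl)
qed

lemma connected_Omega:
  assumes "r1 \<ge> 0" "0 \<le> t1" "t2 \<le> 2 * pi"
  shows "connected (Omega i j r1 t1 t2)"
  unfolding Omega_eq_image[OF assms]
  by (intro connected_continuous_image continuous_on_cyl convex_connected convex_Times convex_zspace) auto

lemma closure_Omega_subset:
  assumes x: "x \<in> closure (Omega i j r1 0 b)" and b: "b \<ge> 0"
  shows "dax x \<ge> r1" "ang x \<le> b"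
proof -
  have "closed {x. dax x \<ge> r1}"
    by (intro closed_Collect_le continuous_coords continuous_intros)
  moreover have "Omega i j r1 0 b \<subseteq> {x. dax x \<ge> r1}" by (auto simp: Omega_def)
  ultimately show "dax x \<ge> r1" using x closure_minimal by blast
  show "ang x \<le> b"
  proof (rule ccontr)
    assume "\<not> ang x \<le> b"
    define U where "U = Omega i j (-1) b (2 * pi)"
    have "x \<in> U" using \<open>\<not> ang x \<le> b\<close> angle_range[of x] dist_axis_nonneg[of x] unfolding U_def Omega_def
      by (auto simp del: dist_axis_nonneg)
    moreover have "open U" unfolding U_def using b by (rule open_Omega)
    ultimately obtain y where "y \<in> U" "y \<in> Omega i j r1 0 b"
      using x unfolding closure_iff_nhds_not_empty by blast
    then show False by (auto simp: U_def Omega_def)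
  qed
qed

lemma in_closure_Omega:
  assumes "r1 \<ge> 0" "0 < b" "b < 2 * pi" and x: "dax x \<ge> r1" "ang x \<le> b"
  shows "x \<in> closure (Omega i j r1 0 b)"
proof -
  let ?S = "{r1<..} \<times> {0<..<b} \<times> zspace i j"
  have "(\<lambda>(r, t, z). cyl r t z) ` closure ?S \<subseteq> closure (Omega i j r1 0 b)"
  proof (rule image_closure_subset[OF continuous_on_cyl closed_closure])
    show "(\<lambda>(r, t, z). cyl r t z) ` ?S \<subseteq> closure (Omega i j r1 0 b)"
      using Omega_eq_image[of r1 0 b] assms closure_subset[of "Omega i j r1 0 b"] by simp
  qed
  moreover have "(dax x, ang x, zp x) \<in> closure ?S"
    unfolding closure_Times using assms angle_range[of x] closure_subset[of "zspace i j"] zpart_zspace[of x]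
    by auto
  ultimately show ?thesis by (force simp: image_subset_iff)
qed

lemma rot_in_Omega:
  assumes "x \<in> Omega i j r1 t1 t2" "r1 \<ge> 0" "0 \<le> t1 + t" "t2 + t \<le> 2 * pi"
  shows "R\<theta> t x \<in> Omega i j r1 (t1 + t) (t2 + t)"
  using assms angle_rot[of x t] by (auto simp: Omega_def)

lemma refl_in_Omega:
  assumes "x \<in> Omega i j r1 t1 t2" "r1 \<ge> 0" "t2 \<le> b" "b < 2 * pi"
  shows "S\<theta> b x \<in> Omega i j r1 (b - t2) (b - t1)"
  using assms angle_refl[of x b] by (auto simp: Omega_def)

lemma Omega_mono: "t1' \<le> t1 \<Longrightarrow> t2 \<le> t2' \<Longrightarrow> Omega i j r1 t1 t2 \<subseteq> Omega i j r1 t1' t2'"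
  by (auto simp: Omega_def)

text \<open>A ball centred slightly below the face \<open>\<theta> = 0\<close>: the ball of radius \<open>R0\<close>
  stays below the face, that of radius \<open>R\<close> reaches into the sector, and neither meets the other
  face. It is used to let zeros propagate from outside the domain through the face.\<close>
lemma face_ball:
  assumes r1: "r1 \<ge> 0" and b: "0 < b" "b \<le> \<beta>" "\<beta> < 2 * pi"
  obtains y R0 R where "0 < R0" "R0 < R"
    "\<And>x. x $ j \<ge> 0 \<Longrightarrow> norm (x - y) \<ge> R0"
    "\<And>x. x \<in> cball y R \<Longrightarrow> x $ j \<ge> 0 \<Longrightarrow> x \<in> Omega i j r1 0 b \<union> Gamma_face i j r1 0"
    "\<And>x. x \<in> cball y R \<Longrightarrow> x \<in> Omega_faces i j r1 \<beta> \<Longrightarrow> x $ j \<ge> 0"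
    "ball y R \<inter> Omega i j r1 0 b \<noteq> {}"
proof -
  define m where "m = min (min b (2 * pi - \<beta>)) (pi / 2)"
  have m: "0 < m" "m \<le> b" "m \<le> 2 * pi - \<beta>" "m \<le> pi / 2"
    using b pi_gt_zero unfolding m_def by (auto simp: min_def)
  have sm: "sin m > 0" using m by (intro sin_gt_zero) auto
  define \<rho> where "\<rho> = min (1 / 2) (sin m / 2)"
  have \<rho>: "0 < \<rho>" "\<rho> \<le> 1 / 2" "\<rho> < sin m" using sm by (auto simp: \<rho>_def)
  define x0 :: "real ^ 'n" where "x0 = axis i (r1 + 2)"
  define y where "y = x0 - axis j (\<rho> / 3)"
  define R0 where "R0 = \<rho> / 3"
  define R where "R = 2 * \<rho> / 3"
  have y: "y $ i = r1 + 2" "y $ j = - R0" using ij by (auto simp: y_def x0_def axis_def R0_def)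
  have near: "x $ i > r1 + 1" "\<bar>x $ j\<bar> \<le> \<rho>" if "x \<in> cball y R" for x
  proof -
    have "norm (x - y) \<le> R" using that by (simp add: dist_norm norm_minus_commute)
    then have "\<bar>(x - y) $ i\<bar> \<le> R" "\<bar>(x - y) $ j\<bar> \<le> R"
      using component_le_norm_cart[of "x - y"] order_trans by blast+
    then have "\<bar>x $ i - (r1 + 2)\<bar> \<le> 2 * \<rho> / 3" "\<bar>x $ j + \<rho> / 3\<bar> \<le> 2 * \<rho> / 3"
      by (simp_all add: y R_def R0_def)
    then show "x $ i > r1 + 1" "\<bar>x $ j\<bar> \<le> \<rho>" using \<rho> unfolding abs_le_iff by linarith+
  qed
  have ang: "dax x > r1 \<and> (ang x < m \<or> ang x > 2 * pi - m) \<and> (x $ j \<ge> 0 \<longleftrightarrow> ang x < m)" if x: "x \<in> cball y R" for x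
  proof -
    have xi: "x $ i = dax x * cos (ang x)" and xj: "x $ j = dax x * sin (ang x)"
      by (rule coord_eq)+
    have "x $ i \<le> dax x" unfolding dist_axis_def by (simp add: real_le_rsqrt)
    then have d: "dax x > r1 + 1" using near[OF x] by linarith
    have c: "cos (ang x) > 0"
    proof -
      have "dax x * cos (ang x) > 0" using near(1)[OF x] r1 by (simp add: xi[symmetric])
      then show ?thesis using d r1 by (simp add: zero_less_mult_iff)
    qed
    have s: "\<bar>sin (ang x)\<bar> < sin m"
    proof -
      have "\<bar>sin (ang x)\<bar> * 1 \<le> \<bar>sin (ang x)\<bar> * dax x" using d r1 by (intro mult_left_mono) auto
      also have "\<dots> = \<bar>x $ j\<bar>" using d r1 by (simp add: xj abs_mult mult.commute)
      finally show ?thesis using near(2)[OF x] \<rho> by linarith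
    qed
    note ar = angle_range[of x]
    consider "ang x < pi / 2" | "pi / 2 \<le> ang x" "ang x \<le> 3 * pi / 2" | "3 * pi / 2 < ang x" by linarith
    then show ?thesis
    proof cases
      case 1
      have "ang x < m"
      proof (rule ccontr)
        assume "\<not> ang x < m"
        then have "sin m \<le> sin (ang x)" using 1 m by (intro sin_monotone_2pi_le) auto
        then show False using s by linarith
      qed
      moreover have "sin (ang x) \<ge> 0" using 1 ar by (intro sin_ge_zero) auto
      ultimately show ?thesis using d xj r1 by auto
    next
      case 2
      have "0 \<le> sin (ang x - pi / 2)" using 2 by (intro sin_ge_zero) auto
      then show ?thesis using c by (simp add: sin_diff)
    next
      case 3
      define a where "a = 2 * pi - ang x"
      have a: "0 < a" "a < pi / 2" using 3 ar by (auto simp: a_def)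
      have sa: "sin (ang x) = - sin a" by (simp add: a_def sin_diff)
      have "a < m"
      proof (rule ccontr)
        assume "\<not> a < m"
        then have "sin m \<le> sin a" using a m by (intro sin_monotone_2pi_le) auto
        then show False using s sa by linarith
      qed
      moreover have "sin a > 0" using a by (intro sin_gt_zero) auto
      then have "dax x * sin (ang x) < 0" using sa d r1 by (simp add: mult_less_0_iff)
      then have "x $ j < 0" by (simp add: xj)
      ultimately show ?thesis using d m 3 by (auto simp: a_def)
    qed
  qed
  show ?thesis
  proof (rule that[of R0 R y])
    show "0 < R0" "R0 < R" using \<rho> by (auto simp: R0_def R_def)
    show "norm (x - y) \<ge> R0" if "x $ j \<ge> 0" for x
      using component_le_norm_cart[of "x - y" j] that y \<rho> by auto
    show "x \<in> Omega i j r1 0 b \<union> Gamma_face i j r1 0" if "x \<in> cball y R" "x $ j \<ge> 0" for x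
      using ang[OF that(1)] that(2) m angle_range[of x] by (auto simp: Omega_def Gamma_face_def)
    show "x $ j \<ge> 0" if "x \<in> cball y R" "x \<in> Omega_faces i j r1 \<beta>" for x
    proof -
      have "ang x \<le> \<beta>" using that(2) b angle_range[of x] by (auto simp: Omega_faces_def Omega_def Gamma_face_def)
      then show ?thesis using ang[OF that(1)] m by auto
    qed
    have "x0 + axis j (\<rho> / 6) \<in> ball y R"
    proof -
      have "y - (x0 + axis j (\<rho> / 6)) = axis j (- \<rho> / 2)" by (auto simp: y_def axis_def vec_eq_iff)
      then show ?thesis using \<rho> by (simp add: dist_norm R_def norm_eq_sqrt_inner inner_axis_axis real_sqrt_divide)
    qed
    moreover have "x0 + axis j (\<rho> / 6) \<in> Omega i j r1 0 b"
    proof -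
      have x: "x0 + axis j (\<rho> / 6) \<in> cball y R" using calculation by simp
      have "(x0 + axis j (\<rho> / 6)) $ j > 0" using ij \<rho> by (simp add: x0_def axis_def)
      moreover from this have "ang (x0 + axis j (\<rho> / 6)) \<noteq> 0"
        using coord_eq(2)[of "x0 + axis j (\<rho> / 6)"] by auto
      ultimately show ?thesis using ang[OF x] angle_range[of "x0 + axis j (\<rho> / 6)"] m by (auto simp: Omega_def)
    qed
    ultimately show "ball y R \<inter> Omega i j r1 0 b \<noteq> {}" by blast
  qed
qed

end

section \<open>Cutoffs near the axis and at infinity\<close>

context cyl_coords
begin

text \<open>Equal to one where \<open>|x| \<le> k\<close> and \<open>d(x) \<ge> 2/k\<close>, and supported in \<open>|x|
  \<le> 2k\<close>, \<open>d(x) \<ge> 1/k\<close>. Since it depends only on \<open>|x|\<close> and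
  \<open>d(x)\<close>, it is invariant under rotations and reflections.\<close>
definition cut :: "real \<Rightarrow> real ^ 'n \<Rightarrow> real" where
  "cut k x = smooth_step (2 - (norm x)\<^sup>2 / k\<^sup>2) * smooth_step (k\<^sup>2 * (dax x)\<^sup>2 - 1)"

definition cut_grad :: "real \<Rightarrow> real ^ 'n \<Rightarrow> real ^ 'n" where
  "cut_grad k x = (smooth_step (2 - (norm x)\<^sup>2 / k\<^sup>2) * smooth_step' (k\<^sup>2 * (dax x)\<^sup>2 - 1)) *\<^sub>R ((- 2 * k\<^sup>2) *\<^sub>R T\<theta> (T\<theta> x))
     + (smooth_step (k\<^sup>2 * (dax x)\<^sup>2 - 1) * smooth_step' (2 - (norm x)\<^sup>2 / k\<^sup>2)) *\<^sub>R ((- 2 / k\<^sup>2) *\<^sub>R x)"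

lemma dist_axis_square: "(dax x)\<^sup>2 = T\<theta> x \<bullet> T\<theta> x"
  by (simp add: norm_tang[symmetric] power2_norm_eq_inner)

lemma GDERIV_dist_axis_square: "GDERIV (\<lambda>x. (dax x)\<^sup>2) x :> - 2 *\<^sub>R T\<theta> (T\<theta> x)"
proof -
  have bl: "bounded_linear T\<theta>" using linear_maps(3) by (simp add: linear_conv_bounded_linear)
  have hT: "(T\<theta> has_derivative T\<theta>) (at x)" by (rule bounded_linear_imp_has_derivative[OF bl])
  have eq: "T\<theta> x \<bullet> T\<theta> h + T\<theta> h \<bullet> T\<theta> x = h \<bullet> (- 2 *\<^sub>R T\<theta> (T\<theta> x))" for h
    using tang_inner[of h "T\<theta> x"] by (simp add: inner_commute)
  show ?thesis
    unfolding gderiv_def dist_axis_square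
    using has_derivative_inner[OF hT hT] unfolding eq .
qed

lemma GDERIV_cut: "GDERIV (cut k) x :> cut_grad k x"
proof -
  have "GDERIV (\<lambda>x. 2 - (norm (x - 0))\<^sup>2 * (1 / k\<^sup>2)) x :> (- 2 / k\<^sup>2) *\<^sub>R x"
    by (rule GDERIV_subst[OF GDERIV_diff[OF GDERIV_const GDERIV_mult[OF GDERIV_norm_diff_square GDERIV_const]]]) simp
  then have 1: "GDERIV (\<lambda>x. 2 - (norm x)\<^sup>2 / k\<^sup>2) x :> (- 2 / k\<^sup>2) *\<^sub>R x" by simp
  have 2: "GDERIV (\<lambda>x. k\<^sup>2 * (dax x)\<^sup>2 - 1) x :> (- 2 * k\<^sup>2) *\<^sub>R T\<theta> (T\<theta> x)"
    by (rule GDERIV_subst[OF GDERIV_diff[OF GDERIV_mult[OF GDERIV_const GDERIV_dist_axis_square] GDERIV_const]]) simp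
  show ?thesis
    unfolding cut_def[abs_def]
    by (rule GDERIV_subst[OF GDERIV_mult[OF GDERIV_DERIV_compose[OF 1 DERIV_smooth_step] GDERIV_DERIV_compose[OF 2 DERIV_smooth_step]]])
      (simp add: cut_grad_def mult.assoc)
qed

lemma continuous_cut: "continuous_on A (cut k)" "continuous_on A (cut_grad k)"
proof -
  show "continuous_on A (cut k)" using GDERIV_continuous_on[OF GDERIV_cut] .
  have T: "continuous_on A (\<lambda>x. T\<theta> (T\<theta> x))"
    by (rule continuous_on_compose2[OF continuous_coords(5)[of UNIV] continuous_coords(5)]) auto
  show "continuous_on A (cut_grad k)" unfolding cut_grad_def[abs_def]
    by (cases "k = 0") (auto intro!: continuous_intros continuous_smooth_step T continuous_coords)
qed

lemma cut_range: "0 \<le> cut k x" "cut k x \<le> 1"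
  unfolding cut_def using smooth_step_bounds by (auto intro: mult_le_one)

lemma cut_zero_imp: "cut k x = 0 \<Longrightarrow> cut_grad k x = 0"
proof -
  define s1 where "s1 = 2 - (norm x)\<^sup>2 / k\<^sup>2"
  define s2 where "s2 = k\<^sup>2 * (dax x)\<^sup>2 - 1"
  assume "cut k x = 0"
  then have "smooth_step s1 = 0 \<or> smooth_step s2 = 0" by (simp add: cut_def s1_def s2_def)
  then have "(smooth_step s1 = 0 \<and> smooth_step' s1 = 0) \<or> (smooth_step s2 = 0 \<and> smooth_step' s2 = 0)"
    using smooth_step_simps(3) smooth_step_zero_iff by blast
  then show ?thesis unfolding cut_grad_def s1_def[symmetric] s2_def[symmetric] by auto
qed

lemma cut_support:
  assumes "k > 0" "cut k x \<noteq> 0"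
  shows "norm x \<le> 2 * k" "dax x \<ge> 1 / k"
proof -
  have "\<not> 2 - (norm x)\<^sup>2 / k\<^sup>2 \<le> 0" "\<not> k\<^sup>2 * (dax x)\<^sup>2 - 1 \<le> 0"
    using assms smooth_step_simps(1) unfolding cut_def by (metis mult_eq_0_iff)+
  then have a: "(norm x)\<^sup>2 < 2 * k\<^sup>2" and b: "1 < (k * dax x)\<^sup>2"
    using assms by (simp_all add: field_simps power_mult_distrib)
  have "(norm x)\<^sup>2 \<le> (2 * k)\<^sup>2" 
  proof -
    have "(2 * k)\<^sup>2 = 4 * k\<^sup>2" by (simp add: power_mult_distrib)
    then show ?thesis using a zero_le_power2[of k] by linarith
  qed
  then show "norm x \<le> 2 * k" by (rule power2_le_imp_le) (use assms in simp)
  have "1 \<le> k * dax x" using b assms by (smt (verit) dist_axis_nonneg mult_nonneg_nonneg power_le_one)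
  then show "dax x \<ge> 1 / k" using assms by (simp add: field_simps)
qed

text \<open>The gradient of the cut-off is of size \<open>1/d(x)\<close> uniformly in \<open>k\<close>, which is exactly
  what is balanced by \<open>|v| \<le> d(x) |\<nabla>u|\<close>.\<close>
lemma cut_grad_bound:
  assumes k: "k > 0"
  shows "dax x * norm (cut_grad k x) \<le> 32"
proof -
  define s1 where "s1 = 2 - (norm x)\<^sup>2 / k\<^sup>2"
  define s2 where "s2 = k\<^sup>2 * (dax x)\<^sup>2 - 1"
  note B = smooth_step_bounds
  have nT: "norm (T\<theta> (T\<theta> x)) \<le> dax x"
    unfolding norm_tang using ij by (simp add: dist_axis_def tang_def add.commute)
  have 1: "dax x * (smooth_step s1 * smooth_step' s2 * (2 * k\<^sup>2 * dax x)) \<le> 16"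
  proof (cases "s2 < 1")
    case True
    have "smooth_step s1 * smooth_step' s2 \<le> 1 * 4" using B by (intro mult_mono) auto
    then have "(smooth_step s1 * smooth_step' s2) * (2 * (k\<^sup>2 * (dax x)\<^sup>2)) \<le> 4 * (2 * 2)"
      using True by (intro mult_mono) (auto simp: s2_def)
    then show ?thesis by (simp add: power2_eq_square mult_ac)
  qed (simp add: smooth_step_simps)
  have 2: "dax x * (smooth_step s2 * smooth_step' s1 * (2 / k\<^sup>2 * norm x)) \<le> 16"
  proof (cases "s1 > 0")
    case True
    have "smooth_step s2 * smooth_step' s1 \<le> 1 * 4" using B by (intro mult_mono) auto
    moreover have "2 * ((norm x)\<^sup>2 / k\<^sup>2) \<le> 2 * 2" using True by (simp add: s1_def)
    moreover have "dax x * norm x / k\<^sup>2 \<le> (norm x)\<^sup>2 / k\<^sup>2"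
      using dist_axis_le_norm[of x] by (intro divide_right_mono) (auto simp: power2_eq_square mult_right_mono)
    then have "2 * (dax x * norm x / k\<^sup>2) \<le> 2 * ((norm x)\<^sup>2 / k\<^sup>2)" by simp
    ultimately have "(smooth_step s2 * smooth_step' s1) * (2 * (dax x * norm x / k\<^sup>2)) \<le> (1 * 4) * (2 * 2)"
      using B by (intro mult_mono) auto
    then show ?thesis by (simp add: mult_ac)
  qed (simp add: smooth_step_simps)
  have "norm (cut_grad k x) \<le> smooth_step s1 * smooth_step' s2 * (2 * k\<^sup>2 * norm (T\<theta> (T\<theta> x)))
      + smooth_step s2 * smooth_step' s1 * (2 / k\<^sup>2 * norm x)"
    unfolding cut_grad_def s1_def[symmetric] s2_def[symmetric]
    by (rule order_trans[OF norm_triangle_ineq]) (use B in \<open>simp add: abs_mult\<close>)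
  also have "\<dots> \<le> smooth_step s1 * smooth_step' s2 * (2 * k\<^sup>2 * dax x)
      + smooth_step s2 * smooth_step' s1 * (2 / k\<^sup>2 * norm x)"
    using B nT by (intro add_right_mono mult_left_mono) auto
  finally have "dax x * norm (cut_grad k x) \<le> dax x * (smooth_step s1 * smooth_step' s2 * (2 * k\<^sup>2 * dax x)
      + smooth_step s2 * smooth_step' s1 * (2 / k\<^sup>2 * norm x))" by (intro mult_left_mono) auto
  then show ?thesis using 1 2 unfolding distrib_left by linarith
qed

lemma cut_eventually:
  assumes "k > 0" "norm x \<le> k" "k * dax x \<ge> 2"
  shows "cut k x = 1" "cut_grad k x = 0"
proof -
  have "(norm x)\<^sup>2 \<le> k\<^sup>2" using assms by (intro power_mono) auto
  then have 1: "2 - (norm x)\<^sup>2 / k\<^sup>2 \<ge> 1" using assms by simp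
  have "2\<^sup>2 \<le> (k * dax x)\<^sup>2" using assms by (intro power_mono) auto
  then have 2: "k\<^sup>2 * (dax x)\<^sup>2 - 1 \<ge> 1" by (simp add: power_mult_distrib)
  show "cut k x = 1" "cut_grad k x = 0"
    using smooth_step_simps(2,4)[OF 1] smooth_step_simps(2,4)[OF 2] by (auto simp: cut_def cut_grad_def)
qed

lemma cut_eventually_seq:
  assumes "dax x > 0"
  shows "\<forall>\<^sub>F n in sequentially. cut (real (Suc n)) x = 1 \<and> cut_grad (real (Suc n)) x = 0"
proof -
  obtain N :: nat where N: "real N \<ge> norm x" "real N \<ge> 2 / dax x"
    using real_arch_simple[of "max (norm x) (2 / dax x)"] by auto
  show ?thesis
  proof (rule eventually_sequentiallyI[of N])
    fix n assume "N \<le> n"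
    then have n: "real (Suc n) \<ge> norm x" "real (Suc n) \<ge> 2 / dax x" using N by linarith+
    then have "real (Suc n) * dax x \<ge> 2" using assms by (simp add: field_simps)
    then show "cut (real (Suc n)) x = 1 \<and> cut_grad (real (Suc n)) x = 0"
      using cut_eventually[of "real (Suc n)" x] n(1) by auto
  qed
qed

end

section \<open>Test functions and the quadratic form on the sector\<close>

lemma C1_0_lin:
  assumes "\<phi> \<in> C1_0 D" "\<psi> \<in> C1_0 D"
  shows "(\<lambda>x. a * \<phi> x + b * \<psi> x) \<in> C1_0 D"
proof -
  obtain g h where g: "continuous_on D g" "\<And>x. x \<in> D \<Longrightarrow> (\<phi> has_derivative (\<lambda>h. g x \<bullet> h)) (at x within D)"
    and h: "continuous_on D h" "\<And>x. x \<in> D \<Longrightarrow> (\<psi> has_derivative (\<lambda>k. h x \<bullet> k)) (at x within D)"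
    using assms unfolding C1_0_def C1_on_def by blast
  have "((\<lambda>x. a * \<phi> x + b * \<psi> x) has_derivative (\<lambda>k. (a *\<^sub>R g x + b *\<^sub>R h x) \<bullet> k)) (at x within D)" if "x \<in> D" for x
  proof -
    have "((\<lambda>x. a * \<phi> x + b * \<psi> x) has_derivative (\<lambda>k. a * (g x \<bullet> k) + b * (h x \<bullet> k))) (at x within D)"
      using g(2)[OF that] h(2)[OF that] by (intro has_derivative_add has_derivative_mult_right)
    then show ?thesis by (simp add: inner_add_left)
  qed
  moreover have "continuous_on D (\<lambda>x. a *\<^sub>R g x + b *\<^sub>R h x)" by (intro continuous_intros g h)
  ultimately have "C1_on D (\<lambda>x. a * \<phi> x + b * \<psi> x)"
    unfolding C1_on_def by blast
  moreover have sub: "closure {x. a * \<phi> x + b * \<psi> x \<noteq> 0} \<subseteq> closure {x. \<phi> x \<noteq> 0} \<union> closure {x. \<psi> x \<noteq> 0}"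
    unfolding closure_Un[symmetric] by (rule closure_mono) auto
  moreover have "compact (closure {x. a * \<phi> x + b * \<psi> x \<noteq> 0})"
  proof -
    have "compact ((closure {x. \<phi> x \<noteq> 0} \<union> closure {x. \<psi> x \<noteq> 0}) \<inter> closure {x. a * \<phi> x + b * \<psi> x \<noteq> 0})"
      using assms by (intro compact_Int_closed compact_Un closed_closure) (auto simp: C1_0_def)
    then show ?thesis using sub by (simp add: inf_absorb2)
  qed
  ultimately show ?thesis using assms unfolding C1_0_def by blast
qed

locale sector = cyl_coords i j for i j :: "'n::finite" +
  fixes r1 \<beta> :: real
  assumes r1: "r1 \<ge> 0" and \<beta>: "0 < \<beta>" "\<beta> < 2 * pi"
begin

abbreviation "Sec b \<equiv> Omega i j r1 0 b"
abbreviation "Om \<equiv> Omega i j r1 0 \<beta>"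
abbreviation "Fc \<equiv> Omega_faces i j r1 \<beta>"

text \<open>The axis is left out because the angular derivative need not extend continuously to it.\<close>
definition "Cl = {x. dax x \<ge> r1 \<and> dax x > 0 \<and> ang x \<le> \<beta>}"

lemma open_Sec [simp]: "open (Sec b)" by (rule open_Omega) simp
lemma Sec_borel [measurable, simp]: "Sec b \<in> sets borel" by (intro borel_open open_Sec)

lemma Om_subset_Fc: "Om \<subseteq> Fc" by (auto simp: Omega_faces_def)

lemma Fc_eq: "Fc = {x. dax x > r1 \<and> ang x \<le> \<beta>}"
proof (intro set_eqI)
  fix x
  show "x \<in> Fc \<longleftrightarrow> x \<in> {x. dax x > r1 \<and> ang x \<le> \<beta>}"
    using \<beta> angle_range[of x] by (auto simp: Omega_faces_def Omega_def Gamma_face_def)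
qed

lemma Fc_subset_Cl: "Fc \<subseteq> Cl" using r1 by (auto simp: Fc_eq Cl_def)

lemma Om_subset_Cl: "Om \<subseteq> Cl" using Om_subset_Fc Fc_subset_Cl by blast

lemma Sec_subset_Om: "b \<le> \<beta> \<Longrightarrow> Sec b \<subseteq> Om" by (rule Omega_mono) auto

text \<open>The admissible test functions of the Morse index, together with a gradient on the sector and its faces. On
  the faces the gradient is one-sided.\<close>
definition tf :: "(real ^ 'n \<Rightarrow> real) \<Rightarrow> (real ^ 'n \<Rightarrow> real ^ 'n) \<Rightarrow> bool" where
  "tf \<phi> g \<longleftrightarrow> \<phi> \<in> C1_0 Fc \<and> continuous_on Fc g \<and> (\<forall>x\<in>Fc. (\<phi> has_derivative (\<lambda>h. g x \<bullet> h)) (at x within Fc))"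

lemma tf_gderiv:
  assumes "tf \<phi> g" "x \<in> Om"
  shows "GDERIV \<phi> x :> g x"
proof -
  have "(\<phi> has_derivative (\<lambda>h. g x \<bullet> h)) (at x within Om)"
    using assms Om_subset_Fc by (auto simp: tf_def intro: has_derivative_subset)
  then have "(\<phi> has_derivative (\<lambda>h. g x \<bullet> h)) (at x)"
    using at_within_open[OF assms(2)] by simp
  then show ?thesis unfolding gderiv_def by (simp add: inner_commute)
qed

lemma tf_cont: "tf \<phi> g \<Longrightarrow> continuous_on Fc \<phi>" "tf \<phi> g \<Longrightarrow> continuous_on Fc g"
  unfolding tf_def by (auto intro!: has_derivative_continuous_on)

lemma tf_support:
  assumes "tf \<phi> g"
  obtains K where "compact K" "K \<subseteq> Fc" "\<And>x. x \<notin> K \<Longrightarrow> \<phi> x = 0" "\<And>x. x \<in> Om \<Longrightarrow> x \<notin> K \<Longrightarrow> g x = 0"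
proof -
  define K where "K = closure {x. \<phi> x \<noteq> 0}"
  have K: "compact K" "K \<subseteq> Fc" using assms by (auto simp: tf_def C1_0_def K_def)
  have z: "\<phi> x = 0" if "x \<notin> K" for x using that closure_subset[of "{x. \<phi> x \<noteq> 0}"] by (auto simp: K_def)
  have "g x = 0" if "x \<in> Om" "x \<notin> K" for x
    by (rule GDERIV_zero_on_open[OF tf_gderiv[OF assms that(1)], of "- K"])
      (use that z K compact_imp_closed in auto)
  with that[OF K z] show ?thesis by auto
qed

lemma tf_lin:
  assumes "tf \<phi> g" "tf \<psi> h"
  shows "tf (\<lambda>x. a * \<phi> x + b * \<psi> x) (\<lambda>x. a *\<^sub>R g x + b *\<^sub>R h x)"
proof -
  have "((\<lambda>x. a * \<phi> x + b * \<psi> x) has_derivative (\<lambda>k. (a *\<^sub>R g x + b *\<^sub>R h x) \<bullet> k)) (at x within Fc)" if "x \<in> Fc" for x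
  proof -
    have "((\<lambda>x. a * \<phi> x + b * \<psi> x) has_derivative (\<lambda>k. a * (g x \<bullet> k) + b * (h x \<bullet> k))) (at x within Fc)"
      using assms that unfolding tf_def by (intro has_derivative_add has_derivative_mult_right) auto
    then show ?thesis by (simp add: inner_add_left)
  qed
  moreover have "continuous_on Fc (\<lambda>x. a *\<^sub>R g x + b *\<^sub>R h x)"
    using assms unfolding tf_def by (intro continuous_intros) auto
  ultimately show ?thesis using assms C1_0_lin unfolding tf_def by blast
qed

text \<open>The usual source of test functions: functions that are differentiable across the faces, restricted to the
  sector.\<close>
lemma tfI:
  assumes U: "open U" "Fc \<subseteq> U" and f: "\<And>x. x \<in> U \<Longrightarrow> GDERIV f x :> g x" "continuous_on U g"
    and K: "compact K" "K \<subseteq> Fc" "\<And>x. x \<in> Fc - K \<Longrightarrow> f x = 0"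
  shows "tf (\<lambda>x. if x \<in> Fc then f x else 0) g"
    and "closure {x. (if x \<in> Fc then f x else 0) \<noteq> 0} \<subseteq> K"
proof -
  let ?f = "\<lambda>x. if x \<in> Fc then f x else 0"
  have d: "(?f has_derivative (\<lambda>h. g x \<bullet> h)) (at x within Fc)" if "x \<in> Fc" for x
  proof -
    have "(f has_derivative (\<lambda>h. g x \<bullet> h)) (at x)"
      using f(1)[of x] that U(2) unfolding gderiv_def by (auto simp: inner_commute)
    then have "(f has_derivative (\<lambda>h. g x \<bullet> h)) (at x within Fc)" by (rule has_derivative_at_withinI)
    then show ?thesis by (rule has_derivative_transform[rotated 2]) (use that in auto)
  qed
  have c: "continuous_on Fc g" using f(2) U(2) continuous_on_subset by blast
  show s: "closure {x. ?f x \<noteq> 0} \<subseteq> K"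
    by (rule closure_minimal) (use K compact_imp_closed in auto)
  have "compact (closure {x. ?f x \<noteq> 0})"
    using compact_Int_closed[OF K(1) closed_closure, of "{x. ?f x \<noteq> 0}"] s by (simp only: inf_absorb2)
  moreover have "C1_on Fc ?f" unfolding C1_on_def using c d by (intro exI[of _ g]) auto
  ultimately have "?f \<in> C1_0 Fc" using s K(2) unfolding C1_0_def by auto
  then show "tf ?f g" using c d unfolding tf_def by auto
qed

lemma C1c_imp_tf:
  assumes "C1c Fc \<phi> g"
  shows "tf \<phi> g"
proof -
  obtain K where K: "compact K" "K \<subseteq> Fc" "\<And>x. x \<notin> K \<Longrightarrow> \<phi> x = 0" "\<And>x. x \<notin> K \<Longrightarrow> g x = 0"
    using C1cE[OF assms] by metis
  have "tf (\<lambda>x. if x \<in> Fc then \<phi> x else 0) g"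
    by (rule tfI[of UNIV, OF _ _ C1c_gderiv[OF assms] C1c_cont(2)[OF assms] K(1,2)]) (use K in auto)
  moreover have "(\<lambda>x. if x \<in> Fc then \<phi> x else 0) = \<phi>" using K by (auto simp: fun_eq_iff)
  ultimately show ?thesis by simp
qed

lemma tf_measurable:
  assumes "tf \<phi> g"
  shows "(\<lambda>x. indicator Om x * \<phi> x) \<in> borel_measurable borel"
  using borel_measurable_continuous_on_indicator[OF _ continuous_on_subset[OF tf_cont(1)[OF assms] Om_subset_Fc]]
  by simp

definition BF :: "(real ^ 'n \<Rightarrow> real) \<Rightarrow> (real ^ 'n \<Rightarrow> real) \<Rightarrow> (real ^ 'n \<Rightarrow> real ^ 'n) \<Rightarrow> (real ^ 'n \<Rightarrow> real) \<Rightarrow> (real ^ 'n \<Rightarrow> real ^ 'n) \<Rightarrow> real" where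
  "BF V \<phi> g \<psi> h = (LINT x|lborel. indicator Om x * (g x \<bullet> h x - V x * \<phi> x * \<psi> x))"

abbreviation "QF V \<phi> g \<equiv> BF V \<phi> g \<phi> g"

lemma BF_integrable:
  assumes V: "continuous_on Cl V" and "tf \<phi> g" "tf \<psi> h"
  shows "integrable lborel (\<lambda>x. indicator Om x * (g x \<bullet> h x - V x * \<phi> x * \<psi> x))"
proof -
  obtain K where K: "compact K" "K \<subseteq> Fc" "\<And>x. x \<notin> K \<Longrightarrow> \<phi> x = 0" "\<And>x. x \<in> Om \<Longrightarrow> x \<notin> K \<Longrightarrow> g x = 0"
    using tf_support[OF assms(2)] by metis
  have c: "continuous_on K (\<lambda>x. g x \<bullet> h x - V x * \<phi> x * \<psi> x)"
    using tf_cont[OF assms(2)] tf_cont[OF assms(3)] K(2) Fc_subset_Cl V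
    by (intro continuous_intros) (blast intro: continuous_on_subset)+
  have "integrable lborel (\<lambda>x. indicator Om x *\<^sub>R (indicator K x *\<^sub>R (g x \<bullet> h x - V x * \<phi> x * \<psi> x)))"
    by (rule integrable_mult_indicator[OF _ borel_integrable_compact[OF K(1) c]]) simp
  moreover have "(\<lambda>x. indicator Om x *\<^sub>R (indicator K x *\<^sub>R (g x \<bullet> h x - V x * \<phi> x * \<psi> x)))
      = (\<lambda>x. indicator Om x * (g x \<bullet> h x - V x * \<phi> x * \<psi> x))"
    using K(3,4) by (force simp: indicator_def fun_eq_iff)
  ultimately show ?thesis by simp
qed

lemma BF_commute: "BF V \<phi> g \<psi> h = BF V \<psi> h \<phi> g"
  unfolding BF_def by (simp add: inner_commute mult_ac)

lemma BF_lin_left: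
  assumes V: "continuous_on Cl V" and "tf \<phi> g" "tf \<phi>' g'" "tf \<psi> h"
  shows "BF V (\<lambda>x. a * \<phi> x + b * \<phi>' x) (\<lambda>x. a *\<^sub>R g x + b *\<^sub>R g' x) \<psi> h = a * BF V \<phi> g \<psi> h + b * BF V \<phi>' g' \<psi> h"
proof -
  have eq: "indicator Om x * ((a *\<^sub>R g x + b *\<^sub>R g' x) \<bullet> h x - V x * (a * \<phi> x + b * \<phi>' x) * \<psi> x)
    = a * (indicator Om x * (g x \<bullet> h x - V x * \<phi> x * \<psi> x)) + b * (indicator Om x * (g' x \<bullet> h x - V x * \<phi>' x * \<psi> x))" for x
    by (simp add: inner_add_left algebra_simps)
  show ?thesis unfolding BF_def eq
    using BF_integrable[OF V assms(2,4)] BF_integrable[OF V assms(3,4)] by simp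
qed

lemma QF_lin:
  assumes V: "continuous_on Cl V" and f: "tf \<phi> g" and p: "tf \<psi> h"
  shows "QF V (\<lambda>x. a * \<phi> x + b * \<psi> x) (\<lambda>x. a *\<^sub>R g x + b *\<^sub>R h x) = a\<^sup>2 * QF V \<phi> g + 2 * a * b * BF V \<phi> g \<psi> h + b\<^sup>2 * QF V \<psi> h"
proof -
  note l = tf_lin[OF f p, of a b]
  have "QF V (\<lambda>x. a * \<phi> x + b * \<psi> x) (\<lambda>x. a *\<^sub>R g x + b *\<^sub>R h x)
      = a * (a * QF V \<phi> g + b * BF V \<psi> h \<phi> g) + b * (a * BF V \<phi> g \<psi> h + b * QF V \<psi> h)"
    unfolding BF_lin_left[OF V f p l] BF_commute[of V \<phi> g "\<lambda>x. a * \<phi> x + b * \<psi> x"] BF_commute[of V \<psi> h "\<lambda>x. a * \<phi> x + b * \<psi> x"]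
    unfolding BF_lin_left[OF V f p f] BF_lin_left[OF V f p p] by simp
  then show ?thesis by (simp add: BF_commute[of V \<psi> h \<phi> g] power2_eq_square algebra_simps)
qed

text \<open>If the form is nonnegative on the span of \<open>\<phi>\<^sub>k\<close> and \<open>\<psi>\<close> and
  \<open>Q(\<phi>\<^sub>k)\<close> tends to a value at most zero, the quadratic polynomial in \<open>t\<close>
  with \<open>Q(\<phi>\<^sub>k + t \<psi>) \<ge> 0\<close> forces its linear coefficient to vanish in the
  limit.\<close>
lemma BF_limit_zero:
  assumes V: "continuous_on Cl V" and f: "\<And>k. tf (\<phi> k) (g k)" and p: "tf \<psi> h"
    and nn: "\<And>k t. QF V (\<lambda>x. 1 * \<phi> k x + t * \<psi> x) (\<lambda>x. 1 *\<^sub>R g k x + t *\<^sub>R h x) \<ge> 0"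
    and le: "\<And>k. QF V (\<phi> k) (g k) \<le> e k" "e \<longlonglongrightarrow> 0"
    and lim: "(\<lambda>k. BF V (\<phi> k) (g k) \<psi> h) \<longlonglongrightarrow> b"
  shows "b = 0"
proof (rule ccontr)
  assume b: "b \<noteq> 0"
  define q where "q = QF V \<psi> h"
  have ineq: "0 \<le> 2 * t * b + t\<^sup>2 * q" for t
  proof (rule tendsto_lowerbound)
    show "(\<lambda>k. e k + 2 * t * BF V (\<phi> k) (g k) \<psi> h + t\<^sup>2 * q) \<longlonglongrightarrow> 2 * t * b + t\<^sup>2 * q"
      using tendsto_add[OF tendsto_add[OF le(2) tendsto_mult[OF tendsto_const lim, of "2 * t"]] tendsto_const] by simp
    show "\<forall>\<^sub>F k in sequentially. 0 \<le> e k + 2 * t * BF V (\<phi> k) (g k) \<psi> h + t\<^sup>2 * q"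
    proof (rule always_eventually, rule allI)
      fix k
      show "0 \<le> e k + 2 * t * BF V (\<phi> k) (g k) \<psi> h + t\<^sup>2 * q"
        using nn[of k t] le(1)[of k] unfolding QF_lin[OF V f p] q_def by simp
    qed
  qed simp
  define s where "s = 1 / (\<bar>q\<bar> + 1)"
  have s: "s > 0" "s * q < 1"
  proof -
    show "s > 0" by (simp add: s_def)
    have "q < \<bar>q\<bar> + 1" by simp
    then show "s * q < 1" by (simp add: s_def field_simps)
  qed
  have "0 \<le> 2 * (- b * s) * b + (- b * s)\<^sup>2 * q" by (rule ineq)
  also have "\<dots> = b\<^sup>2 * s * (s * q - 2)" by (simp add: power2_eq_square algebra_simps)
  also have "\<dots> < 0" using b s by (intro mult_pos_neg) auto
  finally show False by simp
qed

text \<open>Against a bump, which is of class \<open>C\<^sup>2\<close>, the form can be integrated by parts, so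
  pointwise convergence of \<open>\<phi>\<^sub>k\<close> suffices.\<close>
lemma BF_bump_limit:
  assumes V: "continuous_on Cl V" and f: "\<And>k. tf (\<phi> k) (g k)" and p: "tf \<psi> h"
    and b: "\<And>x. x \<in> Om \<Longrightarrow> \<psi> x = bump y R m x" "\<And>x. x \<in> Om \<Longrightarrow> h x = bump_grad y R m x" and m: "m \<ge> 3" and R: "R > 0"
    and K: "\<And>k. \<exists>K. compact K \<and> K \<subseteq> Om \<and> (\<forall>x\<in>Om - K. \<phi> k x = 0 \<or> bump_grad y R m x = 0)"
    and lim: "\<And>x. x \<in> Om \<Longrightarrow> (\<lambda>k. \<phi> k x) \<longlonglongrightarrow> q x"
    and bd: "\<And>k x. x \<in> Om \<Longrightarrow> x \<in> cball y R \<Longrightarrow> \<bar>\<phi> k x\<bar> \<le> M"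
    and Vb: "\<And>x. x \<in> Om \<Longrightarrow> x \<in> cball y R \<Longrightarrow> \<bar>V x\<bar> \<le> K0"
  shows "(\<lambda>k. BF V (\<phi> k) (g k) \<psi> h) \<longlonglongrightarrow> (LINT x|lborel. indicator Om x * (q x * (- bump_lap y R m x - V x * bump y R m x)))"
    and "integrable lborel (\<lambda>x. indicator Om x * (q x * (- bump_lap y R m x - V x * bump y R m x)))"
    and "integrable lborel (\<lambda>x. indicator Om x * (q x * (- bump_lap y R m x + c * bump y R m x)))"
    and "integrable lborel (\<lambda>x. indicator Om x * (q x * ((c + V x) * bump y R m x)))"
proof -
  have VOm: "continuous_on Om V" using V Om_subset_Cl continuous_on_subset by blast
  have Vm: "(\<lambda>x. indicator Om x * V x) \<in> borel_measurable borel"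
    using borel_measurable_continuous_on_indicator[OF _ VOm] by simp
  have bm[measurable]: "bump y R m \<in> borel_measurable borel" "bump_lap y R m \<in> borel_measurable borel"
    using continuous_on_bump[of UNIV y R m] by (auto intro: borel_measurable_continuous_onI)
  have qm: "(\<lambda>x. indicator Om x * q x) \<in> borel_measurable borel"
  proof (rule borel_measurable_LIMSEQ_real)
    show "(\<lambda>k. indicator Om x * \<phi> k x) \<longlonglongrightarrow> indicator Om x * q x" for x
      using lim[of x] by (cases "x \<in> Om") auto
  qed (use tf_measurable[OF f] in simp)
  obtain A where A: "\<And>x. x \<in> cball y R \<Longrightarrow> \<bar>bump_lap y R m x\<bar> \<le> A"
    using compact_imp_bounded[OF compact_continuous_image[OF continuous_on_bump(3)[of "cball y R" y R m] compact_cball]]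
    unfolding bounded_iff by fastforce
  obtain B where B: "\<And>x. x \<in> cball y R \<Longrightarrow> \<bar>bump y R m x\<bar> \<le> B"
    using compact_imp_bounded[OF compact_continuous_image[OF continuous_on_bump(1)[of "cball y R" y R m] compact_cball]]
    unfolding bounded_iff by fastforce
  have off: "bump y R m x = 0" "bump_lap y R m x = 0" if "x \<notin> cball y R" for x
    using bump_outside[OF that R, of m] m by auto
  have qb: "\<bar>q x\<bar> \<le> M" if "x \<in> Om" "x \<in> cball y R" for x
    by (rule LIMSEQ_le_const2[OF tendsto_rabs[OF lim[OF that(1)]]]) (use bd that in auto)
  have dom: "\<bar>indicator Om x * (s * (- bump_lap y R m x + (c * W + d * V x) * bump y R m x))\<bar>
      \<le> M * (A + (\<bar>c\<bar> * \<bar>W\<bar> + \<bar>d\<bar> * K0) * B) * indicator (Om \<inter> cball y R) x" if s: "x \<in> Om \<Longrightarrow> x \<in> cball y R \<Longrightarrow> \<bar>s\<bar> \<le> M" for x s c d W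
  proof (cases "x \<in> Om \<and> x \<in> cball y R")
    case True
    have "\<bar>(c * W + d * V x) * bump y R m x\<bar> \<le> (\<bar>c\<bar> * \<bar>W\<bar> + \<bar>d\<bar> * K0) * B"
      unfolding abs_mult
    proof (rule mult_mono)
      show "\<bar>c * W + d * V x\<bar> \<le> \<bar>c\<bar> * \<bar>W\<bar> + \<bar>d\<bar> * K0"
        using Vb[of x] True mult_left_mono[of "\<bar>V x\<bar>" K0 "\<bar>d\<bar>"] abs_triangle_ineq[of "c * W" "d * V x"] by (auto simp: abs_mult)
      have "0 \<le> K0" using Vb[of x] True by linarith
      then show "0 \<le> \<bar>c\<bar> * \<bar>W\<bar> + \<bar>d\<bar> * K0" by simp
    qed (use B True in auto)
    then have "\<bar>- bump_lap y R m x + (c * W + d * V x) * bump y R m x\<bar> \<le> A + (\<bar>c\<bar> * \<bar>W\<bar> + \<bar>d\<bar> * K0) * B"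
      using A[of x] True by linarith
    then have "\<bar>s\<bar> * \<bar>- bump_lap y R m x + (c * W + d * V x) * bump y R m x\<bar> \<le> M * (A + (\<bar>c\<bar> * \<bar>W\<bar> + \<bar>d\<bar> * K0) * B)"
      using s True by (intro mult_mono) auto
    then show ?thesis using True by (simp add: abs_mult)
  next
    case False then show ?thesis using off[of x] by (cases "x \<in> cball y R") auto
  qed
  have wint: "integrable lborel (\<lambda>x. C * indicator (Om \<inter> cball y R) x)" for C :: real
  proof -
    have "emeasure lborel (Om \<inter> cball y R) \<le> emeasure lborel (cball y R)" by (intro emeasure_mono) auto
    also have "\<dots> < \<infinity>" by (rule emeasure_lborel_cball_finite)
    finally show ?thesis by (intro integrable_mult_right integrable_real_indicator) auto
  qed
  have m1: "(\<lambda>x. indicator Om x * (s x * (- bump_lap y R m x + (c * W + d * V x) * bump y R m x))) \<in> borel_measurable borel"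
    if s: "(\<lambda>x. indicator Om x * s x) \<in> borel_measurable borel" for s c d W
  proof -
    have "(\<lambda>x. indicator Om x * (s x * (- bump_lap y R m x + (c * W + d * V x) * bump y R m x)))
      = (\<lambda>x. (indicator Om x * s x) * (- bump_lap y R m x + (c * W + d * (indicator Om x * V x)) * bump y R m x))"
      by (auto simp: indicator_def)
    also have "\<dots> \<in> borel_measurable borel"
      by (intro borel_measurable_times borel_measurable_add borel_measurable_uminus borel_measurable_const s Vm bm)
    finally show ?thesis .
  qed
  have int: "integrable lborel (\<lambda>x. indicator Om x * (q x * (- bump_lap y R m x + (c * W + d * V x) * bump y R m x)))" for c d W
  proof (rule Bochner_Integration.integrable_bound[OF wint[of "M * (A + (\<bar>c\<bar> * \<bar>W\<bar> + \<bar>d\<bar> * K0) * B)"]])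
    show "(\<lambda>x. indicator Om x * (q x * (- bump_lap y R m x + (c * W + d * V x) * bump y R m x))) \<in> borel_measurable lborel"
      using m1[OF qm, where c = c and W = W and d = d] by simp
    show "AE x in lborel. norm (indicator Om x * (q x * (- bump_lap y R m x + (c * W + d * V x) * bump y R m x)))
        \<le> norm (M * (A + (\<bar>c\<bar> * \<bar>W\<bar> + \<bar>d\<bar> * K0) * B) * indicator (Om \<inter> cball y R) x)"
      unfolding real_norm_def
      by (intro AE_I2 order_trans[OF dom[OF qb, where c = c and W = W and d = d] abs_ge_self])
  qed
  show i1: "integrable lborel (\<lambda>x. indicator Om x * (q x * (- bump_lap y R m x - V x * bump y R m x)))"
    using int[of 0 0 "-1"] by simp
  show i2: "integrable lborel (\<lambda>x. indicator Om x * (q x * (- bump_lap y R m x + c * bump y R m x)))"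
    using int[of c 1 0] by simp
  show "integrable lborel (\<lambda>x. indicator Om x * (q x * ((c + V x) * bump y R m x)))"
    using Bochner_Integration.integrable_diff[OF i2 i1] by (simp add: algebra_simps)
  have eq: "BF V (\<phi> k) (g k) \<psi> h = (LINT x|lborel. indicator Om x * (\<phi> k x * (- bump_lap y R m x - V x * bump y R m x)))" for k
  proof -
    obtain K where K: "compact K" "K \<subseteq> Om" "\<And>x. x \<in> Om - K \<Longrightarrow> \<phi> k x = 0 \<or> bump_grad y R m x = 0"
      using K[of k] by blast
    have gc: "continuous_on Om (g k)" using tf_cont(2)[OF f] Om_subset_Fc continuous_on_subset by blast
    note ig = integral_grad_bump[OF open_Sec tf_gderiv[OF f] gc K m]
    have pt: "indicator Om x * (\<phi> k x * (- bump_lap y R m x - V x * bump y R m x))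
      = indicator Om x * (g k x \<bullet> h x - V x * \<phi> k x * \<psi> x)
        - indicator Om x * (g k x \<bullet> bump_grad y R m x + \<phi> k x * bump_lap y R m x)" for x
      using b[of x] by (cases "x \<in> Om") (auto simp: algebra_simps)
    show ?thesis unfolding pt BF_def using BF_integrable[OF V f p] ig by simp
  qed
  show "(\<lambda>k. BF V (\<phi> k) (g k) \<psi> h) \<longlonglongrightarrow> (LINT x|lborel. indicator Om x * (q x * (- bump_lap y R m x - V x * bump y R m x)))"
    unfolding eq
  proof (rule integral_dominated_convergence[OF _ _ wint[of "M * (A + K0 * B)"]])
    show "AE x in lborel. (\<lambda>k. indicator Om x * (\<phi> k x * (- bump_lap y R m x - V x * bump y R m x)))
        \<longlonglongrightarrow> indicator Om x * (q x * (- bump_lap y R m x - V x * bump y R m x))"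
    proof (rule AE_I2)
      fix x
      show "(\<lambda>k. indicator Om x * (\<phi> k x * (- bump_lap y R m x - V x * bump y R m x)))
        \<longlonglongrightarrow> indicator Om x * (q x * (- bump_lap y R m x - V x * bump y R m x))"
        using lim[of x] by (cases "x \<in> Om") (auto intro!: tendsto_intros)
    qed
    show "AE x in lborel. norm (indicator Om x * (\<phi> k x * (- bump_lap y R m x - V x * bump y R m x)))
        \<le> M * (A + K0 * B) * indicator (Om \<inter> cball y R) x" for k
      using dom[OF bd, where c = 0 and W = 0 and d = "-1"] by (auto intro!: AE_I2)
    show "(\<lambda>x. indicator Om x * (\<phi> k x * (- bump_lap y R m x - V x * bump y R m x))) \<in> borel_measurable lborel" for k
      using m1[OF tf_measurable[OF f], where c = 0 and W = 0 and d = "-1"] by simp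
    show "(\<lambda>x. indicator Om x * (q x * (- bump_lap y R m x - V x * bump y R m x))) \<in> borel_measurable lborel"
      using m1[OF qm, where c = 0 and W = 0 and d = "-1"] by simp
  qed
qed

text \<open>A nonnegative \<open>q\<close> that is annihilated by the form satisfies the hypothesis of the propagation lemmas.\<close>
lemma null_imp_supersolution:
  assumes q: "\<And>x. q x \<ge> 0"
    and z: "(LINT x|lborel. indicator Om x * (q x * (- bump_lap y R m x - V x * bump y R m x))) = 0"
    and i: "integrable lborel (\<lambda>x. indicator Om x * (q x * (- bump_lap y R m x - V x * bump y R m x)))"
      "integrable lborel (\<lambda>x. indicator Om x * (q x * ((K0 + V x) * bump y R m x)))"
    and R: "R > 0" "m \<ge> 1"
    and Vb: "\<And>x. x \<in> Om \<Longrightarrow> x \<in> cball y R \<Longrightarrow> \<bar>V x\<bar> \<le> K0"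
  shows "0 \<le> (LINT x|lborel. indicator Om x * (q x * (- bump_lap y R m x + K0 * bump y R m x)))"
proof -
  have "0 \<le> (LINT x|lborel. indicator Om x * (q x * ((K0 + V x) * bump y R m x)))"
  proof (rule Bochner_Integration.integral_nonneg)
    fix x
    show "0 \<le> indicator Om x * (q x * ((K0 + V x) * bump y R m x))"
    proof (cases "x \<in> Om \<and> x \<in> cball y R")
      case True
      then have "K0 + V x \<ge> 0" using Vb[of x] by linarith
      then show ?thesis using q bump_nonneg by (intro mult_nonneg_nonneg) auto
    qed (use bump_outside(1)[of x y R m] R in auto)
  qed
  also have "\<dots> = (LINT x|lborel. indicator Om x * (q x * (- bump_lap y R m x - V x * bump y R m x))
       + indicator Om x * (q x * ((K0 + V x) * bump y R m x)))"
    using i z by simp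
  also have "\<dots> = (LINT x|lborel. indicator Om x * (q x * (- bump_lap y R m x + K0 * bump y R m x)))"
    by (intro Bochner_Integration.integral_cong) (auto simp: algebra_simps)
  finally show ?thesis .
qed

end

context sector
begin

text \<open>The limit of a null sequence of the form satisfies the linearised equation in the sense of distributions,
  tested with bumps, and therefore the propagation of zeros applies to it.\<close>
lemma null_sequence_unique_continuation:
  assumes V: "continuous_on Cl V" and b: "0 < b" "b \<le> \<beta>" and f: "\<And>k. tf (\<phi> k) (g k)"
    and q: "\<And>x. q x \<ge> 0" "continuous_on (Sec b) q" "\<And>x. x \<notin> Sec b \<Longrightarrow> q x = 0"
    and lim: "\<And>x. x \<in> Om \<Longrightarrow> (\<lambda>k. \<phi> k x) \<longlonglongrightarrow> q x"
    and bd: "\<And>y R. cball y R \<subseteq> Sec b \<Longrightarrow> \<exists>M. \<forall>k. \<forall>x\<in>cball y R. \<bar>\<phi> k x\<bar> \<le> M"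
    and null: "\<And>y R m L. \<lbrakk>R > 0; m \<ge> 3; cball y R \<subseteq> Sec b; (\<lambda>k. BF V (\<phi> k) (g k) (bump y R m) (bump_grad y R m)) \<longlonglongrightarrow> L\<rbrakk> \<Longrightarrow> L = 0"
    and U: "open U" "U \<noteq> {}" "U \<subseteq> Sec b" "\<And>x. x \<in> U \<Longrightarrow> q x = 0" and x: "x \<in> Sec b"
  shows "q x = 0"
proof (rule nonneg_unique_continuation[OF open_Sec _ q(1,2) _ U x])
  note SO = Sec_subset_Om[OF b(2)]
  have ind: "indicator Om x * (q x * c) = q x * c" for x c
    using SO q(3)[of x] by (auto simp: indicator_def)
  show "connected (Sec b)" using connected_Omega[of r1 0 b] r1 b \<beta> by simp
  fix x assume "x \<in> Sec b"
  then obtain \<rho> where \<rho>: "\<rho> > 0" "cball x \<rho> \<subseteq> Sec b" using open_Sec open_contains_cball by blast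
  have "cball x \<rho> \<subseteq> Cl" using \<rho>(2) SO Om_subset_Cl by blast
  then obtain K1 where K1: "\<forall>w\<in>V ` cball x \<rho>. norm w \<le> K1"
    using compact_imp_bounded[OF compact_continuous_image[OF continuous_on_subset[OF V] compact_cball]]
    unfolding bounded_iff by blast
  define K0 where "K0 = max 0 K1"
  have K0: "K0 \<ge> 0" "\<And>z. z \<in> cball x \<rho> \<Longrightarrow> \<bar>V z\<bar> \<le> K0" using K1 by (auto simp: K0_def le_max_iff_disj)
  show "\<exists>\<rho>>0. \<exists>K\<ge>0. cball x \<rho> \<subseteq> Sec b \<and>
      (\<forall>y R m. 0 < R \<longrightarrow> cball y R \<subseteq> cball x \<rho> \<longrightarrow> 3 \<le> m \<longrightarrow>
         integrable lborel (\<lambda>x. q x * (- bump_lap y R m x + K * bump y R m x)) \<and>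
         0 \<le> (LINT x|lborel. q x * (- bump_lap y R m x + K * bump y R m x)))"
  proof (rule exI[of _ \<rho>], rule conjI[OF \<rho>(1)], rule exI[of _ K0], rule conjI[OF K0(1)], rule conjI[OF \<rho>(2)], intro allI impI)
    fix y R m assume R: "0 < (R::real)" "cball y R \<subseteq> cball x \<rho>" and m: "3 \<le> (m::nat)"
    have RS: "cball y R \<subseteq> Sec b" using R \<rho> by blast
    have "C1c Fc (bump y R m) (bump_grad y R m)"
      by (rule C1c_bump) (use m R RS SO Om_subset_Fc in auto)
    note t = C1c_imp_tf[OF this]
    obtain M where M: "\<And>k z. z \<in> cball y R \<Longrightarrow> \<bar>\<phi> k z\<bar> \<le> M" using bd[OF RS] by blast
    have supp: "\<exists>K. compact K \<and> K \<subseteq> Om \<and> (\<forall>z\<in>Om - K. \<phi> k z = 0 \<or> bump_grad y R m z = 0)" for k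
    proof (intro exI[of _ "cball y R"] conjI ballI disjI2)
      show "bump_grad y R m z = 0" if "z \<in> Om - cball y R" for z
        by (rule bump_outside(2)[OF _ R(1)]) (use that m in auto)
    qed (use RS SO in auto)
    have Vb: "\<bar>V z\<bar> \<le> K0" if "z \<in> Om" "z \<in> cball y R" for z using K0(2) R(2) that by blast
    note L = BF_bump_limit[OF V f t refl refl m R(1) supp lim M Vb]
    have "(LINT x|lborel. indicator Om x * (q x * (- bump_lap y R m x - V x * bump y R m x))) = 0"
      by (rule null[OF R(1) m RS L(1)])
    from null_imp_supersolution[OF q(1) this L(2) L(4)[of K0] R(1) _ Vb] m L(3)[of K0]
    show "integrable lborel (\<lambda>x. q x * (- bump_lap y R m x + K0 * bump y R m x)) \<and>
         0 \<le> (LINT x|lborel. q x * (- bump_lap y R m x + K0 * bump y R m x))"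
      unfolding ind by simp
  qed
qed

end

section \<open>Solutions of the linearised equation vanishing on the boundary\<close>

text \<open>The function \<open>p\<close> stands for \<open>\<plusminus>u\<^sub>\<theta>\<close> and \<open>DU\<close>
  for the gradient of \<open>u\<close>; the latter provides the \<open>L\<^sup>2\<close> bound.\<close>
locale sector_solution = sector i j r1 \<beta> for i j :: "'n::finite" and r1 \<beta> :: real +
  fixes V p :: "real ^ 'n \<Rightarrow> real" and Dp DU :: "real ^ 'n \<Rightarrow> real ^ 'n"
  assumes V: "continuous_on Cl V"
    and p: "\<And>x. x \<in> Om \<Longrightarrow> GDERIV p x :> Dp x" "continuous_on Om Dp" "continuous_on Cl p"
    and p_boundary: "\<And>x. x \<in> Cl \<Longrightarrow> x \<notin> Om \<Longrightarrow> p x = 0"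
    and eq: "\<And>\<psi> G. C1c Om \<psi> G \<Longrightarrow> (LINT x|lborel. Dp x \<bullet> G x) = (LINT x|lborel. V x * p x * \<psi> x)"
    and DU: "integrable lborel (\<lambda>x. indicator Om x * (norm (DU x))\<^sup>2)"
    and p_DU: "\<And>x. x \<in> Om \<Longrightarrow> \<bar>p x\<bar> \<le> dax x * norm (DU x)"
begin

text \<open>Almost minimising truncations of \<open>p\<^sup>+\<close>. The gradients are required to vanish
  wherever \<open>p \<le> 0\<close> so that truncations of \<open>p\<close> and of \<open>-p\<close> are orthogonal for the form.\<close>
definition trunc_seq :: "real \<Rightarrow> (nat \<Rightarrow> real ^ 'n \<Rightarrow> real) \<Rightarrow> (nat \<Rightarrow> real ^ 'n \<Rightarrow> real ^ 'n) \<Rightarrow> (nat \<Rightarrow> real) \<Rightarrow> bool" where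
  "trunc_seq b \<phi> g e \<longleftrightarrow> (\<forall>k. C1c (Sec b) (\<phi> k) (g k)) \<and>
     (\<forall>k x. 0 \<le> \<phi> k x \<and> \<phi> k x \<le> max 0 (p x)) \<and> (\<forall>k x. x \<notin> Sec b \<longrightarrow> \<phi> k x = 0) \<and>
     (\<forall>k x. p x \<le> 0 \<longrightarrow> g k x = 0) \<and> (\<forall>x\<in>Sec b. (\<lambda>k. \<phi> k x) \<longlonglongrightarrow> max 0 (p x)) \<and>
     (\<forall>k. QF V (\<phi> k) (g k) \<le> e k) \<and> e \<longlonglongrightarrow> 0"

lemma cp: "continuous_on Om p" using p(3) Om_subset_Cl continuous_on_subset by blast
lemma VOm: "continuous_on Om V" using V Om_subset_Cl continuous_on_subset by blast

text \<open>The truncation at height \<open>\<epsilon>\<close> and the cut-off keep the support compact in the open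
  sector, because \<open>p\<close> is at most zero on its boundary. By the energy estimate the two errors are
  a multiple of \<open>\<epsilon>\<close> and the integral of \<open>p\<^sup>2 |\<nabla>cut|\<^sup>2\<close>.\<close>
lemma truncation_sequence:
  assumes b: "0 < b" "b \<le> \<beta>" and pb: "\<And>x. x \<in> Om \<Longrightarrow> ang x = b \<Longrightarrow> p x \<le> 0"
  shows "\<exists>\<phi> g e. trunc_seq b \<phi> g e"
proof -
  note SO = Sec_subset_Om[OF b(2)]
  define kk where "kk n = real (Suc n)" for n
  have kk: "kk n > 0" for n by (simp add: kk_def)
  define C where "C n = closure (Sec b) \<inter> {x. dax x \<ge> 1 / kk n} \<inter> cball 0 (2 * kk n)" for n
  have cC: "compact (C n)" for n
  proof -
    have "closed {x. dax x \<ge> 1 / kk n}" by (intro closed_Collect_le continuous_coords continuous_intros)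
    then show ?thesis unfolding C_def by (intro closed_Int_compact closed_Int closed_closure compact_cball)
  qed
  have CCl: "C n \<subseteq> Cl" for n
  proof
    fix x assume x: "x \<in> C n"
    have "dax x > 0" using x kk[of n] less_le_trans[of 0 "1 / kk n" "dax x"] by (simp add: C_def)
    then show "x \<in> Cl" using closure_Omega_subset[of x r1 b] x b by (auto simp: C_def Cl_def)
  qed
  have C_cut: "x \<in> C n" if "x \<in> Sec b" "cut (kk n) x \<noteq> 0" for x n
    using cut_support[OF kk that(2)] that(1) closure_subset[of "Sec b"] by (auto simp: C_def)
  define hc where "hc n x = \<bar>V x\<bar> * max 0 (p x) * (cut (kk n) x)\<^sup>2" for n x
  have hc_int: "integrable lborel (\<lambda>x. indicator (Sec b) x * hc n x)" for n
  proof -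
    have c: "continuous_on (C n) (hc n)"
      unfolding hc_def by (intro continuous_intros continuous_cut continuous_on_subset[OF V CCl] continuous_on_subset[OF p(3) CCl])
    have "integrable lborel (\<lambda>x. indicator (Sec b) x *\<^sub>R (indicator (C n) x *\<^sub>R hc n x))"
      by (rule integrable_mult_indicator[OF _ borel_integrable_compact[OF cC c]]) simp
    moreover have "(\<lambda>x. indicator (Sec b) x *\<^sub>R (indicator (C n) x *\<^sub>R hc n x)) = (\<lambda>x. indicator (Sec b) x * hc n x)"
      using C_cut by (auto simp: fun_eq_iff indicator_def hc_def)
    ultimately show ?thesis by simp
  qed
  define c where "c n = (LINT x|lborel. indicator (Sec b) x * hc n x)" for n
  have c0: "c n \<ge> 0" for n unfolding c_def by (intro Bochner_Integration.integral_nonneg) (auto simp: hc_def)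
  \<comment> \<open>the height is chosen after the cut-off: \<open>c n\<close> may be large, and \<open>\<epsilon> n * c n\<close> must tend to zero\<close>
  define \<epsilon> where "\<epsilon> n = 1 / (kk n * (1 + 2 * c n))" for n
  have \<epsilon>: "\<epsilon> n > 0" "\<epsilon> n \<le> 1 / kk n" "2 * \<epsilon> n * c n \<le> 1 / kk n" for n
  proof -
    have den: "kk n * (1 + 2 * c n) > 0" using kk[of n] c0[of n] by (intro mult_pos_pos) auto
    then show "\<epsilon> n > 0" by (simp add: \<epsilon>_def)
    have "kk n * 1 \<le> kk n * (1 + 2 * c n)" using kk[of n] c0[of n] by (intro mult_left_mono) auto
    then show "\<epsilon> n \<le> 1 / kk n" unfolding \<epsilon>_def using kk[of n] by (intro divide_left_mono) auto
    have "2 * \<epsilon> n * c n = (1 / kk n) * (2 * c n / (1 + 2 * c n))" by (simp add: \<epsilon>_def)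
    also have "\<dots> \<le> (1 / kk n) * 1"
      using kk[of n] c0[of n] by (intro mult_left_mono) (auto simp: divide_le_eq)
    finally show "2 * \<epsilon> n * c n \<le> 1 / kk n" by simp
  qed
  define d where "d n = (LINT x|lborel. indicator Om x * ((p x)\<^sup>2 * (norm (cut_grad (kk n) x))\<^sup>2))" for n
  have dbd: "indicator Om x * ((p x)\<^sup>2 * (norm (cut_grad (kk n) x))\<^sup>2) \<le> 1024 * (indicator Om x * (norm (DU x))\<^sup>2)" for x n
  proof (cases "x \<in> Om")
    case True
    have "\<bar>p x\<bar> * norm (cut_grad (kk n) x) \<le> (dax x * norm (DU x)) * norm (cut_grad (kk n) x)"
      using p_DU[OF True] by (intro mult_right_mono) auto
    also have "\<dots> \<le> 32 * norm (DU x)"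
      using mult_right_mono[OF cut_grad_bound[OF kk[of n], of x], of "norm (DU x)"] by (simp add: mult_ac)
    finally have "(\<bar>p x\<bar> * norm (cut_grad (kk n) x))\<^sup>2 \<le> (32 * norm (DU x))\<^sup>2" by (intro power_mono) auto
    then show ?thesis using True by (simp add: power_mult_distrib)
  qed simp
  have dmeas: "(\<lambda>x. indicator Om x * ((p x)\<^sup>2 * (norm (cut_grad (kk n) x))\<^sup>2)) \<in> borel_measurable lborel" for n
  proof -
    have "continuous_on Om (\<lambda>x. (p x)\<^sup>2 * (norm (cut_grad (kk n) x))\<^sup>2)"
      by (intro continuous_intros cp continuous_cut)
    from borel_measurable_continuous_on_indicator[OF _ this] show ?thesis by simp
  qed
  have dint: "integrable lborel (\<lambda>x. indicator Om x * ((p x)\<^sup>2 * (norm (cut_grad (kk n) x))\<^sup>2))" for n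
    by (rule Bochner_Integration.integrable_bound[OF integrable_mult_right[OF DU, of 1024] dmeas]) (use dbd[of _ n] in auto)
  have "d \<longlonglongrightarrow> (LINT x::real^'n|lborel. 0)"
    unfolding d_def
  proof (rule integral_dominated_convergence[OF _ dmeas integrable_mult_right[OF DU, of 1024]])
    show "AE x in lborel. (\<lambda>n. indicator Om x * ((p x)\<^sup>2 * (norm (cut_grad (kk n) x))\<^sup>2)) \<longlonglongrightarrow> 0"
    proof (rule AE_I2)
      fix x
      show "(\<lambda>n. indicator Om x * ((p x)\<^sup>2 * (norm (cut_grad (kk n) x))\<^sup>2)) \<longlonglongrightarrow> 0"
      proof (cases "x \<in> Om")
        case True
        then have "dax x > 0" using r1 by (auto simp: Omega_def)
        from cut_eventually_seq[OF this]
        have "\<forall>\<^sub>F n in sequentially. indicator Om x * ((p x)\<^sup>2 * (norm (cut_grad (kk n) x))\<^sup>2) = 0"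
          by (rule eventually_mono) (simp add: kk_def)
        then show ?thesis by (rule tendsto_eventually)
      qed simp
    qed
    show "AE x in lborel. norm (indicator Om x * ((p x)\<^sup>2 * (norm (cut_grad (kk n) x))\<^sup>2)) \<le> 1024 * (indicator Om x * (norm (DU x))\<^sup>2)" for n
      using dbd[of _ n] by (intro AE_I2) auto
  qed simp
  then have d_lim: "d \<longlonglongrightarrow> 0" by simp
  define \<Phi> where "\<Phi> n x = gtr (\<epsilon> n) (p x) * cut (kk n) x" for n x
  define D\<Phi> where "D\<Phi> n x = (gtr' (\<epsilon> n) (p x) * cut (kk n) x) *\<^sub>R Dp x + gtr (\<epsilon> n) (p x) *\<^sub>R cut_grad (kk n) x" for n x
  define \<phi> where "\<phi> n = (\<lambda>x. if x \<in> Sec b then \<Phi> n x else 0)" for n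
  define g where "g n = (\<lambda>x. if x \<in> Sec b then D\<Phi> n x else 0)" for n
  define K where "K n = C n \<inter> p -` {\<epsilon> n..}" for n
  have cK: "compact (K n)" for n
  proof -
    have "closed (K n)" unfolding K_def
      by (rule continuous_closed_preimage[OF continuous_on_subset[OF p(3) CCl]]) (auto intro: compact_imp_closed cC)
    then have "compact (C n \<inter> K n)" by (intro compact_Int_closed cC)
    moreover have "C n \<inter> K n = K n" by (auto simp: K_def)
    ultimately show ?thesis by simp
  qed
  have KS: "K n \<subseteq> Sec b" for n
  proof
    fix x assume x: "x \<in> K n"
    then have px: "p x > 0" using \<epsilon>(1)[of n] by (auto simp: K_def)
    have "x \<in> Cl" using x CCl by (auto simp: K_def)
    then have "x \<in> Om" using p_boundary px by force
    moreover have "ang x \<le> b" using closure_Omega_subset(2)[of x r1 b] x b by (auto simp: K_def C_def)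
    moreover have "ang x \<noteq> b" using pb[OF \<open>x \<in> Om\<close>] px by auto
    ultimately show "x \<in> Sec b" by (auto simp: Omega_def)
  qed
  have off: "p x \<le> \<epsilon> n \<or> cut (kk n) x = 0" if "x \<in> Sec b - K n" for x n
    using C_cut[of x n] that by (auto simp: K_def)
  have pS: "\<And>x. x \<in> Sec b \<Longrightarrow> GDERIV p x :> Dp x" using p(1) SO by blast
  have DpS: "continuous_on (Sec b) Dp" using p(2) SO continuous_on_subset by blast
  have cpS: "continuous_on (Sec b) p" using cp SO continuous_on_subset by blast
  have VS: "continuous_on (Sec b) V" using VOm SO continuous_on_subset by blast
  have C1: "C1c (Sec b) (\<phi> n) (g n)" for n
    unfolding \<phi>_def g_def
  proof (rule C1c_extend[OF open_Sec _ _ cK KS])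
    show "GDERIV (\<Phi> n) x :> D\<Phi> n x" if "x \<in> Sec b" for x
      unfolding \<Phi>_def[abs_def]
      by (rule GDERIV_subst[OF GDERIV_mult[OF GDERIV_DERIV_compose[OF pS[OF that] DERIV_gtr[OF \<epsilon>(1)]] GDERIV_cut]])
        (simp add: D\<Phi>_def mult_ac add_ac)
    show "continuous_on (Sec b) (D\<Phi> n)" unfolding D\<Phi>_def[abs_def]
      by (intro continuous_intros continuous_gtr[OF \<epsilon>(1) cpS] continuous_cut DpS)
    show "\<Phi> n x = 0" if "x \<in> Sec b - K n" for x
      using off[OF that] by (auto simp: \<Phi>_def gtr_zero)
  qed
  have Q: "QF V (\<phi> n) (g n) \<le> 1 / kk n + d n" for n
  proof -
    have sub: "(LINT x|lborel. Dp x \<bullet> G x) \<le> (LINT x|lborel. V x * p x * \<psi> x)" if "C1c (Sec b) \<psi> G" for \<psi> G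
      using eq[OF C1c_mono[OF that SO]] by simp
    have "QF V (\<phi> n) (g n) = (LINT x|lborel. indicator (Sec b) x * (1 * ((norm ((gtr' (\<epsilon> n) (p x) * cut (kk n) x) *\<^sub>R Dp x
          + gtr (\<epsilon> n) (p x) *\<^sub>R cut_grad (kk n) x))\<^sup>2 - V x * (gtr (\<epsilon> n) (p x) * cut (kk n) x)\<^sup>2)))"
      unfolding BF_def
    proof (rule Bochner_Integration.integral_cong[OF refl])
      fix x
      show "indicator Om x * (g n x \<bullet> g n x - V x * \<phi> n x * \<phi> n x) = indicator (Sec b) x * (1 * ((norm ((gtr' (\<epsilon> n) (p x) * cut (kk n) x) *\<^sub>R Dp x
          + gtr (\<epsilon> n) (p x) *\<^sub>R cut_grad (kk n) x))\<^sup>2 - V x * (gtr (\<epsilon> n) (p x) * cut (kk n) x)\<^sup>2))"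
      proof (cases "x \<in> Sec b")
        case True
        then have "x \<in> Om" using SO by blast
        then show ?thesis using True unfolding g_def \<phi>_def D\<Phi>_def[symmetric] \<Phi>_def[symmetric] power2_norm_eq_inner
          by (simp add: power2_eq_square)
      qed (simp add: g_def \<phi>_def)
    qed
    also have "\<dots> \<le> (LINT x|lborel. indicator (Sec b) x * (1 * (2 * \<epsilon> n * \<bar>V x\<bar> * gtr (\<epsilon> n) (p x) * (cut (kk n) x)\<^sup>2
          + (gtr (\<epsilon> n) (p x))\<^sup>2 * (norm (cut_grad (kk n) x))\<^sup>2) + Gtr (\<epsilon> n) (p x) * (cut (kk n) x)\<^sup>2 * \<bar>Dp x \<bullet> 0\<bar>))"
      by (rule truncated_energy(1)[OF open_Sec pS DpS VS GDERIV_cut continuous_cut(2) cut_zero_imp GDERIV_const continuous_on_const _ _ \<epsilon>(1) _ cK KS])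
        (use off sub in auto)
    also have "\<dots> \<le> (LINT x|lborel. 2 * \<epsilon> n * (indicator (Sec b) x * hc n x) + indicator Om x * ((p x)\<^sup>2 * (norm (cut_grad (kk n) x))\<^sup>2))"
    proof (rule integral_mono')
      show "integrable lborel (\<lambda>x. 2 * \<epsilon> n * (indicator (Sec b) x * hc n x) + indicator Om x * ((p x)\<^sup>2 * (norm (cut_grad (kk n) x))\<^sup>2))"
        using hc_int dint by auto
      fix x
      show "0 \<le> 2 * \<epsilon> n * (indicator (Sec b) x * hc n x) + indicator Om x * ((p x)\<^sup>2 * (norm (cut_grad (kk n) x))\<^sup>2)"
        using \<epsilon>(1)[of n] by (auto simp: hc_def intro!: add_nonneg_nonneg mult_nonneg_nonneg)
      show "indicator (Sec b) x * (1 * (2 * \<epsilon> n * \<bar>V x\<bar> * gtr (\<epsilon> n) (p x) * (cut (kk n) x)\<^sup>2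
          + (gtr (\<epsilon> n) (p x))\<^sup>2 * (norm (cut_grad (kk n) x))\<^sup>2) + Gtr (\<epsilon> n) (p x) * (cut (kk n) x)\<^sup>2 * \<bar>Dp x \<bullet> 0\<bar>)
        \<le> 2 * \<epsilon> n * (indicator (Sec b) x * hc n x) + indicator Om x * ((p x)\<^sup>2 * (norm (cut_grad (kk n) x))\<^sup>2)"
      proof (cases "x \<in> Sec b")
        case True
        then have xO: "x \<in> Om" using SO by blast
        have g1: "0 \<le> gtr (\<epsilon> n) (p x)" "gtr (\<epsilon> n) (p x) \<le> max 0 (p x)"
          using gtr_nonneg(1)[OF \<epsilon>(1)] gtr_approx(1)[OF \<epsilon>(1)] by auto
        have "2 * \<epsilon> n * \<bar>V x\<bar> * gtr (\<epsilon> n) (p x) * (cut (kk n) x)\<^sup>2 \<le> 2 * \<epsilon> n * \<bar>V x\<bar> * max 0 (p x) * (cut (kk n) x)\<^sup>2"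
          using g1 \<epsilon>(1)[of n] by (intro mult_right_mono mult_left_mono) auto
        moreover have "(gtr (\<epsilon> n) (p x))\<^sup>2 \<le> (p x)\<^sup>2"
          using g1 by (intro power2_mono) (auto simp: max_def split: if_splits)
        then have "(gtr (\<epsilon> n) (p x))\<^sup>2 * (norm (cut_grad (kk n) x))\<^sup>2 \<le> (p x)\<^sup>2 * (norm (cut_grad (kk n) x))\<^sup>2"
          by (intro mult_right_mono) auto
        ultimately show ?thesis using True xO by (simp add: hc_def mult_ac)
      qed simp
    qed
    also have "\<dots> = 2 * \<epsilon> n * c n + d n"
      using hc_int[of n] dint[of n] by (simp add: c_def d_def)
    finally show ?thesis using \<epsilon>(3)[of n] by linarith
  qed
  have kk_lim: "(\<lambda>n. 1 / kk n) \<longlonglongrightarrow> 0"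
    using LIMSEQ_inverse_real_of_nat unfolding kk_def by (simp add: inverse_eq_divide)
  have range: "0 \<le> \<phi> n x" "\<phi> n x \<le> max 0 (p x)" for n x
  proof -
    note A = gtr_nonneg(1)[OF \<epsilon>(1)[of n], of "p x"] and B = gtr_approx(1)[OF \<epsilon>(1)[of n], of "p x"]
    show "0 \<le> \<phi> n x" using A cut_range by (simp add: \<phi>_def \<Phi>_def)
    have "gtr (\<epsilon> n) (p x) * cut (kk n) x \<le> gtr (\<epsilon> n) (p x) * 1" using A cut_range by (intro mult_left_mono) auto
    then show "\<phi> n x \<le> max 0 (p x)" using B by (auto simp: \<phi>_def \<Phi>_def)
  qed
  have lim: "(\<lambda>n. \<phi> n x) \<longlonglongrightarrow> max 0 (p x)" if x: "x \<in> Sec b" for x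
  proof (rule tendsto_sandwich[OF _ _ _ tendsto_const])
    have "dax x > 0" using x r1 by (auto simp: Omega_def)
    from cut_eventually_seq[OF this]
    show "\<forall>\<^sub>F n in sequentially. max 0 (p x) - 2 * (1 / kk n) \<le> \<phi> n x"
    proof eventually_elim
      case (elim n)
      then have "\<phi> n x = gtr (\<epsilon> n) (p x)" using x by (simp add: \<phi>_def \<Phi>_def kk_def)
      then show ?case using gtr_approx(2)[OF \<epsilon>(1)[of n], of "p x"] \<epsilon>(2)[of n] by linarith
    qed
    show "\<forall>\<^sub>F n in sequentially. \<phi> n x \<le> max 0 (p x)" using range by simp
    show "(\<lambda>n. max 0 (p x) - 2 * (1 / kk n)) \<longlonglongrightarrow> max 0 (p x)"
      using tendsto_diff[OF tendsto_const tendsto_mult[OF tendsto_const kk_lim, of 2], of "max 0 (p x)"] by simp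
  qed
  have gz: "g n x = 0" if "p x \<le> 0" for n x
  proof -
    have "p x \<le> \<epsilon> n" using that \<epsilon>(1)[of n] by linarith
    then show ?thesis by (simp add: g_def D\<Phi>_def gtr_zero)
  qed
  have "trunc_seq b \<phi> g (\<lambda>n. 1 / kk n + d n)"
    unfolding trunc_seq_def using C1 range gz lim Q tendsto_add[OF kk_lim d_lim] by (auto simp: \<phi>_def)
  then show ?thesis by blast
qed

lemma C1c_Sec_tf: "b \<le> \<beta> \<Longrightarrow> C1c (Sec b) \<phi> g \<Longrightarrow> tf \<phi> g"
  using C1c_imp_tf C1c_mono Sec_subset_Om Om_subset_Fc by (meson subset_trans)

definition pos_part :: "real \<Rightarrow> real ^ 'n \<Rightarrow> real" where
  "pos_part b x = (if x \<in> Sec b then max 0 (p x) else 0)"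

text \<open>The limit of the form along the truncations against a bump is a linear functional of
  \<open>p\<^sup>+\<close>, and \<open>|V| \<le> K0\<close> turns its vanishing into the differential
  inequality required for the propagation of zeros.\<close>
lemma trunc_seq_limit:
  assumes s: "trunc_seq b \<phi> g e" and b: "b \<le> \<beta>" and \<psi>: "tf \<psi> h"
    and bump: "\<And>x. x \<in> Om \<Longrightarrow> \<psi> x = bump y R m x" "\<And>x. x \<in> Om \<Longrightarrow> h x = bump_grad y R m x" and m: "m \<ge> 3" and R: "R > 0"
    and Kc: "compact Kc" "Kc \<subseteq> Cl" "Om \<inter> cball y R \<subseteq> Kc"
    and K0: "\<And>x. x \<in> Om \<Longrightarrow> x \<in> cball y R \<Longrightarrow> \<bar>V x\<bar> \<le> K0"
  shows "\<exists>L. (\<lambda>k. BF V (\<phi> k) (g k) \<psi> h) \<longlonglongrightarrow> L \<and> integrable lborel (\<lambda>x. pos_part b x * (- bump_lap y R m x + K0 * bump y R m x)) \<and>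
     (L = 0 \<longrightarrow> 0 \<le> (LINT x|lborel. pos_part b x * (- bump_lap y R m x + K0 * bump y R m x)))"
proof -
  note SO = Sec_subset_Om[OF b]
  have C1: "C1c (Sec b) (\<phi> k) (g k)" for k using s by (simp add: trunc_seq_def)
  obtain M where M: "\<forall>w\<in>p ` Kc. norm w \<le> M"
    using compact_imp_bounded[OF compact_continuous_image[OF continuous_on_subset[OF p(3) Kc(2)] Kc(1)]]
    unfolding bounded_iff by blast
  have bd: "\<bar>\<phi> k x\<bar> \<le> M" if "x \<in> Om" "x \<in> cball y R" for k x
  proof -
    have "\<bar>p x\<bar> \<le> M" using M that Kc(3) by auto
    moreover have "0 \<le> \<phi> k x" "\<phi> k x \<le> max 0 (p x)" using s by (auto simp: trunc_seq_def)
    ultimately show ?thesis by linarith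
  qed
  have supp: "\<exists>K. compact K \<and> K \<subseteq> Om \<and> (\<forall>x\<in>Om - K. \<phi> k x = 0 \<or> bump_grad y R m x = 0)" for k
  proof -
    obtain K where "compact K" "K \<subseteq> Sec b" "\<And>x. x \<notin> K \<Longrightarrow> \<phi> k x = 0" using C1cE[OF C1[of k]] by metis
    then show ?thesis using SO by (intro exI[of _ K]) auto
  qed
  have lim: "(\<lambda>k. \<phi> k x) \<longlonglongrightarrow> pos_part b x" for x
    using s by (cases "x \<in> Sec b") (auto simp: trunc_seq_def pos_part_def)
  note L = BF_bump_limit[OF V C1c_Sec_tf[OF b C1] \<psi> bump m R supp lim bd K0]
  have ind: "indicator Om x * (pos_part b x * c) = pos_part b x * c" for x c
    using SO by (auto simp: pos_part_def indicator_def)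
  let ?L = "LINT x|lborel. indicator Om x * (pos_part b x * (- bump_lap y R m x - V x * bump y R m x))"
  have "?L = 0 \<Longrightarrow> 0 \<le> (LINT x|lborel. indicator Om x * (pos_part b x * (- bump_lap y R m x + K0 * bump y R m x)))"
    by (rule null_imp_supersolution[OF _ _ L(2) L(4) R _ K0]) (use m in \<open>auto simp: pos_part_def\<close>)
  then show ?thesis using L(1) L(3)[of K0] unfolding ind by blast
qed

lemma interior_null_imp_nonpos:
  assumes s: "trunc_seq b \<phi> g e" and b: "0 < b" "b \<le> \<beta>"
    and null: "\<And>y R m L. \<lbrakk>R > 0; m \<ge> 3; cball y R \<subseteq> Sec b; (\<lambda>k. BF V (\<phi> k) (g k) (bump y R m) (bump_grad y R m)) \<longlonglongrightarrow> L\<rbrakk> \<Longrightarrow> L = 0"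
    and U: "open U" "U \<noteq> {}" "U \<subseteq> Sec b" "\<And>x. x \<in> U \<Longrightarrow> p x \<le> 0" and x: "x \<in> Sec b"
  shows "p x \<le> 0"
proof -
  note SO = Sec_subset_Om[OF b(2)]
  have C1: "C1c (Sec b) (\<phi> k) (g k)" for k using s by (simp add: trunc_seq_def)
  have "pos_part b x = 0"
  proof (rule null_sequence_unique_continuation[OF V b C1c_Sec_tf[OF b(2) C1] _ _ _ _ _ null U(1,2,3) _ x])
    show "pos_part b x \<ge> 0" for x by (simp add: pos_part_def)
    have "continuous_on (Sec b) (\<lambda>x. max 0 (p x))"
      by (intro continuous_intros continuous_on_subset[OF cp SO])
    then show "continuous_on (Sec b) (pos_part b)" by (rule continuous_on_eq) (simp add: pos_part_def)
    show "pos_part b x = 0" if "x \<in> U" for x using U(4)[OF that] by (simp add: pos_part_def)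
    show "(\<lambda>k. \<phi> k x) \<longlonglongrightarrow> pos_part b x" for x
      using s by (cases "x \<in> Sec b") (auto simp: trunc_seq_def pos_part_def)
    show "\<exists>M. \<forall>k. \<forall>x\<in>cball y R. \<bar>\<phi> k x\<bar> \<le> M" if "cball y R \<subseteq> Sec b" for y R
    proof -
      have "cball y R \<subseteq> Om" using that SO by blast
      then obtain M where M: "\<forall>w\<in>p ` cball y R. norm w \<le> M"
        using compact_imp_bounded[OF compact_continuous_image[OF continuous_on_subset[OF cp] compact_cball]]
        unfolding bounded_iff by blast
      have "\<bar>\<phi> k x\<bar> \<le> M" if x: "x \<in> cball y R" for k x
      proof -
        have "\<bar>p x\<bar> \<le> M" using M x by auto
        moreover have "0 \<le> \<phi> k x" "\<phi> k x \<le> max 0 (p x)" using s by (auto simp: trunc_seq_def)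
        ultimately show ?thesis by linarith
      qed
      then show ?thesis by blast
    qed
  qed (simp_all add: pos_part_def)
  then show ?thesis using x by (simp add: pos_part_def max_def split: if_splits)
qed

text \<open>A bump centred below the face \<open>\<theta> = 0\<close>, restricted to the sector. It does not vanish on
  the face, so it is admissible for the Morse index although it is not a test function for the equation.\<close>
definition face_bump :: "real ^ 'n \<Rightarrow> real \<Rightarrow> nat \<Rightarrow> real ^ 'n \<Rightarrow> real" where
  "face_bump y R m x = (if x \<in> Fc then bump y R m x else 0)"

text \<open>The last clause is the point: if the truncations of \<open>p\<^sup>+\<close> are asymptotically orthogonal
  to all these bumps, then \<open>p\<^sup>+\<close> vanishes near the face.\<close>
definition face_test_ball :: "real \<Rightarrow> real ^ 'n \<Rightarrow> real \<Rightarrow> bool" where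
  "face_test_ball b y R \<longleftrightarrow> R > 0 \<and>
     (\<forall>m\<ge>3. tf (face_bump y R m) (bump_grad y R m) \<and>
        closure {x. face_bump y R m x \<noteq> 0} \<subseteq> Sec b \<union> Gamma_face i j r1 0) \<and>
     (\<forall>x\<in>Om - Sec b. x \<notin> cball y R) \<and> ball y R \<inter> Sec b \<noteq> {} \<and>
     (\<forall>b' \<phi> g e. 0 < b' \<longrightarrow> b' \<le> \<beta> \<longrightarrow> trunc_seq b' \<phi> g e \<longrightarrow>
        (\<forall>m\<ge>3. convergent (\<lambda>k. BF V (\<phi> k) (g k) (face_bump y R m) (bump_grad y R m))) \<and>
        ((\<forall>m\<ge>3. \<forall>L. (\<lambda>k. BF V (\<phi> k) (g k) (face_bump y R m) (bump_grad y R m)) \<longlonglongrightarrow> L \<longrightarrow> L = 0) \<longrightarrow>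
           (\<forall>x\<in>ball y R \<inter> Sec b'. p x \<le> 0)))"

text \<open>Extended by zero, \<open>p\<^sup>+\<close> vanishes on the ball of radius \<open>R0\<close>, which lies
  below the face. Orthogonality to the bumps that straddle the face is the differential inequality for this
  extension, so the zeros propagate through the face into the sector.\<close>
lemma face_test_ball_exists:
  assumes b: "0 < b" "b \<le> \<beta>"
  shows "\<exists>y R. face_test_ball b y R"
proof -
  obtain y R0 R where R: "0 < R0" "R0 < R"
    and far: "\<And>x. x $ j \<ge> 0 \<Longrightarrow> norm (x - y) \<ge> R0"
    and up: "\<And>x. x \<in> cball y R \<Longrightarrow> x $ j \<ge> 0 \<Longrightarrow> x \<in> Sec b \<union> Gamma_face i j r1 0"
    and side: "\<And>x. x \<in> cball y R \<Longrightarrow> x \<in> Fc \<Longrightarrow> x $ j \<ge> 0"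
    and ne: "ball y R \<inter> Sec b \<noteq> {}"
    by (rule face_ball[OF r1 b \<beta>(2)]) blast
  define Kc where "Kc = cball y R \<inter> {x. x $ j \<ge> 0}"
  have up': "x \<in> Fc" if "x \<in> Kc" for x
  proof -
    have "x \<in> Sec b \<or> x \<in> Gamma_face i j r1 0" using up[of x] that by (simp add: Kc_def)
    then show ?thesis
    proof
      assume "x \<in> Sec b"
      then show ?thesis using Sec_subset_Om[OF b(2)] Om_subset_Fc by blast
    qed (simp add: Omega_faces_def)
  qed
  have Kc: "compact Kc" "Kc \<subseteq> Fc" "Kc \<subseteq> Cl"
  proof -
    have "closed {x::real^'n. x $ j \<ge> 0}" by (intro closed_Collect_le continuous_intros)
    then show "compact Kc" unfolding Kc_def by (intro compact_Int_closed compact_cball)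
    show "Kc \<subseteq> Fc" "Kc \<subseteq> Cl" using up' Fc_subset_Cl by auto
  qed
  have OmKc: "Om \<inter> cball y R \<subseteq> Kc" using side Om_subset_Fc by (auto simp: Kc_def)
  have KcS: "Kc \<subseteq> Sec b \<union> Gamma_face i j r1 0" using up unfolding Kc_def by blast
  have Rp: "R > 0" using R by simp
  have off: "bump y R m x = 0" if "x \<in> Fc - Kc" "m \<ge> 3" for x m
  proof (rule bump_outside(1)[OF _ Rp])
    show "x \<notin> cball y R" using that side[of x] by (auto simp: Kc_def)
  qed (use that in simp)
  have tf: "tf (face_bump y R m) (bump_grad y R m)" "closure {x. face_bump y R m x \<noteq> 0} \<subseteq> Kc" if m: "m \<ge> 3" for m
    using tfI[of UNIV "bump y R m" "bump_grad y R m" Kc] GDERIV_bump[of m y R] continuous_on_bump(2)[of UNIV y R m] Kc off m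
    unfolding face_bump_def by auto
  obtain K1 where K1: "\<forall>w\<in>V ` Kc. norm w \<le> K1"
    using compact_imp_bounded[OF compact_continuous_image[OF continuous_on_subset[OF V Kc(3)] Kc(1)]]
    unfolding bounded_iff by blast
  define K0 where "K0 = max 0 K1"
  have K0: "K0 \<ge> 0" "\<And>z. z \<in> Kc \<Longrightarrow> \<bar>V z\<bar> \<le> K0" using K1 by (auto simp: K0_def le_max_iff_disj)
  have lim: "\<exists>L. (\<lambda>k. BF V (\<phi> k) (g k) (face_bump y R m) (bump_grad y R m)) \<longlonglongrightarrow> L \<and>
      integrable lborel (\<lambda>x. pos_part b' x * (- bump_lap y R m x + K0 * bump y R m x)) \<and>
      (L = 0 \<longrightarrow> 0 \<le> (LINT x|lborel. pos_part b' x * (- bump_lap y R m x + K0 * bump y R m x)))"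
    if m: "m \<ge> 3" and s: "trunc_seq b' \<phi> g e" "0 < b'" "b' \<le> \<beta>" for m b' \<phi> g e
    by (rule trunc_seq_limit[OF s(1,3) tf(1)[OF m] _ _ m Rp Kc(1,3) OmKc])
      (use K0 OmKc Om_subset_Fc in \<open>auto simp: face_bump_def\<close>)
  have notin: "x \<notin> cball y R" if "x \<in> Om" "x \<notin> Sec b" for x
  proof
    assume "x \<in> cball y R"
    then have "x \<in> Sec b \<union> Gamma_face i j r1 0" using OmKc KcS that by blast
    then show False using that by (auto simp: Gamma_face_def Omega_def)
  qed
  have nonpos: "p x \<le> 0" if b': "0 < b'" "b' \<le> \<beta>" and s: "trunc_seq b' \<phi> g e" and x: "x \<in> ball y R \<inter> Sec b'"
    and null: "\<And>m L. m \<ge> 3 \<Longrightarrow> (\<lambda>k. BF V (\<phi> k) (g k) (face_bump y R m) (bump_grad y R m)) \<longlonglongrightarrow> L \<Longrightarrow> L = 0"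
    for b' \<phi> g e x
  proof -
    note SO = Sec_subset_Om[OF b'(2)]
    have "pos_part b' x = 0"
    proof (rule nonneg_ball_propagation[OF R K0(1), of _ y])
      show "pos_part b' x \<ge> 0" for x by (simp add: pos_part_def)
      show "pos_part b' x = 0" if x: "x \<in> ball y R0" for x
      proof -
        have "x \<notin> Om"
        proof
          assume xO: "x \<in> Om"
          have "x $ j \<ge> 0" using side[of x] x xO R Om_subset_Fc by auto
          from far[OF this] x show False by (simp add: dist_norm norm_minus_commute)
        qed
        then show ?thesis using SO by (auto simp: pos_part_def)
      qed
      show "open (ball y R \<inter> Sec b')" by (simp add: open_Int)
      have "continuous_on (Sec b') (\<lambda>x. max 0 (p x))"
        by (intro continuous_intros continuous_on_subset[OF cp SO])
      then have "continuous_on (Sec b') (pos_part b')" by (rule continuous_on_eq) (simp add: pos_part_def)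
      then show "continuous_on (ball y R \<inter> Sec b') (pos_part b')" by (rule continuous_on_subset) auto
      show "x \<in> ball y R \<inter> Sec b'" by (rule x)
      show "integrable lborel (\<lambda>x. pos_part b' x * (- bump_lap y R m x + K0 * bump y R m x))" if "m \<ge> 3" for m
        using lim[OF that s b'] by blast
      show "0 \<le> (LINT x|lborel. pos_part b' x * (- bump_lap y R m x + K0 * bump y R m x))" if "m \<ge> 3" for m
        using lim[OF that s b'] null[OF that] by blast
    qed auto
    then show "p x \<le> 0" using x by (simp add: pos_part_def max_def split: if_splits)
  qed
  have "face_test_ball b y R"
    unfolding face_test_ball_def
  proof (intro conjI allI impI ballI)
    show "closure {x. face_bump y R m x \<noteq> 0} \<subseteq> Sec b \<union> Gamma_face i j r1 0" if "m \<ge> 3" for m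
      using tf(2)[OF that] KcS by blast
    show "convergent (\<lambda>k. BF V (\<phi> k) (g k) (face_bump y R m) (bump_grad y R m))"
      if "0 < b'" "b' \<le> \<beta>" "trunc_seq b' \<phi> g e" "m \<ge> 3" for b' \<phi> g e m
      using lim[OF that(4,3,1,2)] unfolding convergent_def by blast
    show "p x \<le> 0" if "0 < b'" "b' \<le> \<beta>" "trunc_seq b' \<phi> g e"
      "\<forall>m\<ge>3. \<forall>L. (\<lambda>k. BF V (\<phi> k) (g k) (face_bump y R m) (bump_grad y R m)) \<longlonglongrightarrow> L \<longrightarrow> L = 0"
      "x \<in> ball y R \<inter> Sec b'" for b' \<phi> g e x
      by (rule nonpos[OF that(1-3,5)]) (use that(4) in blast)
  qed (use Rp tf notin ne in auto)
  then show ?thesis by blast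
qed

text \<open>The truncations of \<open>p\<^sup>+\<close> minimise a nonnegative form, hence are asymptotically orthogonal
  to all admissible functions. With the bumps at the face this makes \<open>p\<^sup>+\<close> zero near the
  face, and with interior bumps zero everywhere.\<close>
lemma stable_sector_imp_nonpos:
  assumes b: "0 < b" "b \<le> \<beta>" and pb: "\<And>x. x \<in> Om \<Longrightarrow> ang x = b \<Longrightarrow> p x \<le> 0"
    and stable: "\<And>\<phi> g. tf \<phi> g \<Longrightarrow> closure {x. \<phi> x \<noteq> 0} \<subseteq> Sec b \<union> Gamma_face i j r1 0 \<Longrightarrow> QF V \<phi> g \<ge> 0"
    and x: "x \<in> Sec b"
  shows "p x \<le> 0"
proof -
  obtain \<phi> g e where s: "trunc_seq b \<phi> g e" using truncation_sequence[OF b pb] by blast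
  have C1: "C1c (Sec b) (\<phi> k) (g k)" for k using s by (simp add: trunc_seq_def)
  have tf: "tf (\<phi> k) (g k)" for k by (rule C1c_Sec_tf[OF b(2) C1])
  have supp: "closure {x. \<phi> k x \<noteq> 0} \<subseteq> Sec b" for k
  proof -
    obtain K where "compact K" "K \<subseteq> Sec b" "\<And>x. x \<notin> K \<Longrightarrow> \<phi> k x = 0" using C1cE[OF C1[of k]] by metis
    moreover from this have "closure {x. \<phi> k x \<noteq> 0} \<subseteq> K"
      by (intro closure_minimal) (auto intro: compact_imp_closed)
    ultimately show ?thesis by blast
  qed
  have null: "L = 0" if \<psi>: "tf \<psi> h" and \<psi>s: "closure {x. \<psi> x \<noteq> 0} \<subseteq> Sec b \<union> Gamma_face i j r1 0"
    and L: "(\<lambda>k. BF V (\<phi> k) (g k) \<psi> h) \<longlonglongrightarrow> L" for \<psi> h L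
  proof (rule BF_limit_zero[OF V tf \<psi> _ _ _ L])
    show "QF V (\<phi> k) (g k) \<le> e k" for k using s by (simp add: trunc_seq_def)
    show "e \<longlonglongrightarrow> 0" using s by (simp add: trunc_seq_def)
    show "0 \<le> QF V (\<lambda>x. 1 * \<phi> k x + t * \<psi> x) (\<lambda>x. 1 *\<^sub>R g k x + t *\<^sub>R h x)" for k t
    proof (rule stable[OF tf_lin[OF tf \<psi>]])
      have "closure {x. 1 * \<phi> k x + t * \<psi> x \<noteq> 0} \<subseteq> closure {x. \<phi> k x \<noteq> 0} \<union> closure {x. \<psi> x \<noteq> 0}"
        unfolding closure_Un[symmetric] by (rule closure_mono) auto
      then show "closure {x. 1 * \<phi> k x + t * \<psi> x \<noteq> 0} \<subseteq> Sec b \<union> Gamma_face i j r1 0" using supp \<psi>s by blast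
    qed
  qed
  obtain y R where "face_test_ball b y R" using face_test_ball_exists[OF b] by blast
  then have F2: "\<And>m. m \<ge> 3 \<Longrightarrow> tf (face_bump y R m) (bump_grad y R m)"
    and F3: "\<And>m. m \<ge> 3 \<Longrightarrow> closure {x. face_bump y R m x \<noteq> 0} \<subseteq> Sec b \<union> Gamma_face i j r1 0"
    and F6: "ball y R \<inter> Sec b \<noteq> {}"
    and F7: "(\<forall>m\<ge>3. \<forall>L. (\<lambda>k. BF V (\<phi> k) (g k) (face_bump y R m) (bump_grad y R m)) \<longlonglongrightarrow> L \<longrightarrow> L = 0) \<Longrightarrow>
           (\<forall>x\<in>ball y R \<inter> Sec b. p x \<le> 0)"
    unfolding face_test_ball_def using b s by blast+
  show ?thesis
  proof (rule interior_null_imp_nonpos[OF s b _ _ F6 _ _ x])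
    show "open (ball y R \<inter> Sec b)" by (simp add: open_Int)
    show "p x \<le> 0" if "x \<in> ball y R \<inter> Sec b" for x
      using F7 null[OF F2 F3] that by blast
    fix y R m L assume R: "R > 0" "(m::nat) \<ge> 3" "cball y R \<subseteq> Sec b"
      and L: "(\<lambda>k. BF V (\<phi> k) (g k) (bump y R m) (bump_grad y R m)) \<longlonglongrightarrow> L"
    show "L = 0"
    proof (rule null[OF _ _ L])
      show "tf (bump y R m) (bump_grad y R m)"
        by (rule C1c_Sec_tf[OF b(2) C1c_bump]) (use R in auto)
      have "{x. bump y R m x \<noteq> 0} \<subseteq> cball y R"
        using bump_outside(1)[of _ y R m] R by fastforce
      then have "closure {x. bump y R m x \<noteq> 0} \<subseteq> cball y R"
        by (rule closure_minimal) simp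
      then show "closure {x. bump y R m x \<noteq> 0} \<subseteq> Sec b \<union> Gamma_face i j r1 0" using R by blast
    qed
  qed auto
qed

end

context sector_solution
begin

lemma uminus_solution: "sector_solution i j r1 \<beta> V (\<lambda>x. - p x) (\<lambda>x. - Dp x) DU"
proof
  show "GDERIV (\<lambda>x. - p x) x :> - Dp x" if "x \<in> Om" for x by (rule GDERIV_minus[OF p(1)[OF that]])
  show "(LINT x|lborel. - Dp x \<bullet> G x) = (LINT x|lborel. V x * - p x * \<psi> x)" if "C1c Om \<psi> G" for \<psi> G
    using eq[OF that] by simp
qed (use V p p_boundary DU p_DU in \<open>auto intro!: continuous_intros\<close>)

lemma linear_bound:
  assumes A: "open A" "A \<subseteq> Om" and pos: "\<And>y. y \<in> A \<Longrightarrow> p y \<ge> 0" and x: "x \<in> A"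
  shows "\<exists>\<rho>>0. \<exists>K\<ge>0. cball x \<rho> \<subseteq> A \<and> (\<forall>y\<in>cball x \<rho>. \<bar>V y * p y\<bar> \<le> K * p y)"
proof -
  obtain \<rho> where \<rho>: "\<rho> > 0" "cball x \<rho> \<subseteq> A" using A(1) x open_contains_cball by blast
  then have "cball x \<rho> \<subseteq> Om" using A(2) by blast
  then obtain K1 where K1: "\<forall>w\<in>V ` cball x \<rho>. norm w \<le> K1"
    using compact_imp_bounded[OF compact_continuous_image[OF continuous_on_subset[OF VOm] compact_cball]]
    unfolding bounded_iff by blast
  have "\<bar>V y * p y\<bar> \<le> max 0 K1 * p y" if y: "y \<in> cball x \<rho>" for y
  proof -
    have "\<bar>V y\<bar> \<le> max 0 K1" using K1 y by (auto simp: le_max_iff_disj)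
    moreover have "p y \<ge> 0" using pos \<rho>(2) y by blast
    ultimately show ?thesis by (simp add: abs_mult mult_right_mono)
  qed
  then show ?thesis using \<rho> by (intro exI[of _ \<rho>] conjI exI[of _ "max 0 K1"]) auto
qed

lemma nonneg_zero_on_open_imp_zero:
  assumes b: "0 < b" "b \<le> \<beta>" and pos: "\<And>x. x \<in> Sec b \<Longrightarrow> p x \<ge> 0"
    and U: "open U" "U \<noteq> {}" "U \<subseteq> Sec b" "\<And>x. x \<in> U \<Longrightarrow> p x = 0" and x: "x \<in> Sec b"
  shows "p x = 0"
proof -
  note SO = Sec_subset_Om[OF b(2)]
  show ?thesis
  proof (rule weak_solution_unique_continuation[OF open_Sec _ _ _ pos _ _ _ U x, where r = "\<lambda>x. V x * p x"])
    show "connected (Sec b)" using connected_Omega[of r1 0 b] r1 b \<beta> by simp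
    show "GDERIV p x :> Dp x" if "x \<in> Sec b" for x using p(1) SO that by blast
    show "continuous_on (Sec b) Dp" using p(2) SO continuous_on_subset by blast
    show "continuous_on (Sec b) (\<lambda>x. V x * p x)"
      by (rule continuous_on_subset[OF continuous_on_mult[OF VOm cp] SO])
    show "\<exists>\<rho>>0. \<exists>K\<ge>0. cball x \<rho> \<subseteq> Sec b \<and> (\<forall>y\<in>cball x \<rho>. \<bar>V y * p y\<bar> \<le> K * p y)" if "x \<in> Sec b" for x
      by (rule linear_bound[OF open_Sec SO pos that])
    show "(LINT x|lborel. Dp x \<bullet> G x) = (LINT x|lborel. V x * p x * \<psi> x)" if "C1c (Sec b) \<psi> G" for \<psi> G
      by (rule eq[OF C1c_mono[OF that SO]])
  qed
qed

text \<open>If \<open>p\<^sup>+\<close> is not zero, its truncations cannot be asymptotically orthogonal to all face bumps supported in the sector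
  of opening \<open>b\<close>; a suitable multiple of such a bump added
  to a late truncation gives \<open>\<phi>\<^sub>1\<close> with negative energy. The truncations of
  \<open>p\<^sup>-\<close> live where \<open>p < 0\<close>, outside the support of
  \<open>\<phi>\<^sub>1\<close>. The index hypothesis thus makes them a null sequence: orthogonality to an
  arbitrary function follows from that to its projection along \<open>\<phi>\<^sub>1\<close>.\<close>
lemma nonneg_extends:
  assumes b: "0 < b" "b \<le> \<beta>"
    and index: "\<And>\<phi>1 g1 \<phi> g. tf \<phi>1 g1 \<Longrightarrow> tf \<phi> g \<Longrightarrow> QF V \<phi>1 g1 < 0 \<Longrightarrow> BF V \<phi> g \<phi>1 g1 = 0 \<Longrightarrow> QF V \<phi> g \<ge> 0"
    and pos: "\<And>x. x \<in> Sec b \<Longrightarrow> p x \<ge> 0" and ne: "x0 \<in> Sec b" "p x0 \<noteq> 0"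
    and x: "x \<in> Om"
  shows "p x \<ge> 0"
proof -
  note SO = Sec_subset_Om[OF b(2)]
  interpret neg: sector_solution i j r1 \<beta> V "\<lambda>x. - p x" "\<lambda>x. - Dp x" DU by (rule uminus_solution)
  have noangle: "ang x \<noteq> \<beta>" if "x \<in> Om" for x using that by (auto simp: Omega_def)
  obtain \<phi> g e where s: "trunc_seq \<beta> \<phi> g e"
    using truncation_sequence[OF \<beta>(1) order_refl] noangle by blast
  obtain \<phi>' g' e' where s': "neg.trunc_seq \<beta> \<phi>' g' e'"
    using neg.truncation_sequence[OF \<beta>(1) order_refl] noangle by blast
  have tf: "tf (\<phi> k) (g k)" for k using s C1c_Sec_tf[OF order_refl] by (simp add: trunc_seq_def)
  have tf': "tf (\<phi>' k) (g' k)" for k using s' C1c_Sec_tf[OF order_refl] by (simp add: neg.trunc_seq_def)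
  obtain y R where F: "face_test_ball b y R" using face_test_ball_exists[OF b] by blast
  have F2: "\<And>m. m \<ge> 3 \<Longrightarrow> tf (face_bump y R m) (bump_grad y R m)"
    and F4: "\<And>x. x \<in> Om \<Longrightarrow> x \<notin> Sec b \<Longrightarrow> x \<notin> cball y R" and F5: "ball y R \<inter> Sec b \<noteq> {}" and R: "R > 0"
    using F unfolding face_test_ball_def by blast+
  have F6: "\<And>m. m \<ge> 3 \<Longrightarrow> convergent (\<lambda>k. BF V (\<phi> k) (g k) (face_bump y R m) (bump_grad y R m))"
    and F7: "(\<forall>m\<ge>3. \<forall>L. (\<lambda>k. BF V (\<phi> k) (g k) (face_bump y R m) (bump_grad y R m)) \<longlonglongrightarrow> L \<longrightarrow> L = 0) \<Longrightarrow> (\<forall>x\<in>ball y R \<inter> Om. p x \<le> 0)"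
    using F s \<beta>(1) unfolding face_test_ball_def by blast+
  have "\<exists>m\<ge>3. \<exists>L. (\<lambda>k. BF V (\<phi> k) (g k) (face_bump y R m) (bump_grad y R m)) \<longlonglongrightarrow> L \<and> L \<noteq> 0"
  proof (rule ccontr)
    assume "\<not> ?thesis"
    then have "\<And>x. x \<in> ball y R \<inter> Om \<Longrightarrow> p x \<le> 0" using F7 by blast
    then have "p x = 0" if "x \<in> ball y R \<inter> Sec b" for x using that pos[of x] SO by (force intro: antisym)
    from nonneg_zero_on_open_imp_zero[OF b pos _ F5 _ this ne(1)] ne(2) show False
      by (auto simp: open_Int)
  qed
  then obtain m L where m: "m \<ge> 3" and L: "(\<lambda>k. BF V (\<phi> k) (g k) (face_bump y R m) (bump_grad y R m)) \<longlonglongrightarrow> L" "L \<noteq> 0" by blast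
  define \<psi> where "\<psi> = face_bump y R m"
  define h where "h = (bump_grad y R m :: real ^ 'n \<Rightarrow> real ^ 'n)"
  have tp: "tf \<psi> h" using F2[OF m] by (simp add: \<psi>_def h_def)
  define q where "q = QF V \<psi> h"
  \<comment> \<open>the sign of \<open>t\<close> below makes the linear term negative, its size keeps the quadratic term smaller\<close>
  define \<sigma> where "\<sigma> = 1 / (\<bar>q\<bar> + 1)"
  have \<sigma>: "\<sigma> > 0" "\<sigma> * q < 1"
  proof -
    show "\<sigma> > 0" by (simp add: \<sigma>_def)
    have "q < \<bar>q\<bar> + 1" by simp
    then show "\<sigma> * q < 1" by (simp add: \<sigma>_def field_simps)
  qed
  define t where "t = - L * \<sigma>"
  have "2 * t * L + t\<^sup>2 * q = L\<^sup>2 * \<sigma> * (\<sigma> * q - 2)" by (simp add: t_def power2_eq_square algebra_simps)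
  also have "\<dots> < 0" using L(2) \<sigma> by (intro mult_pos_neg) auto
  finally have neg0: "2 * t * L + t\<^sup>2 * q < 0" .
  have "(\<lambda>k. e k + 2 * t * BF V (\<phi> k) (g k) \<psi> h + t\<^sup>2 * q) \<longlonglongrightarrow> 0 + 2 * t * L + t\<^sup>2 * q"
    using s L(1) unfolding trunc_seq_def \<psi>_def h_def by (intro tendsto_intros) auto
  then have "(\<lambda>k. e k + 2 * t * BF V (\<phi> k) (g k) \<psi> h + t\<^sup>2 * q) \<longlonglongrightarrow> 2 * t * L + t\<^sup>2 * q" by simp
  from order_tendstoD(2)[OF this neg0]
  obtain k where k: "e k + 2 * t * BF V (\<phi> k) (g k) \<psi> h + t\<^sup>2 * q < 0"
    unfolding eventually_sequentially by blast
  define \<phi>1 where "\<phi>1 x = 1 * \<phi> k x + t * \<psi> x" for x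
  define g1 where "g1 x = 1 *\<^sub>R g k x + t *\<^sub>R h x" for x
  have tf1: "tf \<phi>1 g1" unfolding \<phi>1_def g1_def by (rule tf_lin[OF tf tp])
  have Q1: "QF V \<phi>1 g1 < 0"
  proof -
    have "QF V (\<phi> k) (g k) \<le> e k" using s by (simp add: trunc_seq_def)
    then show ?thesis using k unfolding \<phi>1_def g1_def QF_lin[OF V tf tp] by (simp add: q_def)
  qed
  have orth: "BF V (\<phi>' l) (g' l) \<phi>1 g1 = 0" for l
  proof -
    have "indicator Om x * (g' l x \<bullet> g1 x - V x * \<phi>' l x * \<phi>1 x) = 0" for x
    proof (cases "x \<in> Om \<and> p x < 0")
      case True
      then have "x \<notin> Sec b" using pos[of x] by auto
      then have xc: "x \<notin> cball y R" using F4 True by blast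
      have "bump y R m x = 0" by (rule bump_outside(1)[OF xc R]) (use m in simp)
      then have "\<psi> x = 0" by (simp add: \<psi>_def face_bump_def)
      moreover have "h x = 0" unfolding h_def by (rule bump_outside(2)[OF xc R]) (use m in simp)
      moreover have "0 \<le> \<phi> k x" "\<phi> k x \<le> max 0 (p x)" using s unfolding trunc_seq_def by blast+
      then have "\<phi> k x = 0" using True by simp
      moreover have "g k x = 0" using s True unfolding trunc_seq_def by simp
      ultimately show ?thesis by (simp add: \<phi>1_def g1_def)
    next
      case False
      show ?thesis
      proof (cases "x \<in> Om")
        case True
        then have "- p x \<le> 0" using False by simp
        then have "g' l x = 0" using s' unfolding neg.trunc_seq_def by blast
        moreover have "0 \<le> \<phi>' l x" "\<phi>' l x \<le> max 0 (- p x)" using s' unfolding neg.trunc_seq_def by blast+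
        then have "\<phi>' l x = 0" using \<open>- p x \<le> 0\<close> by simp
        ultimately show ?thesis by simp
      qed simp
    qed
    then show ?thesis unfolding BF_def by (simp only: Bochner_Integration.integral_zero)
  qed
  have null: "L' = 0" if t2: "tf \<psi>2 h2" and L': "(\<lambda>k. BF V (\<phi>' k) (g' k) \<psi>2 h2) \<longlonglongrightarrow> L'" for \<psi>2 h2 L'
  proof -
    \<comment> \<open>\<open>\<psi>3\<close> is the projection of \<open>\<psi>2\<close> to the orthogonal complement of \<open>\<phi>1\<close>\<close>
    define c where "c = - BF V \<psi>2 h2 \<phi>1 g1 / QF V \<phi>1 g1"
    define \<psi>3 where "\<psi>3 x = 1 * \<psi>2 x + c * \<phi>1 x" for x
    define h3 where "h3 x = 1 *\<^sub>R h2 x + c *\<^sub>R g1 x" for x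
    have t3: "tf \<psi>3 h3" unfolding \<psi>3_def h3_def by (rule tf_lin[OF t2 tf1])
    have o3: "BF V \<psi>3 h3 \<phi>1 g1 = 0"
      unfolding \<psi>3_def h3_def BF_lin_left[OF V t2 tf1 tf1] c_def using Q1 by simp
    have same: "BF V (\<phi>' k) (g' k) \<psi>3 h3 = BF V (\<phi>' k) (g' k) \<psi>2 h2" for k
      using BF_lin_left[OF V t2 tf1 tf', of 1 c k] orth[of k]
      unfolding \<psi>3_def h3_def BF_commute[of V "\<phi>' k" "g' k"] by simp
    show ?thesis
    proof (rule BF_limit_zero[OF V tf' t3, where e = e'])
      show "QF V (\<phi>' k) (g' k) \<le> e' k" for k using s' by (simp add: neg.trunc_seq_def)
      show "e' \<longlonglongrightarrow> 0" using s' by (simp add: neg.trunc_seq_def)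
      show "(\<lambda>k. BF V (\<phi>' k) (g' k) \<psi>3 h3) \<longlonglongrightarrow> L'" using L' by (simp add: same)
      show "0 \<le> QF V (\<lambda>x. 1 * \<phi>' k x + t * \<psi>3 x) (\<lambda>x. 1 *\<^sub>R g' k x + t *\<^sub>R h3 x)" for k t
      proof (rule index[OF tf1 tf_lin[OF tf' t3] Q1])
        show "BF V (\<lambda>x. 1 * \<phi>' k x + t * \<psi>3 x) (\<lambda>x. 1 *\<^sub>R g' k x + t *\<^sub>R h3 x) \<phi>1 g1 = 0"
          unfolding BF_lin_left[OF V tf' t3 tf1] using orth o3 by simp
      qed
    qed
  qed
  have "- p x \<le> 0"
  proof (rule neg.interior_null_imp_nonpos[OF s' \<beta>(1) order_refl _ open_Sec _ SO _ x])
    show "Sec b \<noteq> {}" using ne by blast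
    show "- p x \<le> 0" if "x \<in> Sec b" for x using pos[OF that] by simp
    show "L = 0" if "R > 0" "(m::nat) \<ge> 3" "cball y R \<subseteq> Om" "(\<lambda>k. BF V (\<phi>' k) (g' k) (bump y R m) (bump_grad y R m)) \<longlonglongrightarrow> L" for y R m L
    proof (rule null[OF _ that(4)])
      show "tf (bump y R m) (bump_grad y R m)"
        by (rule C1c_Sec_tf[OF order_refl C1c_bump]) (use that in auto)
    qed
  qed
  then show ?thesis by simp
qed

end

section \<open>Composition with isometries\<close>

lemma GDERIV_compose_isometry:
  fixes T Ti :: "'a::euclidean_space \<Rightarrow> 'a"
  assumes lin: "linear T" and adj: "\<And>x y. T x \<bullet> y = x \<bullet> Ti y" and f: "GDERIV f (T x) :> d"
  shows "GDERIV (\<lambda>x. f (T x)) x :> Ti d"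
proof -
  have "(T has_derivative T) (at x)"
    by (rule bounded_linear_imp_has_derivative) (use lin in \<open>simp add: linear_conv_bounded_linear\<close>)
  from has_derivative_compose[OF this, of f "\<lambda>h. h \<bullet> d"] f
  show ?thesis unfolding gderiv_def adj by simp
qed

lemma C1c_compose_isometry:
  fixes T Ti :: "'a::euclidean_space \<Rightarrow> 'a"
  assumes lin: "linear T" "linear Ti" and adj: "\<And>x y. T x \<bullet> y = x \<bullet> Ti y" and inv: "\<And>x. Ti (T x) = x"
    and C: "C1c D \<psi> G"
  shows "C1c (Ti ` D) (\<lambda>x. \<psi> (T x)) (\<lambda>x. Ti (G (T x)))"
proof -
  have cT: "continuous_on A T" "continuous_on A Ti" for A
    using lin by (simp_all add: linear_continuous_on linear_conv_bounded_linear)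
  obtain K where K: "compact K" "K \<subseteq> D" "\<And>x. x \<notin> K \<Longrightarrow> \<psi> x = 0" using C1cE[OF C] by metis
  have "compact (Ti ` K)" by (intro compact_continuous_image cT K)
  moreover have "\<psi> (T x) = 0" if "x \<notin> Ti ` K" for x
  proof (rule K(3))
    show "T x \<notin> K" using that inv[of x] by (metis image_eqI)
  qed
  moreover have "continuous_on UNIV (\<lambda>x. Ti (G (T x)))"
    by (rule continuous_on_compose2[OF cT(2)[of UNIV] continuous_on_compose2[OF C1c_cont(2)[OF C, of UNIV] cT(1)]]) auto
  ultimately show ?thesis
    unfolding C1c_def using GDERIV_compose_isometry[OF lin(1) adj C1c_gderiv[OF C]] K(2)
    by (intro conjI allI exI[of _ "Ti ` K"]) auto
qed

context cyl_coords
begin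

lemma rot_adjoint: "R\<theta> t x \<bullet> y = x \<bullet> R\<theta> (- t) y"
  using rot_inner[of t x "R\<theta> (- t) y"] by simp

lemma refl_adjoint: "S\<theta> b x \<bullet> y = x \<bullet> S\<theta> b y"
  using refl_inner[of b x "S\<theta> b y"] by simp

lemma C1c_rot: "C1c D \<psi> G \<Longrightarrow> C1c (R\<theta> (- t) ` D) (\<lambda>x. \<psi> (R\<theta> t x)) (\<lambda>x. R\<theta> (- t) (G (R\<theta> t x)))"
  by (rule C1c_compose_isometry[OF linear_maps(1) linear_maps(1) rot_adjoint]) auto

lemma C1c_refl: "C1c D \<psi> G \<Longrightarrow> C1c (S\<theta> b ` D) (\<lambda>x. \<psi> (S\<theta> b x)) (\<lambda>x. S\<theta> b (G (S\<theta> b x)))"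
  by (rule C1c_compose_isometry[OF linear_maps(2) linear_maps(2) refl_adjoint]) auto

end

context sector
begin

abbreviation "S \<equiv> S\<theta> \<beta>"

lemma cont_refl: "continuous_on A (\<lambda>x. S (g x))" if "continuous_on A g" for g :: "'b::topological_space \<Rightarrow> real ^ 'n"
  by (rule continuous_on_compose2[OF continuous_coords(4)[of UNIV] that]) auto

lemma refl_Om: "x \<in> Om \<Longrightarrow> S x \<in> Om"
  using refl_in_Omega[of x r1 0 \<beta> \<beta>] r1 \<beta> by simp

lemma refl_image_Om: "S ` Om = Om"
proof (intro equalityI subsetI)
  fix x assume "x \<in> Om"
  then have "S x \<in> Om" by (rule refl_Om)
  then show "x \<in> S ` Om" by (rule image_eqI[rotated]) simp
qed (use refl_Om in blast)

lemma refl_Cl: "x \<in> Cl \<Longrightarrow> S x \<in> Cl"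
  using angle_refl[of x \<beta>] \<beta> angle_range[of x] by (auto simp: Cl_def)

lemma refl_Om_iff: "S x \<in> Om \<longleftrightarrow> x \<in> Om"
  using refl_Om[of x] refl_Om[of "S x"] by auto

lemma Cl_eq_closure: "Cl = closure Om - axis_set i j"
proof (intro set_eqI iffI)
  fix x assume "x \<in> Cl"
  then show "x \<in> closure Om - axis_set i j"
    using in_closure_Omega[OF r1 \<beta>, of x] by (auto simp: Cl_def axis_set_def)
next
  fix x assume "x \<in> closure Om - axis_set i j"
  then show "x \<in> Cl" using closure_Omega_subset[of x r1 \<beta>] \<beta> dist_axis_nonneg[of x]
    by (auto simp: Cl_def axis_set_def less_le simp del: dist_axis_nonneg)
qed

end

section \<open>Comparison with the reflected solution\<close>

text \<open>Everything that the reflection argument needs to know about a solution \<open>u\<close>, in a form that is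
  visibly inherited by the reflected function. Convexity of \<open>f\<close> occurs as the tangent line
  inequality at the value of \<open>u\<close>.\<close>
locale neumann_solution = sector_solution i j r1 \<beta> V v Dv Du
  for i j :: "'n::finite" and r1 \<beta> :: real and V v :: "real ^ 'n \<Rightarrow> real" and Dv Du :: "real ^ 'n \<Rightarrow> real ^ 'n" +
  fixes u :: "real ^ 'n \<Rightarrow> real" and f :: "real \<Rightarrow> real ^ 'n \<Rightarrow> real \<Rightarrow> real"
  assumes u: "\<And>x. x \<in> Om \<Longrightarrow> GDERIV u x :> Du x" "continuous_on Om Du" "continuous_on Cl u"
    and v_eq: "\<And>x. x \<in> Om \<Longrightarrow> v x = T\<theta> x \<bullet> Du x"
    and u_gamma: "\<And>x y. \<lbrakk>x \<in> Cl; y \<in> Cl; dax x = r1; dax y = r1; zp x = zp y\<rbrakk> \<Longrightarrow> u x = u y"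
    and weak_u: "\<And>\<psi> G. C1c Om \<psi> G \<Longrightarrow> (LINT x|lborel. Du x \<bullet> G x) = (LINT x|lborel. f (dax x) (zp x) (u x) * \<psi> x)"
    and f_cont: "continuous_on Om (\<lambda>x. f (dax x) (zp x) (u x))"
    and f_convex: "\<And>x s. x \<in> Cl \<Longrightarrow> f (dax x) (zp x) (u x) + V x * (s - u x) \<le> f (dax x) (zp x) s"
begin

abbreviation "half \<equiv> \<beta> / 2"
abbreviation "H \<equiv> Sec half"

lemma half: "0 < half" "half \<le> \<beta>" "half < pi" "half < \<beta>" using \<beta> by auto

lemma H_Om: "H \<subseteq> Om" using half by (intro Sec_subset_Om) auto

definition "w x = u x - u (S x)"
definition "Dw x = Du x - S (Du (S x))"

lemma w_gderiv: "x \<in> Om \<Longrightarrow> GDERIV w x :> Dw x"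
  unfolding w_def[abs_def] Dw_def
  by (intro GDERIV_diff u GDERIV_compose_isometry[OF linear_maps(2) refl_adjoint] refl_Om)

lemma Dw_cont: "continuous_on Om Dw"
  unfolding Dw_def[abs_def]
  by (intro continuous_intros u cont_refl continuous_on_compose2[OF u(2) cont_refl[OF continuous_on_id]])
    (auto simp: refl_Om)

lemma w_cont: "continuous_on Cl w"
  unfolding w_def[abs_def]
  by (intro continuous_intros u continuous_on_compose2[OF u(3) cont_refl[OF continuous_on_id]]) (auto simp: refl_Cl)

lemma w_cont_Om: "continuous_on Om w" using w_cont Om_subset_Cl continuous_on_subset by blast

lemma weak_reflected:
  assumes C: "C1c Om \<psi> G"
  shows "(LINT x|lborel. S (Du (S x)) \<bullet> G x) = (LINT x|lborel. f (dax x) (zp x) (u (S x)) * \<psi> x)"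
    and "integrable lborel (\<lambda>x. S (Du (S x)) \<bullet> G x)" "integrable lborel (\<lambda>x. f (dax x) (zp x) (u (S x)) * \<psi> x)"
proof -
  have C': "C1c Om (\<lambda>x. \<psi> (S x)) (\<lambda>x. S (G (S x)))"
    using C1c_refl[OF C, of \<beta>] unfolding refl_image_Om .
  have i1: "integrable lborel (\<lambda>x. Du x \<bullet> S (G (S x)))" by (rule C1c_integrable(2)[OF C' u(2)])
  have i2: "integrable lborel (\<lambda>x. f (dax x) (zp x) (u x) * \<psi> (S x))" by (rule C1c_integrable(1)[OF C' f_cont])
  have e1: "S (Du (S x)) \<bullet> G x = Du (S x) \<bullet> S (G (S (S x)))" for x by (simp add: refl_adjoint)
  have e2: "f (dax x) (zp x) (u (S x)) * \<psi> x = f (dax (S x)) (zp (S x)) (u (S x)) * \<psi> (S (S x))" for x by simp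
  note m1 = borel_measurable_integrable[OF i1, simplified] and m2 = borel_measurable_integrable[OF i2, simplified]
  show "(LINT x|lborel. S (Du (S x)) \<bullet> G x) = (LINT x|lborel. f (dax x) (zp x) (u (S x)) * \<psi> x)"
    unfolding e1 e2 integral_refl(1)[OF m1] integral_refl(1)[OF m2] by (rule weak_u[OF C'])
  show "integrable lborel (\<lambda>x. S (Du (S x)) \<bullet> G x)" "integrable lborel (\<lambda>x. f (dax x) (zp x) (u (S x)) * \<psi> x)"
    unfolding e1 e2 integral_refl(2)[OF m1] integral_refl(2)[OF m2] by (rule i1 i2)+
qed

text \<open>Both \<open>u\<close> and \<open>u \<circ> S\<close> solve the same equation because \<open>f\<close>
  depends on \<open>d(x)\<close> and \<open>z\<close> only. The tangent line inequality at \<open>u\<close>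
  bounds the difference of the right-hand sides by \<open>V w\<close>.\<close>
lemma w_subsolution:
  assumes C: "C1c Om \<psi> G" and pos: "\<And>x. \<psi> x \<ge> 0"
  shows "(LINT x|lborel. Dw x \<bullet> G x) \<le> (LINT x|lborel. V x * w x * \<psi> x)"
proof -
  have i1: "integrable lborel (\<lambda>x. Du x \<bullet> G x)" by (rule C1c_integrable(2)[OF C u(2)])
  have i2: "integrable lborel (\<lambda>x. f (dax x) (zp x) (u x) * \<psi> x)" by (rule C1c_integrable(1)[OF C f_cont])
  have i3: "integrable lborel (\<lambda>x. V x * w x * \<psi> x)" by (rule C1c_integrable(1)[OF C continuous_on_mult[OF VOm w_cont_Om]])
  have "(LINT x|lborel. Dw x \<bullet> G x) = (LINT x|lborel. Du x \<bullet> G x) - (LINT x|lborel. S (Du (S x)) \<bullet> G x)"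
    using i1 weak_reflected(2)[OF C] by (simp add: Dw_def inner_diff_left)
  also have "\<dots> = (LINT x|lborel. f (dax x) (zp x) (u x) * \<psi> x - f (dax x) (zp x) (u (S x)) * \<psi> x)"
    unfolding weak_u[OF C] weak_reflected(1)[OF C] using i2 weak_reflected(3)[OF C] by simp
  also have "\<dots> \<le> (LINT x|lborel. V x * w x * \<psi> x)"
  proof (rule integral_mono)
    fix x
    show "f (dax x) (zp x) (u x) * \<psi> x - f (dax x) (zp x) (u (S x)) * \<psi> x \<le> V x * w x * \<psi> x"
    proof (cases "x \<in> Om")
      case True
      then have "f (dax x) (zp x) (u x) - f (dax x) (zp x) (u (S x)) \<le> V x * w x"
        using f_convex[of x "u (S x)"] Om_subset_Cl by (auto simp: w_def algebra_simps)
      from mult_right_mono[OF this pos[of x]] show ?thesis by (simp add: algebra_simps)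
    next
      case False
      then have "\<psi> x = 0" using C unfolding C1c_def by blast
      then show ?thesis by simp
    qed
  qed (use i2 i3 weak_reflected(3)[OF C] in auto)
  finally show ?thesis .
qed

lemma Dw_L2: "integrable lborel (\<lambda>x. indicator Om x * (norm (Dw x))\<^sup>2)"
proof -
  have ind: "indicator Om (S x) = (indicator Om x :: real)" for x using refl_Om_iff by (simp add: indicator_def)
  have "integrable lborel (\<lambda>x. indicator Om (S x) * (norm (Du (S x)))\<^sup>2)"
    using integral_refl(2)[OF borel_measurable_integrable[OF DU, simplified]] DU by blast
  then have i: "integrable lborel (\<lambda>x. 2 * (indicator Om x * (norm (Du x))\<^sup>2) + 2 * (indicator Om x * (norm (Du (S x)))\<^sup>2))"
    unfolding ind using DU by (intro Bochner_Integration.integrable_add integrable_mult_right)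
  show ?thesis
  proof (rule Bochner_Integration.integrable_bound[OF i])
    show "(\<lambda>x. indicator Om x * (norm (Dw x))\<^sup>2) \<in> borel_measurable lborel"
    proof -
      have "continuous_on Om (\<lambda>x. (norm (Dw x))\<^sup>2)" by (intro continuous_intros Dw_cont)
      from borel_measurable_continuous_on_indicator[OF _ this] show ?thesis by simp
    qed
    have "(norm (Dw x))\<^sup>2 \<le> 2 * (norm (Du x))\<^sup>2 + 2 * (norm (Du (S x)))\<^sup>2" for x
    proof -
      have "norm (Dw x) \<le> norm (Du x) + norm (Du (S x))"
        unfolding Dw_def using norm_triangle_ineq4[of "Du x" "S (Du (S x))"] by simp
      then have "(norm (Dw x))\<^sup>2 \<le> (norm (Du x) + norm (Du (S x)))\<^sup>2" by (intro power_mono) auto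
      also have "\<dots> \<le> 2 * (norm (Du x))\<^sup>2 + 2 * (norm (Du (S x)))\<^sup>2"
        using zero_le_power2[of "norm (Du x) - norm (Du (S x))"] by (simp add: power2_eq_square algebra_simps)
      finally show ?thesis .
    qed
    then show "AE x in lborel. norm (indicator Om x * (norm (Dw x))\<^sup>2)
        \<le> norm (2 * (indicator Om x * (norm (Du x))\<^sup>2) + 2 * (indicator Om x * (norm (Du (S x)))\<^sup>2))"
      by (intro AE_I2) (auto simp: indicator_def)
  qed
qed

lemma Dw_tang:
  assumes x: "x \<in> Om"
  shows "Dw x \<bullet> T\<theta> x = v x + v (S x)"
proof -
  have "Dw x \<bullet> T\<theta> x = Du x \<bullet> T\<theta> x - Du (S x) \<bullet> S (T\<theta> x)"
    by (simp only: Dw_def inner_diff_left refl_adjoint)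
  also have "\<dots> = T\<theta> x \<bullet> Du x + T\<theta> (S x) \<bullet> Du (S x)" by (simp add: tang_refl inner_commute)
  finally show ?thesis using v_eq[OF x] v_eq[OF refl_Om[OF x]] by simp
qed

lemma u_along_arc:
  assumes "R\<theta> t x \<in> Om"
  shows "((\<lambda>t. u (R\<theta> t x)) has_vector_derivative v (R\<theta> t x)) (at t within A)"
proof -
  have d: "(u has_derivative (\<lambda>h. h \<bullet> Du (R\<theta> t x))) (at (R\<theta> t x))"
    using u(1)[OF assms] by (simp add: gderiv_def)
  have "((\<lambda>t. u (R\<theta> t x)) has_derivative (\<lambda>s. (s *\<^sub>R T\<theta> (R\<theta> t x)) \<bullet> Du (R\<theta> t x))) (at t within A)"
    by (rule has_derivative_compose[OF rot_has_vector_derivative[unfolded has_vector_derivative_def] d])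
  then show ?thesis unfolding has_vector_derivative_def by (simp add: v_eq[OF assms])
qed

lemma Cauchy_Schwarz_mean:
  fixes a :: "real \<Rightarrow> real"
  assumes L: "L > 0" and a: "continuous_on {0..L} a" and A: "\<And>t. 0 \<le> t \<Longrightarrow> t \<le> L \<Longrightarrow> (A has_vector_derivative a t) (at t within {0..L})"
  shows "(A L - A 0)\<^sup>2 \<le> L * (LINT t|lborel. indicator {0..L} t * (a t)\<^sup>2)"
    and "integrable lborel (\<lambda>t. indicator {0..L} t * (a t)\<^sup>2)"
proof -
  define c where "c = (A L - A 0) / L"
  have ia: "(LINT t|lborel. indicator {0..L} t *\<^sub>R a t) = A L - A 0"
    by (rule integral_FTC_Icc[OF _ A a]) (use L in auto)
  have int: "integrable lborel (\<lambda>t. indicator {0..L} t *\<^sub>R h t)" if "continuous_on {0..L} h" for h :: "real \<Rightarrow> real"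
    by (rule borel_integrable_compact[OF _ that]) simp
  have i1: "integrable lborel (\<lambda>t. indicator {0..L} t * a t)" using int[OF a] by simp
  show i2: "integrable lborel (\<lambda>t. indicator {0..L} t * (a t)\<^sup>2)" using int[of "\<lambda>t. (a t)\<^sup>2"] a by (simp add: continuous_intros)
  have i3: "integrable lborel (\<lambda>t. indicator {0..L} t * c\<^sup>2)" using int[of "\<lambda>t. c\<^sup>2"] by simp
  have l3: "(LINT t|lborel. indicator {0..L} t * c\<^sup>2) = L * c\<^sup>2" using L by simp
  have "0 \<le> (LINT t|lborel. indicator {0..L} t * (a t)\<^sup>2 - 2 * c * (indicator {0..L} t * a t) + indicator {0..L} t * c\<^sup>2)"
  proof (rule Bochner_Integration.integral_nonneg)
    fix t
    have "indicator {0..L} t * (a t)\<^sup>2 - 2 * c * (indicator {0..L} t * a t) + indicator {0..L} t * c\<^sup>2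
      = indicator {0..L} t * (a t - c)\<^sup>2" by (simp add: power2_eq_square algebra_simps)
    then show "0 \<le> indicator {0..L} t * (a t)\<^sup>2 - 2 * c * (indicator {0..L} t * a t) + indicator {0..L} t * c\<^sup>2" by simp
  qed
  also have "\<dots> = (LINT t|lborel. indicator {0..L} t * (a t)\<^sup>2) - 2 * c * (A L - A 0) + L * c\<^sup>2"
    using i1 i2 i3 ia l3 by simp
  also have "\<dots> = (LINT t|lborel. indicator {0..L} t * (a t)\<^sup>2) - (A L - A 0)\<^sup>2 / L"
    using L by (simp add: c_def power2_eq_square field_simps)
  finally show "(A L - A 0)\<^sup>2 \<le> L * (LINT t|lborel. indicator {0..L} t * (a t)\<^sup>2)"
    using L by (simp add: field_simps)
qed

text \<open>Replaces the bound \<open>|v| \<le> d(x) |\<nabla>u|\<close> for \<open>w\<close>: the points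
  \<open>x\<close> and \<open>S x\<close> are joined by an arc along which the derivative of \<open>u\<close>
  is \<open>v\<close>, so Cauchy--Schwarz bounds \<open>w\<^sup>2/d\<^sup>2\<close> by a mean of
  \<open>v\<^sup>2/d\<^sup>2 \<le> |\<nabla>u|\<^sup>2\<close> over rotations, and rotations preserve the
  measure.\<close>
lemma w_Hardy: "integrable lborel (\<lambda>x. indicator H x * ((w x)\<^sup>2 / (dax x)\<^sup>2))"
proof -
  define h where "h x = (indicator Om x * ((v x)\<^sup>2 / (dax x)\<^sup>2) :: real)" for x
  have daxOm: "dax x > 0" if "x \<in> Om" for x using that r1 by (auto simp: Omega_def)
  have hm[measurable]: "h \<in> borel_measurable borel"
  proof -
    have "continuous_on Om (\<lambda>x. (v x)\<^sup>2 / (dax x)\<^sup>2)"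
      using daxOm by (intro continuous_intros cp continuous_coords) force
    from borel_measurable_continuous_on_indicator[OF _ this] show ?thesis by (simp add: h_def[abs_def])
  qed
  have wm: "(\<lambda>x. indicator H x * ((w x)\<^sup>2 / (dax x)\<^sup>2)) \<in> borel_measurable borel"
  proof -
    have "continuous_on H (\<lambda>x. (w x)\<^sup>2 / (dax x)\<^sup>2)"
      using daxOm H_Om by (intro continuous_intros continuous_on_subset[OF w_cont_Om H_Om] continuous_coords) force
    from borel_measurable_continuous_on_indicator[OF _ this] show ?thesis by simp
  qed
  have h0: "h x \<ge> 0" for x by (simp add: h_def)
  have hDu: "h x \<le> indicator Om x * (norm (Du x))\<^sup>2" for x
  proof (cases "x \<in> Om")
    case True
    have "(v x)\<^sup>2 \<le> (dax x * norm (Du x))\<^sup>2" using p_DU[OF True] by (simp add: abs_le_square_iff[symmetric])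
    then show ?thesis using True daxOm[OF True] by (simp add: h_def divide_le_eq power_mult_distrib mult.commute)
  qed (simp add: h_def)
  have "(\<integral>\<^sup>+x. ennreal (h x) \<partial>lborel) \<le> (\<integral>\<^sup>+x. ennreal (indicator Om x * (norm (Du x))\<^sup>2) \<partial>lborel)"
    by (intro nn_integral_mono ennreal_leI hDu)
  also have "\<dots> < \<infinity>" using DU by (subst nn_integral_eq_integral) auto
  finally have hfin: "(\<integral>\<^sup>+x. ennreal (h x) \<partial>lborel) < \<infinity>" .
  have jm: "(\<lambda>(t, x). h (R\<theta> t x)) \<in> borel_measurable (lborel \<Otimes>\<^sub>M lborel)"
  proof -
    have "(\<lambda>z. R\<theta> (fst z) (snd z)) \<in> borel_measurable (borel :: (real \<times> (real ^ 'n)) measure)"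
      by (intro borel_measurable_continuous_onI continuous_on_rot continuous_intros)
    from measurable_compose[OF this hm] show ?thesis
      by (simp add: case_prod_unfold lborel_prod)
  qed
  have pt: "ennreal (indicator H x * ((w x)\<^sup>2 / (dax x)\<^sup>2)) \<le> ennreal \<beta> * (\<integral>\<^sup>+t. ennreal (indicator {0..\<beta>} t * h (R\<theta> t x)) \<partial>lborel)" for x
  proof (cases "x \<in> H")
    case True
    define L where "L = \<beta> - 2 * ang x"
    have L: "0 < L" "L \<le> \<beta>" using True by (auto simp: Omega_def L_def)
    have d: "dax x > 0" using True daxOm H_Om by blast
    have inO: "R\<theta> t x \<in> Om" if "0 \<le> t" "t \<le> L" for t
      using angle_rot[of x t] that True \<beta> d r1 by (auto simp: Omega_def L_def)
    have ca: "continuous_on {0..L} (\<lambda>t. v (R\<theta> t x))"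
      by (rule continuous_on_compose2[OF cp]) (use inO in \<open>auto intro!: continuous_on_rot continuous_intros\<close>)
    have CS: "(u (R\<theta> L x) - u (R\<theta> 0 x))\<^sup>2 \<le> L * (LINT t|lborel. indicator {0..L} t * (v (R\<theta> t x))\<^sup>2)"
      "integrable lborel (\<lambda>t. indicator {0..L} t * (v (R\<theta> t x))\<^sup>2)"
      by (rule Cauchy_Schwarz_mean[OF L(1) ca u_along_arc]; use inO in auto)+
    have "S x = R\<theta> L x" by (simp add: refl_eq_rot L_def)
    then have w2: "(w x)\<^sup>2 = (u (R\<theta> L x) - u (R\<theta> 0 x))\<^sup>2" by (simp add: w_def power2_commute)
    have hv: "indicator {0..L} t * (v (R\<theta> t x))\<^sup>2 = (dax x)\<^sup>2 * (indicator {0..L} t * h (R\<theta> t x))" for t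
      using inO[of t] d by (auto simp: h_def indicator_def)
    have ih: "integrable lborel (\<lambda>t. indicator {0..L} t * h (R\<theta> t x))"
      using integrable_mult_right[OF CS(2)[unfolded hv], of "1 / (dax x)\<^sup>2"] d by simp
    have "(w x)\<^sup>2 / (dax x)\<^sup>2 \<le> L * (LINT t|lborel. indicator {0..L} t * h (R\<theta> t x))"
    proof -
      have "(LINT t|lborel. indicator {0..L} t * (v (R\<theta> t x))\<^sup>2) = (dax x)\<^sup>2 * (LINT t|lborel. indicator {0..L} t * h (R\<theta> t x))"
        unfolding hv by (rule integral_mult_right_zero)
      then show ?thesis using CS(1) d unfolding w2 by (simp add: divide_le_eq mult_ac)
    qed
    also have "\<dots> \<le> \<beta> * (LINT t|lborel. indicator {0..L} t * h (R\<theta> t x))"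
      using L h0 by (intro mult_right_mono Bochner_Integration.integral_nonneg) auto
    finally have "ennreal ((w x)\<^sup>2 / (dax x)\<^sup>2) \<le> ennreal (\<beta> * (LINT t|lborel. indicator {0..L} t * h (R\<theta> t x)))"
      by (rule ennreal_leI)
    also have "\<dots> = ennreal \<beta> * (\<integral>\<^sup>+t. ennreal (indicator {0..L} t * h (R\<theta> t x)) \<partial>lborel)"
      using \<beta> ih h0 by (subst nn_integral_eq_integral) (auto simp: ennreal_mult' )
    also have "\<dots> \<le> ennreal \<beta> * (\<integral>\<^sup>+t. ennreal (indicator {0..\<beta>} t * h (R\<theta> t x)) \<partial>lborel)"
      using L h0 by (intro mult_left_mono nn_integral_mono ennreal_leI) (auto simp: indicator_def)
    finally show ?thesis using True by simp
  qed simp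
  have "(\<integral>\<^sup>+x. ennreal (indicator H x * ((w x)\<^sup>2 / (dax x)\<^sup>2)) \<partial>lborel)
      \<le> (\<integral>\<^sup>+x. ennreal \<beta> * (\<integral>\<^sup>+t. ennreal (indicator {0..\<beta>} t * h (R\<theta> t x)) \<partial>lborel) \<partial>lborel)"
    by (intro nn_integral_mono pt)
  also have "\<dots> = ennreal \<beta> * (\<integral>\<^sup>+x. (\<integral>\<^sup>+t. ennreal (indicator {0..\<beta>} t * h (R\<theta> t x)) \<partial>lborel) \<partial>lborel)"
  proof (rule nn_integral_cmult)
    have "(\<lambda>(x, t). ennreal (indicator {0..\<beta>} t * h (R\<theta> t x))) \<in> borel_measurable (lborel \<Otimes>\<^sub>M lborel)"
      using measurable_compose[OF measurable_pair_swap' jm] by (simp add: case_prod_unfold)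
    then show "(\<lambda>x. \<integral>\<^sup>+t. ennreal (indicator {0..\<beta>} t * h (R\<theta> t x)) \<partial>lborel) \<in> borel_measurable lborel"
      by (rule lborel.borel_measurable_nn_integral)
  qed
  also have "(\<integral>\<^sup>+x. (\<integral>\<^sup>+t. ennreal (indicator {0..\<beta>} t * h (R\<theta> t x)) \<partial>lborel) \<partial>lborel)
      = (\<integral>\<^sup>+t. (\<integral>\<^sup>+x. ennreal (indicator {0..\<beta>} t * h (R\<theta> t x)) \<partial>lborel) \<partial>lborel)"
    by (rule lborel_pair.Fubini') (use jm in \<open>simp add: case_prod_unfold\<close>)
  also have "\<dots> = (\<integral>\<^sup>+t. indicator {0..\<beta>} t * (\<integral>\<^sup>+x. ennreal (h x) \<partial>lborel) \<partial>lborel)"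
  proof (rule nn_integral_cong)
    fix t :: real
    have "(\<integral>\<^sup>+x. ennreal (h (R\<theta> t x)) \<partial>lborel) = (\<integral>\<^sup>+x. ennreal (h x) \<partial>lborel)"
      by (rule integral_rot(3)) measurable
    then show "(\<integral>\<^sup>+x. ennreal (indicator {0..\<beta>} t * h (R\<theta> t x)) \<partial>lborel) = indicator {0..\<beta>} t * (\<integral>\<^sup>+x. ennreal (h x) \<partial>lborel)"
      by (cases "t \<in> {0..\<beta>}") auto
  qed
  also have "\<dots> = ennreal \<beta> * (\<integral>\<^sup>+x. ennreal (h x) \<partial>lborel)"
    using \<beta> by (simp add: nn_integral_multc)
  also have "ennreal \<beta> * \<dots> < \<infinity>" using hfin by (simp add: ennreal_mult_less_top)
  finally show ?thesis
    using wm by (intro integrableI_bounded) auto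
qed

end

section \<open>The energy of the truncated difference\<close>

lemma square_add_le: "(a + b)\<^sup>2 \<le> 2 * a\<^sup>2 + 2 * b\<^sup>2" for a b :: real
  using zero_le_power2[of "a - b"] by (simp add: power2_eq_square algebra_simps)

context neumann_solution
begin

text \<open>The test function \<open>g\<^sub>e(w) \<xi>\<close> on the half sector; it need not vanish on the face \<open>\<theta> = 0\<close>.\<close>

definition "\<Phi> e k x = (if x \<in> H then gtr e (w x) * cut k x else 0)"
definition "D\<Phi> e k x = (if x \<in> H then (gtr' e (w x) * cut k x) *\<^sub>R Dw x + gtr e (w x) *\<^sub>R cut_grad k x else 0)"

definition "Ck k = closure H \<inter> {x. dax x \<ge> 1 / k} \<inter> cball 0 (2 * k)"

text \<open>Contains the support of the truncation at height \<open>e\<close>. It stays away from the arc \<open>d(x) =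
  r1\<close> and from the face \<open>\<theta> = \<beta>/2\<close>, where \<open>w\<close> vanishes, but not
  from \<open>\<theta> = 0\<close>.\<close>
definition "Kw e k = Ck k \<inter> w -` {e..}"

lemma closed_dax_ge: "closed {x. dax x \<ge> c}"
  by (intro closed_Collect_le continuous_coords continuous_intros)

lemma compact_Ck: "compact (Ck k)"
  unfolding Ck_def by (intro closed_Int_compact closed_Int closed_closure compact_cball closed_dax_ge)

lemma CkD:
  assumes "x \<in> Ck k" "k > 0"
  shows "x \<in> Cl" "ang x \<le> half" "dax x > 0" "dax x \<ge> 1 / k" "norm x \<le> 2 * k" "x $ j \<ge> 0" "x $ j = 0 \<Longrightarrow> ang x = 0"
proof -
  show "dax x > 0" using assms less_le_trans[of 0 "1 / k" "dax x"] by (simp add: Ck_def)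
  have c: "dax x \<ge> r1" "ang x \<le> half" using closure_Omega_subset[of x r1 half] assms half by (auto simp: Ck_def)
  then show "x \<in> Cl" "ang x \<le> half" using \<open>dax x > 0\<close> half by (auto simp: Cl_def)
  show "dax x \<ge> 1 / k" "norm x \<le> 2 * k" using assms by (auto simp: Ck_def)
  have "0 \<le> sin (ang x)" using c half angle_range[of x] by (intro sin_ge_zero) auto
  then show "x $ j \<ge> 0" by (simp add: coord_eq)
  show "ang x = 0" if "x $ j = 0"
  proof (rule ccontr)
    assume "ang x \<noteq> 0"
    then have "sin (ang x) > 0" using c half angle_range[of x] by (intro sin_gt_zero) auto
    then show False using that \<open>dax x > 0\<close> by (simp add: coord_eq)
  qed
qed

lemma in_Ck: "x \<in> H \<Longrightarrow> k > 0 \<Longrightarrow> cut k x \<noteq> 0 \<Longrightarrow> x \<in> Ck k"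
  using cut_support[of k x] closure_subset[of H] by (auto simp: Ck_def)

lemma compact_Kw: "k > 0 \<Longrightarrow> compact (Kw e k)"
proof -
  assume k: "k > 0"
  have "continuous_on (Ck k) w" by (rule continuous_on_subset[OF w_cont]) (use CkD(1)[OF _ k] in blast)
  then have "closed (Kw e k)" unfolding Kw_def
    by (rule continuous_closed_preimage) (auto intro: compact_imp_closed compact_Ck)
  then have "compact (Ck k \<inter> Kw e k)" by (intro compact_Int_closed compact_Ck)
  moreover have "Ck k \<inter> Kw e k = Kw e k" by (auto simp: Kw_def)
  ultimately show ?thesis by simp
qed

lemma w_zero_half: "ang x = half \<Longrightarrow> w x = 0"
proof -
  assume "ang x = half"
  then have "\<beta> - 2 * ang x = 0" by simp
  then have "S x = x" using refl_eq_rot[of \<beta> x] by (simp only: rot_0)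
  then show ?thesis by (simp add: w_def)
qed

lemma KwD:
  assumes x: "x \<in> Kw e k" and e: "e > 0" and k: "k > 0"
  shows "dax x > r1" "ang x < half"
proof -
  have xC: "x \<in> Ck k" and we: "w x > 0" using x e by (auto simp: Kw_def)
  note c = CkD[OF xC k]
  have "ang x \<noteq> half" using we w_zero_half[of x] by auto
  then show "ang x < half" using c(2) by simp
  show "dax x > r1"
  proof (rule ccontr)
    assume "\<not> dax x > r1"
    then have "dax x = r1" using c(1) by (auto simp: Cl_def)
    then have "u x = u (S x)" using u_gamma[OF c(1) refl_Cl[OF c(1)]] by simp
    then show False using we by (simp add: w_def)
  qed
qed

lemma off_Kw: "x \<in> H - Kw e k \<Longrightarrow> k > 0 \<Longrightarrow> w x \<le> e \<or> cut k x = 0"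
  using in_Ck[of x k] by (auto simp: Kw_def)

lemma \<Phi>_range: "e > 0 \<Longrightarrow> 0 \<le> \<Phi> e k x \<and> \<Phi> e k x \<le> max 0 (w x)"
proof -
  assume e: "e > 0"
  note A = gtr_nonneg(1)[OF e, of "w x"] and B = gtr_approx(1)[OF e, of "w x"]
  have "gtr e (w x) * cut k x \<le> gtr e (w x) * 1" using A cut_range by (intro mult_left_mono) auto
  then show ?thesis using A B cut_range[of k x] by (auto simp: \<Phi>_def)
qed

lemma daxH: "x \<in> H \<Longrightarrow> dax x > 0" using r1 by (auto simp: Omega_def)

lemma DPhi_bound:
  assumes e: "e > 0" and k: "k > 0"
  shows "(norm (D\<Phi> e k x))\<^sup>2 \<le> 2 * (indicator Om x * (norm (Dw x))\<^sup>2) + 2048 * (indicator H x * ((w x)\<^sup>2 / (dax x)\<^sup>2))"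
proof (cases "x \<in> H")
  case True
  then have xO: "x \<in> Om" using H_Om by blast
  have d: "dax x > 0" by (rule daxH[OF True])
  have "norm (D\<Phi> e k x) \<le> gtr' e (w x) * cut k x * norm (Dw x) + gtr e (w x) * norm (cut_grad k x)"
    using True norm_triangle_ineq[of "(gtr' e (w x) * cut k x) *\<^sub>R Dw x" "gtr e (w x) *\<^sub>R cut_grad k x"]
      gtr_nonneg[OF e, of "w x"] cut_range[of k x] by (simp add: D\<Phi>_def abs_mult)
  also have "\<dots> \<le> norm (Dw x) + \<bar>w x\<bar> * (32 / dax x)"
  proof (rule add_mono)
    have "gtr' e (w x) * cut k x \<le> 1" using gtr'_le_1[OF e] gtr_nonneg(2)[OF e] cut_range by (intro mult_le_one) auto
    then show "gtr' e (w x) * cut k x * norm (Dw x) \<le> norm (Dw x)" by (rule mult_left_le_one_le[rotated 2]) (use gtr_nonneg(2)[OF e] cut_range in auto)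
    have "norm (cut_grad k x) \<le> 32 / dax x" using cut_grad_bound[OF k, of x] d by (simp add: field_simps)
    moreover have "gtr e (w x) \<le> \<bar>w x\<bar>" using gtr_approx(1)[OF e, of "w x"] by linarith
    ultimately show "gtr e (w x) * norm (cut_grad k x) \<le> \<bar>w x\<bar> * (32 / dax x)"
      using gtr_nonneg(1)[OF e] by (intro mult_mono) auto
  qed
  finally have "(norm (D\<Phi> e k x))\<^sup>2 \<le> (norm (Dw x) + \<bar>w x\<bar> * (32 / dax x))\<^sup>2" by (intro power_mono) auto
  also have "\<dots> \<le> 2 * (norm (Dw x))\<^sup>2 + 2 * (\<bar>w x\<bar> * (32 / dax x))\<^sup>2"
    by (rule square_add_le)
  also have "2 * (\<bar>w x\<bar> * (32 / dax x))\<^sup>2 = 2048 * ((w x)\<^sup>2 / (dax x)\<^sup>2)" by (simp add: power_mult_distrib power_divide)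
  finally show ?thesis using True xO by simp
qed (simp add: D\<Phi>_def)

lemma DPhi_measurable: "e > 0 \<Longrightarrow> D\<Phi> e k \<in> borel_measurable borel"
  and Phi_measurable: "e > 0 \<Longrightarrow> \<Phi> e k \<in> borel_measurable borel"
proof -
  assume e: "e > 0"
  have wH: "continuous_on H w" and DwH: "continuous_on H Dw"
    using w_cont_Om Dw_cont H_Om continuous_on_subset by blast+
  have "continuous_on H (\<lambda>x. (gtr' e (w x) * cut k x) *\<^sub>R Dw x + gtr e (w x) *\<^sub>R cut_grad k x)"
    "continuous_on H (\<lambda>x. gtr e (w x) * cut k x)"
    by (intro continuous_intros continuous_gtr[OF e wH] continuous_cut DwH)+
  from borel_measurable_continuous_on_indicator[OF _ this(1)] borel_measurable_continuous_on_indicator[OF _ this(2)]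
  have "(\<lambda>x. indicator H x *\<^sub>R ((gtr' e (w x) * cut k x) *\<^sub>R Dw x + gtr e (w x) *\<^sub>R cut_grad k x)) \<in> borel_measurable borel"
    "(\<lambda>x. indicator H x *\<^sub>R (gtr e (w x) * cut k x)) \<in> borel_measurable borel" by simp_all
  moreover have "(\<lambda>x. indicator H x *\<^sub>R ((gtr' e (w x) * cut k x) *\<^sub>R Dw x + gtr e (w x) *\<^sub>R cut_grad k x)) = D\<Phi> e k"
    "(\<lambda>x. indicator H x *\<^sub>R (gtr e (w x) * cut k x)) = \<Phi> e k"
    by (auto simp: D\<Phi>_def \<Phi>_def indicator_def fun_eq_iff)
  ultimately show "D\<Phi> e k \<in> borel_measurable borel" "\<Phi> e k \<in> borel_measurable borel" by simp_all
qed

lemma DPhi_L2: "e > 0 \<Longrightarrow> k > 0 \<Longrightarrow> integrable lborel (\<lambda>x. (norm (D\<Phi> e k x))\<^sup>2)"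
proof -
  assume e: "e > 0" and k: "k > 0"
  note [measurable] = DPhi_measurable[OF e, of k]
  show ?thesis
  proof (rule Bochner_Integration.integrable_bound)
    show "integrable lborel (\<lambda>x. 2 * (indicator Om x * (norm (Dw x))\<^sup>2) + 2048 * (indicator H x * ((w x)\<^sup>2 / (dax x)\<^sup>2)))"
      by (intro Bochner_Integration.integrable_add integrable_mult_right Dw_L2 w_Hardy)
    show "AE x in lborel. norm ((norm (D\<Phi> e k x))\<^sup>2)
        \<le> norm (2 * (indicator Om x * (norm (Dw x))\<^sup>2) + 2048 * (indicator H x * ((w x)\<^sup>2 / (dax x)\<^sup>2)))"
      using DPhi_bound[OF e k] by (intro AE_I2) (auto intro: order_trans)
  qed measurable
qed

lemma bounded_on_Ck:
  fixes g :: "real ^ 'n \<Rightarrow> real"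
  assumes "k > 0" "continuous_on Cl g"
  obtains M where "M \<ge> 0" "\<And>x. x \<in> Ck k \<Longrightarrow> \<bar>g x\<bar> \<le> M"
proof -
  have "continuous_on (Ck k) g" by (rule continuous_on_subset[OF assms(2)]) (use CkD(1)[OF _ assms(1)] in blast)
  then obtain M where "\<forall>w\<in>g ` Ck k. norm w \<le> M"
    using compact_imp_bounded[OF compact_continuous_image[OF \<open>continuous_on (Ck k) g\<close> compact_Ck]]
    unfolding bounded_iff by blast
  then show ?thesis using that[of "max 0 M"] by (auto simp: le_max_iff_disj)
qed

lemma Phi_zero_off_Ck: "k > 0 \<Longrightarrow> x \<notin> Ck k \<Longrightarrow> \<Phi> e k x = 0"
  using in_Ck[of x k] by (auto simp: \<Phi>_def)

lemma integrable_on_Ck: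
  fixes g :: "real ^ 'n \<Rightarrow> real"
  assumes k: "k > 0" and g: "continuous_on Cl g" "\<And>x. x \<in> H \<Longrightarrow> x \<notin> Ck k \<Longrightarrow> g x = 0"
  shows "integrable lborel (\<lambda>x. indicator H x * g x)"
proof -
  have c: "continuous_on (Ck k) g" by (rule continuous_on_subset[OF g(1)]) (use CkD(1)[OF _ k] in blast)
  have "integrable lborel (\<lambda>x. indicator H x *\<^sub>R (indicator (Ck k) x *\<^sub>R g x))"
    by (rule integrable_mult_indicator[OF _ borel_integrable_compact[OF compact_Ck c]]) simp
  moreover have "(\<lambda>x. indicator H x *\<^sub>R (indicator (Ck k) x *\<^sub>R g x)) = (\<lambda>x. indicator H x * g x)"
    using g(2) by (auto simp: fun_eq_iff indicator_def)
  ultimately show ?thesis by simp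
qed

definition "energy e k = (LINT x|lborel. (norm (D\<Phi> e k x))\<^sup>2 - V x * (\<Phi> e k x)\<^sup>2)"

lemma VPhi_integrable: "e > 0 \<Longrightarrow> k > 0 \<Longrightarrow> integrable lborel (\<lambda>x. V x * (\<Phi> e k x)\<^sup>2)"
proof -
  assume e: "e > 0" and k: "k > 0"
  have "integrable lborel (\<lambda>x. indicator H x * (V x * (gtr e (w x) * cut k x)\<^sup>2))"
    by (rule integrable_on_Ck[OF k]) (use in_Ck[OF _ k] in \<open>auto intro!: continuous_intros V continuous_gtr[OF e w_cont] continuous_cut\<close>)
  moreover have "(\<lambda>x. indicator H x * (V x * (gtr e (w x) * cut k x)\<^sup>2)) = (\<lambda>x. V x * (\<Phi> e k x)\<^sup>2)"
    by (auto simp: \<Phi>_def indicator_def fun_eq_iff)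
  ultimately show ?thesis by simp
qed

text \<open>A cutoff near the face \<open>\<theta> = 0\<close>, a function of \<open>sin\<^sup>2 \<theta>\<close>.\<close>

definition "sin2 x = (x $ j)\<^sup>2 * inverse ((dax x)\<^sup>2)"
definition "face_cut h x = smooth_step (sin2 x / h\<^sup>2 - 1)"
definition "face_cut_grad h x = (smooth_step' (sin2 x / h\<^sup>2 - 1) / h\<^sup>2 * (2 * x $ i * x $ j / (dax x) ^ 4)) *\<^sub>R T\<theta> x"

lemma GDERIV_sin2:
  assumes d: "dax x > 0"
  shows "GDERIV sin2 x :> (2 * x $ i * x $ j / (dax x) ^ 4) *\<^sub>R T\<theta> x"
proof -
  have n: "GDERIV (\<lambda>x. x $ j) x :> axis j 1"
    unfolding gderiv_def using bounded_linear_imp_has_derivative[OF bounded_linear_vec_nth] by (simp add: inner_axis)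
  have n2: "GDERIV (\<lambda>x. (x $ j)\<^sup>2) x :> (2 * x $ j) *\<^sub>R axis j 1"
    by (rule GDERIV_subst[OF GDERIV_DERIV_compose[OF n, where g = "\<lambda>s. s\<^sup>2" and dg = "2 * x $ j"]])
      (auto intro!: derivative_eq_intros)
  have D: "(dax x)\<^sup>2 = (x $ i)\<^sup>2 + (x $ j)\<^sup>2" by (simp add: dist_axis_def)
  define E where "E = (dax x)\<^sup>2"
  have E: "E \<noteq> 0" "(dax x) ^ 4 = E\<^sup>2" using d by (auto simp: E_def)
  have c: "x $ j * 2 * inverse E - 2 * (x $ j) ^ 3 * (inverse E)\<^sup>2 = 2 * (x $ i)\<^sup>2 * x $ j / E\<^sup>2"
  proof -
    have "x $ j * 2 * inverse E - 2 * (x $ j) ^ 3 * (inverse E)\<^sup>2 = 2 * x $ j * (E - (x $ j)\<^sup>2) / E\<^sup>2"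
      using E(1) by (simp add: field_simps power2_eq_square power3_eq_cube)
    also have "E - (x $ j)\<^sup>2 = (x $ i)\<^sup>2" by (simp add: E_def D)
    finally show ?thesis by (simp add: mult_ac)
  qed
  have vec: "(x $ j)\<^sup>2 *\<^sub>R (- (inverse E)\<^sup>2 *\<^sub>R (- 2 *\<^sub>R T\<theta> (T\<theta> x))) + inverse E *\<^sub>R ((2 * x $ j) *\<^sub>R axis j 1)
      = (2 * x $ i * x $ j / E\<^sup>2) *\<^sub>R T\<theta> x"
    unfolding vec_eq_iff
  proof
    fix l
    consider "l = j" | "l = i" | "l \<noteq> i" "l \<noteq> j" by blast
    then show "((x $ j)\<^sup>2 *\<^sub>R (- (inverse E)\<^sup>2 *\<^sub>R (- 2 *\<^sub>R T\<theta> (T\<theta> x))) + inverse E *\<^sub>R ((2 * x $ j) *\<^sub>R axis j 1)) $ l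
      = ((2 * x $ i * x $ j / E\<^sup>2) *\<^sub>R T\<theta> x) $ l"
    proof cases
      case 1
      have "(x $ j)\<^sup>2 * (- (inverse E)\<^sup>2 * (- 2 * (- x $ j))) + inverse E * (2 * x $ j)
        = x $ j * 2 * inverse E - 2 * (x $ j) ^ 3 * (inverse E)\<^sup>2" by (simp add: power2_eq_square power3_eq_cube)
      also have "\<dots> = 2 * x $ i * x $ j / E\<^sup>2 * x $ i" unfolding c by (simp add: power2_eq_square)
      finally show ?thesis using 1 ij by (simp add: tang_def axis_def)
    next
      case 2
      then show ?thesis using ij by (simp add: tang_def axis_def divide_inverse power_inverse power2_eq_square)
    next
      case 3
      then show ?thesis by (simp add: tang_def axis_def)
    qed
  qed
  show ?thesis
    unfolding sin2_def[abs_def]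
    by (rule GDERIV_subst[OF GDERIV_mult[OF n2 GDERIV_inverse[OF GDERIV_dist_axis_square]]])
      (use d in simp, unfold E(2) E_def[symmetric], rule vec)
qed

lemma GDERIV_face_cut: "dax x > 0 \<Longrightarrow> GDERIV (face_cut h) x :> face_cut_grad h x"
proof -
  assume d: "dax x > 0"
  have 1: "GDERIV (\<lambda>x. sin2 x / h\<^sup>2 - 1) x :> (1 / h\<^sup>2) *\<^sub>R ((2 * x $ i * x $ j / (dax x) ^ 4) *\<^sub>R T\<theta> x)"
    using GDERIV_diff[OF GDERIV_mult[OF GDERIV_sin2[OF d] GDERIV_const[of "1 / h\<^sup>2"]] GDERIV_const[of 1]] by simp
  show ?thesis unfolding face_cut_def[abs_def]
    by (rule GDERIV_subst[OF GDERIV_DERIV_compose[OF 1 DERIV_smooth_step]]) (simp add: face_cut_grad_def)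
qed

lemma continuous_face_cut_grad: "continuous_on H (face_cut_grad h)"
proof -
  have "continuous_on H sin2" by (rule GDERIV_continuous_on[OF GDERIV_sin2[OF daxH]])
  then have c: "continuous_on H (\<lambda>x. smooth_step' (sin2 x / h\<^sup>2 - 1))"
    by (cases "h = 0") (auto intro!: continuous_smooth_step continuous_intros)
  have d: "\<forall>x\<in>H. (dax x) ^ 4 \<noteq> 0" using daxH by force
  have nth: "continuous_on H (\<lambda>x. x $ l)" for l by (intro continuous_intros)
  show ?thesis unfolding face_cut_grad_def[abs_def]
    by (cases "h = 0") (auto intro!: continuous_on_scaleR continuous_on_mult continuous_on_divide continuous_on_power
        c nth d[rule_format] continuous_coords continuous_on_const dest: daxH)
qed

lemma face_cut_range: "0 \<le> face_cut h x" "face_cut h x \<le> 1"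
  using smooth_step_bounds by (auto simp: face_cut_def)

lemma face_cut_zero_imp: "face_cut h x = 0 \<Longrightarrow> face_cut_grad h x = 0"
  unfolding face_cut_def face_cut_grad_def using smooth_step_simps(3)[OF smooth_step_zero_iff] by simp

lemma sin2_eq: "dax x > 0 \<Longrightarrow> sin2 x = (x $ j / dax x)\<^sup>2"
  by (simp add: sin2_def field_simps)

lemma face_cut_zero:
  assumes "dax x > 0" "0 \<le> x $ j" "x $ j \<le> h * dax x" "h > 0"
  shows "face_cut h x = 0"
proof -
  have "0 \<le> x $ j / dax x" "x $ j / dax x \<le> h" using assms by (auto simp: field_simps)
  then have "sin2 x \<le> h\<^sup>2" unfolding sin2_eq[OF assms(1)] by (intro power_mono) auto
  then show ?thesis using assms(4) by (auto simp: face_cut_def divide_le_eq intro!: smooth_step_simps(1))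
qed

lemma face_cut_one:
  assumes "dax x > 0" "2 * h * dax x \<le> x $ j" "h > 0"
  shows "face_cut h x = 1" "face_cut_grad h x = 0"
proof -
  have "2 * h \<le> x $ j / dax x" using assms by (auto simp: field_simps)
  then have "(2 * h)\<^sup>2 \<le> sin2 x" unfolding sin2_eq[OF assms(1)] using assms(3) by (intro power_mono) auto
  then have "4 * h\<^sup>2 \<le> sin2 x" by (simp add: power_mult_distrib)
  then have "2 * h\<^sup>2 \<le> sin2 x" using zero_le_power2[of h] by linarith
  then have "sin2 x / h\<^sup>2 - 1 \<ge> 1" using assms(3) by (simp add: field_simps)
  then show "face_cut h x = 1" "face_cut_grad h x = 0"
    using smooth_step_simps(2,4) by (auto simp: face_cut_def face_cut_grad_def)
qed

text \<open>The gradient of the cut-off is tangential, so only the angular derivative \<open>v + v \<circ> S\<close> of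
  \<open>w\<close> is seen; this tends to zero at the face.\<close>
lemma face_cut_grad_bound:
  assumes x: "x \<in> H" "x $ j \<ge> 0" and h: "h > 0"
  shows "\<bar>Dw x \<bullet> face_cut_grad h x\<bar> \<le> 16 / (h * (dax x)\<^sup>2) * \<bar>v x + v (S x)\<bar>"
proof (cases "2 * h * dax x \<le> x $ j")
  case True
  then show ?thesis using face_cut_one(2)[OF daxH[OF x(1)] True h] h by simp
next
  case False
  define d where "d = dax x"
  have d: "d > 0" using daxH[OF x(1)] by (simp add: d_def)
  have xi: "\<bar>x $ i\<bar> \<le> d" unfolding d_def dist_axis_def by (simp add: real_le_rsqrt)
  have xj: "\<bar>x $ j\<bar> \<le> 2 * h * d" using False x(2) by (simp add: d_def)
  have "\<bar>2 * x $ i\<bar> * \<bar>x $ j\<bar> \<le> (2 * d) * (2 * h * d)"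
    using xi xj d h by (intro mult_mono) (auto simp: abs_mult)
  then have "\<bar>2 * x $ i * x $ j\<bar> / d ^ 4 \<le> 2 * d * (2 * h * d) / d ^ 4"
    unfolding abs_mult[of "2 * x $ i"] using d by (intro divide_right_mono) auto
  then have "\<bar>2 * x $ i * x $ j / d ^ 4\<bar> \<le> 2 * d * (2 * h * d) / d ^ 4" using d by simp
  also have "\<dots> = 4 * h / d\<^sup>2" using d by (simp add: power2_eq_square power4_eq_xxxx)
  finally have a: "\<bar>2 * x $ i * x $ j / d ^ 4\<bar> \<le> 4 * h / d\<^sup>2" .
  have b: "\<bar>smooth_step' (sin2 x / h\<^sup>2 - 1) / h\<^sup>2\<bar> \<le> 4 / h\<^sup>2"
    using smooth_step_bounds(3,4) h by (simp add: divide_right_mono)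
  have "\<bar>smooth_step' (sin2 x / h\<^sup>2 - 1) / h\<^sup>2 * (2 * x $ i * x $ j / d ^ 4)\<bar> \<le> 4 / h\<^sup>2 * (4 * h / d\<^sup>2)"
    unfolding abs_mult[of "smooth_step' (sin2 x / h\<^sup>2 - 1) / h\<^sup>2"] by (rule mult_mono[OF b a]) auto
  also have "\<dots> = 16 / (h * d\<^sup>2)" using h by (simp add: power2_eq_square)
  finally have c: "\<bar>smooth_step' (sin2 x / h\<^sup>2 - 1) / h\<^sup>2 * (2 * x $ i * x $ j / d ^ 4)\<bar> \<le> 16 / (h * d\<^sup>2)" .
  have "x \<in> Om" using x H_Om by blast
  then have "\<bar>Dw x \<bullet> face_cut_grad h x\<bar> = \<bar>smooth_step' (sin2 x / h\<^sup>2 - 1) / h\<^sup>2 * (2 * x $ i * x $ j / d ^ 4)\<bar> * \<bar>v x + v (S x)\<bar>"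
    by (simp add: face_cut_grad_def d_def[symmetric] abs_mult Dw_tang)
  also have "\<dots> \<le> 16 / (h * d\<^sup>2) * \<bar>v x + v (S x)\<bar>" by (rule mult_right_mono[OF c]) simp
  finally show ?thesis by (simp add: d_def)
qed

text \<open>On the face \<open>\<theta> = 0\<close> the function \<open>w\<close> has vanishing normal derivative but is
  not known to be differentiable up to the face, so the energy identity is applied with a weight that vanishes
  near the face. The flux error is at most a constant times \<open>\<eta> / h\<close> on a set of measure of
  order \<open>h\<close>, where \<open>\<eta>\<close> bounds \<open>v + v \<circ> S\<close> on that set; so it
  disappears as \<open>h\<close> tends to zero.\<close>
lemma energy_estimate:
  assumes e: "e > 0" and k: "k > 0"
  shows "energy e k \<le> 2 * e * (LINT x|lborel. indicator H x * (\<bar>V x\<bar> * max 0 (w x) * (cut k x)\<^sup>2))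
     + (LINT x|lborel. indicator H x * ((w x)\<^sup>2 * (norm (cut_grad k x))\<^sup>2))" (is "_ \<le> 2 * e * ?c + ?d")
proof -
  have wH: "continuous_on H w" and DwH: "continuous_on H Dw" and VH: "continuous_on H V"
    using w_cont_Om Dw_cont VOm H_Om continuous_on_subset by blast+
  have ci: "integrable lborel (\<lambda>x. indicator H x * (\<bar>V x\<bar> * max 0 (w x) * (cut k x)\<^sup>2))"
    by (rule integrable_on_Ck[OF k]) (use in_Ck[OF _ k] in \<open>auto intro!: continuous_intros V w_cont continuous_cut\<close>)
  have dbd: "indicator H x * ((w x)\<^sup>2 * (norm (cut_grad k x))\<^sup>2) \<le> 1024 * (indicator H x * ((w x)\<^sup>2 / (dax x)\<^sup>2))" for x
  proof (cases "x \<in> H")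
    case True
    have d: "dax x > 0" by (rule daxH[OF True])
    have "norm (cut_grad k x) \<le> 32 / dax x" using cut_grad_bound[OF k, of x] d by (simp add: field_simps)
    then have "(norm (cut_grad k x))\<^sup>2 \<le> (32 / dax x)\<^sup>2" by (intro power_mono) auto
    then have "(w x)\<^sup>2 * (norm (cut_grad k x))\<^sup>2 \<le> (w x)\<^sup>2 * (32 / dax x)\<^sup>2" by (intro mult_left_mono) auto
    then show ?thesis using True by (simp add: power_divide mult.commute)
  qed simp
  have di: "integrable lborel (\<lambda>x. indicator H x * ((w x)\<^sup>2 * (norm (cut_grad k x))\<^sup>2))"
  proof (rule Bochner_Integration.integrable_bound[OF integrable_mult_right[OF w_Hardy, of 1024]])
    have "continuous_on H (\<lambda>x. (w x)\<^sup>2 * (norm (cut_grad k x))\<^sup>2)" by (intro continuous_intros wH continuous_cut)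
    from borel_measurable_continuous_on_indicator[OF _ this]
    show "(\<lambda>x. indicator H x * ((w x)\<^sup>2 * (norm (cut_grad k x))\<^sup>2)) \<in> borel_measurable lborel" by simp
    show "AE x in lborel. norm (indicator H x * ((w x)\<^sup>2 * (norm (cut_grad k x))\<^sup>2)) \<le> norm (1024 * (indicator H x * ((w x)\<^sup>2 / (dax x)\<^sup>2)))"
      using dbd by (intro AE_I2) (auto intro: order_trans)
  qed
  obtain M where M: "M \<ge> 0" "\<And>x. x \<in> Ck k \<Longrightarrow> \<bar>w x\<bar> \<le> M" using bounded_on_Ck[OF k w_cont] by blast
  define A where "A = M * (16 * k\<^sup>2)"
  have A: "A \<ge> 0" using M by (simp add: A_def)
  define B where "B h = cbox (\<chi> l. if l = j then 0 else (- (2 * k) :: real)) (\<chi> l. if l = j then 4 * h * k else (2 * k :: real))" for h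
  define N1 where "N1 = (4 * k) ^ (CARD('n) - 1)"
  have B: "measure lborel (B h) = 4 * h * k * N1" "emeasure lborel (B h) < \<infinity>" if "h > 0" for h
  proof -
    have ne: "B h \<noteq> {}" unfolding B_def interval_ne_empty_cart using that k by auto
    have "measure lborel (B h) = (\<Prod>l\<in>UNIV. if l = j then 4 * h * k else 4 * k)"
      unfolding B_def content_cbox_cart[OF ne[unfolded B_def]] by (intro prod.cong) auto
    also have "\<dots> = (4 * h * k) * (\<Prod>l\<in>UNIV - {j}. if l = j then 4 * h * k else 4 * k)" by (subst prod.remove[of UNIV j]) auto
    also have "(\<Prod>l\<in>UNIV - {j}. if l = j then 4 * h * k else 4 * k) = N1"
      by (simp add: N1_def card_Diff_singleton)
    finally show "measure lborel (B h) = 4 * h * k * N1" .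
    show "emeasure lborel (B h) < \<infinity>" unfolding B_def by (rule emeasure_lborel_cbox_finite)
  qed
  have main: "(LINT x|lborel. face_cut h x * ((norm (D\<Phi> e k x))\<^sup>2 - V x * (\<Phi> e k x)\<^sup>2)) \<le> 2 * e * ?c + ?d + A * \<eta> * (4 * k * N1)"
    if h: "h > 0" and \<eta>: "\<eta> \<ge> 0" "\<And>x. x \<in> Ck k \<Longrightarrow> x $ j < 2 * h * dax x \<Longrightarrow> \<bar>v x + v (S x)\<bar> \<le> \<eta>" for h \<eta>
  proof -
    define K where "K = Kw e k \<inter> {x. x $ j \<ge> h * dax x}"
    have cK: "compact K"
      unfolding K_def by (intro compact_Int_closed compact_Kw[OF k] closed_Collect_le continuous_intros continuous_coords)
    have KC: "x \<in> Ck k" if "x \<in> K" for x using that by (auto simp: K_def Kw_def)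
    have KH: "K \<subseteq> H"
    proof
      fix x assume x: "x \<in> K"
      have xK: "x \<in> Kw e k" using x by (simp add: K_def)
      note c = CkD[OF KC[OF x] k]
      have "x $ j > 0" using x c(3) h less_le_trans[of 0 "h * dax x" "x $ j"] by (simp add: K_def)
      then have "ang x \<noteq> 0" using coord_eq(2)[of x] by auto
      then show "x \<in> H" using KwD[OF xK e k] angle_range[of x] by (auto simp: Omega_def)
    qed
    have xj: "x $ j \<ge> 0" if "x \<in> H" for x
    proof -
      have "0 \<le> sin (ang x)" using that half by (intro sin_ge_zero) (auto simp: Omega_def)
      then show ?thesis by (simp add: coord_eq)
    qed
    have off: "w x \<le> e \<or> cut k x = 0 \<or> face_cut h x = 0" if "x \<in> H - K" for x
      using off_Kw[of x e k] k that face_cut_zero[OF daxH[of x] xj[of x], of h] h by (force simp: K_def)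
    have sub: "(LINT x|lborel. Dw x \<bullet> G x) \<le> (LINT x|lborel. V x * w x * \<psi> x)" if "C1c H \<psi> G" "\<And>x. \<psi> x \<ge> 0" for \<psi> G
      by (rule w_subsolution[OF C1c_mono[OF that(1) H_Om] that(2)])
    have "(LINT x|lborel. face_cut h x * ((norm (D\<Phi> e k x))\<^sup>2 - V x * (\<Phi> e k x)\<^sup>2))
        = (LINT x|lborel. indicator H x * (face_cut h x * ((norm ((gtr' e (w x) * cut k x) *\<^sub>R Dw x + gtr e (w x) *\<^sub>R cut_grad k x))\<^sup>2
            - V x * (gtr e (w x) * cut k x)\<^sup>2)))"
      by (intro Bochner_Integration.integral_cong refl) (simp add: D\<Phi>_def \<Phi>_def)
    also have "\<dots> \<le> (LINT x|lborel. indicator H x * (face_cut h x * (2 * e * \<bar>V x\<bar> * gtr e (w x) * (cut k x)\<^sup>2 + (gtr e (w x))\<^sup>2 * (norm (cut_grad k x))\<^sup>2)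
            + Gtr e (w x) * (cut k x)\<^sup>2 * \<bar>Dw x \<bullet> face_cut_grad h x\<bar>))"
      by (rule truncated_energy(1)[OF open_Sec w_gderiv DwH VH GDERIV_cut continuous_cut(2) cut_zero_imp GDERIV_face_cut[OF daxH]
            continuous_face_cut_grad face_cut_zero_imp face_cut_range(1) e sub cK KH off]) (use H_Om in auto)
    also have "\<dots> \<le> (LINT x|lborel. 2 * e * (indicator H x * (\<bar>V x\<bar> * max 0 (w x) * (cut k x)\<^sup>2))
        + indicator H x * ((w x)\<^sup>2 * (norm (cut_grad k x))\<^sup>2) + (A / h * \<eta>) * indicator (B h) x)"
    proof (rule integral_mono')
      show "integrable lborel (\<lambda>x. 2 * e * (indicator H x * (\<bar>V x\<bar> * max 0 (w x) * (cut k x)\<^sup>2))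
        + indicator H x * ((w x)\<^sup>2 * (norm (cut_grad k x))\<^sup>2) + (A / h * \<eta>) * indicator (B h) x)"
        using ci di B(2)[OF h] by (intro Bochner_Integration.integrable_add integrable_mult_right integrable_real_indicator) (auto simp: B_def)
      fix x
      show "0 \<le> 2 * e * (indicator H x * (\<bar>V x\<bar> * max 0 (w x) * (cut k x)\<^sup>2))
        + indicator H x * ((w x)\<^sup>2 * (norm (cut_grad k x))\<^sup>2) + (A / h * \<eta>) * indicator (B h) x"
        using e A h \<eta>(1) by (intro add_nonneg_nonneg mult_nonneg_nonneg) auto
      show "indicator H x * (face_cut h x * (2 * e * \<bar>V x\<bar> * gtr e (w x) * (cut k x)\<^sup>2 + (gtr e (w x))\<^sup>2 * (norm (cut_grad k x))\<^sup>2)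
            + Gtr e (w x) * (cut k x)\<^sup>2 * \<bar>Dw x \<bullet> face_cut_grad h x\<bar>)
        \<le> 2 * e * (indicator H x * (\<bar>V x\<bar> * max 0 (w x) * (cut k x)\<^sup>2))
        + indicator H x * ((w x)\<^sup>2 * (norm (cut_grad k x))\<^sup>2) + (A / h * \<eta>) * indicator (B h) x"
      proof (cases "x \<in> H")
        case True
        have g1: "0 \<le> gtr e (w x)" "gtr e (w x) \<le> max 0 (w x)"
          using gtr_nonneg(1)[OF e] gtr_approx(1)[OF e] by auto
        have 1: "face_cut h x * (2 * e * \<bar>V x\<bar> * gtr e (w x) * (cut k x)\<^sup>2 + (gtr e (w x))\<^sup>2 * (norm (cut_grad k x))\<^sup>2)
            \<le> 1 * (2 * e * \<bar>V x\<bar> * max 0 (w x) * (cut k x)\<^sup>2 + (w x)\<^sup>2 * (norm (cut_grad k x))\<^sup>2)"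
        proof (rule mult_mono)
          have "2 * e * \<bar>V x\<bar> * gtr e (w x) * (cut k x)\<^sup>2 \<le> 2 * e * \<bar>V x\<bar> * max 0 (w x) * (cut k x)\<^sup>2"
            using g1 e by (intro mult_right_mono mult_left_mono) auto
          moreover have "(gtr e (w x))\<^sup>2 \<le> (w x)\<^sup>2"
            using g1 by (intro power2_mono) (auto simp: max_def split: if_splits)
          then have "(gtr e (w x))\<^sup>2 * (norm (cut_grad k x))\<^sup>2 \<le> (w x)\<^sup>2 * (norm (cut_grad k x))\<^sup>2"
            by (intro mult_right_mono) auto
          ultimately show "2 * e * \<bar>V x\<bar> * gtr e (w x) * (cut k x)\<^sup>2 + (gtr e (w x))\<^sup>2 * (norm (cut_grad k x))\<^sup>2
            \<le> 2 * e * \<bar>V x\<bar> * max 0 (w x) * (cut k x)\<^sup>2 + (w x)\<^sup>2 * (norm (cut_grad k x))\<^sup>2" by linarith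
        qed (use face_cut_range g1 e in auto)
        have 2: "Gtr e (w x) * (cut k x)\<^sup>2 * \<bar>Dw x \<bullet> face_cut_grad h x\<bar> \<le> (A / h * \<eta>) * indicator (B h) x"
        proof (cases "cut k x = 0 \<or> 2 * h * dax x \<le> x $ j")
          case True
          then have "Gtr e (w x) * (cut k x)\<^sup>2 * \<bar>Dw x \<bullet> face_cut_grad h x\<bar> = 0"
            using face_cut_one(2)[OF daxH[OF \<open>x \<in> H\<close>] _ h] by auto
          moreover have "0 \<le> (A / h * \<eta>) * indicator (B h) x" using A h \<eta>(1) by (intro mult_nonneg_nonneg) auto
          ultimately show ?thesis by linarith
        next
          case False
          then have xC: "x \<in> Ck k" using in_Ck[OF \<open>x \<in> H\<close> k] by blast
          note c = CkD[OF xC k]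
          have xB: "x \<in> B h"
          proof -
            have n: "\<bar>x $ l\<bar> \<le> 2 * k" for l using component_le_norm_cart[of x l] c(5) by linarith
            have "2 * h * dax x \<le> 2 * h * (2 * k)"
              using c(5) dist_axis_le_norm[of x] h by (intro mult_left_mono) auto
            then have "x $ j \<le> 4 * h * k" using False by simp
            then show ?thesis unfolding B_def mem_box_cart using n c(6) by (auto simp: abs_le_iff minus_le_iff)
          qed
          have "Gtr e (w x) \<le> M"
          proof -
            have "gtr e (w x) * gtr' e (w x) \<le> gtr e (w x) * 1" using gtr'_le_1[OF e] g1 by (intro mult_left_mono) auto
            then show ?thesis using g1(2) M(2)[OF xC] M(1) by (auto simp: Gtr_def)
          qed
          moreover have "(cut k x)\<^sup>2 \<le> 1" using cut_range by (simp add: power_le_one)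
          ultimately have G1: "Gtr e (w x) * (cut k x)\<^sup>2 \<le> M * 1" using M(1) by (intro mult_mono) auto
          have G2: "\<bar>Dw x \<bullet> face_cut_grad h x\<bar> \<le> 16 * k\<^sup>2 / h * \<eta>"
          proof -
            have "1 / (dax x)\<^sup>2 \<le> k\<^sup>2"
            proof -
              have "1 \<le> k * dax x" using c(4) k by (simp add: field_simps)
              then have "1 \<le> (k * dax x)\<^sup>2" by (rule one_le_power)
              then show ?thesis using c(3) by (simp add: field_simps power_mult_distrib)
            qed
            then have "16 / (h * (dax x)\<^sup>2) \<le> 16 * k\<^sup>2 / h"
              using h mult_left_mono[of "1 / (dax x)\<^sup>2" "k\<^sup>2" "16 / h"] by simp
            moreover have "\<bar>v x + v (S x)\<bar> \<le> \<eta>" using \<eta>(2)[OF xC] False by simp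
            ultimately have "16 / (h * (dax x)\<^sup>2) * \<bar>v x + v (S x)\<bar> \<le> 16 * k\<^sup>2 / h * \<eta>"
              using h by (intro mult_mono) auto
            then show ?thesis using face_cut_grad_bound[OF \<open>x \<in> H\<close> c(6) h] by linarith
          qed
          have "Gtr e (w x) * (cut k x)\<^sup>2 * \<bar>Dw x \<bullet> face_cut_grad h x\<bar> \<le> (M * 1) * (16 * k\<^sup>2 / h * \<eta>)"
            by (rule mult_mono[OF G1 G2]) (use M(1) in auto)
          then show ?thesis using xB by (simp add: A_def mult_ac)
        qed
        show ?thesis using 1 2 True by (simp add: algebra_simps)
      qed (use A h \<eta>(1) in simp)
    qed
    also have "\<dots> = 2 * e * ?c + ?d + (A / h * \<eta>) * measure lborel (B h)"
      using ci di B(2)[OF h] by (simp add: B_def)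
    also have "(A / h * \<eta>) * measure lborel (B h) = A * \<eta> * (4 * k * N1)"
      unfolding B(1)[OF h] using h by simp
    finally show ?thesis .
  qed
  have small: "\<exists>\<delta>>0. \<forall>x\<in>Ck k. x $ j < \<delta> * dax x \<longrightarrow> \<bar>v x + v (S x)\<bar> < \<eta>" if \<eta>: "\<eta> > 0" for \<eta>
  proof -
    have vc: "continuous_on Cl (\<lambda>x. \<bar>v x + v (S x)\<bar>)"
      by (intro continuous_intros p(3) continuous_on_compose2[OF p(3) cont_refl[OF continuous_on_id]]) (auto simp: refl_Cl)
    define Z where "Z = Ck k \<inter> (\<lambda>x. \<bar>v x + v (S x)\<bar>) -` {\<eta>..}"
    have "closed Z" unfolding Z_def
      by (rule continuous_closed_preimage[OF continuous_on_subset[OF vc]]) (use CkD(1)[OF _ k] compact_imp_closed[OF compact_Ck] in auto)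
    then have "compact (Ck k \<inter> Z)" by (intro compact_Int_closed compact_Ck)
    moreover have "Ck k \<inter> Z = Z" by (auto simp: Z_def)
    ultimately have cZ: "compact Z" by simp
    show ?thesis
    proof (cases "Z = {}")
      case True
      then show ?thesis by (intro exI[of _ 1]) (auto simp: Z_def not_le[symmetric])
    next
      case False
      have "continuous_on Z (\<lambda>x. x $ j / dax x)"
        using CkD(3)[OF _ k] by (intro continuous_intros continuous_coords) (force simp: Z_def)
      from continuous_attains_inf[OF cZ False this]
      obtain x1 where x1: "x1 \<in> Z" "\<And>x. x \<in> Z \<Longrightarrow> x1 $ j / dax x1 \<le> x $ j / dax x" by blast
      have x1C: "x1 \<in> Ck k" using x1 by (simp add: Z_def)
      note c = CkD[OF x1C k]
      have "x1 $ j \<noteq> 0"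
      proof
        assume "x1 $ j = 0"
        then have a: "ang x1 = 0" by (rule c(7))
        then have "v x1 = 0" using p_boundary[OF c(1)] by (simp add: Omega_def)
        moreover have "ang (S x1) = \<beta>" using angle_refl[OF c(3), of \<beta>] a \<beta> by simp
        then have "v (S x1) = 0" using p_boundary[OF refl_Cl[OF c(1)]] by (simp add: Omega_def)
        ultimately show False using x1(1) \<eta> by (simp add: Z_def)
      qed
      then have pos: "x1 $ j / dax x1 > 0" using c(3,6) by simp
      show ?thesis
      proof (intro exI[of _ "x1 $ j / dax x1"] conjI pos ballI impI)
        fix x assume x: "x \<in> Ck k" "x $ j < x1 $ j / dax x1 * dax x"
        have "x \<notin> Z"
        proof
          assume "x \<in> Z"
          from x1(2)[OF this] show False using x(2) CkD(3)[OF x(1) k] by (simp add: field_simps)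
        qed
        then show "\<bar>v x + v (S x)\<bar> < \<eta>" using x(1) by (auto simp: Z_def)
      qed
    qed
  qed
  define hm where "hm m = 1 / real (Suc m)" for m
  have hm: "hm m > 0" for m by (simp add: hm_def)
  have "hm = (\<lambda>m. inverse (real (Suc m)))" by (auto simp: hm_def inverse_eq_divide)
  then have hlim: "hm \<longlonglongrightarrow> 0" using LIMSEQ_inverse_real_of_nat by (simp only:)
  have Ei: "integrable lborel (\<lambda>x. (norm (D\<Phi> e k x))\<^sup>2 - V x * (\<Phi> e k x)\<^sup>2)"
    using DPhi_L2[OF e k] VPhi_integrable[OF e k] by simp
  have face1: "\<forall>\<^sub>F m in sequentially. face_cut (hm m) x = 1" if "x \<in> H" for x
  proof -
    have "ang x \<in> {0<..<half}" using that by (simp add: Omega_def)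
    then have "sin (ang x) > 0" using half by (intro sin_gt_zero) auto
    then have s: "x $ j / dax x > 0" using daxH[OF that] by (simp add: coord_eq(2)[of x])
    have "(\<lambda>m. 2 * hm m) \<longlonglongrightarrow> 0" using tendsto_mult[OF tendsto_const hlim, of 2] by simp
    from order_tendstoD(2)[OF this s] show ?thesis
    proof eventually_elim
      case (elim m)
      then have "2 * hm m * dax x \<le> x $ j" using daxH[OF that] by (simp add: field_simps)
      then show ?case by (rule face_cut_one(1)[OF daxH[OF that] _ hm])
    qed
  qed
  have fm: "(\<lambda>x. indicator H x * face_cut h x) \<in> borel_measurable borel" for h
    using borel_measurable_continuous_on_indicator[OF _ GDERIV_continuous_on[OF GDERIV_face_cut[OF daxH], of H]] by simp
  have zH: "D\<Phi> e k x = 0" "\<Phi> e k x = 0" if "x \<notin> H" for x using that by (auto simp: D\<Phi>_def \<Phi>_def)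
  have lim: "(\<lambda>m. LINT x|lborel. face_cut (hm m) x * ((norm (D\<Phi> e k x))\<^sup>2 - V x * (\<Phi> e k x)\<^sup>2)) \<longlonglongrightarrow> energy e k"
    unfolding energy_def
  proof (rule integral_dominated_convergence[OF _ _ integrable_norm[OF Ei]])
    show "AE x in lborel. (\<lambda>m. face_cut (hm m) x * ((norm (D\<Phi> e k x))\<^sup>2 - V x * (\<Phi> e k x)\<^sup>2))
        \<longlonglongrightarrow> (norm (D\<Phi> e k x))\<^sup>2 - V x * (\<Phi> e k x)\<^sup>2"
    proof (rule AE_I2)
      fix x
      show "(\<lambda>m. face_cut (hm m) x * ((norm (D\<Phi> e k x))\<^sup>2 - V x * (\<Phi> e k x)\<^sup>2))
        \<longlonglongrightarrow> (norm (D\<Phi> e k x))\<^sup>2 - V x * (\<Phi> e k x)\<^sup>2"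
      proof (cases "x \<in> H")
        case True
        have "\<forall>\<^sub>F m in sequentially. face_cut (hm m) x * ((norm (D\<Phi> e k x))\<^sup>2 - V x * (\<Phi> e k x)\<^sup>2)
          = (norm (D\<Phi> e k x))\<^sup>2 - V x * (\<Phi> e k x)\<^sup>2"
          using face1[OF True] by eventually_elim (simp only: mult_1_left)
        then show ?thesis by (rule tendsto_eventually)
      qed (simp add: zH)
    qed
    show "AE x in lborel. norm (face_cut (hm m) x * ((norm (D\<Phi> e k x))\<^sup>2 - V x * (\<Phi> e k x)\<^sup>2))
        \<le> norm ((norm (D\<Phi> e k x))\<^sup>2 - V x * (\<Phi> e k x)\<^sup>2)" for m
      using face_cut_range by (intro AE_I2) (simp add: abs_mult mult_left_le_one_le)
    show "(\<lambda>x. face_cut (hm m) x * ((norm (D\<Phi> e k x))\<^sup>2 - V x * (\<Phi> e k x)\<^sup>2)) \<in> borel_measurable lborel" for m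
    proof -
      have "(\<lambda>x. face_cut (hm m) x * ((norm (D\<Phi> e k x))\<^sup>2 - V x * (\<Phi> e k x)\<^sup>2))
        = (\<lambda>x. (indicator H x * face_cut (hm m) x) * ((norm (D\<Phi> e k x))\<^sup>2 - V x * (\<Phi> e k x)\<^sup>2))"
        using zH by (auto simp: fun_eq_iff indicator_def)
      also have "\<dots> \<in> borel_measurable lborel"
        using borel_measurable_times[OF fm[of "hm m"]] borel_measurable_integrable[OF Ei] by simp
      finally show ?thesis .
    qed
  qed (use Ei in auto)
  have "energy e k \<le> 2 * e * ?c + ?d + A * \<eta> * (4 * k * N1)" if \<eta>: "\<eta> > 0" for \<eta>
  proof -
    obtain \<delta> where \<delta>: "\<delta> > 0" "\<And>x. x \<in> Ck k \<Longrightarrow> x $ j < \<delta> * dax x \<Longrightarrow> \<bar>v x + v (S x)\<bar> < \<eta>"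
      using small[OF \<eta>] by blast
    have "(\<lambda>m. 2 * hm m) \<longlonglongrightarrow> 0" using tendsto_mult[OF tendsto_const hlim, of 2] by simp
    from order_tendstoD(2)[OF this \<delta>(1)]
    have "\<forall>\<^sub>F m in sequentially. (LINT x|lborel. face_cut (hm m) x * ((norm (D\<Phi> e k x))\<^sup>2 - V x * (\<Phi> e k x)\<^sup>2)) \<le> 2 * e * ?c + ?d + A * \<eta> * (4 * k * N1)"
    proof eventually_elim
      case (elim m)
      show ?case
      proof (rule main[OF hm])
        fix x assume x: "x \<in> Ck k" "x $ j < 2 * hm m * dax x"
        have "2 * hm m * dax x \<le> \<delta> * dax x" using elim CkD(3)[OF x(1) k] by (intro mult_right_mono) auto
        then show "\<bar>v x + v (S x)\<bar> \<le> \<eta>" using \<delta>(2)[OF x(1)] x(2) by linarith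
      qed (use \<eta> in simp)
    qed
    then show ?thesis by (rule tendsto_upperbound[OF lim]) simp
  qed
  then have le: "energy e k \<le> 2 * e * ?c + ?d + \<eta> * (A * (4 * k * N1))" if "\<eta> > 0" for \<eta>
  proof -
    have "A * \<eta> * (4 * k * N1) = \<eta> * (A * (4 * k * N1))" by simp
    with that show ?thesis using \<open>\<And>\<eta>. \<eta> > 0 \<Longrightarrow> energy e k \<le> 2 * e * ?c + ?d + A * \<eta> * (4 * k * N1)\<close>[of \<eta>] by linarith
  qed
  show ?thesis
  proof (rule field_le_epsilon)
    fix \<epsilon> :: real assume \<epsilon>: "\<epsilon> > 0"
    define Q where "Q = A * (4 * k * N1)"
    have Q: "Q \<ge> 0" using A k by (simp add: Q_def N1_def)
    have "\<epsilon> / (Q + 1) * Q \<le> \<epsilon>" using Q \<epsilon> by (simp add: divide_le_eq)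
    then show "energy e k \<le> 2 * e * ?c + ?d + \<epsilon>" using le[of "\<epsilon> / (Q + 1)"] Q \<epsilon> unfolding Q_def[symmetric] by fastforce
  qed
qed

end

section \<open>Stability of the half sector and the sign of the difference\<close>

lemma (in cyl_coords) cut_rot [simp]: "cut k (R\<theta> t x) = cut k x"
  by (simp add: cut_def)

context neumann_solution
begin

text \<open>The truncation of \<open>w\<close> is differentiable only in the open half sector. Rotating it slightly
  moves points of the face \<open>\<theta> = 0\<close> into the interior and so gives an admissible function;
  the energies converge as the rotation tends to the identity.\<close>
lemma rotated_test_function:
  assumes e: "e > 0" and k: "k > 0" and \<eta>: "\<eta> > 0"
  shows "\<exists>h g. 0 < h \<and> h < \<eta> \<and> h < 2 * pi - \<beta> \<and> tf (\<lambda>x. if x \<in> Fc then \<Phi> e k (R\<theta> h x) else 0) g \<and>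
     closure {x. (if x \<in> Fc then \<Phi> e k (R\<theta> h x) else 0) \<noteq> 0} \<subseteq> H \<union> Gamma_face i j r1 0 \<and>
     QF V (\<lambda>x. if x \<in> Fc then \<Phi> e k (R\<theta> h x) else 0) g \<le> energy e k + \<eta>"
proof -
  define W where "W = Omega i j (-1) 0 (2 * pi)"
  have W: "x \<in> W \<longleftrightarrow> ang x > 0" for x
    using angle_range[of x] dist_axis_nonneg[of x] by (auto simp: W_def Omega_def simp del: dist_axis_nonneg)
  have oW: "open W" unfolding W_def by (rule open_Omega) simp
  have oK: "open (- Kw e k)" using compact_Kw[OF k] compact_imp_closed by blast
  have KwH: "x \<in> H" if "x \<in> W" "x \<in> Kw e k" for x
    using KwD[OF that(2) e k] that(1) by (auto simp: W Omega_def)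
  have wH: "continuous_on H w" and DwH: "continuous_on H Dw"
    using w_cont_Om Dw_cont H_Om continuous_on_subset by blast+
  have zero: "\<Phi> e k x = 0" "D\<Phi> e k x = 0" if "x \<notin> Kw e k" for x
    using off_Kw[of x e k] k that cut_zero_imp[of k x] by (auto simp: \<Phi>_def D\<Phi>_def gtr_zero)
  have gd: "GDERIV (\<Phi> e k) x :> D\<Phi> e k x" if x: "x \<in> W" for x
  proof (cases "x \<in> H")
    case True
    have "GDERIV (\<lambda>x. gtr e (w x) * cut k x) x :> D\<Phi> e k x"
      by (rule GDERIV_subst[OF GDERIV_mult[OF GDERIV_DERIV_compose[OF w_gderiv DERIV_gtr[OF e]] GDERIV_cut]])
        (use True H_Om in \<open>auto simp: D\<Phi>_def mult_ac add_ac\<close>)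
    then show ?thesis by (rule GDERIV_cong_open[OF _ open_Sec True]) (simp add: \<Phi>_def)
  next
    case False
    then have xK: "x \<in> - Kw e k" using KwH x by blast
    have "GDERIV (\<Phi> e k) x :> 0"
      by (rule GDERIV_cong_open[OF GDERIV_const[of 0] oK xK]) (use zero in auto)
    then show ?thesis using False by (simp add: D\<Phi>_def)
  qed
  have cd: "continuous_on W (D\<Phi> e k)"
  proof -
    have "continuous_on H (\<lambda>x. (gtr' e (w x) * cut k x) *\<^sub>R Dw x + gtr e (w x) *\<^sub>R cut_grad k x)"
      by (intro continuous_intros continuous_gtr[OF e wH] continuous_cut DwH)
    then have "continuous_on H (D\<Phi> e k)" by (rule continuous_on_eq) (simp add: D\<Phi>_def)
    moreover have "continuous_on (- Kw e k) (D\<Phi> e k)"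
      by (rule continuous_on_eq[OF continuous_on_const[of _ 0]]) (use zero in auto)
    ultimately have "continuous_on (H \<union> - Kw e k) (D\<Phi> e k)"
      using oK by (intro continuous_on_open_Un) auto
    then show ?thesis by (rule continuous_on_subset) (use KwH in blast)
  qed
  define \<phi> where "\<phi> h = (\<lambda>x. if x \<in> Fc then \<Phi> e k (R\<theta> h x) else 0)" for h
  define g where "g h = (\<lambda>x. R\<theta> (- h) (D\<Phi> e k (R\<theta> h x)))" for h
  have test: "tf (\<phi> h) (g h)" "closure {x. \<phi> h x \<noteq> 0} \<subseteq> H \<union> Gamma_face i j r1 0" if h: "0 < h" "h < 2 * pi - \<beta>" for h
  proof -
    define U where "U = R\<theta> h -` W"
    have angFc: "ang (R\<theta> h x) = ang x + h" if "dax x > 0" "ang x \<le> \<beta>" for x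
      using angle_rot[of x h] that h angle_range[of x] by simp
    have oU: "open U" unfolding U_def by (rule open_vimage[OF oW continuous_coords(3)])
    have FU: "Fc \<subseteq> U"
    proof
      fix x assume "x \<in> Fc"
      then have "ang (R\<theta> h x) = ang x + h" using r1 by (intro angFc) (auto simp: Fc_eq)
      then show "x \<in> U" using h angle_range[of x] by (simp add: U_def W)
    qed
    define K' where "K' = closure Om \<inter> R\<theta> (- h) ` Kw e k"
    have cK': "compact K'" unfolding K'_def
      by (intro closed_Int_compact closed_closure compact_continuous_image continuous_coords compact_Kw[OF k])
    have K'D: "dax x > r1 \<and> ang x < half" if x: "x \<in> K'" for x
    proof -
      obtain y where y: "y \<in> Kw e k" "x = R\<theta> (- h) y" using x by (auto simp: K'_def)
      have d: "dax x > r1" using KwD(1)[OF y(1) e k] y by simp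
      have "ang x \<le> \<beta>" using closure_Omega_subset(2)[of x r1 \<beta>] x \<beta> by (simp add: K'_def)
      then have "ang (R\<theta> h x) = ang x + h" using d r1 by (intro angFc) auto
      moreover have "ang (R\<theta> h x) < half" using KwD(2)[OF y(1) e k] y by simp
      ultimately show ?thesis using d h by simp
    qed
    have K'F: "K' \<subseteq> Fc"
    proof
      fix x assume "x \<in> K'"
      from K'D[OF this] half show "x \<in> Fc" by (simp add: Fc_eq)
    qed
    have off: "\<Phi> e k (R\<theta> h x) = 0" if x: "x \<in> Fc - K'" for x
    proof (rule zero(1))
      have "x \<in> closure Om" using in_closure_Omega[OF r1 \<beta>, of x] x by (auto simp: Fc_eq)
      then have "x \<notin> R\<theta> (- h) ` Kw e k" using x by (auto simp: K'_def)
      then show "R\<theta> h x \<notin> Kw e k" using rot_inverse(2)[of h x] by (metis image_eqI)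
    qed
    have gU: "GDERIV (\<lambda>x. \<Phi> e k (R\<theta> h x)) x :> g h x" if "x \<in> U" for x
      unfolding g_def by (rule GDERIV_compose_isometry[OF linear_maps(1) rot_adjoint gd]) (use that in \<open>simp add: U_def\<close>)
    have cU: "continuous_on U (g h)" unfolding g_def
      by (rule continuous_on_compose2[OF continuous_coords(3)[of UNIV] continuous_on_compose2[OF cd continuous_coords(3)]])
        (auto simp: U_def)
    show "tf (\<phi> h) (g h)" unfolding \<phi>_def by (rule tfI(1)[OF oU FU gU cU cK' K'F off])
    have "closure {x. \<phi> h x \<noteq> 0} \<subseteq> K'" unfolding \<phi>_def by (rule tfI(2)[OF oU FU gU cU cK' K'F off])
    also have "\<dots> \<subseteq> H \<union> Gamma_face i j r1 0"
    proof
      fix x assume "x \<in> K'"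
      from K'D[OF this] show "x \<in> H \<union> Gamma_face i j r1 0"
        using angle_range[of x] by (auto simp: Omega_def Gamma_face_def)
    qed
    finally show "closure {x. \<phi> h x \<noteq> 0} \<subseteq> H \<union> Gamma_face i j r1 0" .
  qed
  define F where "F h y = indicator Om (R\<theta> (- h) y) * ((norm (D\<Phi> e k y))\<^sup>2 - V (R\<theta> (- h) y) * (\<Phi> e k y)\<^sup>2)" for h y
  have VOmm: "(\<lambda>x. indicator Om x * V x) \<in> borel_measurable borel"
    using borel_measurable_continuous_on_indicator[OF _ VOm] by simp
  note [measurable] = DPhi_measurable[OF e, of k] Phi_measurable[OF e, of k]
  have Fm: "F h \<in> borel_measurable borel" for h
  proof -
    have "F h = (\<lambda>y. indicator Om (R\<theta> (- h) y) * (norm (D\<Phi> e k y))\<^sup>2 - (indicator Om (R\<theta> (- h) y) * V (R\<theta> (- h) y)) * (\<Phi> e k y)\<^sup>2)"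
      by (auto simp: F_def algebra_simps)
    moreover have "(\<lambda>y. indicator Om (R\<theta> (- h) y) * V (R\<theta> (- h) y)) \<in> borel_measurable borel"
      using measurable_compose[OF borel_measurable_maps(3)[of "- h"] VOmm] .
    moreover have "(\<lambda>y. indicator Om (R\<theta> (- h) y) :: real) \<in> borel_measurable borel" by measurable
    ultimately show ?thesis by simp
  qed
  have QF: "QF V (\<phi> h) (g h) = (LINT y|lborel. F h y)" for h
  proof -
    have "QF V (\<phi> h) (g h) = (LINT x|lborel. F h (R\<theta> h x))"
      unfolding BF_def
    proof (rule Bochner_Integration.integral_cong[OF refl])
      fix x
      show "indicator Om x * (g h x \<bullet> g h x - V x * \<phi> h x * \<phi> h x) = F h (R\<theta> h x)"
        using Om_subset_Fc
        by (cases "x \<in> Om") (auto simp: F_def g_def \<phi>_def power2_norm_eq_inner power2_eq_square[of "\<Phi> e k (R\<theta> h x)"])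
    qed
    also have "\<dots> = (LINT y|lborel. F h y)" by (rule integral_rot(1)[OF Fm])
    finally show ?thesis .
  qed
  define Kc where "Kc = closure Om \<inter> {x. dax x \<ge> 1 / k} \<inter> cball 0 (2 * k)"
  have cKc: "compact Kc" unfolding Kc_def by (intro closed_Int_compact closed_Int closed_closure compact_cball closed_dax_ge)
  have KcCl: "Kc \<subseteq> Cl"
  proof
    fix x assume x: "x \<in> Kc"
    have "dax x > 0" using x k less_le_trans[of 0 "1 / k" "dax x"] by (simp add: Kc_def)
    then show "x \<in> Cl" using closure_Omega_subset[of x r1 \<beta>] x \<beta> by (auto simp: Kc_def Cl_def)
  qed
  obtain K1 where K1: "\<forall>z\<in>V ` Kc. norm z \<le> K1"
    using compact_imp_bounded[OF compact_continuous_image[OF continuous_on_subset[OF V KcCl] cKc]]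
    unfolding bounded_iff by blast
  define K0 where "K0 = max 0 K1"
  have Phi2: "integrable lborel (\<lambda>x. (\<Phi> e k x)\<^sup>2)"
  proof -
    have "integrable lborel (\<lambda>x. indicator H x * (gtr e (w x) * cut k x)\<^sup>2)"
      by (rule integrable_on_Ck[OF k]) (use in_Ck[OF _ k] in \<open>auto intro!: continuous_intros continuous_gtr[OF e w_cont] continuous_cut\<close>)
    moreover have "(\<lambda>x. indicator H x * (gtr e (w x) * cut k x)\<^sup>2) = (\<lambda>x. (\<Phi> e k x)\<^sup>2)"
      by (auto simp: \<Phi>_def indicator_def fun_eq_iff)
    ultimately show ?thesis by simp
  qed
  have dom: "\<bar>F h y\<bar> \<le> (norm (D\<Phi> e k y))\<^sup>2 + K0 * (\<Phi> e k y)\<^sup>2" for h y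
  proof (cases "R\<theta> (- h) y \<in> Om")
    case True
    have "\<bar>V (R\<theta> (- h) y) * (\<Phi> e k y)\<^sup>2\<bar> \<le> K0 * (\<Phi> e k y)\<^sup>2"
    proof (cases "y \<in> Ck k")
      case yC: True
      have "R\<theta> (- h) y \<in> Kc" using CkD[OF yC k] True closure_subset[of Om] by (auto simp: Kc_def)
      then have "\<bar>V (R\<theta> (- h) y)\<bar> \<le> K0" using K1 by (auto simp: K0_def le_max_iff_disj)
      then show ?thesis by (simp add: abs_mult mult_right_mono)
    qed (simp add: Phi_zero_off_Ck[OF k])
    then have "\<bar>(norm (D\<Phi> e k y))\<^sup>2 - V (R\<theta> (- h) y) * (\<Phi> e k y)\<^sup>2\<bar> \<le> (norm (D\<Phi> e k y))\<^sup>2 + K0 * (\<Phi> e k y)\<^sup>2"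
      using zero_le_power2[of "norm (D\<Phi> e k y)"] unfolding abs_le_iff by linarith
    then show ?thesis using True by (simp add: F_def)
  next
    case False then show ?thesis by (simp add: F_def K0_def)
  qed
  define c where "c = min (\<eta> / 2) ((2 * pi - \<beta>) / 2)"
  have c: "c > 0" "c < \<eta>" "c < 2 * pi - \<beta>" using \<eta> \<beta> by (auto simp: c_def min_def)
  define hm where "hm m = c * inverse (real (Suc m))" for m
  have hm: "0 < hm m" "hm m < \<eta>" "hm m < 2 * pi - \<beta>" for m
  proof -
    have "c * inverse (real (Suc m)) \<le> c * 1" using c by (intro mult_left_mono) (auto simp: field_simps)
    then have "hm m \<le> c" unfolding hm_def by (simp only: mult_1_right)
    moreover have "0 < hm m" using c(1) unfolding hm_def by (intro mult_pos_pos) auto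
    ultimately show "0 < hm m" "hm m < \<eta>" "hm m < 2 * pi - \<beta>" using c by linarith+
  qed
  have hlim: "hm \<longlonglongrightarrow> 0" unfolding hm_def[abs_def] using tendsto_mult[OF tendsto_const LIMSEQ_inverse_real_of_nat, of c] by simp
  have "(\<lambda>m. LINT y|lborel. F (hm m) y) \<longlonglongrightarrow> energy e k"
    unfolding energy_def
  proof (rule integral_dominated_convergence)
    show "integrable lborel (\<lambda>y. (norm (D\<Phi> e k y))\<^sup>2 + K0 * (\<Phi> e k y)\<^sup>2)"
      using DPhi_L2[OF e k] Phi2 by auto
    show "AE y in lborel. norm (F (hm m) y) \<le> (norm (D\<Phi> e k y))\<^sup>2 + K0 * (\<Phi> e k y)\<^sup>2" for m
      using dom by (intro AE_I2) simp
    show "AE y in lborel. (\<lambda>m. F (hm m) y) \<longlonglongrightarrow> (norm (D\<Phi> e k y))\<^sup>2 - V y * (\<Phi> e k y)\<^sup>2"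
    proof (rule AE_I2)
      fix y
      show "(\<lambda>m. F (hm m) y) \<longlonglongrightarrow> (norm (D\<Phi> e k y))\<^sup>2 - V y * (\<Phi> e k y)\<^sup>2"
      proof (cases "y \<in> H")
        case True
        then have yO: "y \<in> Om" using H_Om by blast
        have "continuous_on UNIV (\<lambda>t. R\<theta> (- t) y)" by (intro continuous_on_rot continuous_intros)
        then have "isCont (\<lambda>t. R\<theta> (- t) y) 0" by (simp add: continuous_on_eq_continuous_at)
        from isCont_tendsto_compose[OF this hlim] have yl: "(\<lambda>m. R\<theta> (- hm m) y) \<longlonglongrightarrow> y" by simp
        have "isCont V y" using VOm yO open_Sec continuous_on_eq_continuous_at by blast
        from isCont_tendsto_compose[OF this yl] have Vl: "(\<lambda>m. V (R\<theta> (- hm m) y)) \<longlonglongrightarrow> V y" .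
        have "\<forall>\<^sub>F m in sequentially. R\<theta> (- hm m) y \<in> Om" using yl open_Sec yO by (rule topological_tendstoD)
        then have ev: "\<forall>\<^sub>F m in sequentially. (norm (D\<Phi> e k y))\<^sup>2 - V (R\<theta> (- hm m) y) * (\<Phi> e k y)\<^sup>2 = F (hm m) y"
          by eventually_elim (simp add: F_def)
        have "(\<lambda>m. (norm (D\<Phi> e k y))\<^sup>2 - V (R\<theta> (- hm m) y) * (\<Phi> e k y)\<^sup>2) \<longlonglongrightarrow> (norm (D\<Phi> e k y))\<^sup>2 - V y * (\<Phi> e k y)\<^sup>2"
          by (intro tendsto_intros Vl)
        from Lim_transform_eventually[OF this ev] show ?thesis .
      qed (simp add: F_def D\<Phi>_def \<Phi>_def)
    qed
    show "(\<lambda>y. (norm (D\<Phi> e k y))\<^sup>2 - V y * (\<Phi> e k y)\<^sup>2) \<in> borel_measurable lborel"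
      using borel_measurable_integrable[OF Bochner_Integration.integrable_diff[OF DPhi_L2[OF e k] VPhi_integrable[OF e k]]] .
  qed (use Fm in simp)
  from order_tendstoD(2)[OF this, of "energy e k + \<eta>"] \<eta>
  obtain m where m: "(LINT y|lborel. F (hm m) y) < energy e k + \<eta>"
    unfolding eventually_sequentially by auto
  show ?thesis
    by (rule exI[of _ "hm m"], rule exI[of _ "g (hm m)"])
      (use hm[of m] test[OF hm(1,3), of m] m QF[of "hm m"] in \<open>simp add: \<phi>_def\<close>)
qed

text \<open>As for the angular derivative, but with the rotated truncations of \<open>w\<^sup>+\<close> in place of
  those of \<open>v\<^sup>+\<close>: they are a null sequence of a nonnegative form, so
  \<open>w\<^sup>+\<close> vanishes once it vanishes on the open set where \<open>w\<close> is negative.\<close>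
lemma stable_half_imp_reflection_sign:
  assumes stable: "\<And>\<phi> g. tf \<phi> g \<Longrightarrow> closure {x. \<phi> x \<noteq> 0} \<subseteq> H \<union> Gamma_face i j r1 0 \<Longrightarrow> QF V \<phi> g \<ge> 0"
    and neg: "y0 \<in> H" "w y0 < 0" and x: "x \<in> H"
  shows "w x \<le> 0"
proof -
  define kk where "kk n = real (Suc n)" for n
  have kk: "kk n > 0" for n by (simp add: kk_def)
  define c where "c n = (LINT x|lborel. indicator H x * (\<bar>V x\<bar> * max 0 (w x) * (cut (kk n) x)\<^sup>2))" for n
  define d where "d n = (LINT x|lborel. indicator H x * ((w x)\<^sup>2 * (norm (cut_grad (kk n) x))\<^sup>2))" for n
  have c0: "c n \<ge> 0" for n unfolding c_def by (intro Bochner_Integration.integral_nonneg) auto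
  \<comment> \<open>the height is chosen after the cut-off, so that \<open>\<epsilon> n * c n\<close> tends to zero although \<open>c n\<close> may be unbounded\<close>
  define \<epsilon> where "\<epsilon> n = 1 / (kk n * (1 + 2 * c n))" for n
  have \<epsilon>: "\<epsilon> n > 0" "\<epsilon> n \<le> 1 / kk n" "2 * \<epsilon> n * c n \<le> 1 / kk n" for n
  proof -
    have den: "kk n * (1 + 2 * c n) > 0" using kk[of n] c0[of n] by (intro mult_pos_pos) auto
    then show "\<epsilon> n > 0" by (simp add: \<epsilon>_def)
    have "kk n * 1 \<le> kk n * (1 + 2 * c n)" using kk[of n] c0[of n] by (intro mult_left_mono) auto
    then show "\<epsilon> n \<le> 1 / kk n" unfolding \<epsilon>_def using kk[of n] by (intro divide_left_mono) auto
    have "2 * \<epsilon> n * c n = (1 / kk n) * (2 * c n / (1 + 2 * c n))" by (simp add: \<epsilon>_def)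
    also have "\<dots> \<le> (1 / kk n) * 1"
      using kk[of n] c0[of n] by (intro mult_left_mono) (auto simp: divide_le_eq)
    finally show "2 * \<epsilon> n * c n \<le> 1 / kk n" by simp
  qed
  have kk_lim: "(\<lambda>n. 1 / kk n) \<longlonglongrightarrow> 0"
    using LIMSEQ_inverse_real_of_nat unfolding kk_def by (simp add: inverse_eq_divide)
  have d_lim: "d \<longlonglongrightarrow> 0"
  proof -
    have dbd: "indicator H x * ((w x)\<^sup>2 * (norm (cut_grad (kk n) x))\<^sup>2) \<le> 1024 * (indicator H x * ((w x)\<^sup>2 / (dax x)\<^sup>2))" for x n
    proof (cases "x \<in> H")
      case True
      have dx: "dax x > 0" by (rule daxH[OF True])
      have "norm (cut_grad (kk n) x) \<le> 32 / dax x" using cut_grad_bound[OF kk, of x n] dx by (simp add: field_simps)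
      then have "(norm (cut_grad (kk n) x))\<^sup>2 \<le> (32 / dax x)\<^sup>2" by (intro power_mono) auto
      then have "(w x)\<^sup>2 * (norm (cut_grad (kk n) x))\<^sup>2 \<le> (w x)\<^sup>2 * (32 / dax x)\<^sup>2" by (intro mult_left_mono) auto
      then show ?thesis using True by (simp add: power_divide mult.commute)
    qed simp
    have "d \<longlonglongrightarrow> (LINT x::real^'n|lborel. 0)"
      unfolding d_def
    proof (rule integral_dominated_convergence[OF _ _ integrable_mult_right[OF w_Hardy, of 1024]])
      have "continuous_on H (\<lambda>x. (w x)\<^sup>2 * (norm (cut_grad (kk n) x))\<^sup>2)" for n
        using continuous_on_subset[OF w_cont_Om H_Om] by (intro continuous_intros continuous_cut)
      from borel_measurable_continuous_on_indicator[OF _ this]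
      show "(\<lambda>x. indicator H x * ((w x)\<^sup>2 * (norm (cut_grad (kk n) x))\<^sup>2)) \<in> borel_measurable lborel" for n by simp
      show "AE x in lborel. norm (indicator H x * ((w x)\<^sup>2 * (norm (cut_grad (kk n) x))\<^sup>2)) \<le> 1024 * (indicator H x * ((w x)\<^sup>2 / (dax x)\<^sup>2))" for n
        using dbd by (intro AE_I2) simp
      show "AE x in lborel. (\<lambda>n. indicator H x * ((w x)\<^sup>2 * (norm (cut_grad (kk n) x))\<^sup>2)) \<longlonglongrightarrow> 0"
      proof (rule AE_I2)
        fix x
        show "(\<lambda>n. indicator H x * ((w x)\<^sup>2 * (norm (cut_grad (kk n) x))\<^sup>2)) \<longlonglongrightarrow> 0"
        proof (cases "x \<in> H")
          case True
          from cut_eventually_seq[OF daxH[OF True]]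
          have "\<forall>\<^sub>F n in sequentially. indicator H x * ((w x)\<^sup>2 * (norm (cut_grad (kk n) x))\<^sup>2) = 0"
            by (rule eventually_mono) (simp add: kk_def)
          then show ?thesis by (rule tendsto_eventually)
        qed simp
      qed
    qed simp
    then show ?thesis by simp
  qed
  define rot_test where "rot_test n h = (\<lambda>x. if x \<in> Fc then \<Phi> (\<epsilon> n) (kk n) (R\<theta> h x) else 0)" for n h
  have "\<forall>n. \<exists>hg. 0 < fst hg \<and> fst hg < 1 / kk n \<and> fst hg < 2 * pi - \<beta> \<and> tf (rot_test n (fst hg)) (snd hg) \<and>
     closure {x. rot_test n (fst hg) x \<noteq> 0} \<subseteq> H \<union> Gamma_face i j r1 0 \<and>
     QF V (rot_test n (fst hg)) (snd hg) \<le> energy (\<epsilon> n) (kk n) + 1 / kk n"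
  proof
    fix n
    have "1 / kk n > 0" using kk[of n] by simp
    from rotated_test_function[OF \<epsilon>(1)[of n] kk this] obtain h g where
      "0 < h \<and> h < 1 / kk n \<and> h < 2 * pi - \<beta> \<and> tf (rot_test n h) g \<and>
     closure {x. rot_test n h x \<noteq> 0} \<subseteq> H \<union> Gamma_face i j r1 0 \<and>
     QF V (rot_test n h) g \<le> energy (\<epsilon> n) (kk n) + 1 / kk n"
      unfolding rot_test_def by blast
    then show "\<exists>hg. 0 < fst hg \<and> fst hg < 1 / kk n \<and> fst hg < 2 * pi - \<beta> \<and> tf (rot_test n (fst hg)) (snd hg) \<and>
     closure {x. rot_test n (fst hg) x \<noteq> 0} \<subseteq> H \<union> Gamma_face i j r1 0 \<and>
     QF V (rot_test n (fst hg)) (snd hg) \<le> energy (\<epsilon> n) (kk n) + 1 / kk n"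
      by (intro exI[of _ "(h, g)"]) simp
  qed
  from choice[OF this] obtain hg where hg: "\<And>n. 0 < fst (hg n)" "\<And>n. fst (hg n) < 1 / kk n" "\<And>n. fst (hg n) < 2 * pi - \<beta>"
     "\<And>n. tf (rot_test n (fst (hg n))) (snd (hg n))"
     "\<And>n. closure {x. rot_test n (fst (hg n)) x \<noteq> 0} \<subseteq> H \<union> Gamma_face i j r1 0"
     "\<And>n. QF V (rot_test n (fst (hg n))) (snd (hg n)) \<le> energy (\<epsilon> n) (kk n) + 1 / kk n" by blast
  define h where "h n = fst (hg n)" for n
  define g where "g n = snd (hg n)" for n
  define \<phi> where "\<phi> n = rot_test n (h n)" for n
  have tf: "tf (\<phi> n) (g n)" for n using hg(4) by (simp add: \<phi>_def h_def g_def)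
  have Q: "QF V (\<phi> n) (g n) \<le> 2 * (1 / kk n) + d n" for n
  proof -
    have "energy (\<epsilon> n) (kk n) \<le> 2 * \<epsilon> n * c n + d n" using energy_estimate[OF \<epsilon>(1) kk] by (simp add: c_def d_def)
    then show ?thesis using hg(6)[of n] \<epsilon>(3)[of n] by (simp add: \<phi>_def h_def g_def)
  qed
  have Qlim: "(\<lambda>n. 2 * (1 / kk n) + d n) \<longlonglongrightarrow> 0"
    using tendsto_add[OF tendsto_mult[OF tendsto_const kk_lim, of 2] d_lim] by simp
  have hlim: "h \<longlonglongrightarrow> 0"
    by (rule tendsto_sandwich[OF _ _ tendsto_const kk_lim]) (use hg(1,2) in \<open>auto simp: h_def less_imp_le\<close>)
  have null: "L = 0" if \<psi>: "tf \<psi> p" and s: "closure {x. \<psi> x \<noteq> 0} \<subseteq> H \<union> Gamma_face i j r1 0"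
    and L: "(\<lambda>k. BF V (\<phi> k) (g k) \<psi> p) \<longlonglongrightarrow> L" for \<psi> p L
  proof (rule BF_limit_zero[OF V tf \<psi> _ Q Qlim L])
    show "0 \<le> QF V (\<lambda>x. 1 * \<phi> k x + t * \<psi> x) (\<lambda>x. 1 *\<^sub>R g k x + t *\<^sub>R p x)" for k t
    proof (rule stable[OF tf_lin[OF tf \<psi>]])
      have "closure {x. 1 * \<phi> k x + t * \<psi> x \<noteq> 0} \<subseteq> closure {x. \<phi> k x \<noteq> 0} \<union> closure {x. \<psi> x \<noteq> 0}"
        unfolding closure_Un[symmetric] by (rule closure_mono) auto
      also have "\<dots> \<subseteq> H \<union> Gamma_face i j r1 0" using hg(5)[of k] s by (simp add: \<phi>_def h_def)
      finally show "closure {x. 1 * \<phi> k x + t * \<psi> x \<noteq> 0} \<subseteq> H \<union> Gamma_face i j r1 0" .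
    qed
  qed
  define q where "q x = (if x \<in> H then max 0 (w x) else 0)" for x
  have wH: "continuous_on H w" by (rule continuous_on_subset[OF w_cont_Om H_Om])
  have "q x = 0"
  proof (rule null_sequence_unique_continuation[OF V half(1,2) tf])
    show "q x \<ge> 0" for x by (simp add: q_def)
    have "continuous_on H (\<lambda>x. max 0 (w x))" by (intro continuous_intros wH)
    then show "continuous_on H q" by (rule continuous_on_eq) (simp add: q_def)
    show "q x = 0" if "x \<notin> H" for x using that by (simp add: q_def)
    show "(\<lambda>n. \<phi> n x) \<longlonglongrightarrow> q x" if x: "x \<in> Om" for x
    proof (cases "x \<in> H")
      case False
      have "\<phi> n x = 0" for n
      proof -
        have "dax x > 0" "ang x \<ge> half" "ang x < \<beta>" using x False r1 by (auto simp: Omega_def)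
        then have "ang (R\<theta> (h n) x) = ang x + h n" using hg(1,3)[of n] angle_range[of x] by (intro angle_rot) (auto simp: h_def)
        then have "R\<theta> (h n) x \<notin> H" using \<open>ang x \<ge> half\<close> hg(1)[of n] by (auto simp: Omega_def h_def)
        then show ?thesis by (simp add: \<phi>_def rot_test_def \<Phi>_def)
      qed
      then show ?thesis using False by (simp add: q_def)
    next
      case True
      have "continuous_on UNIV (\<lambda>t. R\<theta> t x)" by (intro continuous_on_rot continuous_intros)
      then have "isCont (\<lambda>t. R\<theta> t x) 0" by (simp add: continuous_on_eq_continuous_at)
      from isCont_tendsto_compose[OF this hlim] have yl: "(\<lambda>n. R\<theta> (h n) x) \<longlonglongrightarrow> x" by simp
      have "isCont w x" using wH True open_Sec continuous_on_eq_continuous_at by blast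
      from isCont_tendsto_compose[OF this yl] have wl: "(\<lambda>n. w (R\<theta> (h n) x)) \<longlonglongrightarrow> w x" .
      have ml: "(\<lambda>n. max 0 (w (R\<theta> (h n) x))) \<longlonglongrightarrow> max 0 (w x)" by (intro tendsto_max tendsto_const wl)
      have ev: "\<forall>\<^sub>F n in sequentially. \<phi> n x = gtr (\<epsilon> n) (w (R\<theta> (h n) x))"
        using topological_tendstoD[OF yl open_Sec True] cut_eventually_seq[OF daxH[OF True]]
      proof eventually_elim
        case (elim n)
        then show ?case using x Om_subset_Fc by (auto simp: \<phi>_def rot_test_def \<Phi>_def kk_def)
      qed
      have "(\<lambda>n. \<phi> n x) \<longlonglongrightarrow> max 0 (w x)"
      proof (rule tendsto_sandwich[OF _ _ _ ml])
        show "\<forall>\<^sub>F n in sequentially. max 0 (w (R\<theta> (h n) x)) - 2 * (1 / kk n) \<le> \<phi> n x" using ev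
        proof eventually_elim
          case (elim n)
          then show ?case using gtr_approx(2)[OF \<epsilon>(1)[of n], of "w (R\<theta> (h n) x)"] \<epsilon>(2)[of n] by linarith
        qed
        show "\<forall>\<^sub>F n in sequentially. \<phi> n x \<le> max 0 (w (R\<theta> (h n) x))" using ev
        proof eventually_elim
          case (elim n)
          then show ?case using gtr_approx(1)[OF \<epsilon>(1)[of n], of "w (R\<theta> (h n) x)"] by linarith
        qed
        show "(\<lambda>n. max 0 (w (R\<theta> (h n) x)) - 2 * (1 / kk n)) \<longlonglongrightarrow> max 0 (w x)"
          using tendsto_diff[OF ml tendsto_mult[OF tendsto_const kk_lim, of 2]] by simp
      qed
      then show ?thesis using True by (simp add: q_def)
    qed
    show "\<exists>M. \<forall>n. \<forall>x\<in>cball y R. \<bar>\<phi> n x\<bar> \<le> M" if yR: "cball y R \<subseteq> H" for y R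
    proof (cases "cball y R = {}")
      case False
      obtain x1 where x1: "x1 \<in> cball y R" "\<And>x. x \<in> cball y R \<Longrightarrow> dax x1 \<le> dax x"
        using continuous_attains_inf[OF compact_cball False continuous_coords(1)] by blast
      have d1: "dax x1 > 0" using daxH x1(1) yR by blast
      define K where "K = max (1 / dax x1) (norm y + R + 1)"
      have R0: "R \<ge> 0" using False by (simp add: not_less[symmetric])
      have K: "K > 0" "1 / K \<le> dax x1" "norm y + R \<le> 2 * K"
      proof -
        show K0: "K > 0" using d1 by (auto simp: K_def less_max_iff_disj)
        have "1 / dax x1 \<le> K" by (simp add: K_def)
        then show "1 / K \<le> dax x1" using d1 K0 by (simp add: field_simps)
        have "norm y + R + 1 \<le> K" by (simp add: K_def)
        then show "norm y + R \<le> 2 * K" using R0 norm_ge_zero[of y] by linarith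
      qed
      obtain M where M: "M \<ge> 0" "\<And>x. x \<in> Ck K \<Longrightarrow> \<bar>w x\<bar> \<le> M" using bounded_on_Ck[OF K(1) w_cont] by blast
      have "\<bar>\<phi> n x\<bar> \<le> M" if x: "x \<in> cball y R" for n x
      proof (cases "R\<theta> (h n) x \<in> H")
        case True
        have "norm x \<le> norm y + R" using x norm_triangle_sub[of x y] by (simp add: dist_norm norm_minus_commute)
        then have "R\<theta> (h n) x \<in> Ck K" using True closure_subset[of H] K x1(2)[OF x] by (auto simp: Ck_def)
        from M(2)[OF this] show ?thesis using \<Phi>_range[OF \<epsilon>(1)[of n], of "kk n" "R\<theta> (h n) x"] M(1)
          by (auto simp: \<phi>_def rot_test_def)
      qed (use M(1) in \<open>simp add: \<phi>_def rot_test_def \<Phi>_def\<close>)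
      then show ?thesis by blast
    qed auto
    show "L = 0" if R: "R > 0" "(m::nat) \<ge> 3" "cball y R \<subseteq> H" and L: "(\<lambda>k. BF V (\<phi> k) (g k) (bump y R m) (bump_grad y R m)) \<longlonglongrightarrow> L" for y R m L
    proof (rule null[OF _ _ L])
      show "tf (bump y R m) (bump_grad y R m)"
        by (rule C1c_Sec_tf[OF half(2) C1c_bump]) (use R in auto)
      have "{x. bump y R m x \<noteq> 0} \<subseteq> cball y R"
        using bump_outside(1)[of _ y R m] R by fastforce
      then have "closure {x. bump y R m x \<noteq> 0} \<subseteq> cball y R"
        by (rule closure_minimal) simp
      then show "closure {x. bump y R m x \<noteq> 0} \<subseteq> H \<union> Gamma_face i j r1 0" using R by blast
    qed
    show "open (H \<inter> w -` {..<0})" by (rule continuous_open_preimage[OF wH]) auto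
    show "H \<inter> w -` {..<0} \<noteq> {}" using neg by auto
    show "q x = 0" if "x \<in> H \<inter> w -` {..<0}" for x using that by (simp add: q_def)
    show "x \<in> H" by (rule x)
  qed auto
  then show ?thesis using x by (simp add: q_def max_def split: if_splits)
qed

end

section \<open>From the half sector to the whole sector\<close>

context neumann_solution
begin

text \<open>On \<open>\<theta> = \<beta>/2\<close>, where \<open>w\<close> vanishes, its angular derivative is
  \<open>2v\<close>.\<close>
lemma symmetry_axis_sign:
  assumes x: "x \<in> Om" "ang x = half"
  shows "\<forall>y\<in>H. w y \<le> 0 \<Longrightarrow> v x \<ge> 0" and "\<forall>y\<in>H. w y \<ge> 0 \<Longrightarrow> v x \<le> 0"
proof -
  have "\<beta> - 2 * ang x = 0" using x by simp
  then have Sx: "S x = x" by (simp only: refl_eq_rot rot_0)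
  have w0: "w (R\<theta> 0 x) = 0" by (simp add: w_def Sx)
  have d: "DERIV (\<lambda>t. w (R\<theta> t x)) 0 :> 2 * v x"
  proof -
    have "(w has_derivative (\<lambda>h. h \<bullet> Dw x)) (at (R\<theta> 0 x))"
      using w_gderiv[OF x(1)] by (simp add: gderiv_def)
    from has_derivative_compose[OF rot_has_vector_derivative[of x 0 UNIV, unfolded has_vector_derivative_def] this]
    have "((\<lambda>t. w (R\<theta> t x)) has_derivative (\<lambda>s. (s *\<^sub>R T\<theta> x) \<bullet> Dw x)) (at 0)" by simp
    moreover have "(\<lambda>s. (s *\<^sub>R T\<theta> x) \<bullet> Dw x) = (*) (2 * v x)"
      using Dw_tang[OF x(1)] by (simp add: Sx inner_commute fun_eq_iff)
    ultimately show ?thesis unfolding has_field_derivative_def by simp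
  qed
  have inH: "R\<theta> (- h) x \<in> H" if "0 < h" "h < half" for h
    using angle_rot[of x "- h"] x that r1 half by (auto simp: Omega_def)
  show "v x \<ge> 0" if s: "\<forall>y\<in>H. w y \<le> 0"
  proof (rule ccontr)
    assume "\<not> ?thesis"
    then obtain e where e: "e > 0" "\<And>h. 0 < h \<Longrightarrow> h < e \<Longrightarrow> w (R\<theta> 0 x) < w (R\<theta> (0 - h) x)"
      using DERIV_neg_dec_left[OF d] by auto
    define h where "h = min e half / 2"
    have h: "0 < h" "h < e" "h < half" using e half(1) by (auto simp: h_def min_def)
    from e(2)[OF h(1,2)] s inH[OF h(1,3)] w0 show False by force
  qed
  show "v x \<le> 0" if s: "\<forall>y\<in>H. w y \<ge> 0"
  proof (rule ccontr)
    assume "\<not> ?thesis"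
    then obtain e where e: "e > 0" "\<And>h. 0 < h \<Longrightarrow> h < e \<Longrightarrow> w (R\<theta> (0 - h) x) < w (R\<theta> 0 x)"
      using DERIV_pos_inc_left[OF d] by auto
    define h where "h = min e half / 2"
    have h: "0 < h" "h < e" "h < half" using e half(1) by (auto simp: h_def min_def)
    from e(2)[OF h(1,2)] s inH[OF h(1,3)] w0 show False by force
  qed
qed

text \<open>On the half sector \<open>u\<close> is constant along arcs. Hence the difference \<open>W\<close> of
  \<open>u\<close> and its rotation by \<open>\<tau>\<close> vanishes for angles up to
  \<open>\<beta>/2\<close>, and beyond it equals \<open>-w \<circ> S\<close>, which has one sign. Since
  \<open>W\<close> solves a linear inequality, it vanishes, and \<open>v\<close> at a point equals
  \<open>v\<close> at the rotated point, which lies in the half sector. The choice \<open>\<tau> =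
  \<theta>(x)/2\<close> keeps every point involved inside the sector.\<close>
lemma zero_on_half_imp_zero:
  assumes z: "\<And>x. x \<in> H \<Longrightarrow> v x = 0" and \<sigma>: "\<bar>\<sigma>\<bar> = 1" and sg: "\<And>x. x \<in> H \<Longrightarrow> \<sigma> * w x \<le> 0"
    and x: "x \<in> Om"
  shows "v x = 0"
proof (cases "x \<in> H")
  case False
  define \<tau> where "\<tau> = ang x / 2"
  have \<tau>: "0 < \<tau>" "\<tau> < half" "half \<le> ang x" using x False by (auto simp: \<tau>_def Omega_def)
  define D where "D = Omega i j r1 \<tau> (half + \<tau>)"
  have xD: "x \<in> D" using x \<tau> by (auto simp: D_def \<tau>_def Omega_def)
  have DOm: "D \<subseteq> Om" unfolding D_def using \<tau> by (intro Omega_mono) auto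
  have oD: "open D" unfolding D_def by (rule open_Omega) (use \<tau> in simp)
  have RD: "R\<theta> (- \<tau>) y \<in> H" if "y \<in> D" for y
    using rot_in_Omega[of y r1 \<tau> "half + \<tau>" "- \<tau>"] that r1 half by (simp add: D_def)
  have RDOm: "R\<theta> (- \<tau>) y \<in> Om" if "y \<in> D" for y using RD[OF that] H_Om by blast
  have const: "u (R\<theta> s y) = u y" if y: "y \<in> Om" "ang y \<le> half" and s: "s < 0" "ang y + s > 0" for y s
  proof -
    have R: "R\<theta> t y \<in> Om" "ang (R\<theta> t y) = ang y + t" if "s \<le> t" "t \<le> 0" for t
      using angle_rot[of y t] y s that r1 half \<beta> by (auto simp: Omega_def)
    have d: "DERIV (\<lambda>t. u (R\<theta> t y)) t :> v (R\<theta> t y)" if "s \<le> t" "t \<le> 0" for t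
      using u_along_arc[OF R(1)[OF that]] by (simp add: has_real_derivative_iff_has_vector_derivative)
    have "u (R\<theta> 0 y) = u (R\<theta> s y)"
    proof (rule DERIV_isconst_end[OF s(1)])
      show "continuous_on {s..0} (\<lambda>t. u (R\<theta> t y))"
        by (rule DERIV_continuous_on[where D = "\<lambda>t. v (R\<theta> t y)"])
          (use d in \<open>auto intro: has_field_derivative_at_within\<close>)
      fix t assume t: "s < t" "t < 0"
      then have "R\<theta> t y \<in> H" using R[of t] y by (auto simp: Omega_def)
      then show "DERIV (\<lambda>t. u (R\<theta> t y)) t :> 0" using d[of t] t z by simp
    qed
    then show ?thesis by simp
  qed
  define W where "W y = u y - u (R\<theta> (- \<tau>) y)" for y
  define DW where "DW y = Du y - R\<theta> \<tau> (Du (R\<theta> (- \<tau>) y))" for y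
  define r where "r y = f (dax y) (zp y) (u y) - f (dax y) (zp y) (u (R\<theta> (- \<tau>) y))" for y
  have W0: "W y = 0" if "y \<in> D" "ang y \<le> half" for y
    using const[of y "- \<tau>"] that \<tau> DOm by (auto simp: W_def D_def Omega_def)
  have Ww: "W y = - w (S y)" "S y \<in> H" if "y \<in> D" "half < ang y" for y
  proof -
    have yOm: "y \<in> Om" using that DOm by blast
    have d: "dax y > 0" "dax y > r1" using yOm r1 by (auto simp: Omega_def)
    have "ang (S y) = \<beta> - ang y" using yOm \<beta> d by (intro angle_refl) (auto simp: Omega_def)
    then show SH: "S y \<in> H" using that yOm d \<beta> by (auto simp: Omega_def)
    have aR: "ang (R\<theta> (- \<tau>) y) = ang y - \<tau>" using yOm that(2) \<tau> \<beta> d by (subst angle_rot) (auto simp: Omega_def)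
    have SR: "S y = R\<theta> (\<beta> - 2 * ang y) y" by (rule refl_eq_rot)
    have "u (R\<theta> (- \<tau>) y) = u (S y)"
    proof (cases "ang y - \<tau>" "\<beta> - ang y" rule: linorder_cases)
      case less
      have "R\<theta> (- \<tau>) y = R\<theta> (ang y - \<tau> - (\<beta> - ang y)) (S y)" by (simp add: SR rot_add)
      moreover have "u (R\<theta> (ang y - \<tau> - (\<beta> - ang y)) (S y)) = u (S y)"
      proof (rule const)
        show "S y \<in> Om" "ang (S y) \<le> half" using SH H_Om by (auto simp: Omega_def)
        show "0 < ang (S y) + (ang y - \<tau> - (\<beta> - ang y))" using \<open>ang (S y) = \<beta> - ang y\<close> that \<tau> by simp
      qed (use less in simp)
      ultimately show ?thesis by simp
    next
      case equal
      then have "\<beta> - 2 * ang y = - \<tau>" by simp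
      then show ?thesis by (simp add: SR)
    next
      case greater
      have "S y = R\<theta> (\<beta> - ang y - (ang y - \<tau>)) (R\<theta> (- \<tau>) y)" by (simp add: SR rot_add)
      moreover have "u (R\<theta> (\<beta> - ang y - (ang y - \<tau>)) (R\<theta> (- \<tau>) y)) = u (R\<theta> (- \<tau>) y)"
      proof (rule const)
        show "R\<theta> (- \<tau>) y \<in> Om" "ang (R\<theta> (- \<tau>) y) \<le> half" using RD[OF that(1)] H_Om by (auto simp: Omega_def)
        show "0 < ang (R\<theta> (- \<tau>) y) + (\<beta> - ang y - (ang y - \<tau>))" using aR yOm by (simp add: Omega_def)
      qed (use greater in simp)
      ultimately show ?thesis by simp
    qed
    then show "W y = - w (S y)" by (simp add: W_def w_def)
  qed
  have pos: "\<sigma> * W y \<ge> 0" if "y \<in> D" for y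
  proof (cases "ang y \<le> half")
    case True then show ?thesis using W0 that by simp
  next
    case False
    then show ?thesis using Ww[OF that] sg[of "S y"] by simp
  qed
  have absW: "\<bar>W y\<bar> = \<sigma> * W y" if "y \<in> D" for y
    using pos[OF that] \<sigma> abs_mult[of \<sigma> "W y"] by simp
  have W': "GDERIV W y :> DW y" if "y \<in> D" for y
  proof -
    have "GDERIV (\<lambda>y. u (R\<theta> (- \<tau>) y)) y :> R\<theta> (- (- \<tau>)) (Du (R\<theta> (- \<tau>) y))"
      by (rule GDERIV_compose_isometry[OF linear_maps(1) rot_adjoint u(1)[OF RDOm[OF that]]])
    from GDERIV_diff[OF u(1) this] that DOm show ?thesis by (auto simp: W_def[abs_def] DW_def)
  qed
  have cRD: "continuous_on D (\<lambda>y. R\<theta> (- \<tau>) y)" by (rule continuous_coords(3))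
  have cR: "continuous_on D (\<lambda>y. g (R\<theta> (- \<tau>) y))" if "continuous_on Om g" for g :: "real ^ 'n \<Rightarrow> 'c::topological_space"
    by (rule continuous_on_compose2[OF that cRD]) (use RDOm in auto)
  have cDW: "continuous_on D DW" unfolding DW_def[abs_def]
    by (intro continuous_intros continuous_on_subset[OF u(2) DOm] continuous_on_compose2[OF continuous_coords(3)[of UNIV] cR[OF u(2)]]) auto
  have cr: "continuous_on D r" unfolding r_def[abs_def]
    using continuous_on_diff[OF continuous_on_subset[OF f_cont DOm] cR[OF f_cont]] by simp
  have weak: "(LINT x|lborel. DW x \<bullet> G x) = (LINT x|lborel. r x * \<psi> x)" if C: "C1c D \<psi> G" for \<psi> G
  proof -
    have C1: "C1c Om \<psi> G" by (rule C1c_mono[OF C DOm])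
    have C2: "C1c Om (\<lambda>x. \<psi> (R\<theta> \<tau> x)) (\<lambda>x. R\<theta> (- \<tau>) (G (R\<theta> \<tau> x)))"
      by (rule C1c_mono[OF C1c_rot[OF C]]) (use RDOm in auto)
    have i1: "integrable lborel (\<lambda>x. Du x \<bullet> R\<theta> (- \<tau>) (G (R\<theta> \<tau> x)))" by (rule C1c_integrable(2)[OF C2 u(2)])
    have i2: "integrable lborel (\<lambda>x. f (dax x) (zp x) (u x) * \<psi> (R\<theta> \<tau> x))" by (rule C1c_integrable(1)[OF C2 f_cont])
    have e1: "R\<theta> \<tau> (Du (R\<theta> (- \<tau>) x)) \<bullet> G x = Du (R\<theta> (- \<tau>) x) \<bullet> R\<theta> (- \<tau>) (G (R\<theta> \<tau> (R\<theta> (- \<tau>) x)))" for x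
      by (simp add: rot_adjoint)
    have e2: "f (dax x) (zp x) (u (R\<theta> (- \<tau>) x)) * \<psi> x
      = f (dax (R\<theta> (- \<tau>) x)) (zp (R\<theta> (- \<tau>) x)) (u (R\<theta> (- \<tau>) x)) * \<psi> (R\<theta> \<tau> (R\<theta> (- \<tau>) x))" for x by simp
    note m1 = borel_measurable_integrable[OF i1, simplified] and m2 = borel_measurable_integrable[OF i2, simplified]
    have s: "(LINT x|lborel. R\<theta> \<tau> (Du (R\<theta> (- \<tau>) x)) \<bullet> G x) = (LINT x|lborel. f (dax x) (zp x) (u (R\<theta> (- \<tau>) x)) * \<psi> x)"
      "integrable lborel (\<lambda>x. R\<theta> \<tau> (Du (R\<theta> (- \<tau>) x)) \<bullet> G x)" "integrable lborel (\<lambda>x. f (dax x) (zp x) (u (R\<theta> (- \<tau>) x)) * \<psi> x)"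
      unfolding e1 e2 integral_rot(1)[OF m1] integral_rot(1)[OF m2] integral_rot(2)[OF m1] integral_rot(2)[OF m2]
      by (rule weak_u[OF C2] i1 i2)+
    show ?thesis
      using C1c_integrable(2)[OF C1 u(2)] C1c_integrable(1)[OF C1 f_cont] s weak_u[OF C1]
      by (simp add: DW_def r_def inner_diff_left left_diff_distrib)
  qed
  have "\<sigma> * W y = 0" if "y \<in> D" for y
  proof (rule weak_solution_unique_continuation[OF oD _ _ _ pos _ _ _ _ _ _ _ that, where r = "\<lambda>x. \<sigma> * r x" and U = "D \<inter> H"])
    show "connected D" unfolding D_def by (rule connected_Omega) (use r1 \<tau> half in auto)
    show "GDERIV (\<lambda>y. \<sigma> * W y) y :> \<sigma> *\<^sub>R DW y" if "y \<in> D" for y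
      by (rule GDERIV_subst[OF GDERIV_mult[OF GDERIV_const[of \<sigma>] W'[OF that]]]) simp
    show "continuous_on D (\<lambda>y. \<sigma> *\<^sub>R DW y)" "continuous_on D (\<lambda>y. \<sigma> * r y)" by (intro continuous_intros cDW cr)+
    show "(LINT x|lborel. \<sigma> *\<^sub>R DW x \<bullet> G x) = (LINT x|lborel. \<sigma> * r x * \<psi> x)" if "C1c D \<psi> G" for \<psi> G
      using weak[OF that] by (simp add: mult.assoc)
    show "open (D \<inter> H)" by (intro open_Int oD open_Sec)
    show "D \<inter> H \<noteq> {}"
    proof -
      have "cyl (r1 + 1) ((\<tau> + half) / 2) 0 \<in> D \<inter> H"
        using \<tau> r1 half pi_gt_zero by (auto simp: D_def Omega_def dist_axis_cyl angle_cyl)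
      then show ?thesis by blast
    qed
    show "\<sigma> * W x = 0" if "x \<in> D \<inter> H" for x using W0[of x] that by (auto simp: Omega_def)
    fix x assume "x \<in> D"
    then obtain \<rho> where \<rho>: "\<rho> > 0" "cball x \<rho> \<subseteq> D" using oD open_contains_cball by blast
    define K where "K = (SUP y\<in>cball x \<rho>. \<bar>V y\<bar> + \<bar>V (R\<theta> (- \<tau>) y)\<bar>)"
    have "continuous_on D (\<lambda>y. \<bar>V y\<bar> + \<bar>V (R\<theta> (- \<tau>) y)\<bar>)"
      by (intro continuous_intros continuous_on_subset[OF VOm DOm] cR[OF VOm])
    then have "compact ((\<lambda>y. \<bar>V y\<bar> + \<bar>V (R\<theta> (- \<tau>) y)\<bar>) ` cball x \<rho>)"
      by (intro compact_continuous_image) (auto intro: continuous_on_subset[OF _ \<rho>(2)])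
    then have "bdd_above ((\<lambda>y. \<bar>V y\<bar> + \<bar>V (R\<theta> (- \<tau>) y)\<bar>) ` cball x \<rho>)"
      by (intro bounded_imp_bdd_above compact_imp_bounded)
    then have K: "\<bar>V y\<bar> + \<bar>V (R\<theta> (- \<tau>) y)\<bar> \<le> K" if "y \<in> cball x \<rho>" for y
      unfolding K_def using that by (rule cSUP_upper2) simp
    have K0: "K \<ge> 0" using K[of x] \<rho>(1) by force
    have "\<bar>\<sigma> * r y\<bar> \<le> K * (\<sigma> * W y)" if y: "y \<in> cball x \<rho>" for y
    proof -
      have yD: "y \<in> D" using y \<rho> by blast
      have yCl: "y \<in> Cl" "R\<theta> (- \<tau>) y \<in> Cl" using yD DOm RDOm[OF yD] Om_subset_Cl by blast+
      have 1: "r y \<le> V y * W y"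
        using f_convex[OF yCl(1), of "u (R\<theta> (- \<tau>) y)"] by (simp add: r_def W_def algebra_simps)
      have 2: "V (R\<theta> (- \<tau>) y) * W y \<le> r y"
        using f_convex[OF yCl(2), of "u y"] by (simp add: r_def W_def algebra_simps)
      have "\<bar>V y * W y\<bar> \<le> K * \<bar>W y\<bar>" "\<bar>V (R\<theta> (- \<tau>) y) * W y\<bar> \<le> K * \<bar>W y\<bar>"
        unfolding abs_mult using K[OF y] by (intro mult_right_mono; linarith)+
      then have "\<bar>r y\<bar> \<le> K * \<bar>W y\<bar>" using 1 2 by linarith
      then show ?thesis using \<sigma> absW[OF yD] by (simp add: abs_mult)
    qed
    then show "\<exists>\<rho>>0. \<exists>K\<ge>0. cball x \<rho> \<subseteq> D \<and> (\<forall>y\<in>cball x \<rho>. \<bar>\<sigma> * r y\<bar> \<le> K * (\<sigma> * W y))"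
      using \<rho> K0 by blast
  qed auto
  then have "W y = 0" if "y \<in> D" for y using absW[OF that] \<open>\<And>y. y \<in> D \<Longrightarrow> \<sigma> * W y = 0\<close>[OF that] by simp
  then have "DW x = 0" by (rule GDERIV_zero_on_open[OF W'[OF xD] oD xD])
  then have "Du x = R\<theta> \<tau> (Du (R\<theta> (- \<tau>) x))" by (simp add: DW_def)
  then have "v x = R\<theta> \<tau> (T\<theta> (R\<theta> (- \<tau>) x)) \<bullet> R\<theta> \<tau> (Du (R\<theta> (- \<tau>) x))"
    by (simp add: v_eq[OF x] tang_rot)
  also have "\<dots> = v (R\<theta> (- \<tau>) x)" by (simp only: rot_inner v_eq[OF RDOm[OF xD]])
  finally show ?thesis using z[OF RD[OF xD]] by simp
qed (use z in blast)

lemma one_sign: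
  assumes stable: "\<And>\<phi> g. tf \<phi> g \<Longrightarrow> closure {x. \<phi> x \<noteq> 0} \<subseteq> H \<union> Gamma_face i j r1 0 \<Longrightarrow> QF V \<phi> g \<ge> 0"
    and index: "\<And>\<phi>1 g1 \<phi> g. tf \<phi>1 g1 \<Longrightarrow> tf \<phi> g \<Longrightarrow> QF V \<phi>1 g1 < 0 \<Longrightarrow> BF V \<phi> g \<phi>1 g1 = 0 \<Longrightarrow> QF V \<phi> g \<ge> 0"
  shows "(\<forall>x\<in>Om. v x \<ge> 0) \<or> (\<forall>x\<in>Om. v x \<le> 0)"
proof -
  interpret neg: sector_solution i j r1 \<beta> V "\<lambda>x. - v x" "\<lambda>x. - Dv x" Du by (rule uminus_solution)
  have wsign: "(\<forall>x\<in>H. w x \<le> 0) \<or> (\<forall>x\<in>H. w x \<ge> 0)"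
  proof (cases "\<exists>y\<in>H. w y < 0")
    case True
    then obtain y where "y \<in> H" "w y < 0" by blast
    from stable_half_imp_reflection_sign[OF stable this] show ?thesis by blast
  qed force
  then obtain \<sigma> :: real where \<sigma>: "\<bar>\<sigma>\<bar> = 1" "\<And>x. x \<in> H \<Longrightarrow> \<sigma> * w x \<le> 0"
  proof
    assume "\<forall>x\<in>H. w x \<le> 0" then show ?thesis using that[of 1] by simp
  next
    assume "\<forall>x\<in>H. w x \<ge> 0" then show ?thesis using that[of "-1"] by simp
  qed
  show ?thesis
  proof (cases "\<forall>x\<in>H. v x = 0")
    case True
    then show ?thesis using zero_on_half_imp_zero[OF _ \<sigma>] by simp
  next
    case False
    then obtain x0 where x0: "x0 \<in> H" "v x0 \<noteq> 0" by blast
    from wsign show ?thesis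
    proof
      assume s: "\<forall>x\<in>H. w x \<le> 0"
      have vH: "v x \<ge> 0" if "x \<in> H" for x
        using neg.stable_sector_imp_nonpos[OF half(1,2) _ stable that] symmetry_axis_sign(1)[OF _ _ s] by simp
      have "v x \<ge> 0" if "x \<in> Om" for x
        by (rule nonneg_extends[OF half(1,2) index _ x0 that]) (use vH in auto)
      then show ?thesis by auto
    next
      assume s: "\<forall>x\<in>H. w x \<ge> 0"
      have vH: "v x \<le> 0" if "x \<in> H" for x
        using stable_sector_imp_nonpos[OF half(1,2) _ stable that] symmetry_axis_sign(2)[OF _ _ s] by simp
      have "- v x \<ge> 0" if "x \<in> Om" for x
        by (rule neg.nonneg_extends[OF half(1,2) index _ x0(1) _ that]) (use vH x0(2) in auto)
      then show ?thesis by auto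
    qed
  qed
qed

end

section \<open>The two halves of the sector\<close>

context sector
begin

lemma refl_Fc: "x \<in> Fc \<Longrightarrow> S x \<in> Fc"
  using angle_refl[of x \<beta>] \<beta> angle_range[of x] r1 by (auto simp: Fc_eq)

lemma tf_refl:
  assumes t: "tf \<phi> g"
  shows "tf (\<lambda>x. \<phi> (S x)) (\<lambda>x. S (g (S x)))"
    and "closure {x. \<phi> (S x) \<noteq> 0} \<subseteq> S ` closure {x. \<phi> x \<noteq> 0}"
proof -
  let ?K = "closure {x. \<phi> x \<noteq> 0}"
  have K: "compact ?K" "?K \<subseteq> Fc" using t by (auto simp: tf_def C1_0_def)
  have SK: "compact (S ` ?K)" by (intro compact_continuous_image continuous_coords K)
  have sub: "{x. \<phi> (S x) \<noteq> 0} \<subseteq> S ` ?K"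
  proof
    fix x assume "x \<in> {x. \<phi> (S x) \<noteq> 0}"
    then have "S x \<in> ?K" using closure_subset[of "{x. \<phi> x \<noteq> 0}"] by blast
    then show "x \<in> S ` ?K" by (rule image_eqI[rotated]) simp
  qed
  then show cl: "closure {x. \<phi> (S x) \<noteq> 0} \<subseteq> S ` ?K"
    by (rule closure_minimal) (rule compact_imp_closed[OF SK])
  have cpt: "compact (closure {x. \<phi> (S x) \<noteq> 0})"
    using bounded_subset[OF compact_imp_bounded[OF SK] sub] by simp
  have SF: "S ` Fc \<subseteq> Fc" using refl_Fc by blast
  have d: "((\<lambda>x. \<phi> (S x)) has_derivative (\<lambda>h. S (g (S x)) \<bullet> h)) (at x within Fc)" if x: "x \<in> Fc" for x
  proof -
    have S': "(S has_derivative S) (at x within Fc)"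
      using linear_maps(2)[of \<beta>] by (intro bounded_linear_imp_has_derivative) (simp add: linear_conv_bounded_linear)
    have "(\<phi> has_derivative (\<lambda>h. g (S x) \<bullet> h)) (at (S x) within Fc)"
      using t refl_Fc[OF x] by (simp add: tf_def)
    from has_derivative_in_compose[OF S' has_derivative_subset[OF this SF]]
    show ?thesis by (simp add: refl_adjoint)
  qed
  have cg: "continuous_on Fc (\<lambda>x. S (g (S x)))"
    by (intro cont_refl continuous_on_compose2[OF tf_cont(2)[OF t] continuous_coords(4) SF])
  have "closure {x. \<phi> (S x) \<noteq> 0} \<subseteq> Fc" using cl K(2) refl_Fc by blast
  then show "tf (\<lambda>x. \<phi> (S x)) (\<lambda>x. S (g (S x)))"
    using cpt cg d unfolding tf_def C1_0_def C1_on_def by blast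
qed

lemma BF_refl:
  assumes V: "continuous_on Cl V" and t: "tf \<phi> g" "tf \<psi> h"
  shows "BF (\<lambda>x. V (S x)) (\<lambda>x. \<phi> (S x)) (\<lambda>x. S (g (S x))) (\<lambda>x. \<psi> (S x)) (\<lambda>x. S (h (S x))) = BF V \<phi> g \<psi> h"
proof -
  have ind: "indicator Om (S x) = (indicator Om x :: real)" for x using refl_Om_iff by (simp add: indicator_def)
  show ?thesis
    unfolding BF_def refl_inner
    using integral_refl(1)[OF borel_measurable_integrable[OF BF_integrable[OF V t], simplified], of \<beta>] unfolding ind .
qed

text \<open>Two test functions with supports in different halves are orthogonal for the quadratic form, so an
  index at most one leaves no room for negative directions in both halves.\<close>

lemma stable_on_one_half:
  assumes index: "\<And>\<phi>1 g1 \<phi> g. tf \<phi>1 g1 \<Longrightarrow> tf \<phi> g \<Longrightarrow> QF V \<phi>1 g1 < 0 \<Longrightarrow> BF V \<phi> g \<phi>1 g1 = 0 \<Longrightarrow> QF V \<phi> g \<ge> 0"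
    and A: "A \<inter> B = {}"
  shows "(\<forall>\<phi> g. tf \<phi> g \<longrightarrow> closure {x. \<phi> x \<noteq> 0} \<subseteq> A \<longrightarrow> QF V \<phi> g \<ge> 0) \<or>
         (\<forall>\<phi> g. tf \<phi> g \<longrightarrow> closure {x. \<phi> x \<noteq> 0} \<subseteq> B \<longrightarrow> QF V \<phi> g \<ge> 0)"
proof (rule ccontr)
  assume "\<not> ?thesis"
  then obtain \<phi>1 g1 \<phi> g where t1: "tf \<phi>1 g1" "closure {x. \<phi>1 x \<noteq> 0} \<subseteq> A" "QF V \<phi>1 g1 < 0"
    and t: "tf \<phi> g" "closure {x. \<phi> x \<noteq> 0} \<subseteq> B" "QF V \<phi> g < 0" by (auto simp: not_le)
  have off: "\<psi> x = 0 \<and> h x = 0" if "tf \<psi> h" "x \<in> Om" "x \<notin> closure {x. \<psi> x \<noteq> 0}" for \<psi> h x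
  proof -
    have z: "\<psi> y = 0" if "y \<in> Om - closure {x. \<psi> x \<noteq> 0}" for y
      using that closure_subset[of "{x. \<psi> x \<noteq> 0}"] by auto
    have o: "open (Om - closure {x. \<psi> x \<noteq> 0})" by (intro open_Diff open_Sec closed_closure)
    have xi: "x \<in> Om - closure {x. \<psi> x \<noteq> 0}" using that(2,3) by simp
    from GDERIV_zero_on_open[OF tf_gderiv[OF that(1,2)] o xi z] z[OF xi] show ?thesis by simp
  qed
  have "indicator Om x * (g x \<bullet> g1 x - V x * \<phi> x * \<phi>1 x) = 0" for x
  proof (cases "x \<in> Om")
    case True
    have "x \<notin> closure {x. \<phi> x \<noteq> 0} \<or> x \<notin> closure {x. \<phi>1 x \<noteq> 0}" using A t(2) t1(2) by blast
    then show ?thesis using off[OF t(1) True] off[OF t1(1) True] by auto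
  qed simp
  then have "BF V \<phi> g \<phi>1 g1 = 0" unfolding BF_def by (simp only: Bochner_Integration.integral_zero)
  from index[OF t1(1) t(1) t1(3) this] t(3) show False by simp
qed

end

context neumann_solution
begin

text \<open>The equation is invariant under the reflection, while the angular derivative changes its sign. So a
  statement about the half \<open>\<theta> < \<beta>/2\<close> also yields one about the other half.\<close>
lemma reflected_solution:
  "neumann_solution i j r1 \<beta> (\<lambda>x. V (S x)) (\<lambda>x. - v (S x)) (\<lambda>x. - S (Dv (S x))) (\<lambda>x. S (Du (S x))) (\<lambda>x. u (S x)) f"
proof
  have cCl: "continuous_on Cl (\<lambda>x. g (S x))" if "continuous_on Cl g" for g :: "real ^ 'n \<Rightarrow> 'c::topological_space"
    by (rule continuous_on_compose2[OF that continuous_coords(4)]) (use refl_Cl in auto)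
  have cOm: "continuous_on Om (\<lambda>x. g (S x))" if "continuous_on Om g" for g :: "real ^ 'n \<Rightarrow> 'c::topological_space"
    by (rule continuous_on_compose2[OF that continuous_coords(4)]) (use refl_Om in auto)
  show "continuous_on Cl (\<lambda>x. V (S x))" by (rule cCl[OF V])
  show "GDERIV (\<lambda>x. - v (S x)) x :> - S (Dv (S x))" if "x \<in> Om" for x
    by (rule GDERIV_minus[OF GDERIV_compose_isometry[OF linear_maps(2) refl_adjoint p(1)[OF refl_Om[OF that]]]])
  show "continuous_on Om (\<lambda>x. - S (Dv (S x)))" by (intro continuous_intros cont_refl cOm p)
  show "continuous_on Cl (\<lambda>x. - v (S x))" by (intro continuous_intros cCl p)
  show "- v (S x) = 0" if "x \<in> Cl" "x \<notin> Om" for x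
    using p_boundary[OF refl_Cl[OF that(1)]] that(2) refl_Om_iff by simp
  show "(LINT x|lborel. - S (Dv (S x)) \<bullet> G x) = (LINT x|lborel. V (S x) * - v (S x) * \<psi> x)"
    if C: "C1c Om \<psi> G" for \<psi> G
  proof -
    have C': "C1c Om (\<lambda>x. \<psi> (S x)) (\<lambda>x. S (G (S x)))"
      using C1c_refl[OF C, of \<beta>] unfolding refl_image_Om .
    have i1: "integrable lborel (\<lambda>x. Dv x \<bullet> S (G (S x)))" by (rule C1c_integrable(2)[OF C' p(2)])
    have i2: "integrable lborel (\<lambda>x. V x * v x * \<psi> (S x))"
      by (rule C1c_integrable(1)[OF C' continuous_on_mult[OF VOm cp]])
    have e1: "S (Dv (S x)) \<bullet> G x = Dv (S x) \<bullet> S (G (S (S x)))" for x by (simp add: refl_adjoint)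
    have e2: "V (S x) * v (S x) * \<psi> x = V (S x) * v (S x) * \<psi> (S (S x))" for x by simp
    have "(LINT x|lborel. S (Dv (S x)) \<bullet> G x) = (LINT x|lborel. V (S x) * v (S x) * \<psi> x)"
      unfolding e1 e2 integral_refl(1)[OF borel_measurable_integrable[OF i1, simplified]]
        integral_refl(1)[OF borel_measurable_integrable[OF i2, simplified]] by (rule eq[OF C'])
    then show ?thesis by simp
  qed
  show "integrable lborel (\<lambda>x. indicator Om x * (norm (S (Du (S x))))\<^sup>2)"
  proof -
    have ind: "indicator Om (S x) = (indicator Om x :: real)" for x using refl_Om_iff by (simp add: indicator_def)
    have "integrable lborel (\<lambda>x. indicator Om (S x) * (norm (Du (S x)))\<^sup>2)"
      using integral_refl(2)[OF borel_measurable_integrable[OF DU, simplified]] DU by blast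
    then show ?thesis by (simp add: ind)
  qed
  show "\<bar>- v (S x)\<bar> \<le> dax x * norm (S (Du (S x)))" if "x \<in> Om" for x
    using p_DU[OF refl_Om[OF that]] by simp
  show "GDERIV (\<lambda>x. u (S x)) x :> S (Du (S x))" if "x \<in> Om" for x
    by (rule GDERIV_compose_isometry[OF linear_maps(2) refl_adjoint u(1)[OF refl_Om[OF that]]])
  show "continuous_on Om (\<lambda>x. S (Du (S x)))" by (intro cont_refl cOm u)
  show "continuous_on Cl (\<lambda>x. u (S x))" by (rule cCl[OF u(3)])
  show "- v (S x) = T\<theta> x \<bullet> S (Du (S x))" if "x \<in> Om" for x
    using v_eq[OF refl_Om[OF that]] by (simp add: refl_adjoint[symmetric] tang_refl)
  show "u (S x) = u (S y)" if "x \<in> Cl" "y \<in> Cl" "dax x = r1" "dax y = r1" "zp x = zp y" for x y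
    by (rule u_gamma) (use that refl_Cl in auto)
  show "(LINT x|lborel. S (Du (S x)) \<bullet> G x) = (LINT x|lborel. f (dax x) (zp x) (u (S x)) * \<psi> x)"
    if "C1c Om \<psi> G" for \<psi> G by (rule weak_reflected(1)[OF that])
  show "continuous_on Om (\<lambda>x. f (dax x) (zp x) (u (S x)))" using cOm[OF f_cont] by simp
  show "f (dax x) (zp x) (u (S x)) + V (S x) * (s - u (S x)) \<le> f (dax x) (zp x) s" if "x \<in> Cl" for x s
    using f_convex[OF refl_Cl[OF that], of s] by simp
qed

text \<open>The reflection maps a half sector without its inner boundary to the other one; on one of the two the form is
  nonnegative.\<close>
lemma index_one_imp_one_sign:
  assumes index: "\<And>\<phi>1 g1 \<phi> g. tf \<phi>1 g1 \<Longrightarrow> tf \<phi> g \<Longrightarrow> QF V \<phi>1 g1 < 0 \<Longrightarrow> BF V \<phi> g \<phi>1 g1 = 0 \<Longrightarrow> QF V \<phi> g \<ge> 0"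
  shows "(\<forall>x\<in>Om. v x \<ge> 0) \<or> (\<forall>x\<in>Om. v x \<le> 0)"
proof -
  define A where "A = H \<union> Gamma_face i j r1 0"
  have ang_A: "dax x > 0 \<and> ang x < half" if "x \<in> A" for x
    using that half r1 by (auto simp: A_def Omega_def Gamma_face_def)
  have "A \<inter> S ` A = {}"
  proof (rule ccontr)
    assume "A \<inter> S ` A \<noteq> {}"
    then obtain y where y: "y \<in> A" "S y \<in> A" by blast
    then have "ang (S y) = \<beta> - ang y" using ang_A[OF y(1)] half \<beta> by (intro angle_refl) auto
    then show False using ang_A[OF y(1)] ang_A[OF y(2)] by simp
  qed
  from stable_on_one_half[OF index this] show ?thesis
  proof
    assume "\<forall>\<phi> g. tf \<phi> g \<longrightarrow> closure {x. \<phi> x \<noteq> 0} \<subseteq> A \<longrightarrow> QF V \<phi> g \<ge> 0"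
    then have st: "QF V \<phi> g \<ge> 0" if "tf \<phi> g" "closure {x. \<phi> x \<noteq> 0} \<subseteq> A" for \<phi> g using that by simp
    show ?thesis by (rule one_sign[OF st[unfolded A_def] index])
  next
    assume st: "\<forall>\<phi> g. tf \<phi> g \<longrightarrow> closure {x. \<phi> x \<noteq> 0} \<subseteq> S ` A \<longrightarrow> QF V \<phi> g \<ge> 0"
    interpret R: neumann_solution i j r1 \<beta> "\<lambda>x. V (S x)" "\<lambda>x. - v (S x)" "\<lambda>x. - S (Dv (S x))" "\<lambda>x. S (Du (S x))" "\<lambda>x. u (S x)" f
      by (rule reflected_solution)
    have B: "BF (\<lambda>x. V (S x)) \<phi> g \<psi> h = BF V (\<lambda>x. \<phi> (S x)) (\<lambda>x. S (g (S x))) (\<lambda>x. \<psi> (S x)) (\<lambda>x. S (h (S x)))"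
      if "tf \<phi> g" "tf \<psi> h" for \<phi> g \<psi> h
      using BF_refl[OF R.V that] by simp
    have "(\<forall>x\<in>Om. - v (S x) \<ge> 0) \<or> (\<forall>x\<in>Om. - v (S x) \<le> 0)"
    proof (rule R.one_sign)
      show "QF (\<lambda>x. V (S x)) \<phi> g \<ge> 0" if t: "tf \<phi> g" and s: "closure {x. \<phi> x \<noteq> 0} \<subseteq> H \<union> Gamma_face i j r1 0" for \<phi> g
      proof -
        have "closure {x. \<phi> (S x) \<noteq> 0} \<subseteq> S ` A" using tf_refl(2)[OF t] s unfolding A_def by blast
        from st[rule_format, OF tf_refl(1)[OF t] this] show ?thesis unfolding B[OF t t] .
      qed
      show "QF (\<lambda>x. V (S x)) \<phi> g \<ge> 0" if t1: "tf \<phi>1 g1" and t: "tf \<phi> g" and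
        "QF (\<lambda>x. V (S x)) \<phi>1 g1 < 0" "BF (\<lambda>x. V (S x)) \<phi> g \<phi>1 g1 = 0" for \<phi>1 g1 \<phi> g
        unfolding B[OF t t]
        by (rule index[OF tf_refl(1)[OF t1] tf_refl(1)[OF t] that(3)[unfolded B[OF t1 t1]] that(4)[unfolded B[OF t t1]]])
    qed
    then show ?thesis
    proof
      assume a: "\<forall>x\<in>Om. - v (S x) \<ge> 0"
      have "v x \<le> 0" if "x \<in> Om" for x using a[rule_format, OF refl_Om[OF that]] by simp
      then show ?thesis by blast
    next
      assume a: "\<forall>x\<in>Om. - v (S x) \<le> 0"
      have "v x \<ge> 0" if "x \<in> Om" for x using a[rule_format, OF refl_Om[OF that]] by simp
      then show ?thesis by blast
    qed
  qed
qed

end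

section \<open>Gradients and differentiation under the integral\<close>

lemma GDERIV_grad:
  fixes f :: "real ^ 'n::finite \<Rightarrow> real"
  assumes "f differentiable (at x)"
  shows "GDERIV f x :> grad f x"
proof -
  let ?D = "frechet_derivative f (at x)"
  have D: "(f has_derivative ?D) (at x)" using assms by (rule frechet_derivative_works[THEN iffD1])
  have lin: "linear ?D" by (rule has_derivative_linear[OF D])
  have "?D h = h \<bullet> grad f x" for h
  proof -
    have "?D (\<Sum>k\<in>UNIV. (h $ k) *\<^sub>R axis k 1) = (\<Sum>k\<in>UNIV. (h $ k) * ?D (axis k 1))"
      by (simp add: linear_sum[OF lin] linear_scale[OF lin])
    moreover have "(\<Sum>k\<in>UNIV. (h $ k) *\<^sub>R axis k 1) = h"
      using basis_expansion[of h] by (simp add: scalar_mult_eq_scaleR)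
    ultimately show ?thesis by (simp add: inner_vec_def grad_def partial_def)
  qed
  then have "?D = (\<lambda>h. h \<bullet> grad f x)" by (rule ext)
  then show ?thesis using D by (simp add: gderiv_def)
qed

lemma grad_eqI:
  fixes f :: "real ^ 'n::finite \<Rightarrow> real"
  assumes "GDERIV f x :> d"
  shows "grad f x = d"
proof -
  have "(\<lambda>h. h \<bullet> d) = frechet_derivative f (at x)"
    using assms unfolding gderiv_def by (rule frechet_derivative_at)
  then show ?thesis by (simp add: grad_def partial_def vec_eq_iff inner_axis' fun_eq_iff[symmetric] flip: \<open>(\<lambda>h. h \<bullet> d) = _\<close>)
qed

lemma GDERIV_component: "GDERIV (\<lambda>x. x $ k) x :> axis k (1::real)"
proof -
  have "((\<lambda>x::real ^ 'a. x $ k) has_derivative (\<lambda>h. h $ k)) (at x)"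
    by (intro bounded_linear_imp_has_derivative bounded_linear_vec_nth)
  then show ?thesis by (simp add: gderiv_def inner_axis)
qed

lemma locally_holder_imp_continuous:
  assumes "locally_holder_on S g"
  shows "continuous_on S g"
  unfolding continuous_on_def
proof
  fix x assume x: "x \<in> S"
  obtain e \<alpha> C where e: "e > 0" "0 < \<alpha>"
    and C: "\<And>p q. p \<in> S \<inter> ball x e \<Longrightarrow> q \<in> S \<inter> ball x e \<Longrightarrow> \<bar>g p - g q\<bar> \<le> C * dist p q powr \<alpha>"
    using assms x unfolding locally_holder_on_def by blast
  have "((\<lambda>p. dist p x) \<longlongrightarrow> 0) (at x within S)"
    using tendsto_dist[OF tendsto_ident_at[of x S] tendsto_const[of x]] by simp
  then have "((\<lambda>p. dist p x powr \<alpha>) \<longlongrightarrow> 0) (at x within S)"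
    by (rule tendsto_zero_powrI[OF _ tendsto_const]) (use e in auto)
  from tendsto_mult_right_zero[OF this, of C]
  have "((\<lambda>p. g p - g x) \<longlongrightarrow> 0) (at x within S)"
  proof (rule Lim_null_comparison[rotated])
    show "\<forall>\<^sub>F p in at x within S. norm (g p - g x) \<le> C * dist p x powr \<alpha>"
      unfolding eventually_at using e C[OF _ , of _ x] x by (intro exI[of _ e]) (auto simp: dist_commute)
  qed
  then show "(g \<longlongrightarrow> g x) (at x within S)" by (simp add: LIM_zero_iff)
qed

text \<open>Differentiation under the integral sign along one sequence; the difference quotients are bounded by the mean
  value theorem.\<close>
lemma integral_derivative_at_zero:
  fixes F F' :: "real \<Rightarrow> 'a::euclidean_space \<Rightarrow> real"
  assumes K: "compact K" and t0: "t0 > 0"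
    and d: "\<And>t x. 0 \<le> t \<Longrightarrow> t \<le> t0 \<Longrightarrow> x \<in> K \<Longrightarrow> DERIV (\<lambda>t. F t x) t :> F' t x"
    and c: "continuous_on ({0..t0} \<times> K) (\<lambda>z. F' (fst z) (snd z))"
    and z: "\<And>t x. x \<notin> K \<Longrightarrow> F t x = 0"
    and i: "\<And>t. 0 \<le> t \<Longrightarrow> t \<le> t0 \<Longrightarrow> integrable lborel (F t)"
  shows "(\<lambda>n. ((LINT x|lborel. F (t0 / real (Suc n)) x) - (LINT x|lborel. F 0 x)) / (t0 / real (Suc n)))
     \<longlonglongrightarrow> (LINT x|lborel. indicator K x * F' 0 x)"
proof -
  define h where "h n = t0 / real (Suc n)" for n
  have h: "0 < h n" "h n \<le> t0" for n using t0 by (auto simp: h_def divide_le_eq mult_le_cancel_left1)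
  have hlim: "h \<longlonglongrightarrow> 0"
    using tendsto_mult[OF tendsto_const LIMSEQ_inverse_real_of_nat, of t0] by (simp add: h_def[abs_def] divide_inverse)
  have "compact ((\<lambda>z. F' (fst z) (snd z)) ` ({0..t0} \<times> K))"
    by (intro compact_continuous_image[OF c] compact_Times compact_Icc K)
  then obtain C where "\<forall>w\<in>(\<lambda>z. F' (fst z) (snd z)) ` ({0..t0} \<times> K). norm w \<le> C"
    using compact_imp_bounded bounded_iff by blast
  then have C: "\<bar>F' t x\<bar> \<le> C" if "0 \<le> t" "t \<le> t0" "x \<in> K" for t x using that by force
  have "(\<lambda>n. LINT x|lborel. (F (h n) x - F 0 x) / h n) \<longlonglongrightarrow> (LINT x|lborel. indicator K x * F' 0 x)"
  proof (rule integral_dominated_convergence[where w = "\<lambda>x. indicator K x * C"])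
    have "continuous_on K (F' 0)"
      using continuous_on_compose2[OF c, of K "\<lambda>x. (0, x)"] t0 by (simp add: continuous_on_Pair image_subset_iff)
    from borel_measurable_continuous_on_indicator[OF _ this]
    show "(\<lambda>x. indicator K x * F' 0 x) \<in> borel_measurable lborel" using K by (simp add: borel_compact)
    show "(\<lambda>x. (F (h n) x - F 0 x) / h n) \<in> borel_measurable lborel" for n
      using borel_measurable_integrable[OF i[of "h n"]] borel_measurable_integrable[OF i[of 0]] h[of n] t0 by simp
    have "emeasure lborel K < \<infinity>" using emeasure_compact_finite[OF K] by simp
    then show "integrable lborel (\<lambda>x. indicator K x * C)"
      using K by (intro integrable_mult_left integrable_real_indicator) (auto simp: borel_compact)
    show "AE x in lborel. norm ((F (h n) x - F 0 x) / h n) \<le> indicator K x * C" for n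
    proof (rule AE_I2)
      fix x
      show "norm ((F (h n) x - F 0 x) / h n) \<le> indicator K x * C"
      proof (cases "x \<in> K")
        case True
        obtain s where s: "0 < s" "s < h n" "F (h n) x - F 0 x = (h n - 0) * F' s x"
          using MVT2[OF h(1)[of n], of "\<lambda>t. F t x" "\<lambda>t. F' t x"] d[OF _ _ True] h(2)[of n] by fastforce
        then have "(F (h n) x - F 0 x) / h n = F' s x" using h(1)[of n] by simp
        then show ?thesis using C[of s x] s h(2)[of n] True by simp
      qed (simp add: z)
    qed
    show "AE x in lborel. (\<lambda>n. (F (h n) x - F 0 x) / h n) \<longlonglongrightarrow> indicator K x * F' 0 x"
    proof (rule AE_I2)
      fix x
      show "(\<lambda>n. (F (h n) x - F 0 x) / h n) \<longlonglongrightarrow> indicator K x * F' 0 x"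
      proof (cases "x \<in> K")
        case True
        have "((\<lambda>s. (F (0 + s) x - F 0 x) / s) \<longlongrightarrow> F' 0 x) (at 0)"
          using d[of 0 x] True t0 by (simp add: DERIV_def)
        moreover have "filterlim h (at 0) sequentially"
          using hlim h(1) by (intro filterlim_atI) (auto simp: less_imp_neq[THEN not_sym])
        ultimately show ?thesis using filterlim_compose[of "\<lambda>s. (F (0 + s) x - F 0 x) / s"] True by force
      qed (simp add: z)
    qed
  qed
  moreover have "(LINT x|lborel. (F (h n) x - F 0 x) / h n) = ((LINT x|lborel. F (h n) x) - (LINT x|lborel. F 0 x)) / h n" for n
    using i[of "h n"] i[of 0] h[of n] t0 by simp
  ultimately have "(\<lambda>n. ((LINT x|lborel. F (h n) x) - (LINT x|lborel. F 0 x)) / h n) \<longlonglongrightarrow> (LINT x|lborel. indicator K x * F' 0 x)"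
    by (simp only:)
  then show ?thesis unfolding h_def .
qed

section \<open>Differentiation along rotations\<close>

context cyl_coords
begin

lemma tang_inner_eq: "T\<theta> x \<bullet> y = x $ i * y $ j - x $ j * y $ i"
  using ij unfolding inner_split by (simp add: tang_def cong: sum.cong_simp)

lemma DERIV_along_rotation:
  assumes "GDERIV h (R\<theta> t x) :> d"
  shows "DERIV (\<lambda>t. h (R\<theta> t x)) t :> T\<theta> (R\<theta> t x) \<bullet> d"
proof -
  have "(h has_derivative (\<lambda>k. k \<bullet> d)) (at (R\<theta> t x))" using assms by (simp add: gderiv_def)
  from has_derivative_compose[OF rot_has_vector_derivative[of x t UNIV, unfolded has_vector_derivative_def] this]
  have "((\<lambda>t. h (R\<theta> t x)) has_derivative (\<lambda>s. s * (T\<theta> (R\<theta> t x) \<bullet> d))) (at t)" by simp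
  then show ?thesis unfolding has_field_derivative_def by (simp add: mult_commute_abs)
qed

lemma rot_displacement: "norm (R\<theta> t x - x) \<le> 2 * \<bar>t\<bar> * norm x"
proof -
  have "R\<theta> t x - x = (1 - cos t) *\<^sub>R T\<theta> (T\<theta> x) + sin t *\<^sub>R T\<theta> x"
    unfolding rot_expand by (simp add: algebra_simps)
  then have "norm (R\<theta> t x - x) \<le> \<bar>1 - cos t\<bar> * norm (T\<theta> (T\<theta> x)) + \<bar>sin t\<bar> * norm (T\<theta> x)"
    using norm_triangle_ineq[of "(1 - cos t) *\<^sub>R T\<theta> (T\<theta> x)" "sin t *\<^sub>R T\<theta> x"] by simp
  also have "\<dots> \<le> \<bar>t\<bar> * norm x + \<bar>t\<bar> * norm x"
  proof (intro add_mono mult_mono)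
    have T: "norm (T\<theta> y) \<le> norm y" for y using norm_tang[of y] dist_axis_le_norm[of y] by simp
    show "norm (T\<theta> x) \<le> norm x" "norm (T\<theta> (T\<theta> x)) \<le> norm x" using T[of x] T[of "T\<theta> x"] by auto
    show "\<bar>sin t\<bar> \<le> \<bar>t\<bar>" by (rule abs_sin_x_le_abs_x)
    have "1 - cos t = 2 * (sin (t / 2))\<^sup>2" using cos_double_sin[of "t / 2"] by simp
    also have "\<dots> = 2 * (\<bar>sin (t / 2)\<bar> * \<bar>sin (t / 2)\<bar>)" by (simp add: power2_eq_square)
    also have "\<dots> \<le> 2 * (1 * \<bar>t / 2\<bar>)"
      by (intro mult_left_mono mult_mono abs_sin_x_le_abs_x) auto
    finally show "\<bar>1 - cos t\<bar> \<le> \<bar>t\<bar>" using cos_le_one[of t] by simp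
  qed auto
  finally show ?thesis by simp
qed

end

section \<open>The linearised equation for the angular derivative\<close>

text \<open>The hypotheses of the theorem apart from the one on the Morse index.\<close>
locale neumann_problem = sector i j r1 \<beta> for i j :: "'n::finite" and r1 \<beta> :: real +
  fixes f :: "real \<Rightarrow> real ^ 'n \<Rightarrow> real \<Rightarrow> real" and u :: "real ^ 'n \<Rightarrow> real"
  assumes f_ok: "nonlinearity_ok i j f" and uY: "u \<in> Yspace i j r1 \<beta>" and sol: "is_solution i j r1 \<beta> f u"
    and conv: "\<forall>r\<ge>0. \<forall>z\<in>zspace i j. convex_on UNIV (f r z)"
begin

abbreviation "v \<equiv> dtheta i j \<beta> u"
definition "V x = deriv (f (dax x) (zp x)) (u x)"

text \<open>The product rule applied to \<open>v = x\<^sub>i \<partial>\<^sub>j u - x\<^sub>j \<partial>\<^sub>i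
  u\<close>.\<close>
definition "Dv x = ((x $ i) *\<^sub>R grad (partial j u) x + partial j u x *\<^sub>R axis i 1)
   - ((x $ j) *\<^sub>R grad (partial i u) x + partial i u x *\<^sub>R axis j 1)"

lemma u_cont: "continuous_on Cl u"
  using uY unfolding Yspace_def Cl_eq_closure by (auto intro: continuous_on_subset)

lemma v_cont: "continuous_on Cl v" using uY unfolding Yspace_def Cl_eq_closure by auto

lemma coords_cont: "continuous_on Cl (\<lambda>x. (dax x, zp x, u x))"
  by (intro continuous_intros continuous_coords u_cont)

lemma coords_range: "(\<lambda>x. (dax x, zp x, u x)) ` Cl \<subseteq> {0..} \<times> zspace i j \<times> UNIV" by auto

lemma V_cont: "continuous_on Cl V"
proof -
  have "continuous_on ({0..} \<times> zspace i j \<times> UNIV) (\<lambda>(r, z, s). deriv (f r z) s)"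
    using f_ok by (auto simp: nonlinearity_ok_def intro: locally_holder_imp_continuous)
  from continuous_on_compose2[OF this coords_cont coords_range] show ?thesis by (simp add: V_def[abs_def])
qed

lemma f_cont: "continuous_on Cl (\<lambda>x. f (dax x) (zp x) (u x))"
proof -
  have "continuous_on ({0..} \<times> zspace i j \<times> UNIV) (\<lambda>(r, z, s). f r z s)"
    using f_ok by (auto simp: nonlinearity_ok_def intro: locally_holder_imp_continuous)
  from continuous_on_compose2[OF this coords_cont coords_range] show ?thesis by simp
qed

lemma f_deriv: "DERIV (f (dax x) (zp x)) s :> deriv (f (dax x) (zp x)) s"
  using f_ok by (auto simp: nonlinearity_ok_def intro: field_differentiable_derivI)

lemma C2: "C2_on Om u" using uY by (simp add: Yspace_def)

lemma u_grad: "x \<in> Om \<Longrightarrow> GDERIV u x :> grad u x"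
  using C2 by (auto simp: C2_on_def intro: GDERIV_grad)

lemma partial_grad: "x \<in> Om \<Longrightarrow> GDERIV (partial k u) x :> grad (partial k u) x"
  using C2 by (auto simp: C2_on_def intro: GDERIV_grad)

lemma cont_partial_grad: "continuous_on Om (grad (partial k u))"
proof -
  have "continuous_on Om (\<lambda>x. \<chi> l. partial l (partial k u) x)"
    using C2 by (intro continuous_on_vec_lambda) (auto simp: C2_on_def)
  then show ?thesis by (simp add: grad_def[abs_def])
qed

lemma cont_partial: "continuous_on Om (partial k u)" by (rule GDERIV_continuous_on[OF partial_grad])

lemma cont_grad: "continuous_on Om (grad u)"
proof -
  have "continuous_on Om (\<lambda>x. \<chi> l. partial l u x)" by (intro continuous_on_vec_lambda cont_partial)
  then show ?thesis by (simp add: grad_def[abs_def])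
qed

lemma arc_derivative:
  assumes r: "r > 0" "r \<ge> r1" and z: "z \<in> zspace i j" and t: "t \<in> {0..\<beta>}"
  shows "((\<lambda>s. u (cyl r s z)) has_vector_derivative v (cyl r t z)) (at t within {0..\<beta>})"
proof -
  define y where "y = cyl r t z"
  have y: "dax y = r" "ang y = t" "zp y = z"
    using r z t \<beta> by (simp_all add: y_def dist_axis_cyl angle_cyl zpart_cyl)
  have "y \<in> closure Om - axis_set i j"
    using in_closure_Omega[OF r1 \<beta>, of y] y r t by (simp add: axis_set_def)
  then have "dtheta_exists i j \<beta> u y" using uY by (auto simp: Yspace_def)
  then show ?thesis
    unfolding dtheta_exists_def y vector_derivative_works dtheta_def y_def[symmetric] .
qed

lemma arc_constant:
  assumes r: "r > 0" "r \<ge> r1" and z: "z \<in> zspace i j" and v0: "\<And>t. t \<in> {0..\<beta>} \<Longrightarrow> v (cyl r t z) = 0"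
    and st: "s \<in> {0..\<beta>}" "t \<in> {0..\<beta>}"
  shows "u (cyl r s z) = u (cyl r t z)"
proof -
  have "\<exists>c. \<forall>t\<in>{0..\<beta>}. u (cyl r t z) = c"
  proof (rule has_derivative_zero_constant)
    fix t assume "t \<in> {0..\<beta>}"
    from arc_derivative[OF r z this] v0[OF this]
    show "((\<lambda>s. u (cyl r s z)) has_derivative (\<lambda>h. 0)) (at t within {0..\<beta>})"
      by (simp add: has_vector_derivative_def)
  qed simp
  then show ?thesis using st by metis
qed

lemma v_eq:
  assumes x: "x \<in> Om"
  shows "v x = T\<theta> x \<bullet> grad u x"
proof -
  have c: "cyl (dax x) t (zp x) = R\<theta> t (R\<theta> (- ang x) x)" for t by (simp add: cyl_rot rot_add)
  have "DERIV (\<lambda>t. u (R\<theta> t (R\<theta> (- ang x) x))) (ang x) :> T\<theta> (R\<theta> (ang x) (R\<theta> (- ang x) x)) \<bullet> grad u (R\<theta> (ang x) (R\<theta> (- ang x) x))"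
    by (rule DERIV_along_rotation) (use u_grad[OF x] in simp)
  then have "((\<lambda>t. u (cyl (dax x) t (zp x))) has_vector_derivative T\<theta> x \<bullet> grad u x) (at (ang x) within {0..\<beta>})"
    unfolding c by (simp add: has_real_derivative_iff_has_vector_derivative has_vector_derivative_at_within)
  then show ?thesis
    unfolding dtheta_def by (intro vector_derivative_within_closed_interval) (use x \<beta> in \<open>auto simp: Omega_def\<close>)
qed

lemma v_grad:
  assumes x: "x \<in> Om"
  shows "GDERIV v x :> Dv x"
proof -
  have "GDERIV (\<lambda>x. x $ i * partial j u x - x $ j * partial i u x) x :> Dv x"
    unfolding Dv_def by (intro GDERIV_diff GDERIV_mult GDERIV_component partial_grad x)
  then show ?thesis
    by (rule GDERIV_cong_open[OF _ open_Sec x]) (simp add: v_eq tang_inner_eq grad_def)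
qed

lemma Dv_cont: "continuous_on Om Dv"
  unfolding Dv_def[abs_def] by (intro continuous_intros cont_partial cont_partial_grad)

lemma v_zero_on_boundary:
  assumes "x \<in> Cl" "x \<notin> Om"
  shows "v x = 0"
proof -
  have "x \<in> gamma_arc i j r1 0 \<beta> \<union> Gamma_face i j r1 0 \<union> Gamma_face i j r1 \<beta>"
    using assms angle_range[of x] by (force simp: Cl_def Omega_def gamma_arc_def Gamma_face_def)
  then show ?thesis using sol by (auto simp: is_solution_def)
qed

lemma weak_equation:
  assumes C: "C1c Om \<psi> G"
  shows "(LINT x|lborel. grad u x \<bullet> G x) = (LINT x|lborel. f (dax x) (zp x) (u x) * \<psi> x)"
proof -
  obtain K where K: "compact K" "K \<subseteq> Om" "\<And>x. x \<notin> K \<Longrightarrow> \<psi> x = 0" "\<And>x. x \<notin> K \<Longrightarrow> G x = 0"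
    using C1cE[OF C] by metis
  define Hb where "Hb b = grad (\<lambda>x. grad u x \<bullet> b)" for b
  have Hb: "Hb (axis k 1) = grad (partial k u)" "(\<lambda>x. grad u x \<bullet> axis k 1) = partial k u" for k
    by (simp_all add: Hb_def inner_axis grad_def[of u, abs_def])
  have basis: "\<exists>k. b = axis k 1" if "b \<in> (Basis :: (real ^ 'n) set)" for b using that by (auto simp: Basis_vec_def)
  have lap: "(\<Sum>b\<in>Basis. Hb b x \<bullet> b) = laplacian u x" for x
  proof -
    have "(\<Sum>b\<in>Basis. Hb b x \<bullet> b) = (\<Sum>b\<in>range (\<lambda>k. axis k 1). Hb b x \<bullet> b)"
      by (intro sum.cong) (auto simp: Basis_vec_def)
    also have "\<dots> = (\<Sum>k\<in>UNIV. Hb (axis k 1) x \<bullet> axis k 1)"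
      by (subst sum.reindex) (auto simp: inj_on_def axis_eq_axis)
    finally show ?thesis by (simp add: Hb inner_axis laplacian_def grad_def)
  qed
  have i1: "integrable lborel (\<lambda>x. grad u x \<bullet> G x)" by (rule C1c_integrable(2)[OF C cont_grad])
  have i2: "integrable lborel (\<lambda>x. f (dax x) (zp x) (u x) * \<psi> x)"
    by (rule C1c_integrable(1)[OF C continuous_on_subset[OF f_cont Om_subset_Cl]])
  have "(LINT x|lborel. indicator Om x * (G x \<bullet> grad u x + \<psi> x * (\<Sum>b\<in>Basis. Hb b x \<bullet> b))) = 0"
  proof (rule divergence_theorem_compact_support(1)[OF open_Sec _ _ _ _ K(1,2)])
    show "GDERIV \<psi> x :> G x" for x by (rule C1c_gderiv[OF C])
    show "continuous_on Om G" by (rule C1c_cont(2)[OF C])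
    show "GDERIV (\<lambda>x. grad u x \<bullet> b) x :> Hb b x" if "x \<in> Om" "b \<in> Basis" for x b
      using basis[OF that(2)] partial_grad[OF that(1)] by (auto simp: Hb)
    show "continuous_on Om (Hb b)" if "b \<in> Basis" for b using basis[OF that] cont_partial_grad by (auto simp: Hb)
    show "\<psi> x = 0 \<or> grad u x = 0" if "x \<in> Om - K" for x using K(3) that by blast
  qed
  moreover have "indicator Om x * (G x \<bullet> grad u x + \<psi> x * (\<Sum>b\<in>Basis. Hb b x \<bullet> b))
      = grad u x \<bullet> G x - f (dax x) (zp x) (u x) * \<psi> x" for x
  proof (cases "x \<in> Om")
    case True
    then have "laplacian u x = - f (dax x) (zp x) (u x)" using sol by (force simp: is_solution_def)
    then show ?thesis unfolding lap using True by (simp add: inner_commute)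
  next
    case False
    then have "x \<notin> K" using K(2) by blast
    then show ?thesis using False K(3,4)[of x] by simp
  qed
  ultimately show ?thesis using i1 i2 by simp
qed

lemma partial_commute: "x \<in> Om \<Longrightarrow> partial l (partial k u) x = partial k (partial l u) x"
proof -
  assume x: "x \<in> Om"
  have e: "(\<lambda>y. axis k 1 \<bullet> grad u y) = partial k u" for k by (simp add: inner_axis' grad_def)
  have "axis l 1 \<bullet> grad (partial k u) x = axis k 1 \<bullet> grad (partial l u) x"
    by (rule second_derivative_symmetric[OF open_Sec x u_grad]) (use partial_grad cont_partial_grad in \<open>auto simp: e\<close>)
  then show ?thesis by (simp add: inner_axis' grad_def)
qed

text \<open>Both sides express the mixed derivative of \<open>u(R\<^sub>t x)\<close> in \<open>t\<close> and in the
  direction \<open>g\<close>: the gradient of a rotated function is differentiated along rotations into the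
  gradient of the angular derivative. This needs the symmetry of the second derivatives.\<close>
lemma DERIV_rotated_gradient:
  assumes x: "R\<theta> t x \<in> Om"
  shows "DERIV (\<lambda>t. grad u (R\<theta> t x) \<bullet> R\<theta> t g) t :> Dv (R\<theta> t x) \<bullet> R\<theta> t g"
proof -
  define X where "X = R\<theta> t x"
  define Y where "Y = R\<theta> t g"
  have XO: "X \<in> Om" using x by (simp add: X_def)
  have inn: "a \<bullet> b = (\<Sum>k\<in>UNIV. a $ k * b $ k)" for a b :: "real ^ 'n" by (simp add: inner_vec_def)
  have d: "DERIV (\<lambda>t. \<Sum>k\<in>UNIV. partial k u (R\<theta> t x) * (R\<theta> t g) $ k) t :>
      (\<Sum>k\<in>UNIV. (T\<theta> X \<bullet> grad (partial k u) X) * Y $ k + (T\<theta> Y) $ k * partial k u X)"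
    unfolding X_def Y_def
  proof (intro DERIV_sum DERIV_mult)
    fix k
    show "DERIV (\<lambda>t. partial k u (R\<theta> t x)) t :> T\<theta> (R\<theta> t x) \<bullet> grad (partial k u) (R\<theta> t x)"
      by (rule DERIV_along_rotation[OF partial_grad[OF x]])
    show "DERIV (\<lambda>t. (R\<theta> t g) $ k) t :> (T\<theta> (R\<theta> t g)) $ k"
      using DERIV_along_rotation[OF GDERIV_component[where k = k and x = "R\<theta> t g"]] by (simp add: inner_axis)
  qed
  have "(\<Sum>k\<in>UNIV. (T\<theta> X \<bullet> grad (partial k u) X) * Y $ k) = (\<Sum>k\<in>UNIV. X $ i * (grad (partial j u) X $ k * Y $ k) - X $ j * (grad (partial i u) X $ k * Y $ k))"
  proof (rule sum.cong[OF refl])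
    fix k
    show "(T\<theta> X \<bullet> grad (partial k u) X) * Y $ k = X $ i * (grad (partial j u) X $ k * Y $ k) - X $ j * (grad (partial i u) X $ k * Y $ k)"
      using partial_commute[OF XO, of j k] partial_commute[OF XO, of i k]
      by (simp add: tang_inner_eq grad_def algebra_simps)
  qed
  also have "\<dots> = X $ i * (grad (partial j u) X \<bullet> Y) - X $ j * (grad (partial i u) X \<bullet> Y)"
    by (simp add: sum_subtractf sum_distrib_left inn)
  finally have 1: "(\<Sum>k\<in>UNIV. (T\<theta> X \<bullet> grad (partial k u) X) * Y $ k) = X $ i * (grad (partial j u) X \<bullet> Y) - X $ j * (grad (partial i u) X \<bullet> Y)" .
  have "(\<Sum>k\<in>UNIV. (T\<theta> Y) $ k * partial k u X) = T\<theta> Y \<bullet> grad u X" by (simp add: inn grad_def)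
  then have 2: "(\<Sum>k\<in>UNIV. (T\<theta> Y) $ k * partial k u X) = Y $ i * partial j u X - Y $ j * partial i u X"
    by (simp add: tang_inner_eq grad_def)
  have e: "(\<Sum>k\<in>UNIV. (T\<theta> X \<bullet> grad (partial k u) X) * Y $ k + (T\<theta> Y) $ k * partial k u X) = Dv X \<bullet> Y"
    unfolding sum.distrib 1 2 Dv_def by (simp add: inner_diff_left inner_add_left inner_axis' algebra_simps)
  have "(\<lambda>t. grad u (R\<theta> t x) \<bullet> R\<theta> t g) = (\<lambda>t. \<Sum>k\<in>UNIV. partial k u (R\<theta> t x) * (R\<theta> t g) $ k)"
    by (simp add: inn grad_def)
  then show ?thesis using d unfolding e by (simp add: X_def Y_def)
qed

lemma small_rotations:
  assumes K: "compact K" "K \<subseteq> Om"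
  shows "\<exists>t0>0. \<forall>t x. 0 \<le> t \<longrightarrow> t \<le> t0 \<longrightarrow> x \<in> K \<longrightarrow> R\<theta> t x \<in> Om"
proof -
  have "K \<inter> - Om = {}" using K(2) by blast
  from separate_compact_closed[OF K(1) closed_Compl[OF open_Sec] this]
  obtain \<delta> where \<delta>: "\<delta> > 0" "\<And>x y. x \<in> K \<Longrightarrow> y \<in> - Om \<Longrightarrow> \<delta> \<le> dist x y" by blast
  obtain B where B: "B > 0" "\<And>x. x \<in> K \<Longrightarrow> norm x \<le> B"
    using compact_imp_bounded[OF K(1)] unfolding bounded_pos by blast
  define t0 where "t0 = \<delta> / (4 * B)"
  have t0: "t0 > 0" using \<delta> B by (simp add: t0_def)
  have "R\<theta> t x \<in> Om" if t: "0 \<le> t" "t \<le> t0" and x: "x \<in> K" for t x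
  proof (rule ccontr)
    assume "R\<theta> t x \<notin> Om"
    then have "\<delta> \<le> dist x (R\<theta> t x)" using \<delta>(2) x by blast
    also have "\<dots> \<le> 2 * t * norm x" using rot_displacement[of t x] t by (simp add: dist_norm norm_minus_commute)
    also have "\<dots> \<le> 2 * t0 * B" using t B x by (intro mult_mono) auto
    also have "\<dots> = \<delta> / 2" using B by (simp add: t0_def)
    finally show False using \<delta>(1) by simp
  qed
  then show ?thesis using t0 by blast
qed

text \<open>The linearised equation is not obtained by differentiating \<open>f(d(x), z, u)\<close>, which is only
  Hoelder continuous in \<open>x\<close>: rotating the weak equation leaves \<open>d(x)\<close> and
  \<open>z\<close> fixed, and only the dependence on \<open>u\<close> is differentiated at angle zero.\<close>
lemma linearised_equation:
  assumes C: "C1c Om \<psi> G"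
  shows "(LINT x|lborel. Dv x \<bullet> G x) = (LINT x|lborel. V x * v x * \<psi> x)"
proof -
  obtain K where K: "compact K" "K \<subseteq> Om" "\<And>x. x \<notin> K \<Longrightarrow> \<psi> x = 0" "\<And>x. x \<notin> K \<Longrightarrow> G x = 0"
    using C1cE[OF C] by metis
  obtain t0 where t0: "t0 > 0" and R: "\<And>t x. 0 \<le> t \<Longrightarrow> t \<le> t0 \<Longrightarrow> x \<in> K \<Longrightarrow> R\<theta> t x \<in> Om"
    using small_rotations[OF K(1,2)] by blast
  define F where "F t x = grad u (R\<theta> t x) \<bullet> R\<theta> t (G x)" for t x
  define E where "E t x = f (dax x) (zp x) (u (R\<theta> t x)) * \<psi> x" for t x
  have FE: "(LINT x|lborel. F t x) = (LINT x|lborel. E t x)" "integrable lborel (F t)" "integrable lborel (E t)"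
    if t: "0 \<le> t" "t \<le> t0" for t
  proof -
    have CK: "C1c K \<psi> G" using C K(1,3) unfolding C1c_def by blast
    have "R\<theta> t ` K \<subseteq> Om" using R[OF t] by blast
    then have C2: "C1c Om (\<lambda>x. \<psi> (R\<theta> (- t) x)) (\<lambda>x. R\<theta> t (G (R\<theta> (- t) x)))"
      using C1c_mono[OF C1c_rot[OF CK, of "- t"], of Om] by simp
    have i1: "integrable lborel (\<lambda>x. grad u x \<bullet> R\<theta> t (G (R\<theta> (- t) x)))" by (rule C1c_integrable(2)[OF C2 cont_grad])
    have i2: "integrable lborel (\<lambda>x. f (dax x) (zp x) (u x) * \<psi> (R\<theta> (- t) x))"
      by (rule C1c_integrable(1)[OF C2 continuous_on_subset[OF f_cont Om_subset_Cl]])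
    note m1 = borel_measurable_integrable[OF i1, simplified] and m2 = borel_measurable_integrable[OF i2, simplified]
    have e: "F t = (\<lambda>x. grad u (R\<theta> t x) \<bullet> R\<theta> t (G (R\<theta> (- t) (R\<theta> t x))))"
      "E t = (\<lambda>x. f (dax (R\<theta> t x)) (zp (R\<theta> t x)) (u (R\<theta> t x)) * \<psi> (R\<theta> (- t) (R\<theta> t x)))"
      by (simp_all add: F_def E_def fun_eq_iff)
    show "(LINT x|lborel. F t x) = (LINT x|lborel. E t x)" "integrable lborel (F t)" "integrable lborel (E t)"
      unfolding e integral_rot(1)[OF m1] integral_rot(1)[OF m2] integral_rot(2)[OF m1] integral_rot(2)[OF m2]
      by (rule weak_equation[OF C2] i1 i2)+
  qed
  have crot: "continuous_on ({0..t0} \<times> K) (\<lambda>z. R\<theta> (fst z) (snd z))"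
    by (intro continuous_on_rot continuous_intros)
  have cv: "continuous_on Om v" by (rule continuous_on_subset[OF v_cont Om_subset_Cl])
  have cV: "continuous_on Om V" by (rule continuous_on_subset[OF V_cont Om_subset_Cl])
  have 1: "(\<lambda>n. ((LINT x|lborel. F (t0 / real (Suc n)) x) - (LINT x|lborel. F 0 x)) / (t0 / real (Suc n)))
     \<longlonglongrightarrow> (LINT x|lborel. indicator K x * (Dv (R\<theta> 0 x) \<bullet> R\<theta> 0 (G x)))"
  proof (rule integral_derivative_at_zero[OF K(1) t0])
    show "DERIV (\<lambda>t. F t x) t :> Dv (R\<theta> t x) \<bullet> R\<theta> t (G x)" if "0 \<le> t" "t \<le> t0" "x \<in> K" for t x
      unfolding F_def by (rule DERIV_rotated_gradient[OF R[OF that]])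
    show "continuous_on ({0..t0} \<times> K) (\<lambda>z. Dv (R\<theta> (fst z) (snd z)) \<bullet> R\<theta> (fst z) (G (snd z)))"
      by (intro continuous_intros continuous_on_compose2[OF Dv_cont crot] continuous_on_rot
          continuous_on_compose2[OF C1c_cont(2)[OF C, of UNIV]]) (use R in auto)
    show "F t x = 0" if "x \<notin> K" for t x using K(4)[OF that] linear_0[OF linear_maps(1)] by (simp add: F_def)
  qed (rule FE(2))
  have 2: "(\<lambda>n. ((LINT x|lborel. E (t0 / real (Suc n)) x) - (LINT x|lborel. E 0 x)) / (t0 / real (Suc n)))
     \<longlonglongrightarrow> (LINT x|lborel. indicator K x * (V (R\<theta> 0 x) * v (R\<theta> 0 x) * \<psi> x))"
  proof (rule integral_derivative_at_zero[OF K(1) t0])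
    show "DERIV (\<lambda>t. E t x) t :> V (R\<theta> t x) * v (R\<theta> t x) * \<psi> x" if t: "0 \<le> t" "t \<le> t0" "x \<in> K" for t x
    proof -
      have "DERIV (\<lambda>t. u (R\<theta> t x)) t :> v (R\<theta> t x)"
        using DERIV_along_rotation[OF u_grad[OF R[OF t]]] v_eq[OF R[OF t]] by simp
      from DERIV_cmult_right[OF DERIV_chain2[OF f_deriv[of x] this], of "\<psi> x"]
      show ?thesis by (simp add: E_def V_def)
    qed
    show "continuous_on ({0..t0} \<times> K) (\<lambda>z. V (R\<theta> (fst z) (snd z)) * v (R\<theta> (fst z) (snd z)) * \<psi> (snd z))"
      by (intro continuous_intros continuous_on_compose2[OF cV crot] continuous_on_compose2[OF cv crot]
          continuous_on_compose2[OF C1c_cont(1)[OF C, of UNIV]]) (use R in auto)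
    show "E t x = 0" if "x \<notin> K" for t x using K(3)[OF that] by (simp add: E_def)
  qed (rule FE(3))
  have h: "0 \<le> t0 / real (Suc n)" "t0 / real (Suc n) \<le> t0" for n
    using t0 by (auto simp: divide_le_eq mult_le_cancel_left1)
  have "(LINT x|lborel. indicator K x * (Dv (R\<theta> 0 x) \<bullet> R\<theta> 0 (G x))) = (LINT x|lborel. indicator K x * (V (R\<theta> 0 x) * v (R\<theta> 0 x) * \<psi> x))"
    using LIMSEQ_unique[OF 1] 2 FE(1)[OF h] FE(1)[of 0] t0 by simp
  moreover have "indicator K x * (Dv (R\<theta> 0 x) \<bullet> R\<theta> 0 (G x)) = Dv x \<bullet> G x" "indicator K x * (V (R\<theta> 0 x) * v (R\<theta> 0 x) * \<psi> x) = V x * v x * \<psi> x" for x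
    using K(3,4)[of x] by (cases "x \<in> K"; simp)+
  ultimately show ?thesis by (simp only:)
qed

sublocale sol: neumann_solution i j r1 \<beta> V v Dv "grad u" u f
proof
  show "continuous_on Cl V" "continuous_on Cl v" "continuous_on Cl u" "continuous_on Om Dv" "continuous_on Om (grad u)"
    by (rule V_cont v_cont u_cont Dv_cont cont_grad)+
  show "GDERIV v x :> Dv x" "GDERIV u x :> grad u x" "v x = T\<theta> x \<bullet> grad u x" if "x \<in> Om" for x
    using v_grad u_grad v_eq that by auto
  show "v x = 0" if "x \<in> Cl" "x \<notin> Om" for x by (rule v_zero_on_boundary[OF that])
  show "integrable lborel (\<lambda>x. indicator Om x * (norm (grad u x))\<^sup>2)"
    using uY by (simp add: Yspace_def set_integrable_def)
  show "\<bar>v x\<bar> \<le> dax x * norm (grad u x)" if "x \<in> Om" for x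
    unfolding v_eq[OF that] using Cauchy_Schwarz_ineq2[of "T\<theta> x" "grad u x"] by (simp add: norm_tang)
  show "continuous_on Om (\<lambda>x. f (dax x) (zp x) (u x))" by (rule continuous_on_subset[OF f_cont Om_subset_Cl])
  show "(LINT x|lborel. Dv x \<bullet> G x) = (LINT x|lborel. V x * v x * \<psi> x)"
    "(LINT x|lborel. grad u x \<bullet> G x) = (LINT x|lborel. f (dax x) (zp x) (u x) * \<psi> x)" if "C1c Om \<psi> G" for \<psi> G
    by (rule linearised_equation[OF that] weak_equation[OF that])+
  show "f (dax x) (zp x) (u x) + V x * (s - u x) \<le> f (dax x) (zp x) s" for x s
    using convex_on_imp_above_tangent[of UNIV "f (dax x) (zp x)" "u x" s "V x"] conv f_deriv[of x "u x"]
    by (simp add: V_def)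
  show "u x = u y" if xy: "x \<in> Cl" "y \<in> Cl" "dax x = r1" "dax y = r1" "zp x = zp y" for x y
  proof -
    have r: "r1 > 0" using xy by (auto simp: Cl_def)
    have "u (cyl r1 (ang x) (zp x)) = u (cyl r1 (ang y) (zp x))"
    proof (rule arc_constant[OF r order_refl zpart_zspace])
      fix t assume t: "t \<in> {0..\<beta>}"
      then have "cyl r1 t (zp x) \<in> gamma_arc i j r1 0 \<beta>"
        using r \<beta> by (simp add: gamma_arc_def dist_axis_cyl angle_cyl)
      then show "v (cyl r1 t (zp x)) = 0" using sol by (auto simp: is_solution_def)
    qed (use xy angle_range in \<open>auto simp: Cl_def\<close>)
    then show ?thesis using cyl_point_eq[of x] cyl_point_eq[of y] xy by simp
  qed
qed

end

section \<open>The Morse index\<close>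

lemma C1_0_imp_C1c:
  assumes D: "open D" and \<psi>: "\<psi> \<in> C1_0 D"
  shows "\<exists>G. C1c D \<psi> G"
proof -
  let ?K = "closure {x. \<psi> x \<noteq> 0}"
  obtain g where g: "continuous_on D g" "\<And>x. x \<in> D \<Longrightarrow> (\<psi> has_derivative (\<lambda>h. g x \<bullet> h)) (at x within D)"
    and K: "compact ?K" "?K \<subseteq> D" using \<psi> unfolding C1_0_def C1_on_def by blast
  have z: "\<psi> x = 0" if "x \<notin> ?K" for x using that closure_subset[of "{x. \<psi> x \<noteq> 0}"] by auto
  have "GDERIV \<psi> x :> g x" if "x \<in> D" for x
    using g(2)[OF that] at_within_open[OF that D] by (simp add: gderiv_def inner_commute)
  from C1c_extend[OF D this g(1) K] z
  have "C1c D (\<lambda>x. if x \<in> D then \<psi> x else 0) (\<lambda>x. if x \<in> D then g x else 0)" by blast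
  moreover have "(if x \<in> D then \<psi> x else 0) = \<psi> x" for x
  proof (cases "x \<in> D")
    case False
    then have "x \<notin> ?K" using K(2) by blast
    then show ?thesis using z[of x] by simp
  qed simp
  ultimately show ?thesis by (intro exI) (simp only:)
qed

context neumann_problem
begin

lemma Qform_eq_QF:
  assumes "tf \<phi> g"
  shows "Qform i j r1 \<beta> f u \<phi> = QF V \<phi> g"
  unfolding Qform_def BF_def set_lebesgue_integral_def
proof (rule Bochner_Integration.integral_cong[OF refl])
  fix x
  show "indicator Om x *\<^sub>R ((norm (grad \<phi> x))\<^sup>2 - deriv (f (dax x) (zp x)) (u x) * (\<phi> x)\<^sup>2)
    = indicator Om x * (g x \<bullet> g x - V x * \<phi> x * \<phi> x)"
    using grad_eqI[OF tf_gderiv[OF assms]]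
    by (cases "x \<in> Om") (simp_all add: V_def power2_norm_eq_inner power2_eq_square[of "\<phi> x"] mult.assoc)
qed

lemma QF_negative_imp_nonzero:
  assumes t: "tf \<phi> g" and neg: "QF V \<phi> g < 0"
  shows "\<phi> \<noteq> 0"
proof
  assume z: "\<phi> = 0"
  have "g x = 0" if "x \<in> Om" for x
    by (rule GDERIV_zero_on_open[OF tf_gderiv[OF t that] open_Sec that]) (simp add: z)
  then have "indicator Om x * (g x \<bullet> g x - V x * \<phi> x * \<phi> x) = 0" for x by (cases "x \<in> Om") (auto simp: z)
  then have "QF V \<phi> g = 0" unfolding BF_def by (simp only: Bochner_Integration.integral_zero)
  then show False using neg by simp
qed

text \<open>Two orthogonal directions of negative energy would span a two-dimensional negative subspace.\<close>
lemma morse_index_one_imp_orthogonal_nonneg: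
  assumes M: "has_morse_index i j r1 \<beta> f u 1"
    and t1: "tf \<phi>1 g1" and t: "tf \<phi> g" and neg: "QF V \<phi>1 g1 < 0" and orth: "BF V \<phi> g \<phi>1 g1 = 0"
  shows "QF V \<phi> g \<ge> 0"
proof (rule ccontr)
  assume "\<not> QF V \<phi> g \<ge> 0"
  then have neg': "QF V \<phi> g < 0" by simp
  have tl: "tf (\<lambda>x. a * \<phi>1 x + b * \<phi> x) (\<lambda>x. a *\<^sub>R g1 x + b *\<^sub>R g x)" for a b by (rule tf_lin[OF t1 t])
  have Ql: "QF V (\<lambda>x. a * \<phi>1 x + b * \<phi> x) (\<lambda>x. a *\<^sub>R g1 x + b *\<^sub>R g x) < 0" if "a \<noteq> 0 \<or> b \<noteq> 0" for a b
  proof -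
    have "a\<^sup>2 * QF V \<phi>1 g1 + b\<^sup>2 * QF V \<phi> g < 0"
    proof (cases "a = 0")
      case True
      then show ?thesis using that neg' by (simp add: mult_pos_neg)
    next
      case False
      then have "a\<^sup>2 * QF V \<phi>1 g1 < 0" using neg by (simp add: mult_pos_neg)
      moreover have "b\<^sup>2 * QF V \<phi> g \<le> 0" using neg' by (simp add: mult_nonneg_nonpos)
      ultimately show ?thesis by linarith
    qed
    then show ?thesis using orth unfolding QF_lin[OF V_cont t1 t] BF_commute[of V \<phi>1 g1 \<phi> g] by simp
  qed
  have nz: "(\<lambda>x. a * \<phi>1 x + b * \<phi> x) \<noteq> 0" if "a \<noteq> 0 \<or> b \<noteq> 0" for a b
    by (rule QF_negative_imp_nonzero[OF tl Ql[OF that]])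
  define X where "X = fun_space.span {\<phi>1, \<phi>}"
  have elem0: "\<exists>b. \<psi> = (\<lambda>x. b * \<phi> x)" if "\<psi> \<in> fun_space.span {\<phi>}" for \<psi>
    using that fun_space.span_breakdown_eq[of \<psi> \<phi> "{}"] by (auto simp: fun_eq_iff)
  have elem: "\<exists>a b. \<psi> = (\<lambda>x. a * \<phi>1 x + b * \<phi> x)" if \<psi>: "\<psi> \<in> X" for \<psi>
  proof -
    obtain a where "\<psi> - (\<lambda>x. a * \<phi>1 x) \<in> fun_space.span {\<phi>}"
      using \<psi> fun_space.span_breakdown_eq[of \<psi> \<phi>1 "{\<phi>}"] by (auto simp: X_def)
    from elem0[OF this] obtain b where "\<psi> - (\<lambda>x. a * \<phi>1 x) = (\<lambda>x. b * \<phi> x)" by blast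
    then have "\<psi> x = a * \<phi>1 x + b * \<phi> x" for x by (simp add: fun_eq_iff algebra_simps)
    then show ?thesis by blast
  qed
  have ind1: "\<phi> \<notin> fun_space.span {}" using nz[of 0 1] by (auto simp: fun_eq_iff)
  have ind2: "\<phi>1 \<notin> fun_space.span {\<phi>}"
  proof
    assume "\<phi>1 \<in> fun_space.span {\<phi>}"
    then obtain b where "\<phi>1 = (\<lambda>x. b * \<phi> x)" using elem0 by blast
    then have "1 * \<phi>1 x + (- b) * \<phi> x = 0" for x by (simp add: fun_eq_iff)
    then show False using nz[of 1 "- b"] by (simp add: fun_eq_iff)
  qed
  have "fun_space.independent {\<phi>1, \<phi>}"
    by (intro fun_space.independent_insertI ind1 ind2 fun_space.independent_empty)
  then have "fun_space.dim X = card {\<phi>1, \<phi>}" unfolding X_def by (rule fun_space.dim_span_eq_card_independent)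
  moreover have "\<phi>1 \<noteq> \<phi>" using ind2 fun_space.span_base[of \<phi> "{\<phi>}"] by auto
  ultimately have dim: "fun_space.dim X = 2" by simp
  have "negative_subspace i j r1 \<beta> f u X"
    unfolding negative_subspace_def
  proof (intro conjI ballI subsetI)
    show "fun_space.subspace X" unfolding X_def by (rule fun_space.subspace_span)
    show "\<psi> \<in> C1_0 Fc" if "\<psi> \<in> X" for \<psi> using elem[OF that] tl unfolding tf_def by auto
    fix \<psi> assume \<psi>: "\<psi> \<in> X - {0}"
    then obtain a b where e: "\<psi> = (\<lambda>x. a * \<phi>1 x + b * \<phi> x)" using elem by blast
    have "a \<noteq> 0 \<or> b \<noteq> 0" using \<psi> e by (auto simp: fun_eq_iff)
    from Ql[OF this] show "Qform i j r1 \<beta> f u \<psi> < 0" unfolding e Qform_eq_QF[OF tl] .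
  qed
  then have "fun_space.dim X \<le> 1" using M by (auto simp: has_morse_index_def)
  with dim show False by simp
qed

lemma zero_derivative_imp_theta_independent:
  assumes z: "\<And>x. x \<in> Om \<Longrightarrow> v x = 0"
  shows "theta_independent_on i j (closure Om) u"
  unfolding theta_independent_on_def
proof (intro ballI impI)
  fix x y assume xy: "x \<in> closure Om" "y \<in> closure Om" "dax x = dax y" "zp x = zp y"
  show "u x = u y"
  proof (cases "dax x = 0")
    case True
    \<comment> \<open>on the axis the two points coincide\<close>
    have "cyl 0 (ang x) (zp x) = cyl 0 (ang y) (zp x)" by (auto simp: cyl_point_def vec_eq_iff)
    moreover have "cyl 0 (ang x) (zp x) = x" using cyl_point_eq[of x] True by (simp del: cyl_point_eq)
    moreover have "cyl 0 (ang y) (zp x) = y" using cyl_point_eq[of y] True xy(3,4) by (simp del: cyl_point_eq)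
    ultimately have "x = y" by (simp only:)
    then show ?thesis by simp
  next
    case False
    then have d: "dax x > 0" using dist_axis_nonneg[of x] by linarith
    have c: "dax x \<ge> r1" "ang x \<le> \<beta>" "ang y \<le> \<beta>"
      using closure_Omega_subset[OF xy(1)] closure_Omega_subset[OF xy(2)] \<beta> by auto
    have "u (cyl (dax x) (ang x) (zp x)) = u (cyl (dax x) (ang y) (zp x))"
    proof (rule arc_constant[OF d c(1) zpart_zspace])
      fix t assume t: "t \<in> {0..\<beta>}"
      have "cyl (dax x) t (zp x) \<in> Cl" using t d c \<beta> by (simp add: Cl_def dist_axis_cyl angle_cyl)
      then show "v (cyl (dax x) t (zp x)) = 0" using z v_zero_on_boundary by blast
    qed (use c angle_range in auto)
    then show ?thesis using cyl_point_eq[of x] cyl_point_eq[of y] xy(3,4) by simp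
  qed
qed

lemma stable_imp_theta_independent:
  assumes M: "has_morse_index i j r1 \<beta> f u 0"
  shows "theta_independent_on i j (closure Om) u"
proof (rule zero_derivative_imp_theta_independent)
  fix x assume x: "x \<in> Om"
  interpret neg: sector_solution i j r1 \<beta> V "\<lambda>x. - v x" "\<lambda>x. - Dv x" "grad u" by (rule sol.uminus_solution)
  have stable: "QF V \<phi> g \<ge> 0" if "tf \<phi> g" for \<phi> g
    using M that Qform_eq_QF[OF that] by (auto simp: has_morse_index_def tf_def)
  have no: "ang y \<noteq> \<beta>" if "y \<in> Om" for y using that by (auto simp: Omega_def)
  have "v x \<le> 0" by (rule sol.stable_sector_imp_nonpos[OF \<beta>(1) order_refl _ _ x]) (use no stable in auto)
  moreover have "- v x \<le> 0" by (rule neg.stable_sector_imp_nonpos[OF \<beta>(1) order_refl _ _ x]) (use no stable in auto)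
  ultimately show "v x = 0" by simp
qed

lemma strict_increase_along_arcs:
  assumes pos: "\<And>x. x \<in> Om \<Longrightarrow> \<sigma> * v x > 0"
    and xy: "x \<in> Om" "y \<in> Om" "dax x = dax y" "zp x = zp y" "ang x < ang y"
  shows "\<sigma> * u x < \<sigma> * u y"
proof -
  have inO: "R\<theta> t x \<in> Om" if "0 \<le> t" "t \<le> ang y - ang x" for t
    using angle_rot[of x t] that xy r1 \<beta> by (auto simp: Omega_def)
  have "\<sigma> * u (R\<theta> 0 x) < \<sigma> * u (R\<theta> (ang y - ang x) x)"
  proof (rule DERIV_pos_imp_increasing[where f = "\<lambda>t. \<sigma> * u (R\<theta> t x)"])
    fix t assume t: "0 \<le> t" "t \<le> ang y - ang x"
    have "DERIV (\<lambda>t. u (R\<theta> t x)) t :> v (R\<theta> t x)"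
      using DERIV_along_rotation[OF u_grad[OF inO[OF t]]] v_eq[OF inO[OF t]] by simp
    from DERIV_cmult[OF this, of \<sigma>] pos[OF inO[OF t]]
    show "\<exists>d. DERIV (\<lambda>t. \<sigma> * u (R\<theta> t x)) t :> d \<and> d > 0" by blast
  qed (use xy in simp)
  moreover have "R\<theta> (ang y - ang x) x = y" using cyl_rot[of x "ang y"] xy(3,4) by simp
  ultimately show ?thesis by simp
qed

lemma nonvanishing_derivative_imp_INF_zero:
  assumes nz: "\<And>x. x \<in> Om \<Longrightarrow> v x \<noteq> 0"
  shows "(INF \<psi> \<in> C1_0 Om. ereal (Qform i j r1 \<beta> f u \<psi>)) = 0"
proof (rule antisym)
  have VO: "continuous_on Om V" by (rule continuous_on_subset[OF V_cont Om_subset_Cl])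
  show "0 \<le> (INF \<psi> \<in> C1_0 Om. ereal (Qform i j r1 \<beta> f u \<psi>))"
  proof (rule INF_greatest)
    fix \<psi> assume "\<psi> \<in> C1_0 Om"
    then obtain G where C: "C1c Om \<psi> G" using C1_0_imp_C1c[OF open_Sec] by blast
    obtain K where K: "K \<subseteq> Om" "\<And>x. x \<notin> K \<Longrightarrow> \<psi> x = 0" "\<And>x. x \<notin> K \<Longrightarrow> G x = 0" using C1cE[OF C] by metis
    have "Qform i j r1 \<beta> f u \<psi> = (LINT x|lborel. (norm (G x))\<^sup>2 - V x * (\<psi> x)\<^sup>2)"
      unfolding Qform_def set_lebesgue_integral_def
    proof (rule Bochner_Integration.integral_cong[OF refl])
      fix x
      show "indicator Om x *\<^sub>R ((norm (grad \<psi> x))\<^sup>2 - deriv (f (dax x) (zp x)) (u x) * (\<psi> x)\<^sup>2) = (norm (G x))\<^sup>2 - V x * (\<psi> x)\<^sup>2"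
      proof (cases "x \<in> Om")
        case True
        then show ?thesis using grad_eqI[OF C1c_gderiv[OF C, of x]] by (simp add: V_def)
      next
        case False
        then have "x \<notin> K" using K(1) by blast
        then show ?thesis using False K(2,3)[of x] by simp
      qed
    qed
    also have "\<dots> \<ge> 0"
      by (rule positive_solution_imp_stable[OF open_Sec v_grad Dv_cont nz VO linearised_equation C])
    finally show "0 \<le> ereal (Qform i j r1 \<beta> f u \<psi>)" by simp
  qed
  have d: "((\<lambda>x. 0) has_derivative (\<lambda>h. (0 :: real ^ 'n) \<bullet> h)) (at x within A)" for x :: "real ^ 'n" and A
    unfolding inner_zero_left by (rule has_derivative_const)
  have tz: "tf (\<lambda>x. 0) (\<lambda>x. 0)"
    unfolding tf_def C1_0_def C1_on_def by (intro conjI CollectI exI[of _ "\<lambda>x. 0"] ballI continuous_on_const d) auto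
  have z: "(\<lambda>x. 0) \<in> C1_0 Om"
    unfolding C1_0_def C1_on_def by (intro conjI CollectI exI[of _ "\<lambda>x. 0"] ballI continuous_on_const d) auto
  show "(INF \<psi> \<in> C1_0 Om. ereal (Qform i j r1 \<beta> f u \<psi>)) \<le> 0"
    using INF_lower[OF z, of "\<lambda>\<psi>. ereal (Qform i j r1 \<beta> f u \<psi>)"] unfolding Qform_eq_QF[OF tz] by (simp add: BF_def flip: zero_ereal_def)
qed

lemma index_one_dichotomy:
  assumes M: "has_morse_index i j r1 \<beta> f u 1"
  shows "theta_independent_on i j (closure Om) u \<or>
    (theta_strict_monotone_on i j Om u \<and> (\<forall>x\<in>Om. v x \<noteq> 0) \<and>
     (INF \<psi> \<in> C1_0 Om. ereal (Qform i j r1 \<beta> f u \<psi>)) = 0)"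
proof -
  have "(\<forall>x\<in>Om. v x \<ge> 0) \<or> (\<forall>x\<in>Om. v x \<le> 0)"
    by (rule sol.index_one_imp_one_sign[OF morse_index_one_imp_orthogonal_nonneg[OF M]])
  then obtain \<sigma> :: real where \<sigma>: "\<sigma> = 1 \<or> \<sigma> = -1" "\<And>x. x \<in> Om \<Longrightarrow> \<sigma> * v x \<ge> 0"
  proof
    assume "\<forall>x\<in>Om. v x \<ge> 0" then show ?thesis using that[of 1] by simp
  next
    assume "\<forall>x\<in>Om. v x \<le> 0" then show ?thesis using that[of "-1"] by simp
  qed
  have VO: "continuous_on Om V" by (rule continuous_on_subset[OF V_cont Om_subset_Cl])
  show ?thesis
  proof (cases "\<exists>x0\<in>Om. v x0 = 0")
    case True
    then obtain x0 where x0: "x0 \<in> Om" "v x0 = 0" by blast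
    have "\<sigma> * v x = 0" if x: "x \<in> Om" for x
    proof (rule strong_maximum_principle[OF open_Sec _ _ _ \<sigma>(2) VO _ x0(1) _ x])
      show "connected Om" by (rule connected_Omega) (use r1 \<beta> in auto)
      show "GDERIV (\<lambda>x. \<sigma> * v x) x :> \<sigma> *\<^sub>R Dv x" if "x \<in> Om" for x
        by (rule GDERIV_subst[OF GDERIV_mult[OF GDERIV_const[of \<sigma>] v_grad[OF that]]]) simp
      show "continuous_on Om (\<lambda>x. \<sigma> *\<^sub>R Dv x)" by (intro continuous_intros Dv_cont)
      show "(LINT x|lborel. \<sigma> *\<^sub>R Dv x \<bullet> G x) = (LINT x|lborel. V x * (\<sigma> * v x) * \<psi> x)" if "C1c Om \<psi> G" for \<psi> G
      proof -
        have e: "V x * (\<sigma> * v x) * \<psi> x = \<sigma> * (V x * v x * \<psi> x)" for x by simp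
        show ?thesis unfolding e using linearised_equation[OF that] by simp
      qed
      show "\<sigma> * v x0 = 0" using x0(2) by simp
    qed auto
    then have "theta_independent_on i j (closure Om) u"
      using \<sigma>(1) by (intro zero_derivative_imp_theta_independent) auto
    then show ?thesis ..
  next
    case False
    then have nz: "v x \<noteq> 0" if "x \<in> Om" for x using that by blast
    have pos: "\<sigma> * v x > 0" if "x \<in> Om" for x using \<sigma>(1) \<sigma>(2)[OF that] nz[OF that] by (auto simp: less_le)
    have "theta_strict_increasing_on i j Om (\<lambda>x. \<sigma> * u x)"
      unfolding theta_strict_increasing_on_def using strict_increase_along_arcs[OF pos] by blast
    then have "theta_strict_monotone_on i j Om u" using \<sigma>(1) unfolding theta_strict_monotone_on_def by auto
    then show ?thesis using nz nonvanishing_derivative_imp_INF_zero[OF nz] by blast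
  qed
qed

end

theorem theorem6p4:
  fixes i j :: "'n::finite"
    and r1 \<beta> :: real
    and f :: "real \<Rightarrow> real ^ 'n \<Rightarrow> real \<Rightarrow> real"
    and u :: "real ^ 'n \<Rightarrow> real"
    and M :: nat
  assumes "i \<noteq> j"
    and "r1 \<ge> 0"
    and "0 < \<beta>" and "\<beta> < 2 * pi"
    and "nonlinearity_ok i j f"
    and "u \<in> Yspace i j r1 \<beta>"
    and "is_solution i j r1 \<beta> f u"
    and "has_morse_index i j r1 \<beta> f u M" and "M \<le> 1"
    and "\<forall>r\<ge>0. \<forall>z\<in>zspace i j. convex_on UNIV (f r z)"
  shows "(M = 0 \<longrightarrow> theta_independent_on i j (closure (Omega i j r1 0 \<beta>)) u) \<and>
         (M = 1 \<longrightarrow>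
            theta_independent_on i j (closure (Omega i j r1 0 \<beta>)) u \<or>
            (theta_strict_monotone_on i j (Omega i j r1 0 \<beta>) u \<and>
             (\<forall>x \<in> Omega i j r1 0 \<beta>. dtheta i j \<beta> u x \<noteq> 0) \<and>
             (INF \<psi> \<in> C1_0 (Omega i j r1 0 \<beta>). ereal (Qform i j r1 \<beta> f u \<psi>)) = 0))"
proof -
  interpret neumann_problem i j r1 \<beta> f u using assms by unfold_locales auto
  show ?thesis
  proof (intro conjI impI)
    assume "M = 0"
    then show "theta_independent_on i j (closure (Omega i j r1 0 \<beta>)) u"
      using stable_imp_theta_independent assms(8) by blast
  next
    assume "M = 1"
    then show "theta_independent_on i j (closure (Omega i j r1 0 \<beta>)) u \<or>
        (theta_strict_monotone_on i j (Omega i j r1 0 \<beta>) u \<and>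
         (\<forall>x \<in> Omega i j r1 0 \<beta>. dtheta i j \<beta> u x \<noteq> 0) \<and>
         (INF \<psi> \<in> C1_0 (Omega i j r1 0 \<beta>). ereal (Qform i j r1 \<beta> f u \<psi>)) = 0)"
      using index_one_dichotomy assms(8) by blast
  qed
qed

end
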